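(* Let $k\in L^\infty(\mathbb{R}^{3-})$ be real-valued, with $k\ge k_{min}$ a.e. for a constant $k_{min}>0$, and $k(x)=k_0$ for $|x|\ge R_0$ for some constants $R_0,k_0>0$. For $i=1,2$ let $\Gamma_i$ be a Lipschitz open surface of class $\mathcal{P}$ whose closure is in $\mathbb{R}^{3-}$, let $g^i\in\tilde H^{1/2}(\Gamma_i)$ have full support in $\Gamma_i$, and for $t>0$ let $u^i=u^i_t$ be the unique solution of $$(\Delta+t^2k^2)u^i=0 \text{ in } \mathbb{R}^{3-}\setminus\overline{\Gamma_i},\quad \partial_{x_3}u^i=0 \text{ on } \{x_3=0\},\quad \Big[\frac{\partial u^i}{\partial n}\Big]=0,\quad [u^i]=g^i \text{ across }\Gamma_i,\quad u^i\in\mathcal{V}_{t,\Gamma_i}.$$ Then there is a discrete set $\mathcal{D}\subset[0,\infty)$ such that if $t\notin\mathcal{D}$, $V$ is a non-empty relatively open subset of $\{x: x_3=0\}$, and $u^1=u^2$ on $V$, then $\overline{\Gamma_1}=\overline{\Gamma_2}$ and $g^1=g^2$ almost everywhere.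
   Context: $\mathbb{R}^{3-}=\{x\in\mathbb{R}^3: x_3<0\}$. $\mathcal{P}$ is the class of Lipschitz open surfaces that are finite unions of polygons (equivalently, obtainable from a finite triangulation). For an open surface $\Gamma$ with closure in $\mathbb{R}^{3-}$, $\tilde H^{1/2}(\Gamma)$ is the space of functions in $H^{1/2}(\partial D)$ supported in $\overline{\Gamma}$, for a Lipschitz domain $D\subset\mathbb{R}^{3-}$ with $\Gamma\subset\partial D$; $n$ is a unit normal on $\Gamma$ and $[v]$ is the jump across $\Gamma$ in direction $n$. With $r=|x|$, $\mathcal{V}_{t,\Gamma}:=\{v\in H^1_{loc}(\mathbb{R}^{3-}\setminus\overline{\Gamma}): \frac{v}{\sqrt{1+r^2}},\frac{\nabla v}{\sqrt{1+r^2}},\frac{\partial v}{\partial r}-itk_0v\in L^2(\mathbb{R}^{3-}\setminus\overline{\Gamma})\}$; the problem is uniquely solvable there. *)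

theory Defs
  imports "HOL-Analysis.Analysis"
begin

definition lower_half :: "(real^3) set" where
  "lower_half = {x. x $ 3 < 0}"

definition bdry_plane :: "(real^3) set" where
  "bdry_plane = {x. x $ 3 = 0}"

definition lipschitz_domain :: "(real^3) set \<Rightarrow> bool" where
  "lipschitz_domain D \<longleftrightarrow> open D \<and> bounded D \<and> connected D \<and> D \<noteq> {} \<and>
     (\<forall>p\<in>frontier D. \<exists>r>0. \<exists>(Q :: real^3 \<Rightarrow> real^3) (f :: real \<times> real \<Rightarrow> real) L.
        orthogonal_transformation Q \<and> L-lipschitz_on UNIV f \<and>
        (\<forall>x\<in>ball p r. x \<in> D \<longleftrightarrow> Q (x - p) $ 3 < f (Q (x - p) $ 1, Q (x - p) $ 2)))"

text \<open>Gamma is a Lipschitz open surface: a relatively open part of the boundary of a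
  Lipschitz domain D, forming a Lipschitz dissection of the boundary of D together with
  its complement Gamma' and the Lipschitz curve Pi between them.\<close>
definition lipschitz_open_surface :: "(real^3) set \<Rightarrow> bool" where
  "lipschitz_open_surface \<Gamma> \<longleftrightarrow> (\<exists>D \<Gamma>' Pc. lipschitz_domain D \<and>
     frontier D = \<Gamma> \<union> Pc \<union> \<Gamma>' \<and> \<Gamma> \<inter> Pc = {} \<and> \<Gamma> \<inter> \<Gamma>' = {} \<and> Pc \<inter> \<Gamma>' = {} \<and>
     \<Gamma> \<noteq> {} \<and> \<Gamma>' \<noteq> {} \<and>
     openin (top_of_set (frontier D)) \<Gamma> \<and> openin (top_of_set (frontier D)) \<Gamma>' \<and>
     (\<forall>p\<in>Pc. \<exists>r>0. \<exists>(Q :: real^3 \<Rightarrow> real^3) (f :: real \<times> real \<Rightarrow> real) (h :: real \<Rightarrow> real) L M.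
        orthogonal_transformation Q \<and> L-lipschitz_on UNIV f \<and> M-lipschitz_on UNIV h \<and>
        (\<forall>x\<in>ball p r.
           (x \<in> D \<longleftrightarrow> Q (x - p) $ 3 < f (Q (x - p) $ 1, Q (x - p) $ 2)) \<and>
           (x \<in> \<Gamma> \<longleftrightarrow> Q (x - p) $ 3 = f (Q (x - p) $ 1, Q (x - p) $ 2) \<and>
                        Q (x - p) $ 2 < h (Q (x - p) $ 1)) \<and>
           (x \<in> \<Gamma>' \<longleftrightarrow> Q (x - p) $ 3 = f (Q (x - p) $ 1, Q (x - p) $ 2) \<and>
                        Q (x - p) $ 2 > h (Q (x - p) $ 1)))))"

definition std_simplex2 :: "(real \<times> real) set" where
  "std_simplex2 = {(s, r). 0 \<le> s \<and> 0 \<le> r \<and> s + r \<le> 1}"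

definition tri_param :: "real^3 \<Rightarrow> real^3 \<Rightarrow> real^3 \<Rightarrow> real \<times> real \<Rightarrow> real^3" where
  "tri_param a b c p = a + fst p *\<^sub>R (b - a) + snd p *\<^sub>R (c - a)"

definition tri_set :: "(real^3) \<times> (real^3) \<times> (real^3) \<Rightarrow> (real^3) set" where
  "tri_set T = (case T of (a, b, c) \<Rightarrow> convex hull {a, b, c})"

definition is_triangulation :: "(real^3) set \<Rightarrow> ((real^3) \<times> (real^3) \<times> (real^3)) set \<Rightarrow> bool" where
  "is_triangulation S Ts \<longleftrightarrow> finite Ts \<and>
     (\<forall>(a, b, c)\<in>Ts. cross3 (b - a) (c - a) \<noteq> 0) \<and>
     S = (\<Union>T\<in>Ts. tri_set T) \<and>
     (\<forall>T1\<in>Ts. \<forall>T2\<in>Ts. T1 \<noteq> T2 \<longrightarrow> rel_interior (tri_set T1) \<inter> rel_interior (tri_set T2) = {})"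

text \<open>Class P: Lipschitz open surfaces that are finite unions of (planar) polygons,
  i.e. whose closure admits a finite triangulation.\<close>
definition class_P :: "(real^3) set \<Rightarrow> bool" where
  "class_P \<Gamma> \<longleftrightarrow> lipschitz_open_surface \<Gamma> \<and> (\<exists>Ts. is_triangulation (closure \<Gamma>) Ts)"

definition tris :: "(real^3) set \<Rightarrow> ((real^3) \<times> (real^3) \<times> (real^3)) set" where
  "tris \<Gamma> = (SOME Ts. is_triangulation (closure \<Gamma>) Ts)"

definition surf_int :: "(real^3) set \<Rightarrow> (real^3 \<Rightarrow> complex) \<Rightarrow> complex" where
  "surf_int \<Gamma> f = (\<Sum>(a, b, c)\<in>tris \<Gamma>.
      of_real (norm (cross3 (b - a) (c - a))) *
      (LINT p | lebesgue_on std_simplex2. f (tri_param a b c p)))"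

definition surf_null :: "(real^3) set \<Rightarrow> (real^3) set \<Rightarrow> bool" where
  "surf_null \<Gamma> N \<longleftrightarrow> (\<forall>(a, b, c)\<in>tris \<Gamma>.
      {p \<in> std_simplex2. tri_param a b c p \<in> N} \<in> null_sets lebesgue)"

definition surf_ae :: "(real^3) set \<Rightarrow> (real^3 \<Rightarrow> bool) \<Rightarrow> bool" where
  "surf_ae \<Gamma> P \<longleftrightarrow> (\<exists>N. surf_null \<Gamma> N \<and> (\<forall>x\<in>\<Gamma> - N. P x))"

definition unit_normal_on :: "(real^3) set \<Rightarrow> (real^3 \<Rightarrow> real^3) \<Rightarrow> bool" where
  "unit_normal_on \<Gamma> n \<longleftrightarrow> (\<forall>(a, b, c)\<in>tris \<Gamma>. \<exists>\<sigma>\<in>{1, -1::real}.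
      \<forall>x\<in>rel_interior (convex hull {a, b, c}).
        n x = (\<sigma> / norm (cross3 (b - a) (c - a))) *\<^sub>R cross3 (b - a) (c - a))"

definition L2_on :: "'a::euclidean_space set \<Rightarrow> ('a \<Rightarrow> complex) \<Rightarrow> bool" where
  "L2_on \<Omega> f \<longleftrightarrow> f \<in> borel_measurable (lebesgue_on \<Omega>) \<and>
     integrable (lebesgue_on \<Omega>) (\<lambda>x. (norm (f x))\<^sup>2)"

definition surf_L2 :: "(real^3) set \<Rightarrow> (real^3 \<Rightarrow> complex) \<Rightarrow> bool" where
  "surf_L2 \<Gamma> g \<longleftrightarrow> (\<forall>(a, b, c)\<in>tris \<Gamma>. L2_on std_simplex2 (\<lambda>p. g (tri_param a b c p)))"

definition full_support :: "(real^3) set \<Rightarrow> (real^3 \<Rightarrow> complex) \<Rightarrow> bool" where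
  "full_support \<Gamma> g \<longleftrightarrow> (\<forall>x\<in>\<Gamma>. \<forall>r>0. \<not> surf_ae \<Gamma> (\<lambda>y. y \<in> ball x r \<longrightarrow> g y = 0))"

definition tsupp :: "(real^3 \<Rightarrow> real) \<Rightarrow> (real^3) set" where
  "tsupp \<phi> = closure {x. \<phi> x \<noteq> 0}"

definition test_fn :: "(real^3 \<Rightarrow> real) \<Rightarrow> (real^3 \<Rightarrow> real^3) \<Rightarrow> bool" where
  "test_fn \<phi> d\<phi> \<longleftrightarrow> continuous_on UNIV d\<phi> \<and>
     (\<forall>x. (\<phi> has_derivative (\<lambda>h. d\<phi> x \<bullet> h)) (at x)) \<and> compact (tsupp \<phi>)"

definition weak_grad :: "(real^3) set \<Rightarrow> (real^3 \<Rightarrow> complex) \<Rightarrow> (real^3 \<Rightarrow> complex^3) \<Rightarrow> bool" where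
  "weak_grad \<Omega> u w \<longleftrightarrow> (\<forall>\<phi> d\<phi>. test_fn \<phi> d\<phi> \<and> tsupp \<phi> \<subseteq> \<Omega> \<longrightarrow> (\<forall>j.
      (LINT x | lebesgue_on \<Omega>. u x * of_real (d\<phi> x $ j)) =
      - (LINT x | lebesgue_on \<Omega>. w x $ j * of_real (\<phi> x))))"

text \<open>u (with weak gradient w on the complement of closure Gamma in the lower half-space)
  solves the problem with wavenumber t*k, Neumann condition on the plane x3 = 0,
  continuity of the normal derivative across Gamma, jump [u] = g across Gamma in direction n,
  and u in the space V_{t,Gamma}. The PDE, the Neumann condition and the normal derivative
  transmission condition are imposed in the standard weak form; the jump condition via
  the distributional gradient across Gamma.\<close>
definition is_solution ::
  "(real^3 \<Rightarrow> real) \<Rightarrow> real \<Rightarrow> real \<Rightarrow> (real^3) set \<Rightarrow> (real^3 \<Rightarrow> complex) \<Rightarrow> (real^3 \<Rightarrow> real^3)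
     \<Rightarrow> (real^3 \<Rightarrow> complex) \<Rightarrow> (real^3 \<Rightarrow> complex^3) \<Rightarrow> bool" where
  "is_solution k k0 t \<Gamma> g n u w \<longleftrightarrow>
     (let \<Omega> = lower_half - closure \<Gamma> in
       weak_grad \<Omega> u w \<and>
       L2_on \<Omega> (\<lambda>x. u x / of_real (sqrt (1 + (norm x)\<^sup>2))) \<and>
       (\<forall>j. L2_on \<Omega> (\<lambda>x. w x $ j / of_real (sqrt (1 + (norm x)\<^sup>2)))) \<and>
       L2_on \<Omega> (\<lambda>x. (\<Sum>j\<in>UNIV. w x $ j * of_real (x $ j / norm x)) - \<i> * of_real (t * k0) * u x) \<and>
       (\<forall>\<phi> d\<phi>. test_fn \<phi> d\<phi> \<longrightarrow>
          (LINT x | lebesgue_on \<Omega>.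
             (\<Sum>j\<in>UNIV. w x $ j * of_real (d\<phi> x $ j)) - of_real (t\<^sup>2 * (k x)\<^sup>2) * u x * of_real (\<phi> x)) = 0) \<and>
       (\<forall>\<phi> d\<phi>. test_fn \<phi> d\<phi> \<and> tsupp \<phi> \<subseteq> lower_half \<longrightarrow> (\<forall>j.
          (LINT x | lebesgue_on \<Omega>. u x * of_real (d\<phi> x $ j) + w x $ j * of_real (\<phi> x)) =
          - surf_int \<Gamma> (\<lambda>x. g x * of_real (n x $ j) * of_real (\<phi> x)))))"

text \<open>The traces of u1 and u2 on the relatively open set V of the plane x3 = 0 coincide
  (weak formulation via the Gauss-Green formula, localized away from both surfaces).\<close>
definition traces_agree_on ::
  "(real^3) set \<Rightarrow> (real^3) set \<Rightarrow> (real^3) set \<Rightarrow> (real^3 \<Rightarrow> complex) \<Rightarrow> (real^3 \<Rightarrow> complex^3)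
     \<Rightarrow> (real^3 \<Rightarrow> complex) \<Rightarrow> (real^3 \<Rightarrow> complex^3) \<Rightarrow> bool" where
  "traces_agree_on V \<Gamma>1 \<Gamma>2 u1 w1 u2 w2 \<longleftrightarrow>
     (\<forall>\<phi> d\<phi>. test_fn \<phi> d\<phi> \<and> tsupp \<phi> \<inter> bdry_plane \<subseteq> V \<and>
        tsupp \<phi> \<inter> (closure \<Gamma>1 \<union> closure \<Gamma>2) = {} \<longrightarrow>
        (LINT x | lebesgue_on lower_half.
           (u1 x - u2 x) * of_real (d\<phi> x $ 3) + (w1 x $ 3 - w2 x $ 3) * of_real (\<phi> x)) = 0)"

end

theory Submission
  imports Defs
begin

text \<open>
  The jump condition says that \<open>(\<Delta> + t\<^sup>2 k\<^sup>2) u = F\<close> in the sense of distributions on the half-space, where the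
  double layer \<open>F\<close> is given by the surface and the jump and does not depend on \<open>t\<close>. If the traces of \<open>u1\<close> and \<open>u2\<close>
  agree on \<open>V\<close>, unique continuation from the plane (via a Carleman estimate, as \<open>k\<close> is only bounded) shows that
  \<open>v = u1 - u2\<close> vanishes outside a fixed box, so \<open>F1 - F2\<close> does not radiate at the frequency \<open>t\<close>.

  Suppose this happens at distinct frequencies \<open>t n\<close> that accumulate. The divided differences \<open>b n\<close> of the corresponding
  \<open>v\<close> with respect to \<open>l n = (t n)\<^sup>2\<close> have compact support and satisfy \<open>(\<Delta> + l n k\<^sup>2) (b n) = - k\<^sup>2 (b (n - 1))\<close>. By the
  Carleman estimate their norms decay faster than any geometric sequence; by symmetry of the Laplacian they are almost
  log-convex and cannot do so unless they vanish. Hence \<open>F1 = F2\<close>, and then surfaces and jumps coincide for all \<open>t\<close>.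
  So either the conclusion always holds or the exceptional frequencies have no accumulation point.
\<close>

section \<open>Square-integrable functions\<close>

text \<open>Across the surfaces a single \<open>v n\<close> solves no equation with a
  square-integrable right-hand side, because the double layer is a derivative of a surface measure.
  Only differences between two frequencies do. This is why one frequency gives no conclusion and why
  Newton divided differences appear: from order one on they no longer contain the double layer. They
  replace analytic dependence on \<open>t\<close>, so no resolvent or spectral theory enters, and an
  accumulation point 0 is treated like any other.

  Log-convexity is disturbed by the differences of consecutive \<open>l n\<close>. These must be
  summable, so the accumulating frequencies are picked with geometric speed. The Carleman weight is
  singular at its centre; the origin serves as centre, since it lies on the boundary plane and hence
  outside the box.

  The two surfaces together may enclose a region that unique continuation from the plane cannot
  reach. Hence the solutions are only shown to vanish outside a box around both, and what happens
  inside is left to the divided differences.\<close>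

definition L2 :: "'a measure \<Rightarrow> ('a \<Rightarrow> real) \<Rightarrow> bool" where
  "L2 M f \<longleftrightarrow> f \<in> borel_measurable M \<and> integrable M (\<lambda>x. (f x)\<^sup>2)"

lemma L2_measurable [measurable_dest]: "L2 M f \<Longrightarrow> f \<in> borel_measurable M"
  and L2_square_integrable: "L2 M f \<Longrightarrow> integrable M (\<lambda>x. (f x)\<^sup>2)"
  by (auto simp: L2_def)

lemma L2_bound:
  assumes "f \<in> borel_measurable M" "integrable M g" "\<And>x. x \<in> space M \<Longrightarrow> (f x)\<^sup>2 \<le> g x"
  shows "L2 M f"
  unfolding L2_def
proof
  have m[measurable]: "f \<in> borel_measurable M" by fact
  show "integrable M (\<lambda>x. (f x)\<^sup>2)"
    by (rule Bochner_Integration.integrable_bound[OF assms(2)])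
       (auto intro!: AE_I2 order.trans[OF assms(3)])
qed fact

lemma L2_mult_integrable:
  assumes "L2 M f" "L2 M g" shows "integrable M (\<lambda>x. f x * g x)"
proof (rule Bochner_Integration.integrable_bound)
  show "integrable M (\<lambda>x. (f x)\<^sup>2 + (g x)\<^sup>2)" using assms by (auto simp: L2_def)
  show "(\<lambda>x. f x * g x) \<in> borel_measurable M" using assms by (auto simp: L2_def)
  have "\<bar>a * b\<bar> \<le> a\<^sup>2 + b\<^sup>2" for a b :: real
  proof -
    have "0 \<le> (\<bar>a\<bar> - \<bar>b\<bar>)\<^sup>2" by simp
    then have "2 * (\<bar>a\<bar> * \<bar>b\<bar>) \<le> a\<^sup>2 + b\<^sup>2" by (simp add: power2_diff)
    moreover have "0 \<le> \<bar>a\<bar> * \<bar>b\<bar>" by simp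
    ultimately show ?thesis unfolding abs_mult by linarith
  qed
  then show "AE x in M. norm (f x * g x) \<le> norm ((f x)\<^sup>2 + (g x)\<^sup>2)" by (auto simp: abs_mult)
qed

lemma L2_add: assumes "L2 M f" "L2 M g" shows "L2 M (\<lambda>x. f x + g x)"
proof -
  have "integrable M (\<lambda>x. (f x)\<^sup>2 + (g x)\<^sup>2 + 2 * (f x * g x))"
    using assms L2_mult_integrable[OF assms] by (auto simp: L2_def)
  then show ?thesis using assms by (auto simp: L2_def power2_sum mult.assoc)
qed

lemma L2_cmult: "L2 M f \<Longrightarrow> L2 M (\<lambda>x. c * f x)"
  by (auto simp: L2_def power_mult_distrib)

lemma L2_diff: assumes "L2 M f" "L2 M g" shows "L2 M (\<lambda>x. f x - g x)"
  using L2_add[OF assms(1) L2_cmult[OF assms(2), of "-1"]] by simp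

lemma L2_zero [simp]: "L2 M (\<lambda>x. 0)" by (simp add: L2_def)

lemma L2_sum: "finite A \<Longrightarrow> (\<And>i. i \<in> A \<Longrightarrow> L2 M (f i)) \<Longrightarrow> L2 M (\<lambda>x. \<Sum>i\<in>A. f i x)"
  by (induction A rule: finite_induct) (auto intro: L2_add)

lemma L2_bounded_mult:
  assumes "L2 M f" "b \<in> borel_measurable M" "\<And>x. \<bar>b x\<bar> \<le> C"
  shows "L2 M (\<lambda>x. b x * f x)"
proof (rule L2_bound[where g = "\<lambda>x. C\<^sup>2 * (f x)\<^sup>2"])
  show "(b x * f x)\<^sup>2 \<le> C\<^sup>2 * (f x)\<^sup>2" for x
    using power_mono[OF assms(3), of x 2] by (auto simp: power_mult_distrib intro!: mult_right_mono)
qed (use assms in \<open>auto simp: L2_def\<close>)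

text \<open>The integral of \<open>(f + t * g)\<^sup>2\<close> is a nonnegative quadratic polynomial
  in \<open>t\<close>; its value at the minimiser \<open>- B / C\<close> yields the claim. For
  \<open>C = 0\<close> the polynomial is affine, so \<open>B\<close> must vanish.\<close>

lemma L2_Cauchy_Schwarz:
  assumes "L2 M f" "L2 M g"
  shows "(\<integral>x. f x * g x \<partial>M)\<^sup>2 \<le> (\<integral>x. (f x)\<^sup>2 \<partial>M) * (\<integral>x. (g x)\<^sup>2 \<partial>M)"
proof -
  define A B C where "A = (\<integral>x. (f x)\<^sup>2 \<partial>M)" and "B = (\<integral>x. f x * g x \<partial>M)" and "C = (\<integral>x. (g x)\<^sup>2 \<partial>M)"
  note i = L2_square_integrable[OF assms(1)] L2_square_integrable[OF assms(2)] L2_mult_integrable[OF assms]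
  have q: "0 \<le> A + 2 * t * B + t\<^sup>2 * C" for t
  proof -
    have "0 \<le> (\<integral>x. (f x + t * g x)\<^sup>2 \<partial>M)" by simp
    also have "\<dots> = (\<integral>x. (f x)\<^sup>2 + (2 * t) * (f x * g x) + t\<^sup>2 * (g x)\<^sup>2 \<partial>M)"
      by (rule Bochner_Integration.integral_cong) (auto simp: power2_sum power_mult_distrib)
    also have "\<dots> = A + 2 * t * B + t\<^sup>2 * C"
      using i by (simp add: A_def B_def C_def)
    finally show ?thesis .
  qed
  have C0: "C \<ge> 0" by (simp add: C_def)
  show ?thesis
  proof (cases "C = 0")
    case True
    have "B = 0"
    proof (rule ccontr)
      assume "B \<noteq> 0"
      \<comment> \<open>At this \<open>t\<close> the affine polynomial would equal -1.\<close>
      with q[of "- (A + 1) / (2 * B)"] True show False by (simp add: field_simps)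
    qed
    then show ?thesis using True by (simp add: A_def B_def C_def)
  next
    case False
    with C0 have "C > 0" by simp
    have "0 \<le> C * (A + 2 * (- B / C) * B + (- B / C)\<^sup>2 * C)"
      using q[of "- B / C"] C0 by (intro mult_nonneg_nonneg) auto
    also have "\<dots> = A * C - B\<^sup>2" using \<open>C > 0\<close> by (simp add: field_simps power2_eq_square)
    finally show ?thesis unfolding A_def[symmetric] B_def[symmetric] C_def[symmetric] by simp
  qed
qed

lemma L2_Cauchy_Schwarz_abs:
  assumes "L2 M f" "L2 M g"
  shows "\<bar>\<integral>x. f x * g x \<partial>M\<bar> \<le> sqrt (\<integral>x. (f x)\<^sup>2 \<partial>M) * sqrt (\<integral>x. (g x)\<^sup>2 \<partial>M)"
  using real_sqrt_le_mono[OF L2_Cauchy_Schwarz[OF assms]] by (simp add: real_sqrt_mult)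

definition L2_conv :: "'a measure \<Rightarrow> (nat \<Rightarrow> 'a \<Rightarrow> real) \<Rightarrow> ('a \<Rightarrow> real) \<Rightarrow> bool" where
  "L2_conv M F f \<longleftrightarrow> (\<forall>n. L2 M (F n)) \<and> L2 M f \<and> (\<lambda>n. \<integral>x. (F n x - f x)\<^sup>2 \<partial>M) \<longlonglongrightarrow> 0"

lemma L2_conv_const: "L2 M f \<Longrightarrow> L2_conv M (\<lambda>n. f) f"
  by (simp add: L2_conv_def)

lemma L2_conv_bounded_mult:
  assumes "L2_conv M F f" "b \<in> borel_measurable M" "\<And>x. \<bar>b x\<bar> \<le> C"
  shows "L2_conv M (\<lambda>n x. b x * F n x) (\<lambda>x. b x * f x)"
proof -
  have L: "L2 M (F n)" "L2 M f" for n using assms(1) by (auto simp: L2_conv_def)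
  have lim: "(\<lambda>n. \<integral>x. (F n x - f x)\<^sup>2 \<partial>M) \<longlonglongrightarrow> 0" using assms(1) by (auto simp: L2_conv_def)
  have le: "(\<integral>x. (b x * F n x - b x * f x)\<^sup>2 \<partial>M) \<le> C\<^sup>2 * (\<integral>x. (F n x - f x)\<^sup>2 \<partial>M)" for n
  proof -
    have "(\<integral>x. (b x * F n x - b x * f x)\<^sup>2 \<partial>M) \<le> (\<integral>x. C\<^sup>2 * (F n x - f x)\<^sup>2 \<partial>M)"
    proof (rule integral_mono)
      show "integrable M (\<lambda>x. (b x * F n x - b x * f x)\<^sup>2)"
        by (intro L2_square_integrable L2_diff L2_bounded_mult[OF _ assms(2,3)] L)
      show "integrable M (\<lambda>x. C\<^sup>2 * (F n x - f x)\<^sup>2)"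
        by (intro integrable_mult_right L2_square_integrable L2_diff L)
      show "(b x * F n x - b x * f x)\<^sup>2 \<le> C\<^sup>2 * (F n x - f x)\<^sup>2" for x
        using power_mono[OF assms(3), of x 2]
        by (auto simp: power_mult_distrib right_diff_distrib[symmetric] intro!: mult_right_mono)
    qed
    then show ?thesis by simp
  qed
  have "(\<lambda>n. C\<^sup>2 * (\<integral>x. (F n x - f x)\<^sup>2 \<partial>M)) \<longlonglongrightarrow> 0"
    using tendsto_mult_left[OF lim, of "C\<^sup>2"] by simp
  then have "(\<lambda>n. \<integral>x. (b x * F n x - b x * f x)\<^sup>2 \<partial>M) \<longlonglongrightarrow> 0"
  proof (rule Lim_null_comparison[rotated], intro always_eventually allI)
    fix n show "norm (\<integral>x. (b x * F n x - b x * f x)\<^sup>2 \<partial>M) \<le> C\<^sup>2 * (\<integral>x. (F n x - f x)\<^sup>2 \<partial>M)"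
      using le[of n] by (simp only: real_norm_def abs_of_nonneg integral_nonneg_AE AE_I2 zero_le_power2)
  qed
  then show ?thesis using L2_bounded_mult[OF L(1) assms(2,3)] L2_bounded_mult[OF L(2) assms(2,3)]
    by (simp add: L2_conv_def)
qed

text \<open>Products are all that has to survive the removal of mollifiers: both sides of the
  Carleman estimate and the symmetric pairing of the Laplacian are integrals of this kind.\<close>

lemma L2_conv_mult:
  assumes "L2_conv M F f" "L2_conv M G g"
  shows "(\<lambda>n. \<integral>x. F n x * G n x \<partial>M) \<longlonglongrightarrow> (\<integral>x. f x * g x \<partial>M)"
proof -
  have L: "L2 M (F n)" "L2 M f" "L2 M (G n)" "L2 M g" for n using assms by (auto simp: L2_conv_def)
  define e d where "e = (\<lambda>n. \<integral>x. (F n x - f x)\<^sup>2 \<partial>M)" and "d = (\<lambda>n. \<integral>x. (G n x - g x)\<^sup>2 \<partial>M)"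
  have lim: "e \<longlonglongrightarrow> 0" "d \<longlonglongrightarrow> 0" using assms by (auto simp: L2_conv_def e_def d_def)
  have i: "integrable M (\<lambda>x. (F n x - f x) * (G n x - g x))" "integrable M (\<lambda>x. (F n x - f x) * g x)"
    "integrable M (\<lambda>x. f x * (G n x - g x))" for n
    by (intro L2_mult_integrable L2_diff L)+
  \<comment> \<open>Each of the three products contains a factor that tends to 0 in L2, so
    Cauchy-Schwarz handles all of them.\<close>
  have eq: "(\<integral>x. F n x * G n x \<partial>M) - (\<integral>x. f x * g x \<partial>M) =
     (\<integral>x. (F n x - f x) * (G n x - g x) \<partial>M) + (\<integral>x. (F n x - f x) * g x \<partial>M) + (\<integral>x. f x * (G n x - g x) \<partial>M)" for n
  proof -
    have "(\<integral>x. F n x * G n x \<partial>M) - (\<integral>x. f x * g x \<partial>M) = (\<integral>x. F n x * G n x - f x * g x \<partial>M)"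
      by (intro Bochner_Integration.integral_diff[symmetric] L2_mult_integrable L)
    also have "\<dots> = (\<integral>x. ((F n x - f x) * (G n x - g x) + (F n x - f x) * g x) + f x * (G n x - g x) \<partial>M)"
      by (rule Bochner_Integration.integral_cong) (auto simp: algebra_simps)
    also have "\<dots> = (\<integral>x. (F n x - f x) * (G n x - g x) \<partial>M) + (\<integral>x. (F n x - f x) * g x \<partial>M) + (\<integral>x. f x * (G n x - g x) \<partial>M)"
      using i by (simp add: integrable_add)
    finally show ?thesis .
  qed
  have bd: "norm ((\<integral>x. F n x * G n x \<partial>M) - (\<integral>x. f x * g x \<partial>M)) \<le>
     sqrt (e n) * sqrt (d n) + sqrt (e n) * sqrt (\<integral>x. (g x)\<^sup>2 \<partial>M) + sqrt (\<integral>x. (f x)\<^sup>2 \<partial>M) * sqrt (d n)" for n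
  proof -
    have t: "\<bar>a\<bar> \<le> a' \<Longrightarrow> \<bar>b\<bar> \<le> b' \<Longrightarrow> \<bar>c\<bar> \<le> c' \<Longrightarrow> \<bar>a + b + c\<bar> \<le> a' + b' + c'" for a b c a' b' c' :: real
      by linarith
    show ?thesis unfolding eq e_def d_def real_norm_def
    by (intro t L2_Cauchy_Schwarz_abs L2_diff L)
  qed
  have "(\<lambda>n. sqrt (e n) * sqrt (d n) + sqrt (e n) * sqrt (\<integral>x. (g x)\<^sup>2 \<partial>M) + sqrt (\<integral>x. (f x)\<^sup>2 \<partial>M) * sqrt (d n))
    \<longlonglongrightarrow> sqrt 0 * sqrt 0 + sqrt 0 * sqrt (\<integral>x. (g x)\<^sup>2 \<partial>M) + sqrt (\<integral>x. (f x)\<^sup>2 \<partial>M) * sqrt 0"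
    by (intro tendsto_intros lim)
  then have "(\<lambda>n. sqrt (e n) * sqrt (d n) + sqrt (e n) * sqrt (\<integral>x. (g x)\<^sup>2 \<partial>M) + sqrt (\<integral>x. (f x)\<^sup>2 \<partial>M) * sqrt (d n)) \<longlonglongrightarrow> 0"
    by simp
  then have "(\<lambda>n. (\<integral>x. F n x * G n x \<partial>M) - (\<integral>x. f x * g x \<partial>M)) \<longlonglongrightarrow> 0"
    by (rule Lim_null_comparison[rotated]) (use bd in auto)
  then show ?thesis by (simp add: LIM_zero_iff)
qed

text \<open>\<open>measurable_on\<close> means by definition that the function is a limit of
  continuous functions off a negligible set; Borel measurability is converted into it.\<close>

lemma borel_imp_ae_limit_continuous:
  fixes f :: "'a::euclidean_space \<Rightarrow> real"
  assumes "f \<in> borel_measurable borel"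
  obtains g where "\<And>n. continuous_on UNIV (g n)" "AE x in lborel. (\<lambda>n. g n x) \<longlonglongrightarrow> f x"
proof -
  have "f measurable_on UNIV"
    by (rule lebesgue_measurable_imp_measurable_on_real)
       (use assms in \<open>simp_all add: measurable_completion lebesgue_on_UNIV_eq\<close>)
  then obtain N g where N: "negligible N" and g: "\<And>n. continuous_on UNIV (g n)"
    and lim: "\<And>x. x \<notin> N \<Longrightarrow> (\<lambda>n. g n x) \<longlonglongrightarrow> f x"
    unfolding measurable_on_UNIV by (auto simp: measurable_on_def)
  have "AE x in lebesgue. x \<notin> N" using N by (simp add: negligible_iff_null_sets AE_not_in)
  then have "AE x in lebesgue. (\<lambda>n. g n x) \<longlonglongrightarrow> f x"
    by (rule AE_mp) (auto intro!: AE_I2 lim)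
  then have "AE x in lborel. (\<lambda>n. g n x) \<longlonglongrightarrow> f x"
    by (simp add: AE_completion_iff)
  with g show thesis by (rule that)
qed

section \<open>Mollification\<close>

lemma continuous_compact_support_integrable:
  fixes f :: "'a::euclidean_space \<Rightarrow> real"
  assumes "continuous_on UNIV f" "\<And>x. x \<notin> S \<Longrightarrow> f x = 0" "bounded S"
  shows "integrable lborel f"
proof -
  have "compact (closure S)" using assms(3) by simp
  then have "integrable lborel (\<lambda>x. indicator (closure S) x *\<^sub>R f x)"
    by (rule borel_integrable_compact) (rule continuous_on_subset[OF assms(1)], simp)
  moreover have "(\<lambda>x. indicator (closure S) x *\<^sub>R f x) = f"
    using assms(2) closure_subset[of S] by (auto simp: indicator_def fun_eq_iff)
  ultimately show ?thesis by simp
qed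

lemma continuous_compact_support_L2:
  fixes f :: "'a::euclidean_space \<Rightarrow> real"
  assumes "continuous_on UNIV f" "\<And>x. x \<notin> S \<Longrightarrow> f x = 0" "bounded S"
  shows "L2 lborel f"
  unfolding L2_def
proof
  show "f \<in> borel_measurable lborel" using borel_measurable_continuous_onI[OF assms(1)] by simp
  show "integrable lborel (\<lambda>x. (f x)\<^sup>2)"
    by (rule continuous_compact_support_integrable[where S = S])
       (use assms in \<open>auto intro!: continuous_intros\<close>)
qed

lemma continuous_compact_support_bounded:
  fixes f :: "'a::euclidean_space \<Rightarrow> real"
  assumes "continuous_on UNIV f" "\<And>x. x \<notin> S \<Longrightarrow> f x = 0" "bounded S"
  obtains B where "B \<ge> 0" "\<And>x. \<bar>f x\<bar> \<le> B"
proof -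
  have "compact (closure S)" using assms(3) by simp
  then have "bounded (f ` closure S)"
    by (intro compact_imp_bounded compact_continuous_image continuous_on_subset[OF assms(1)]) auto
  then obtain B where B: "\<And>x. x \<in> closure S \<Longrightarrow> \<bar>f x\<bar> \<le> B" by (auto simp: bounded_iff)
  have "\<bar>f x\<bar> \<le> max B 0" for x
    using B[of x] assms(2)[of x] closure_subset[of S] by (cases "x \<in> closure S") (auto simp: subset_eq max_def)
  then show thesis by (intro that[of "max B 0"]) auto
qed

lemma lborel_integral_translate:
  fixes f :: "'a::euclidean_space \<Rightarrow> real"
  assumes [measurable]: "f \<in> borel_measurable borel"
  shows "(\<integral>x. f (x - t) \<partial>lborel) = (\<integral>x. f x \<partial>lborel)"
proof -
  have "(\<integral>x. f x \<partial>lborel) = (\<integral>x. f x \<partial>(distr lborel borel ((+) (- t))))"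
    by (simp add: lborel_distr_plus)
  also have "\<dots> = (\<integral>x. f (- t + x) \<partial>lborel)"
    by (rule integral_distr) auto
  finally show ?thesis by simp
qed

lemma lborel_distr_reflect:
  "distr lborel borel (\<lambda>x. t - x) = (lborel :: 'a::euclidean_space measure)"
proof -
  have "(lborel :: 'a measure) = density (distr lborel borel (\<lambda>x. t + (\<Sum>j\<in>Basis. ((-1) * (x \<bullet> j)) *\<^sub>R j))) (\<lambda>_. ennreal (\<Prod>j\<in>(Basis::'a set). \<bar>-1::real\<bar>))"
    by (rule lborel_affine_euclidean) simp
  also have "(\<lambda>x. t + (\<Sum>j\<in>Basis. ((-1) * (x \<bullet> j)) *\<^sub>R j)) = (\<lambda>x. t - x)"
    by (auto simp: fun_eq_iff sum_negf euclidean_representation)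
  finally show ?thesis by (simp add: density_1)
qed

lemma lborel_integral_reflect:
  fixes f :: "'a::euclidean_space \<Rightarrow> real"
  assumes [measurable]: "f \<in> borel_measurable borel"
  shows "(\<integral>x. f (t - x) \<partial>lborel) = (\<integral>x. f x \<partial>lborel)"
proof -
  have "(\<integral>x. f x \<partial>lborel) = (\<integral>x. f x \<partial>(distr lborel borel (\<lambda>x. t - x)))"
    by (simp add: lborel_distr_reflect)
  also have "\<dots> = (\<integral>x. f (t - x) \<partial>lborel)"
    by (rule integral_distr) auto
  finally show ?thesis by simp
qed

text \<open>The truncation depends continuously on the value \<open>f x\<close> and on
  \<open>x\<close>, so it turns continuous functions into continuous functions of bounded support.
  It never moves a value by more than \<open>\<bar>f x\<bar>\<close>, which provides the dominating
  function.\<close>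

lemma L2_truncation:
  fixes f :: "'a::euclidean_space \<Rightarrow> real"
  assumes "L2 lborel f"
  shows "(\<lambda>n::nat. \<integral>x. (f x - max (- real n) (min (real n) (f x)) * max 0 (min 1 (real n - norm x)))\<^sup>2 \<partial>lborel) \<longlonglongrightarrow> 0"
proof -
  have [measurable]: "f \<in> borel_measurable borel" using L2_measurable[OF assms] by simp
  define F where "F = (\<lambda>n x. f x - max (- real n) (min (real n) (f x)) * max 0 (min 1 (real n - norm x)))"
  have "(\<lambda>n. \<integral>x. (F n x)\<^sup>2 \<partial>lborel) \<longlonglongrightarrow> (\<integral>x. 0 \<partial>(lborel :: 'a measure))"
  proof (rule integral_dominated_convergence[where w = "\<lambda>x. (f x)\<^sup>2"])
    show "AE x in lborel. (\<lambda>n. (F n x)\<^sup>2) \<longlonglongrightarrow> 0"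
    proof (rule AE_I2)
      fix x :: 'a
      obtain N :: nat where N: "real N \<ge> \<bar>f x\<bar> + norm x + 1" using real_arch_simple by blast
      have "F n x = 0" if "n \<ge> N" for n
      proof -
        have "real n \<ge> \<bar>f x\<bar> + norm x + 1" using N that by linarith
        then have "max (- real n) (min (real n) (f x)) = f x" "max 0 (min 1 (real n - norm x)) = 1"
          using norm_ge_zero[of x] by linarith+
        then show ?thesis by (simp add: F_def)
      qed
      then show "(\<lambda>n. (F n x)\<^sup>2) \<longlonglongrightarrow> 0"
        by (intro tendsto_eventually eventually_sequentiallyI[of N]) auto
    qed
    show "AE x in lborel. norm ((F n x)\<^sup>2) \<le> (f x)\<^sup>2" for n
    proof (rule AE_I2)
      fix x
      define c s where "c = max (- real n) (min (real n) (f x))" and "s = max 0 (min 1 (real n - norm x))"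
      have s: "0 \<le> s" "s \<le> 1" by (auto simp: s_def)
      have c: "(0 \<le> c \<and> c \<le> f x) \<or> (f x \<le> c \<and> c \<le> 0)" by (auto simp: c_def)
      have "\<bar>f x - c * s\<bar> \<le> \<bar>f x\<bar>"
      proof (cases "0 \<le> c \<and> c \<le> f x")
        case True
        then have "0 \<le> c * s" "c * s \<le> c" using s by (auto intro: mult_left_le)
        with True show ?thesis by linarith
      next
        case False
        with c have c': "f x \<le> c" "c \<le> 0" by auto
        then have "0 \<le> (- c) * s" "(- c) * s \<le> - c" using s by (intro mult_nonneg_nonneg mult_left_le; simp)+
        with c' show ?thesis by simp
      qed
      then show "norm ((F n x)\<^sup>2) \<le> (f x)\<^sup>2" by (simp add: F_def c_def s_def abs_le_square_iff)
    qed
  qed (use L2_square_integrable[OF assms] in \<open>auto simp: F_def\<close>)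
  then show ?thesis by (simp add: F_def)
qed

text \<open>The continuous functions \<open>g n\<close> converge to \<open>f\<close> almost
  everywhere, but without any domination. One fixed truncation applied to both \<open>g n\<close>
  and \<open>f\<close> bounds them by a constant on a ball, and then dominated convergence applies;
  the error made on \<open>f\<close> is small by \<open>L2_truncation\<close>.\<close>

lemma L2_dense_continuous:
  fixes f :: "'a::euclidean_space \<Rightarrow> real"
  assumes "L2 lborel f" "e > 0"
  obtains g R where "continuous_on UNIV g" "\<And>x. x \<notin> cball 0 R \<Longrightarrow> g x = 0"
    "(\<integral>x. (f x - g x)\<^sup>2 \<partial>lborel) < e"
proof -
  have fm[measurable]: "f \<in> borel_measurable borel" using L2_measurable[OF assms(1)] by simp
  obtain g where g: "\<And>n. continuous_on UNIV (g n)" "AE x in lborel. (\<lambda>n. g n x) \<longlonglongrightarrow> f x"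
    using borel_imp_ae_limit_continuous[OF fm] by blast
  have gm[measurable]: "g n \<in> borel_measurable borel" for n by (rule borel_measurable_continuous_onI[OF g(1)])
  have "\<forall>\<^sub>F n in sequentially. (\<integral>x. (f x - max (- real n) (min (real n) (f x)) * max 0 (min 1 (real n - norm x)))\<^sup>2 \<partial>lborel) < e / 4"
    by (rule order_tendstoD(2)[OF L2_truncation[OF assms(1)]]) (use assms in auto)
  then obtain N :: nat where N: "(\<integral>x. (f x - max (- real N) (min (real N) (f x)) * max 0 (min 1 (real N - norm x)))\<^sup>2 \<partial>lborel) < e / 4"
    by (auto simp: eventually_sequentially)
  define T where "T = (\<lambda>y x. max (- real N) (min (real N) y) * max 0 (min 1 (real N - norm (x::'a))))"
  have Tb: "\<bar>T y x\<bar> \<le> real N * indicator (cball 0 (real N)) x" for x y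
  proof (cases "norm x \<le> real N")
    case True
    have "\<bar>max (- real N) (min (real N) y)\<bar> \<le> real N" by auto
    moreover have "\<bar>max 0 (min 1 (real N - norm x))\<bar> \<le> 1" by auto
    ultimately have "\<bar>T y x\<bar> \<le> real N * 1" unfolding T_def abs_mult by (intro mult_mono) auto
    then show ?thesis using True by (simp add: dist_norm)
  next
    case False
    then show ?thesis by (simp add: T_def)
  qed
  have Tm[measurable]: "(\<lambda>x. T (h x) x) \<in> borel_measurable borel" if [measurable]: "h \<in> borel_measurable borel" for h
    unfolding T_def by measurable
  have vol: "integrable lborel (\<lambda>x::'a. c * indicator (cball 0 (real N)) x)" for c :: real
    by (intro integrable_mult_right integrable_real_indicator) (use emeasure_bounded_finite[OF bounded_cball] in auto)
  have TL: "L2 lborel (\<lambda>x. T (h x) x)" if "h \<in> borel_measurable borel" for h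
  proof (rule L2_bound[where g = "\<lambda>x. (real N)\<^sup>2 * indicator (cball 0 (real N)) x"])
    show "(\<lambda>x. T (h x) x) \<in> borel_measurable lborel" using Tm[OF that] by simp
    show "(T (h x) x)\<^sup>2 \<le> (real N)\<^sup>2 * indicator (cball 0 (real N)) x" for x
      using power_mono[OF Tb[of "h x" x], of 2] by (auto simp: power_mult_distrib indicator_def split: if_splits)
  qed (rule vol)
  have "(\<lambda>n. \<integral>x. (T (g n x) x - T (f x) x)\<^sup>2 \<partial>lborel) \<longlonglongrightarrow> (\<integral>x. 0 \<partial>(lborel::'a measure))"
  proof (rule integral_dominated_convergence[where w = "\<lambda>x. (2 * real N)\<^sup>2 * indicator (cball 0 (real N)) x"])
    show "AE x in lborel. (\<lambda>n. (T (g n x) x - T (f x) x)\<^sup>2) \<longlonglongrightarrow> 0"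
      using g(2)
    proof (rule AE_mp, intro AE_I2 impI)
      fix x assume "(\<lambda>n. g n x) \<longlonglongrightarrow> f x"
      then have "(\<lambda>n. (T (g n x) x - T (f x) x)\<^sup>2) \<longlonglongrightarrow> (T (f x) x - T (f x) x)\<^sup>2"
        unfolding T_def by (intro tendsto_intros)
      then show "(\<lambda>n. (T (g n x) x - T (f x) x)\<^sup>2) \<longlonglongrightarrow> 0" by simp
    qed
    show "AE x in lborel. norm ((T (g n x) x - T (f x) x)\<^sup>2) \<le> (2 * real N)\<^sup>2 * indicator (cball 0 (real N)) x" for n
    proof (rule AE_I2)
      fix x
      have "\<bar>T (g n x) x - T (f x) x\<bar> \<le> 2 * real N * indicator (cball 0 (real N)) x"
        using Tb[of "g n x" x] Tb[of "f x" x] by linarith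
      from power_mono[OF this, of 2] show "norm ((T (g n x) x - T (f x) x)\<^sup>2) \<le> (2 * real N)\<^sup>2 * indicator (cball 0 (real N)) x"
        by (auto simp: power_mult_distrib indicator_def split: if_splits)
    qed
    show "(\<lambda>x. (T (g n x) x - T (f x) x)\<^sup>2) \<in> borel_measurable lborel" for n
      using Tm[OF gm[of n]] Tm[OF fm] by simp
  qed (simp, rule vol)
  then have "\<forall>\<^sub>F n in sequentially. (\<integral>x. (T (g n x) x - T (f x) x)\<^sup>2 \<partial>lborel) < e / 4"
    by (intro order_tendstoD(2)) (use assms in auto)
  then obtain n where n: "(\<integral>x. (T (g n x) x - T (f x) x)\<^sup>2 \<partial>lborel) < e / 4"
    by (auto simp: eventually_sequentially)
  show thesis
  proof (rule that[of "\<lambda>x. T (g n x) x" "real N"])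
    show "continuous_on UNIV (\<lambda>x. T (g n x) x)" unfolding T_def
      by (intro continuous_intros g(1))
    show "T (g n x) x = 0" if "x \<notin> cball 0 (real N)" for x using Tb[of "g n x" x] that by simp
    have i: "integrable lborel (\<lambda>x. (f x - T (f x) x)\<^sup>2)" "integrable lborel (\<lambda>x. (T (g n x) x - T (f x) x)\<^sup>2)"
      "integrable lborel (\<lambda>x. (f x - T (g n x) x)\<^sup>2)"
      by (intro L2_square_integrable L2_diff assms TL fm gm)+
    have "(\<integral>x. (f x - T (g n x) x)\<^sup>2 \<partial>lborel) \<le> (\<integral>x. 2 * (f x - T (f x) x)\<^sup>2 + 2 * (T (g n x) x - T (f x) x)\<^sup>2 \<partial>lborel)"
    proof (rule integral_mono)
      fix x
      have "(a - c)\<^sup>2 \<le> 2 * (a - b)\<^sup>2 + 2 * (c - b)\<^sup>2" for a b c :: real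
      proof -
        have "2 * (a - b)\<^sup>2 + 2 * (c - b)\<^sup>2 - (a - c)\<^sup>2 = (a + c - 2 * b)\<^sup>2" by (simp add: power2_eq_square algebra_simps)
        then show ?thesis using zero_le_power2[of "a + c - 2 * b"] by linarith
      qed
      then show "(f x - T (g n x) x)\<^sup>2 \<le> 2 * (f x - T (f x) x)\<^sup>2 + 2 * (T (g n x) x - T (f x) x)\<^sup>2" .
    qed (use i in auto)
    also have "\<dots> = 2 * (\<integral>x. (f x - T (f x) x)\<^sup>2 \<partial>lborel) + 2 * (\<integral>x. (T (g n x) x - T (f x) x)\<^sup>2 \<partial>lborel)"
      using i by simp
    also have "\<dots> < e" using N n by (simp add: T_def)
    finally show "(\<integral>x. (f x - T (g n x) x)\<^sup>2 \<partial>lborel) < e" .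
  qed
qed

section \<open>Convolution and convergence of mollifications in L2\<close>

definition conv :: "('a::euclidean_space \<Rightarrow> real) \<Rightarrow> ('a \<Rightarrow> real) \<Rightarrow> 'a \<Rightarrow> real" where
  "conv v k x = (\<integral>y. v y * k (x - y) \<partial>lborel)"

definition mollifier :: "real \<Rightarrow> ('a::euclidean_space \<Rightarrow> real) \<Rightarrow> bool" where
  "mollifier e k \<longleftrightarrow> continuous_on UNIV k \<and> (\<forall>x. 0 \<le> k x) \<and> (\<forall>x. x \<notin> cball 0 e \<longrightarrow> k x = 0) \<and>
     (\<integral>x. k x \<partial>lborel) = 1 \<and> (\<forall>x. k (- x) = k x)"

lemma kernel_translate:
  fixes k :: "'a::euclidean_space \<Rightarrow> real"
  assumes "continuous_on UNIV k" "\<And>z. z \<notin> cball 0 e \<Longrightarrow> k z = 0"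
  shows "continuous_on UNIV (\<lambda>y. k (x - y))" "\<And>y. y \<notin> cball x e \<Longrightarrow> k (x - y) = 0"
proof -
  show "continuous_on UNIV (\<lambda>y. k (x - y))"
    by (rule continuous_on_compose2[OF assms(1)]) (auto intro!: continuous_intros)
  show "\<And>y. y \<notin> cball x e \<Longrightarrow> k (x - y) = 0" using assms(2) by (auto simp: dist_norm)
qed

lemma conv_integrable:
  fixes k :: "'a::euclidean_space \<Rightarrow> real"
  assumes "L2 lborel v" "continuous_on UNIV k" "\<And>z. z \<notin> cball 0 e \<Longrightarrow> k z = 0"
  shows "integrable lborel (\<lambda>y. v y * k (x - y))"
  by (intro L2_mult_integrable assms(1) continuous_compact_support_L2[where S = "cball x e"]
        kernel_translate[OF assms(2,3)]) auto

lemma conv_measurable [measurable]: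
  fixes k :: "'a::euclidean_space \<Rightarrow> real"
  assumes [measurable]: "v \<in> borel_measurable borel" "k \<in> borel_measurable borel"
  shows "conv v k \<in> borel_measurable borel"
proof -
  have "(\<lambda>x. \<integral>y. v y * k (x - y) \<partial>lborel) \<in> borel_measurable lborel"
    by measurable
  then show ?thesis by (simp add: conv_def[abs_def])
qed

text \<open>Since \<open>k (x - y)\<close> is a probability density in \<open>y\<close>, Jensen's
  inequality bounds the square of the average by the average of the square; here it is
  Cauchy-Schwarz with \<open>sqrt k\<close> as one factor. Exchanging the integrals and integrating
  in \<open>x\<close> first then gives the norm bound.\<close>

lemma mollify_contraction:
  fixes k :: "'a::euclidean_space \<Rightarrow> real"
  assumes v: "L2 lborel v" and k: "mollifier e k"
  shows "L2 lborel (conv v k)" "(\<integral>x. (conv v k x)\<^sup>2 \<partial>lborel) \<le> (\<integral>x. (v x)\<^sup>2 \<partial>lborel)"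
proof -
  have kc: "continuous_on UNIV k" and k0: "\<And>z. 0 \<le> k z" and ks: "\<And>z. z \<notin> cball 0 e \<Longrightarrow> k z = 0"
    and k1: "(\<integral>x. k x \<partial>lborel) = 1" using k by (auto simp: mollifier_def)
  have vm[measurable]: "v \<in> borel_measurable borel" using L2_measurable[OF v] by simp
  have km[measurable]: "k \<in> borel_measurable borel" by (rule borel_measurable_continuous_onI[OF kc])
  obtain B where B: "B \<ge> 0" "\<And>x. \<bar>k x\<bar> \<le> B"
    using continuous_compact_support_bounded[OF kc ks] by blast
  have i2: "integrable lborel (\<lambda>y. (v y)\<^sup>2 * k (x - y))" for x
  proof (rule Bochner_Integration.integrable_bound[of _ "\<lambda>y. B * (v y)\<^sup>2"])
    show "AE y in lborel. norm ((v y)\<^sup>2 * k (x - y)) \<le> norm (B * (v y)\<^sup>2)"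
      using B by (intro AE_I2) (auto simp: abs_mult mult.commute[of "(v y)\<^sup>2" for y] intro!: mult_right_mono)
  qed (use L2_square_integrable[OF v] in auto)
  have pt: "(conv v k x)\<^sup>2 \<le> (\<integral>y. (v y)\<^sup>2 * k (x - y) \<partial>lborel)" for x
  proof -
    have ki: "integrable lborel (\<lambda>y. k (x - y))"
      by (rule continuous_compact_support_integrable[OF kernel_translate[OF kc ks] bounded_cball])
    have L: "L2 lborel (\<lambda>y. v y * sqrt (k (x - y)))" "L2 lborel (\<lambda>y. sqrt (k (x - y)))"
      using i2[of x] ki by (auto simp: L2_def power_mult_distrib k0)
    have "(conv v k x)\<^sup>2 = (\<integral>y. (v y * sqrt (k (x - y))) * sqrt (k (x - y)) \<partial>lborel)\<^sup>2"
      by (simp add: conv_def mult.assoc k0)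
    also have "\<dots> \<le> (\<integral>y. (v y * sqrt (k (x - y)))\<^sup>2 \<partial>lborel) * (\<integral>y. (sqrt (k (x - y)))\<^sup>2 \<partial>lborel)"
      by (rule L2_Cauchy_Schwarz[OF L])
    also have "(\<integral>y. (sqrt (k (x - y)))\<^sup>2 \<partial>lborel) = 1"
      using lborel_integral_reflect[OF km, of x] k1 by (simp add: k0)
    finally show ?thesis by (simp add: power_mult_distrib k0)
  qed
  define F where "F = (\<lambda>(y, x). (v y)\<^sup>2 * k (x - y))"
  have k1t: "(\<integral>x. k (x - y) \<partial>lborel) = 1" for y
    using lborel_integral_translate[OF km, of y] k1 by simp
  have iF: "integrable (lborel \<Otimes>\<^sub>M lborel) F"
  proof (rule lborel_pair.Fubini_integrable)
    show "F \<in> borel_measurable (lborel \<Otimes>\<^sub>M lborel)" unfolding F_def by measurable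
    have "(\<lambda>y. \<integral>x. norm (F (y, x)) \<partial>lborel) = (\<lambda>y. (v y)\<^sup>2)"
      unfolding F_def by (simp add: abs_mult k0 k1t)
    then show "integrable lborel (\<lambda>y. \<integral>x. norm (F (y, x)) \<partial>lborel)"
      using L2_square_integrable[OF v] by simp
    have "integrable lborel (\<lambda>x. k (x - y))" for y
      by (rule continuous_compact_support_integrable[where S = "cball y e"])
         (use ks in \<open>auto simp: dist_norm norm_minus_commute intro!: continuous_on_compose2[OF kc] continuous_intros\<close>)
    then show "AE y in lborel. integrable lborel (\<lambda>x. F (y, x))"
      by (auto simp: F_def)
  qed
  have ix: "integrable lborel (\<lambda>x. \<integral>y. F (y, x) \<partial>lborel)"
    by (rule lborel_pair.integrable_snd) (use iF in simp)
  have L: "L2 lborel (conv v k)"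
  proof (rule L2_bound[OF _ ix])
    show "(conv v k x)\<^sup>2 \<le> (\<integral>y. F (y, x) \<partial>lborel)" for x using pt[of x] by (simp add: F_def)
  qed simp
  show "L2 lborel (conv v k)" by fact
  have "(\<integral>x. (conv v k x)\<^sup>2 \<partial>lborel) \<le> (\<integral>x. \<integral>y. F (y, x) \<partial>lborel \<partial>lborel)"
    by (rule integral_mono[OF L2_square_integrable[OF L] ix]) (use pt in \<open>simp add: F_def\<close>)
  also have "\<dots> = (\<integral>y. \<integral>x. F (y, x) \<partial>lborel \<partial>lborel)"
    using lborel_pair.Fubini_integral[of "\<lambda>y x. F (y, x)"] iF by simp
  also have "\<dots> = (\<integral>y. (v y)\<^sup>2 \<partial>lborel)" by (simp add: F_def k1t)
  finally show "(\<integral>x. (conv v k x)\<^sup>2 \<partial>lborel) \<le> (\<integral>x. (v x)\<^sup>2 \<partial>lborel)" .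
qed

lemma conv_diff:
  fixes k :: "'a::euclidean_space \<Rightarrow> real"
  assumes "L2 lborel v" "L2 lborel w" "continuous_on UNIV k" "\<And>z. z \<notin> cball 0 e \<Longrightarrow> k z = 0"
  shows "conv (\<lambda>x. v x - w x) k x = conv v k x - conv w k x"
  using conv_integrable[OF assms(1,3,4), of e x] conv_integrable[OF assms(2,3,4), of e x]
  by (simp add: conv_def left_diff_distrib)

lemma mollify_continuous_close:
  fixes k :: "'a::euclidean_space \<Rightarrow> real"
  assumes g: "continuous_on UNIV g" "\<And>x. x \<notin> S \<Longrightarrow> g x = 0" "bounded S"
    and k: "mollifier e k" and close: "\<And>x y. dist x y \<le> e \<Longrightarrow> \<bar>g x - g y\<bar> \<le> d"
  shows "\<bar>conv g k x - g x\<bar> \<le> d"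
proof -
  have kc: "continuous_on UNIV k" and k0: "\<And>z. 0 \<le> k z" and ks: "\<And>z. z \<notin> cball 0 e \<Longrightarrow> k z = 0"
    and k1: "(\<integral>x. k x \<partial>lborel) = 1" using k by (auto simp: mollifier_def)
  have km[measurable]: "k \<in> borel_measurable borel" by (rule borel_measurable_continuous_onI[OF kc])
  have L: "L2 lborel g" by (rule continuous_compact_support_L2[OF g])
  have ki: "integrable lborel (\<lambda>y. k (x - y))"
    by (rule continuous_compact_support_integrable[OF kernel_translate[OF kc ks] bounded_cball])
  have k1': "(\<integral>y. k (x - y) \<partial>lborel) = 1" using lborel_integral_reflect[OF km, of x] k1 by simp
  have gi: "integrable lborel (\<lambda>y. g y * k (x - y))" by (rule conv_integrable[OF L kc ks])
  have "conv g k x - g x = (\<integral>y. g y * k (x - y) - g x * k (x - y) \<partial>lborel)"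
    using gi ki k1' by (simp add: conv_def)
  then have "\<bar>conv g k x - g x\<bar> \<le> (\<integral>y. \<bar>g y * k (x - y) - g x * k (x - y)\<bar> \<partial>lborel)"
    by (simp add: integral_abs_bound)
  also have "\<dots> \<le> (\<integral>y. d * k (x - y) \<partial>lborel)"
  proof (rule integral_mono)
    fix y
    show "\<bar>g y * k (x - y) - g x * k (x - y)\<bar> \<le> d * k (x - y)"
    proof (cases "dist y x \<le> e")
      case True
      then show ?thesis using close[OF True] k0[of "x - y"]
        by (simp add: left_diff_distrib[symmetric] abs_mult mult_right_mono)
    next
      case False
      then have "k (x - y) = 0" using ks[of "x - y"] by (simp add: dist_norm norm_minus_commute)
      then show ?thesis by simp
    qed
  qed (use gi ki in auto)
  also have "\<dots> = d" using k1' by simp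
  finally show ?thesis .
qed

lemma conv_support:
  fixes k :: "'a::euclidean_space \<Rightarrow> real"
  assumes "\<And>z. z \<notin> cball 0 e \<Longrightarrow> k z = 0" "\<And>y. y \<in> cball x e \<Longrightarrow> v y = 0"
  shows "conv v k x = 0"
proof -
  have "v y * k (x - y) = 0" for y
    using assms(1)[of "x - y"] assms(2)[of y] by (cases "y \<in> cball x e") (auto simp: dist_norm norm_minus_commute)
  then have "(\<lambda>y. v y * k (x - y)) = (\<lambda>y. 0)" by blast
  then show ?thesis by (simp add: conv_def)
qed

text \<open>By contraction it is enough to treat a dense class. For continuous functions of bounded
  support, uniform continuity gives uniform closeness, and since all supports lie in one ball this
  is closeness in L2.\<close>

lemma mollify_L2_conv:
  fixes k :: "nat \<Rightarrow> 'a::euclidean_space \<Rightarrow> real"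
  assumes v: "L2 lborel v" and k: "\<And>n. mollifier (e n) (k n)" and e: "e \<longlonglongrightarrow> 0"
  shows "L2_conv lborel (\<lambda>n. conv v (k n)) v"
  unfolding L2_conv_def
proof (intro conjI allI v mollify_contraction(1)[OF v k])
  have kc: "continuous_on UNIV (k n)" and ks: "\<And>z. z \<notin> cball 0 (e n) \<Longrightarrow> k n z = 0" for n
    using k[of n] by (auto simp: mollifier_def)
  show "(\<lambda>n. \<integral>x. (conv v (k n) x - v x)\<^sup>2 \<partial>lborel) \<longlonglongrightarrow> 0"
  proof (rule LIMSEQ_I)
    fix r :: real assume r: "r > 0"
    \<comment> \<open>One ninth, because the error is split into three terms and squaring a sum of
      three costs a further factor 3.\<close>
    obtain g R where g: "continuous_on UNIV g" "\<And>x. x \<notin> cball 0 R \<Longrightarrow> g x = 0"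
      and gr: "(\<integral>x. (v x - g x)\<^sup>2 \<partial>lborel) < r / 9"
      using L2_dense_continuous[OF v, of "r / 9"] r by auto
    have gL: "L2 lborel g" by (rule continuous_compact_support_L2[OF g bounded_cball])
    define V where "V = measure lborel (cball (0::'a) (R + 1))"
    have V: "V \<ge> 0" by (simp add: V_def)
    \<comment> \<open>A uniform error \<open>d\<close> on the ball of volume \<open>V\<close> costs
      \<open>d\<^sup>2 * V < r / 9\<close>. The ball has radius \<open>R + 1\<close> to leave room
      for kernels of radius below 1.\<close>
    define d where "d = sqrt (r / (9 * (V + 1)))"
    have d: "d > 0" using r V by (simp add: d_def)
    have d2: "d\<^sup>2 * V < r / 9"
    proof -
      have "d\<^sup>2 * V = r / 9 * (V / (V + 1))" using r V by (simp add: d_def)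
      also have "\<dots> < r / 9 * 1" using r V by (intro mult_strict_left_mono) auto
      finally show ?thesis by simp
    qed
    have "uniformly_continuous_on (cball 0 (R + 1)) g"
      by (rule compact_uniformly_continuous[OF continuous_on_subset[OF g(1)]]) auto
    then obtain \<delta> where \<delta>: "\<delta> > 0" "\<And>x y. x \<in> cball 0 (R + 1) \<Longrightarrow> y \<in> cball 0 (R + 1) \<Longrightarrow> dist y x < \<delta> \<Longrightarrow> dist (g y) (g x) < d"
      unfolding uniformly_continuous_on_def using d by metis
    have "\<forall>\<^sub>F n in sequentially. e n < min \<delta> 1"
      by (rule order_tendstoD(2)[OF e]) (use \<delta> in auto)
    then obtain N where N: "\<And>n. n \<ge> N \<Longrightarrow> e n < min \<delta> 1" by (auto simp: eventually_sequentially)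
    have "norm ((\<integral>x. (conv v (k n) x - v x)\<^sup>2 \<partial>lborel) - 0) < r" if n: "n \<ge> N" for n
    proof -
      have en: "e n < \<delta>" "e n < 1" using N[OF n] by auto
      have close: "\<bar>g x - g y\<bar> \<le> d" if "dist x y \<le> e n" for x y
      proof (cases "x \<in> cball 0 R \<or> y \<in> cball 0 R")
        case True
        then have "x \<in> cball 0 (R + 1)" "y \<in> cball 0 (R + 1)"
          using that en norm_triangle_ineq2[of x y] norm_triangle_ineq3[of x y]
          by (auto simp: dist_norm)
        then show ?thesis using \<delta>(2)[of y x] that en by (simp add: dist_real_def)
      next
        case False
        then show ?thesis using g(2)[of x] g(2)[of y] d by auto
      qed
      have mg: "\<bar>conv g (k n) x - g x\<bar> \<le> d * indicator (cball 0 (R + 1)) x" for x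
      proof (cases "x \<in> cball 0 (R + 1)")
        case True
        have "\<bar>conv g (k n) x - g x\<bar> \<le> d"
          by (rule mollify_continuous_close[where S = "cball 0 R", OF g _ k close]) auto
        with True show ?thesis by simp
      next
        case False
        then have "g y = 0" if "y \<in> cball x (e n)" for y
          using that en norm_triangle_ineq3[of x y] by (intro g(2)) (auto simp: dist_norm)
        from conv_support[where v = g and x = x, OF ks this] False g(2)[of x] show ?thesis by auto
      qed
      have cL: "L2 lborel (conv v (k n))" "L2 lborel (conv g (k n))"
        by (intro mollify_contraction(1)[OF _ k] v gL)+
      have vgL: "L2 lborel (\<lambda>x. v x - g x)" by (intro L2_diff v gL)
      have cvg: "L2 lborel (conv (\<lambda>x. v x - g x) (k n))" by (rule mollify_contraction(1)[OF vgL k])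
      have cgg: "L2 lborel (\<lambda>x. conv g (k n) x - g x)" by (intro L2_diff cL gL)
      have i: "integrable lborel (\<lambda>x. (conv (\<lambda>x. v x - g x) (k n) x)\<^sup>2)"
         "integrable lborel (\<lambda>x. (conv g (k n) x - g x)\<^sup>2)" "integrable lborel (\<lambda>x. (v x - g x)\<^sup>2)"
         "integrable lborel (\<lambda>x. (conv v (k n) x - v x)\<^sup>2)"
        using cvg cgg vgL L2_diff[OF cL(1) v] by (auto dest: L2_square_integrable)
      have i1: "(\<integral>x. (conv (\<lambda>x. v x - g x) (k n) x)\<^sup>2 \<partial>lborel) < r / 9"
        using mollify_contraction(2)[OF vgL k, of n] gr by linarith
      have i2: "(\<integral>x. (conv g (k n) x - g x)\<^sup>2 \<partial>lborel) < r / 9"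
      proof -
        have "(\<integral>x. (conv g (k n) x - g x)\<^sup>2 \<partial>lborel) \<le> (\<integral>x. d\<^sup>2 * indicator (cball 0 (R + 1)) x \<partial>(lborel::'a measure))"
        proof (rule integral_mono[OF i(2)])
          show "integrable lborel (\<lambda>x::'a. d\<^sup>2 * indicator (cball 0 (R + 1)) x)"
            by (intro integrable_mult_right integrable_real_indicator) (use emeasure_bounded_finite[OF bounded_cball] in auto)
          show "(conv g (k n) x - g x)\<^sup>2 \<le> d\<^sup>2 * indicator (cball 0 (R + 1)) x" for x
            using power_mono[OF mg[of x], of 2] by (auto simp: power_mult_distrib indicator_def split: if_splits)
        qed
        also have "\<dots> = d\<^sup>2 * V" by (simp add: V_def)
        finally show ?thesis using d2 by linarith
      qed
      have "(\<integral>x. (conv v (k n) x - v x)\<^sup>2 \<partial>lborel) \<le>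
        (\<integral>x. 3 * (conv (\<lambda>x. v x - g x) (k n) x)\<^sup>2 + 3 * (conv g (k n) x - g x)\<^sup>2 + 3 * (v x - g x)\<^sup>2 \<partial>lborel)"
      proof (rule integral_mono)
        fix x
        have *: "(a + b - c)\<^sup>2 \<le> 3 * a\<^sup>2 + 3 * b\<^sup>2 + 3 * c\<^sup>2" for a b c :: real
        proof -
          have "3 * a\<^sup>2 + 3 * b\<^sup>2 + 3 * c\<^sup>2 - (a + b - c)\<^sup>2 = (a - b)\<^sup>2 + (b + c)\<^sup>2 + (a + c)\<^sup>2"
            by (simp add: power2_eq_square algebra_simps)
          then show ?thesis using zero_le_power2[of "a - b"] zero_le_power2[of "b + c"] zero_le_power2[of "a + c"] by linarith
        qed
        have "conv v (k n) x - v x = conv (\<lambda>x. v x - g x) (k n) x + (conv g (k n) x - g x) - (v x - g x)"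
          using conv_diff[OF v gL kc ks] by simp
        then show "(conv v (k n) x - v x)\<^sup>2 \<le> 3 * (conv (\<lambda>x. v x - g x) (k n) x)\<^sup>2 + 3 * (conv g (k n) x - g x)\<^sup>2 + 3 * (v x - g x)\<^sup>2"
          by (simp only: *)
      qed (use i in auto)
      also have "\<dots> = 3 * (\<integral>x. (conv (\<lambda>x. v x - g x) (k n) x)\<^sup>2 \<partial>lborel) + 3 * (\<integral>x. (conv g (k n) x - g x)\<^sup>2 \<partial>lborel) + 3 * (\<integral>x. (v x - g x)\<^sup>2 \<partial>lborel)"
        using i by simp
      also have "\<dots> < r" using i1 i2 gr by linarith
      finally show ?thesis by simp
    qed
    then show "\<exists>no. \<forall>n\<ge>no. norm ((\<integral>x. (conv v (k n) x - v x)\<^sup>2 \<partial>lborel) - 0) < r" by blast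
  qed
qed

section \<open>Partial derivatives, and differentiation of convolutions\<close>

definition pd :: "3 \<Rightarrow> (real^3 \<Rightarrow> real) \<Rightarrow> (real^3 \<Rightarrow> real) \<Rightarrow> bool" where
  "pd j f D \<longleftrightarrow> (\<forall>x. ((\<lambda>t. f (x + t *\<^sub>R axis j 1)) has_real_derivative D x) (at 0))"

lemma pdD_at:
  assumes "pd j f D"
  shows "((\<lambda>t. f (x + t *\<^sub>R axis j 1)) has_real_derivative D (x + s *\<^sub>R axis j 1)) (at s)"
proof -
  have "((\<lambda>t. f ((x + s *\<^sub>R axis j 1) + t *\<^sub>R axis j 1)) has_real_derivative D (x + s *\<^sub>R axis j 1)) (at 0)"
    using assms by (simp add: pd_def)
  moreover have "(\<lambda>t. f ((x + s *\<^sub>R axis j 1) + t *\<^sub>R axis j 1)) = (\<lambda>t. f (x + (t + s) *\<^sub>R axis j 1))"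
    by (simp add: algebra_simps)
  ultimately show ?thesis
    using DERIV_shift[of "\<lambda>t. f (x + t *\<^sub>R axis j 1)" _ 0 s] by simp
qed

lemma pd_mvt:
  assumes "pd j f D" "h \<noteq> 0"
  obtains s where "\<bar>s\<bar> \<le> \<bar>h\<bar>" "f (x + h *\<^sub>R axis j 1) - f x = h * D (x + s *\<^sub>R axis j 1)"
proof (cases "h > 0")
  case True
  from MVT2[OF True pdD_at[OF assms(1)]] obtain s where "0 < s" "s < h"
    "f (x + h *\<^sub>R axis j 1) - f (x + 0 *\<^sub>R axis j 1) = (h - 0) * D (x + s *\<^sub>R axis j 1)" by blast
  then show thesis by (intro that[of s]) auto
next
  case False
  with assms have "h < 0" by simp
  from MVT2[OF this pdD_at[OF assms(1)]] obtain s where "h < s" "s < 0"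
    "f (x + 0 *\<^sub>R axis j 1) - f (x + h *\<^sub>R axis j 1) = (0 - h) * D (x + s *\<^sub>R axis j 1)" by blast
  then show thesis by (intro that[of s]) auto
qed

lemma dist_axis: "dist (x + s *\<^sub>R axis j 1) (x :: real^3) = \<bar>s\<bar>"
  by (simp add: dist_norm)

lemma compact_support_uniformly_continuous:
  fixes k :: "'a::euclidean_space \<Rightarrow> real"
  assumes "continuous_on UNIV k" "\<And>z. z \<notin> cball 0 e \<Longrightarrow> k z = 0" "d > 0"
  obtains \<delta> where "\<delta> > 0" "\<And>x y. dist x y < \<delta> \<Longrightarrow> \<bar>k x - k y\<bar> < d"
proof -
  have "uniformly_continuous_on (cball 0 (e + 1)) k"
    by (rule compact_uniformly_continuous[OF continuous_on_subset[OF assms(1)]]) auto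
  then obtain \<delta> where \<delta>: "\<delta> > 0" "\<And>x y. x \<in> cball 0 (e + 1) \<Longrightarrow> y \<in> cball 0 (e + 1) \<Longrightarrow> dist y x < \<delta> \<Longrightarrow> dist (k y) (k x) < d"
    unfolding uniformly_continuous_on_def using assms(3) by metis
  show thesis
  proof (rule that[of "min \<delta> 1"])
    fix x y :: 'a assume xy: "dist x y < min \<delta> 1"
    show "\<bar>k x - k y\<bar> < d"
    proof (cases "x \<in> cball 0 e \<or> y \<in> cball 0 e")
      case True
      then have "x \<in> cball 0 (e + 1)" "y \<in> cball 0 (e + 1)"
        using xy norm_triangle_ineq3[of x y] by (auto simp: dist_norm)
      then show ?thesis using \<delta>(2)[of y x] xy by (simp add: dist_real_def)
    next
      case False
      then show ?thesis using assms(2)[of x] assms(2)[of y] assms(3) by simp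
    qed
  qed (use \<delta> in auto)
qed

text \<open>The divergence theorem for fields of bounded support. Difference quotients of
  \<open>f\<close> have integral 0 by translation invariance; the mean value theorem bounds them by
  \<open>B\<close> on a ball, so they converge to \<open>D\<close> under the integral sign.\<close>

lemma integral_pd_eq_0:
  assumes f: "pd j f D" "continuous_on UNIV f" "continuous_on UNIV D"
    and S: "bounded S" "\<And>x. x \<notin> S \<Longrightarrow> f x = 0" "\<And>x. x \<notin> S \<Longrightarrow> D x = 0"
  shows "(\<integral>x. D x \<partial>lborel) = 0"
proof -
  obtain R where R: "S \<subseteq> cball (0 :: real^3) R" using S(1) by (auto simp: bounded_iff subset_eq)
  obtain B where B: "B \<ge> 0" "\<And>x. \<bar>D x\<bar> \<le> B"
    using continuous_compact_support_bounded[OF f(3) S(3,1)] by blast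
  have fi: "integrable lborel f" by (rule continuous_compact_support_integrable[OF f(2) S(2,1)])
  have fm[measurable]: "f \<in> borel_measurable borel" by (rule borel_measurable_continuous_onI[OF f(2)])
  have Dm[measurable]: "D \<in> borel_measurable borel" by (rule borel_measurable_continuous_onI[OF f(3)])
  define a :: "real^3" where "a = axis j 1"
  define h where "h = (\<lambda>n. 1 / real (Suc n))"
  have h: "h n > 0" "h n \<le> 1" for n by (auto simp: h_def)
  have h0: "h \<longlonglongrightarrow> 0" unfolding h_def by (rule LIMSEQ_Suc[OF lim_1_over_n])
  define q where "q = (\<lambda>n x. (f (x + h n *\<^sub>R a) - f x) / h n)"
  have fti: "integrable lborel (\<lambda>x. f (x + h n *\<^sub>R a))" for n
  proof (rule continuous_compact_support_integrable[where S = "cball 0 (R + 1)"])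
    show "continuous_on UNIV (\<lambda>x. f (x + h n *\<^sub>R a))"
      by (rule continuous_on_compose2[OF f(2)]) (auto intro!: continuous_intros)
    fix x :: "real^3" assume x: "x \<notin> cball 0 (R + 1)"
    have "norm x \<le> norm (x + h n *\<^sub>R a) + norm (h n *\<^sub>R a)" using norm_triangle_ineq4[of "x + h n *\<^sub>R a" "h n *\<^sub>R a"] by simp
    moreover have "norm (h n *\<^sub>R a) \<le> 1" using h[of n] by (simp add: a_def)
    ultimately have "x + h n *\<^sub>R a \<notin> S" using x R by auto
    then show "f (x + h n *\<^sub>R a) = 0" by (rule S(2))
  qed auto
  have q0: "(\<integral>x. q n x \<partial>lborel) = 0" for n
    using lborel_integral_translate[OF fm, of "- h n *\<^sub>R a"] fi fti[of n]
    by (simp add: q_def)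
  have "(\<lambda>n. \<integral>x. q n x \<partial>lborel) \<longlonglongrightarrow> (\<integral>x. D x \<partial>lborel)"
  proof (rule integral_dominated_convergence[where w = "\<lambda>x. B * indicator (cball 0 (R + 1)) x"])
    show "integrable lborel (\<lambda>x::real^3. B * indicator (cball 0 (R + 1)) x)"
      by (intro integrable_mult_right integrable_real_indicator) (use emeasure_bounded_finite[OF bounded_cball] in auto)
    show "AE x in lborel. (\<lambda>n. q n x) \<longlonglongrightarrow> D x"
    proof (rule AE_I2)
      fix x
      have "((\<lambda>t. (f (x + t *\<^sub>R a) - f (x + 0 *\<^sub>R a)) / (t - 0)) \<longlongrightarrow> D x) (at 0)"
        using f(1) unfolding pd_def has_field_derivative_iff a_def by blast
      moreover have "filterlim h (at 0) sequentially"
        using h0 h(1) by (auto simp: filterlim_at intro!: always_eventually less_imp_neq[symmetric])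
      ultimately have "(\<lambda>n. (f (x + h n *\<^sub>R a) - f (x + 0 *\<^sub>R a)) / (h n - 0)) \<longlonglongrightarrow> D x"
        by (rule filterlim_compose)
      then show "(\<lambda>n. q n x) \<longlonglongrightarrow> D x" by (simp add: q_def)
    qed
    show "AE x in lborel. norm (q n x) \<le> B * indicator (cball 0 (R + 1)) x" for n
    proof (rule AE_I2)
      fix x
      obtain s where s: "\<bar>s\<bar> \<le> \<bar>h n\<bar>" "f (x + h n *\<^sub>R a) - f x = h n * D (x + s *\<^sub>R a)"
        using pd_mvt[OF f(1), of "h n" x] h(1)[of n] by (auto simp: a_def)
      have q: "q n x = D (x + s *\<^sub>R a)" using s(2) h(1)[of n] by (simp add: q_def)
      show "norm (q n x) \<le> B * indicator (cball 0 (R + 1)) x"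
      proof (cases "x \<in> cball 0 (R + 1)")
        case True then show ?thesis using B q by simp
      next
        case False
        have "norm x \<le> norm (x + s *\<^sub>R a) + dist (x + s *\<^sub>R a) x"
          using norm_triangle_ineq4[of "x + s *\<^sub>R a" "s *\<^sub>R a"] by (simp add: dist_norm)
        then have "norm x \<le> norm (x + s *\<^sub>R a) + 1" using s(1) h[of n] unfolding a_def dist_axis by linarith
        then have "x + s *\<^sub>R a \<notin> S" using False R by auto
        then show ?thesis using q S(3) B(1) by simp
      qed
    qed
  qed (auto simp: q_def)
  then show ?thesis using q0 by (simp add: LIMSEQ_const_iff)
qed

lemma integrable_indicator_bounded:
  fixes A :: "'a::euclidean_space set"
  assumes "bounded A" "A \<in> sets borel"
  shows "integrable lborel (indicator A :: 'a \<Rightarrow> real)"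
  using emeasure_bounded_finite[OF assms(1)] assms(2) by (intro integrable_real_indicator) auto

lemma L2_indicator:
  fixes A :: "'a::euclidean_space set"
  assumes "bounded A" "A \<in> sets borel"
  shows "L2 lborel (indicator A :: 'a \<Rightarrow> real)"
  by (rule L2_bound[OF _ integrable_indicator_bounded[OF assms]])
     (use assms in \<open>auto simp: indicator_def\<close>)

text \<open>A square-integrable \<open>v\<close> is integrable over balls, so a uniformly small
  kernel living in a fixed ball gives a small integral. Continuity and differentiability of
  \<open>conv v k\<close> are both reduced to this.\<close>

lemma conv_local_bound:
  fixes k :: "real^3 \<Rightarrow> real"
  assumes v: "L2 lborel v" and k: "k \<in> borel_measurable borel"
    "\<And>y. \<bar>k y\<bar> \<le> d * indicator (cball x r) y"
  shows "\<bar>\<integral>y. v y * k y \<partial>lborel\<bar> \<le> d * (\<integral>y. \<bar>v y\<bar> * indicator (cball x r) y \<partial>lborel)"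
proof -
  have [measurable]: "v \<in> borel_measurable borel" using L2_measurable[OF v] by simp
  note [measurable] = k(1)
  have av: "L2 lborel (\<lambda>y. \<bar>v y\<bar>)" using v by (simp add: L2_def)
  have "L2 lborel (indicator (cball x r) :: real^3 \<Rightarrow> real)" by (intro L2_indicator) auto
  from L2_mult_integrable[OF av this]
  have i: "integrable lborel (\<lambda>y. \<bar>v y\<bar> * indicator (cball x r) y)" .
  have b: "\<bar>v y * k y\<bar> \<le> d * (\<bar>v y\<bar> * indicator (cball x r) y)" for y
    using mult_left_mono[OF k(2)[of y], of "\<bar>v y\<bar>"] by (simp add: abs_mult mult_ac)
  have i2: "integrable lborel (\<lambda>y. v y * k y)"
    by (rule Bochner_Integration.integrable_bound[OF integrable_mult_right[OF i, of d]])
       (use b in \<open>auto intro!: AE_I2 order.trans[OF _ abs_ge_self]\<close>)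
  have "\<bar>\<integral>y. v y * k y \<partial>lborel\<bar> \<le> (\<integral>y. \<bar>v y * k y\<bar> \<partial>lborel)" by simp
  also have "\<dots> \<le> (\<integral>y. d * (\<bar>v y\<bar> * indicator (cball x r) y) \<partial>lborel)"
    using i i2 b by (intro integral_mono) auto
  finally show ?thesis using i by simp
qed

lemma conv_continuous:
  fixes k :: "real^3 \<Rightarrow> real"
  assumes v: "L2 lborel v" and k: "continuous_on UNIV k" "\<And>z. z \<notin> cball 0 e \<Longrightarrow> k z = 0"
  shows "continuous_on UNIV (conv v k)"
  unfolding continuous_on_iff
proof (intro ballI allI impI)
  fix x :: "real^3" and r :: real assume r: "r > 0"
  note [measurable] = borel_measurable_continuous_onI[OF k(1)]
  \<comment> \<open>For shifts of length below 1, all kernels involved live in the ball of radius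
    \<open>e + 1\<close>.\<close>
  define C where "C = (\<integral>y. \<bar>v y\<bar> * indicator (cball x (e + 1)) y \<partial>lborel)"
  have C: "C \<ge> 0" by (simp add: C_def)
  define d where "d = r / (C + 1)"
  have d: "d > 0" using r C by (simp add: d_def)
  obtain \<delta> where \<delta>: "\<delta> > 0" "\<And>x y. dist x y < \<delta> \<Longrightarrow> \<bar>k x - k y\<bar> < d"
    using compact_support_uniformly_continuous[OF k d] by blast
  have "dist (conv v k x') (conv v k x) < r" if x': "dist x' x < min \<delta> 1" for x'
  proof -
    have "conv v k x' - conv v k x = (\<integral>y. v y * (k (x' - y) - k (x - y)) \<partial>lborel)"
      using conv_integrable[OF v k] by (simp add: conv_def right_diff_distrib)
    moreover have "\<bar>k (x' - y) - k (x - y)\<bar> \<le> d * indicator (cball x (e + 1)) y" for y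
    proof (cases "y \<in> cball x (e + 1)")
      case True
      then show ?thesis using \<delta>(2)[of "x' - y" "x - y"] x' by (simp add: dist_norm)
    next
      case False
      moreover have "dist x y \<le> dist x' x + dist x' y" by (metis dist_commute dist_triangle)
      ultimately have "x' - y \<notin> cball 0 e" "x - y \<notin> cball 0 e"
        using x' by (auto simp: dist_norm norm_minus_commute)
      then show ?thesis using k(2) d by simp
    qed
    ultimately have "\<bar>conv v k x' - conv v k x\<bar> \<le> d * C"
      using conv_local_bound[OF v, of "\<lambda>y. k (x' - y) - k (x - y)" d x "e + 1"] by (simp add: C_def)
    also have "\<dots> < r" using r C by (simp add: d_def field_simps)
    finally show ?thesis by (simp add: dist_real_def)
  qed
  then show "\<exists>d>0. \<forall>x'\<in>UNIV. dist x' x < d \<longrightarrow> dist (conv v k x') (conv v k x) < r"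
    using \<delta>(1) by (intro exI[of _ "min \<delta> 1"]) auto
qed

text \<open>By the mean value theorem the error of a difference quotient of \<open>k\<close> is a
  difference of two values of \<open>kd\<close> at nearby points. Uniform continuity of
  \<open>kd\<close> makes it uniformly small, so the limit passes under the integral.\<close>

lemma conv_pd:
  assumes v: "L2 lborel v" and k: "continuous_on UNIV k" "\<And>z. z \<notin> cball 0 e \<Longrightarrow> k z = 0"
    and kd: "continuous_on UNIV kd" "\<And>z. z \<notin> cball 0 e \<Longrightarrow> kd z = 0" and pd: "pd j k kd"
  shows "pd j (conv v k) (conv v kd)"
  unfolding pd_def has_field_derivative_iff LIM_def
proof (intro allI impI)
  fix x :: "real^3" and r :: real assume r: "r > 0"
  note [measurable] = borel_measurable_continuous_onI[OF k(1)] borel_measurable_continuous_onI[OF kd(1)]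
  define C where "C = (\<integral>y. \<bar>v y\<bar> * indicator (cball x (e + 1)) y \<partial>lborel)"
  have C: "C \<ge> 0" by (simp add: C_def)
  define d where "d = r / (C + 1)"
  have d: "d > 0" using r C by (simp add: d_def)
  obtain \<delta> where \<delta>: "\<delta> > 0" "\<And>x y. dist x y < \<delta> \<Longrightarrow> \<bar>kd x - kd y\<bar> < d"
    using compact_support_uniformly_continuous[OF kd d] by blast
  define a :: "real^3" where "a = axis j 1"
  have "dist ((conv v k (x + h *\<^sub>R a) - conv v k (x + 0 *\<^sub>R a)) / (h - 0)) (conv v kd x) < r"
    if h: "h \<noteq> 0" "dist h 0 < min \<delta> 1" for h
  proof -
    define q where "q = (\<lambda>y. (k (x + h *\<^sub>R a - y) - k (x - y)) / h - kd (x - y))"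
    have "(conv v k (x + h *\<^sub>R a) - conv v k (x + 0 *\<^sub>R a)) / (h - 0) - conv v kd x = (\<integral>y. v y * q y \<partial>lborel)"
    proof -
      have "(\<integral>y. v y * q y \<partial>lborel) = (\<integral>y. (v y * k (x + h *\<^sub>R a - y) - v y * k (x - y)) / h - v y * kd (x - y) \<partial>lborel)"
        by (rule Bochner_Integration.integral_cong) (auto simp: q_def algebra_simps diff_divide_distrib)
      then show ?thesis
        using conv_integrable[OF v k] conv_integrable[OF v kd] by (simp add: conv_def)
    qed
    moreover have "\<bar>q y\<bar> \<le> d * indicator (cball x (e + 1)) y" for y
    proof -
      obtain s where s: "\<bar>s\<bar> \<le> \<bar>h\<bar>" "k ((x - y) + h *\<^sub>R a) - k (x - y) = h * kd ((x - y) + s *\<^sub>R a)"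
        using pd_mvt[OF pd h(1), of "x - y"] by (auto simp: a_def)
      have q: "q y = kd ((x - y) + s *\<^sub>R a) - kd (x - y)"
        using s(2) h(1) by (simp add: q_def algebra_simps)
      have ds: "dist ((x - y) + s *\<^sub>R a) (x - y) = \<bar>s\<bar>" unfolding a_def dist_axis ..
      show ?thesis
      proof (cases "y \<in> cball x (e + 1)")
        case True
        then show ?thesis using \<delta>(2)[of "(x - y) + s *\<^sub>R a" "x - y"] q ds s(1) h(2) by simp
      next
        case False
        moreover have "norm (x - y) \<le> norm ((x - y) + s *\<^sub>R a) + \<bar>s\<bar>"
          using norm_triangle_ineq3[of "x - y + s *\<^sub>R a" "x - y"] ds unfolding dist_norm by linarith
        ultimately have "(x - y) + s *\<^sub>R a \<notin> cball 0 e" "x - y \<notin> cball 0 e"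
          using s(1) h(2) unfolding mem_cball_0 by (auto simp: dist_norm)
        then show ?thesis using kd(2) d q by simp
      qed
    qed
    moreover have "q \<in> borel_measurable borel" unfolding q_def by measurable
    ultimately have "\<bar>(conv v k (x + h *\<^sub>R a) - conv v k (x + 0 *\<^sub>R a)) / (h - 0) - conv v kd x\<bar> \<le> d * C"
      using conv_local_bound[OF v, of q d x "e + 1"] by (simp add: C_def)
    also have "\<dots> < r" using r C by (simp add: d_def field_simps)
    finally show ?thesis by (simp add: dist_real_def)
  qed
  then show "\<exists>s>0. \<forall>h. h \<noteq> 0 \<and> dist h 0 < s \<longrightarrow>
     dist ((conv v k (x + h *\<^sub>R axis j 1) - conv v k (x + 0 *\<^sub>R axis j 1)) / (h - 0)) (conv v kd x) < r"
    using \<delta>(1) by (intro exI[of _ "min \<delta> 1"]) (auto simp: a_def)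
qed

section \<open>The Carleman estimate\<close>

text \<open>Everything built from the Carleman weight is singular at \<open>y0\<close>, where
  \<open>inverse 0 = 0\<close> is a meaningless default. As the functions vanish near
  \<open>y0\<close>, formulas derived for \<open>x \<noteq> y0\<close> extend to the whole space;
  \<open>continuous_zero_near\<close> does the same for continuity.\<close>

lemma pd_zero_near:
  assumes "\<And>x. dist x y0 < \<rho> \<Longrightarrow> f x = 0" "\<And>x. dist x y0 < \<rho> \<Longrightarrow> D x = 0"
    and "\<And>x. x \<noteq> y0 \<Longrightarrow> ((\<lambda>t. f (x + t *\<^sub>R axis j 1)) has_real_derivative D x) (at 0)"
    and "\<rho> > 0"
  shows "pd j f D"
  unfolding pd_def
proof
  fix x
  show "((\<lambda>t. f (x + t *\<^sub>R axis j 1)) has_real_derivative D x) (at 0)"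
  proof (cases "x = y0")
    case True
    have "((\<lambda>t::real. 0) has_real_derivative 0) (at 0)" by simp
    then have "((\<lambda>t. f (x + t *\<^sub>R axis j 1)) has_real_derivative 0) (at 0)"
      by (rule has_field_derivative_transform_within[where d = \<rho>])
         (use assms(1,4) True in \<open>auto simp: dist_norm\<close>)
    then show ?thesis using assms(2)[of x] assms(4) True by simp
  qed (rule assms(3))
qed

lemma continuous_zero_near:
  fixes f :: "real^3 \<Rightarrow> real"
  assumes "\<And>x. dist x y0 < \<rho> \<Longrightarrow> f x = 0" "continuous_on (- {y0}) f" "\<rho> > 0"
  shows "continuous_on UNIV f"
proof -
  have "continuous_on (ball y0 \<rho>) f"
    using assms(1) by (intro continuous_on_cong[THEN iffD2, OF refl _ continuous_on_const[of _ 0]]) (simp add: dist_commute)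
  then have "continuous_on (ball y0 \<rho> \<union> - {y0}) f"
    by (intro continuous_on_open_Un) (use assms in auto)
  moreover have "ball y0 \<rho> \<union> - {y0} = UNIV" using assms(3) by auto
  ultimately show ?thesis by simp
qed

lemma nth_translate_deriv:
  "((\<lambda>t. (x + t *\<^sub>R axis j 1 - y) $ i) has_real_derivative (if i = j then 1 else 0)) (at 0)"
  by (auto simp: axis_def intro!: derivative_eq_intros)

text \<open>The weight is \<open>exp (\<tau> / |x - y0|\<^sup>2)\<close>. With \<open>u = exp (\<tau> z) v\<close> the conjugated Laplacian of \<open>v\<close>
  splits into \<open>S + A\<close> below, and \<open>2 S A\<close> is a nonnegative form plus the divergence of \<open>X\<close>; the multiplier
  \<open>- 6 \<tau> z\<^sup>2 u\<close> in \<open>A\<close> is chosen so that the form has no negative gradient part.\<close>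
lemma carleman_C2:
  fixes y0 :: "real^3" and v :: "real^3 \<Rightarrow> real" and p :: "3 \<Rightarrow> real^3 \<Rightarrow> real" and h :: "3 \<Rightarrow> 3 \<Rightarrow> real^3 \<Rightarrow> real"
  defines "z \<equiv> \<lambda>x. inverse ((x - y0) \<bullet> (x - y0))"
  assumes v: "\<And>i. pd i v (p i)" and p: "\<And>i j. pd j (p i) (h i j)" and sym: "\<And>i j. h i j = h j i"
    and cont: "continuous_on UNIV v" "\<And>i. continuous_on UNIV (p i)" "\<And>i j. continuous_on UNIV (h i j)"
    and supp: "\<And>x. dist x y0 < \<rho> \<or> dist x y0 > R \<Longrightarrow> v x = 0"
      "\<And>x i. dist x y0 < \<rho> \<or> dist x y0 > R \<Longrightarrow> p i x = 0"
      "\<And>x i j. dist x y0 < \<rho> \<or> dist x y0 > R \<Longrightarrow> h i j x = 0"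
    and \<rho>: "\<rho> > 0" and \<tau>: "4 * \<tau> \<ge> 9 * R\<^sup>2" "\<tau> > 0"
  shows "64 * \<tau>^3 * (\<integral>x. (z x)^5 * (exp (\<tau> * z x))\<^sup>2 * (v x)\<^sup>2 \<partial>lborel)
      \<le> (\<integral>x. (exp (\<tau> * z x))\<^sup>2 * (\<Sum>j\<in>UNIV. h j j x)\<^sup>2 \<partial>lborel)"
proof -
  define c where "c = (\<lambda>i x. (x - y0) $ i)"
  define s where "s = (\<lambda>x. (x - y0) \<bullet> (x - y0))"
  define E where "E = (\<lambda>x. exp (\<tau> * z x))"
  define dl where "dl = (\<lambda>(i::3) (j::3). if i = j then 1 else 0 :: real)"
  have dlsym: "dl i j = dl j i" for i j by (auto simp: dl_def)
  have s_alt: "s x = (c 1 x)\<^sup>2 + (c 2 x)\<^sup>2 + (c 3 x)\<^sup>2" for x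
    by (simp add: s_def c_def inner_vec_def sum_3 power2_eq_square)
  have s_norm: "s x = (dist x y0)\<^sup>2" for x by (simp add: s_def dist_norm power2_norm_eq_inner)
  have s0: "s x \<noteq> 0" if "x \<noteq> y0" for x using that by (simp add: s_norm)
  have sz: "s x * z x = 1" if "x \<noteq> y0" for x using s0[OF that] by (simp add: z_def s_def)
  have dc: "((\<lambda>t. c i (x + t *\<^sub>R axis j 1)) has_real_derivative dl i j) (at 0)" for i j x
    unfolding c_def dl_def by (rule nth_translate_deriv)
  have ds: "((\<lambda>t. s (x + t *\<^sub>R axis j 1)) has_real_derivative 2 * c j x) (at 0)" for j x
  proof -
    have "((\<lambda>t. s (x + t *\<^sub>R axis j 1)) has_real_derivative 2 * c 1 x * dl 1 j + 2 * c 2 x * dl 2 j + 2 * c 3 x * dl 3 j) (at 0)"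
      unfolding s_alt by (auto intro!: derivative_eq_intros dc)
    moreover have "2 * c 1 x * dl 1 j + 2 * c 2 x * dl 2 j + 2 * c 3 x * dl 3 j = 2 * c j x"
      using exhaust_3[of j] by (auto simp: dl_def)
    ultimately show ?thesis by simp
  qed
  have dz: "((\<lambda>t. z (x + t *\<^sub>R axis j 1)) has_real_derivative - 2 * c j x * (z x)\<^sup>2) (at 0)" if "x \<noteq> y0" for j x
  proof -
    have "((\<lambda>t. inverse (s (x + t *\<^sub>R axis j 1))) has_real_derivative - (inverse (s x) * (2 * c j x) * inverse (s x))) (at 0)"
      using DERIV_inverse'[OF ds[of x j]] s0[OF that] by simp
    moreover have "inverse (s y) = z y" for y by (simp add: z_def s_def)
    ultimately show ?thesis by (simp add: power2_eq_square mult_ac)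
  qed
  have dE: "((\<lambda>t. E (x + t *\<^sub>R axis j 1)) has_real_derivative E x * (- 2 * \<tau> * c j x * (z x)\<^sup>2)) (at 0)" if "x \<noteq> y0" for j x
    unfolding E_def by (auto intro!: derivative_eq_intros dz[OF that])
  define u where "u = (\<lambda>x. E x * v x)"
  define U where "U = (\<lambda>i x. E x * (p i x - 2 * \<tau> * c i x * (z x)\<^sup>2 * v x))"
  define H where "H = (\<lambda>i j x. E x * (h i j x - 2 * \<tau> * (z x)\<^sup>2 * (c i x * p j x + c j x * p i x)
     + (4 * \<tau>\<^sup>2 * (z x)^4 * c i x * c j x + 8 * \<tau> * (z x)^3 * c i x * c j x - 2 * \<tau> * (z x)\<^sup>2 * dl i j) * v x))"
  have vd: "((\<lambda>t. v (x + t *\<^sub>R axis j 1)) has_real_derivative p j x) (at 0)" for j x using v by (simp add: pd_def)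
  have pdd: "((\<lambda>t. p i (x + t *\<^sub>R axis j 1)) has_real_derivative h i j x) (at 0)" for i j x using p by (simp add: pd_def)
  have du: "((\<lambda>t. u (x + t *\<^sub>R axis j 1)) has_real_derivative U j x) (at 0)" if "x \<noteq> y0" for j x
    unfolding u_def by (auto intro!: derivative_eq_intros dE[OF that] vd) (simp add: U_def algebra_simps)
  have dU: "((\<lambda>t. U i (x + t *\<^sub>R axis j 1)) has_real_derivative H i j x) (at 0)" if "x \<noteq> y0" for i j x
    unfolding U_def by (auto intro!: derivative_eq_intros dE[OF that] vd pdd dz[OF that] dc)
      (simp add: H_def algebra_simps power2_eq_square power3_eq_cube power4_eq_xxxx)
  have Hsym: "H i j = H j i" for i j
    unfolding H_def by (auto simp: fun_eq_iff sym[of i j] dlsym[of i j] algebra_simps)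
  define cU where "cU = (\<lambda>x. c 1 x * U 1 x + c 2 x * U 2 x + c 3 x * U 3 x)"
  define UU where "UU = (\<lambda>x. (U 1 x)\<^sup>2 + (U 2 x)\<^sup>2 + (U 3 x)\<^sup>2)"
  \<comment> \<open>The field collects all integrations by parts in \<open>2 * S * A\<close>. The
    Rellich identity for \<open>\<Delta> u\<close> times the radial derivative gives the first two
    terms. \<open>\<Delta> u\<close> times \<open>u\<close> gives the third and, after writing
    \<open>u * U j\<close> as half a derivative of \<open>u\<^sup>2\<close>, the fourth. The
    zero-order part of \<open>S\<close> times the radial derivative gives the last.\<close>
  define X where "X = (\<lambda>j x. 8 * \<tau> * (z x)\<^sup>2 * cU x * U j x - 4 * \<tau> * (z x)\<^sup>2 * UU x * c j x
     - 12 * \<tau> * (z x)\<^sup>2 * u x * U j x - 24 * \<tau> * (z x)^3 * (u x)\<^sup>2 * c j x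
     + (16 * \<tau>^3 * (z x)^5 + 16 * \<tau>\<^sup>2 * (z x)^4) * (u x)\<^sup>2 * c j x)"
  define DX where "DX = (\<lambda>j x.
       8 * \<tau> * (- 4 * c j x * (z x)^3 * cU x * U j x
          + (z x)\<^sup>2 * (U j x + c 1 x * H 1 j x + c 2 x * H 2 j x + c 3 x * H 3 j x) * U j x + (z x)\<^sup>2 * cU x * H j j x)
     - 4 * \<tau> * (- 4 * c j x * (z x)^3 * UU x * c j x
          + 2 * (z x)\<^sup>2 * (U 1 x * H 1 j x + U 2 x * H 2 j x + U 3 x * H 3 j x) * c j x + (z x)\<^sup>2 * UU x)
     - 12 * \<tau> * (- 4 * c j x * (z x)^3 * u x * U j x + (z x)\<^sup>2 * (U j x)\<^sup>2 + (z x)\<^sup>2 * u x * H j j x)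
     - 24 * \<tau> * (- 6 * c j x * (z x)^4 * (u x)\<^sup>2 * c j x + 2 * (z x)^3 * u x * U j x * c j x + (z x)^3 * (u x)\<^sup>2)
     + 16 * \<tau>^3 * (- 10 * c j x * (z x)^6 * (u x)\<^sup>2 * c j x + 2 * (z x)^5 * u x * U j x * c j x + (z x)^5 * (u x)\<^sup>2)
     + 16 * \<tau>\<^sup>2 * (- 8 * c j x * (z x)^5 * (u x)\<^sup>2 * c j x + 2 * (z x)^4 * u x * U j x * c j x + (z x)^4 * (u x)\<^sup>2))"
  have dX: "((\<lambda>t. X j (x + t *\<^sub>R axis j 1)) has_real_derivative DX j x) (at 0)" if "x \<noteq> y0" for j x
  proof -
    have dcU: "((\<lambda>t. cU (x + t *\<^sub>R axis j 1)) has_real_derivative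
       U j x + c 1 x * H 1 j x + c 2 x * H 2 j x + c 3 x * H 3 j x) (at 0)"
    proof -
      have "((\<lambda>t. cU (x + t *\<^sub>R axis j 1)) has_real_derivative
         dl 1 j * U 1 x + dl 2 j * U 2 x + dl 3 j * U 3 x + c 1 x * H 1 j x + c 2 x * H 2 j x + c 3 x * H 3 j x) (at 0)"
        unfolding cU_def by (auto intro!: derivative_eq_intros dU[OF that] dc)
      moreover have "dl 1 j * U 1 x + dl 2 j * U 2 x + dl 3 j * U 3 x = U j x"
        using exhaust_3[of j] by (auto simp: dl_def)
      ultimately show ?thesis by simp
    qed
    have dUU: "((\<lambda>t. UU (x + t *\<^sub>R axis j 1)) has_real_derivative
       2 * (U 1 x * H 1 j x + U 2 x * H 2 j x + U 3 x * H 3 j x)) (at 0)"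
      unfolding UU_def by (auto intro!: derivative_eq_intros dU[OF that])
    have dcj: "((\<lambda>t. c j (x + t *\<^sub>R axis j 1)) has_real_derivative 1) (at 0)"
      using dc[of j x j] by (simp add: dl_def)
    show ?thesis unfolding X_def
      by (auto intro!: derivative_eq_intros dcU dUU dcj dz[OF that] du[OF that] dU[OF that])
         (simp add: DX_def algebra_simps eval_nat_numeral)
  qed
  have near: "u x = 0" "U i x = 0" "H i j x = 0" if "dist x y0 < \<rho> \<or> dist x y0 > R" for x i j
    using supp[OF that] by (auto simp: u_def U_def H_def)
  have nearX: "X j x = 0" "DX j x = 0" if "dist x y0 < \<rho> \<or> dist x y0 > R" for x j
    using near[OF that] by (auto simp: X_def DX_def UU_def)
  have pdX: "pd j (X j) (DX j)" for j
    by (rule pd_zero_near[OF _ _ dX \<rho>]) (use nearX in auto)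
  have cz: "continuous_on (- {y0}) z" unfolding z_def by (auto intro!: continuous_intros)
  have cc: "continuous_on A (c i)" for A i unfolding c_def by (intro continuous_intros)
  have cvp: "continuous_on (- {y0}) v" "continuous_on (- {y0}) (p i)" "continuous_on (- {y0}) (h i j)" for i j
    using cont by (auto intro: continuous_on_subset)
  have cE: "continuous_on (- {y0}) E" unfolding E_def by (intro continuous_intros cz)
  have cu: "continuous_on (- {y0}) u" unfolding u_def by (intro continuous_intros cE cvp)
  have cUi: "continuous_on (- {y0}) (U i)" for i unfolding U_def by (intro continuous_intros cE cvp cz cc)
  have cH: "continuous_on (- {y0}) (H i j)" for i j unfolding H_def by (intro continuous_intros cE cvp cz cc)
  have cUUs: "continuous_on (- {y0}) UU" "continuous_on (- {y0}) cU"
    unfolding UU_def cU_def by (intro continuous_intros cUi cc)+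
  have cX: "continuous_on UNIV (X j)" for j
    by (rule continuous_zero_near[OF nearX(1) _ \<rho>])
       (auto simp: X_def intro!: continuous_intros cz cc cu cUi cUUs)
  have cDX: "continuous_on UNIV (DX j)" for j
    by (rule continuous_zero_near[OF nearX(2) _ \<rho>])
       (auto simp: DX_def intro!: continuous_intros cz cc cu cUi cUUs cH)
  have far: "dist x y0 > R" if "x \<notin> cball y0 R" for x using that by (simp add: dist_commute)
  have int0: "(\<integral>x. DX j x \<partial>lborel) = 0" for j
    by (rule integral_pd_eq_0[OF pdX cX cDX bounded_cball[of y0 R]]) (use nearX far in blast)+
  have iDX: "integrable lborel (DX j)" for j
    by (rule continuous_compact_support_integrable[OF cDX _ bounded_cball[of y0 R]]) (use nearX far in blast)
  define L where "L = (\<lambda>x. (E x)\<^sup>2 * (\<Sum>j\<in>UNIV. h j j x)\<^sup>2)"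
  define Q where "Q = (\<lambda>x. 64 * \<tau>^3 * ((z x)^5 * (E x)\<^sup>2 * (v x)\<^sup>2))"
  have nearLQ: "L x = 0" "Q x = 0" if "dist x y0 < \<rho> \<or> dist x y0 > R" for x
    using supp[OF that] by (auto simp: L_def Q_def)
  have iL: "integrable lborel L"
    by (rule continuous_compact_support_integrable[OF continuous_zero_near[OF nearLQ(1) _ \<rho>] _ bounded_cball[of y0 R]])
       (use nearLQ(1) far in \<open>auto simp: L_def intro!: continuous_intros cE cvp\<close>)
  have iQ: "integrable lborel Q"
    by (rule continuous_compact_support_integrable[OF continuous_zero_near[OF nearLQ(2) _ \<rho>] _ bounded_cball[of y0 R]])
       (use nearLQ(2) far in \<open>auto simp: Q_def intro!: continuous_intros cE cvp cz\<close>)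
  have pt: "Q x + (DX 1 x + DX 2 x + DX 3 x) \<le> L x" for x
  proof (cases "dist x y0 < \<rho> \<or> dist x y0 > R")
    case True
    then show ?thesis using nearX[OF True] nearLQ[OF True] by simp
  next
    case False
    then have xy: "x \<noteq> y0" and d: "dist x y0 \<le> R" using \<rho> by auto
    have s: "s x > 0" "s x \<le> R\<^sup>2" using d xy by (auto simp: s_norm power_mono)
    have zpos: "z x > 0" using s by (simp add: z_def s_def)
    have sz1: "s x * z x - 1 = 0" using sz[OF xy] by simp
    \<comment> \<open>As \<open>z\<close> has squared gradient \<open>4 z^3\<close> and Laplacian
      \<open>2 z^2\<close>, the conjugated Laplacian is \<open>\<Delta> u + 4 \<tau> z^2 cU + (4
      \<tau>^2 z^3 - 2 \<tau> z^2) u\<close>. The term \<open>6 \<tau> z^2 u\<close> is added to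
      \<open>S\<close> and subtracted in \<open>A\<close>.\<close>
    define S A where "S = H 1 1 x + H 2 2 x + H 3 3 x + (4 * \<tau>\<^sup>2 * (z x)^3 + 4 * \<tau> * (z x)\<^sup>2) * u x"
      and "A = 4 * \<tau> * (z x)\<^sup>2 * cU x - 6 * \<tau> * (z x)\<^sup>2 * u x"
    have "S + A - E x * (\<Sum>j\<in>UNIV. h j j x) = (s x * z x - 1) * (8 * \<tau> * (z x)\<^sup>2 - 4 * \<tau>\<^sup>2 * (z x)^3) * v x * E x"
      unfolding S_def A_def H_def cU_def U_def u_def sum_3 s_alt dl_def
      by (simp add: algebra_simps eval_nat_numeral)
    then have SA: "L x = (S + A)\<^sup>2" using sz1 by (simp add: L_def power_mult_distrib)
    \<comment> \<open>The multiplier contributes \<open>12 \<tau> z^2 UU\<close>, which exactly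
      cancels the gradient term left over by the Rellich identity; of the gradient only the radial
      square \<open>cU^2\<close> remains. The identity holds modulo \<open>s z = 1\<close>, so the
      cofactor of \<open>s z - 1\<close> is written out to make it polynomial.\<close>
    have "32 * \<tau> * (z x)^3 * (cU x)\<^sup>2 + (64 * \<tau>^3 * (z x)^5 + 32 * \<tau>\<^sup>2 * (z x)^4 - 72 * \<tau> * (z x)^3) * (u x)\<^sup>2
       + (DX 1 x + DX 2 x + DX 3 x) - 2 * S * A
       = (s x * z x - 1) * (16 * \<tau> * (z x)\<^sup>2 * UU x + 144 * \<tau> * (z x)^3 * (u x)\<^sup>2
           - 160 * \<tau>^3 * (z x)^5 * (u x)\<^sup>2 - 128 * \<tau>\<^sup>2 * (z x)^4 * (u x)\<^sup>2)"
      unfolding S_def A_def DX_def cU_def UU_def s_alt Hsym[of 2 1] Hsym[of 3 1] Hsym[of 3 2]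
      by algebra
    then have eq: "2 * S * A = 32 * \<tau> * (z x)^3 * (cU x)\<^sup>2 + (64 * \<tau>^3 * (z x)^5 + 32 * \<tau>\<^sup>2 * (z x)^4 - 72 * \<tau> * (z x)^3) * (u x)\<^sup>2
       + (DX 1 x + DX 2 x + DX 3 x)" using sz1 by simp
    \<comment> \<open>The lower bound on \<open>\<tau>\<close> lets \<open>32 \<tau>^2 z^4\<close>
      absorb the negative term \<open>- 72 \<tau> z^3\<close>.\<close>
    have "9 \<le> 4 * \<tau> * z x"
    proof -
      have "9 * s x \<le> 4 * \<tau>" using s \<tau> by linarith
      then have "9 * s x * z x \<le> 4 * \<tau> * z x" using zpos by (intro mult_right_mono) auto
      then show ?thesis using sz[OF xy] by (simp add: mult.assoc)
    qed
    then have "8 * \<tau> * (z x)^3 * 9 \<le> 8 * \<tau> * (z x)^3 * (4 * \<tau> * z x)"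
      using zpos \<tau> by (intro mult_left_mono) auto
    then have "0 \<le> 32 * \<tau>\<^sup>2 * (z x)^4 - 72 * \<tau> * (z x)^3" by (simp add: eval_nat_numeral mult_ac)
    then have "0 \<le> (32 * \<tau>\<^sup>2 * (z x)^4 - 72 * \<tau> * (z x)^3) * (u x)\<^sup>2" by simp
    moreover have "0 \<le> 32 * \<tau> * (z x)^3 * (cU x)\<^sup>2" using zpos \<tau> by simp
    moreover have "Q x = 64 * \<tau>^3 * (z x)^5 * (u x)\<^sup>2" by (simp add: Q_def u_def power_mult_distrib mult_ac)
    moreover have "(S + A)\<^sup>2 - 2 * S * A = S\<^sup>2 + A\<^sup>2" by (simp add: power2_sum)
    then have "2 * S * A \<le> (S + A)\<^sup>2" using zero_le_power2[of S] zero_le_power2[of A] by linarith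
    ultimately show ?thesis using eq SA by (simp add: algebra_simps)
  qed
  have "(\<integral>x. Q x + (DX 1 x + DX 2 x + DX 3 x) \<partial>lborel) \<le> (\<integral>x. L x \<partial>lborel)"
    by (rule integral_mono) (use iQ iDX iL pt in auto)
  then have "(\<integral>x. Q x \<partial>lborel) \<le> (\<integral>x. L x \<partial>lborel)"
    using iQ iDX int0 by simp
  then show ?thesis by (simp add: Q_def L_def E_def)
qed

section \<open>Weak Laplacians\<close>

lemma DERIV_pos_part_power:
  assumes "n \<ge> 2"
  shows "((\<lambda>s::real. (max 0 s)^n) has_real_derivative real n * (max 0 s)^(n - 1)) (at s)"
proof -
  consider "s > 0" | "s < 0" | "s = 0" by linarith
  then show ?thesis
  proof cases
    case 1
    have "((\<lambda>s. s^n) has_real_derivative real n * s^(n - 1)) (at s)"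
      by (auto intro!: derivative_eq_intros)
    then have "((\<lambda>s::real. (max 0 s)^n) has_real_derivative real n * s^(n - 1)) (at s)"
      by (rule has_field_derivative_transform_within_open[where S = "{0<..}"]) (use 1 in auto)
    then show ?thesis using 1 by simp
  next
    case 2
    have "((\<lambda>s::real. 0) has_real_derivative 0) (at s)" by simp
    then have "((\<lambda>s::real. (max 0 s)^n) has_real_derivative 0) (at s)"
      by (rule has_field_derivative_transform_within_open[where S = "{..<0}"]) (use 2 assms in auto)
    then show ?thesis using 2 assms by (simp add: power_0_left)
  next
    case 3
    have b: "\<bar>(max 0 h ^ n - max 0 0 ^ n) / (h - 0)\<bar> \<le> \<bar>h\<bar>^(n - 1)" for h :: real
    proof (cases "h > 0")
      case True
      then show ?thesis using assms by (cases n) (auto simp: field_simps)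
    next
      case False
      then have "max 0 h = 0" by simp
      then show ?thesis using assms by simp
    qed
    have "((\<lambda>h::real. \<bar>h\<bar>^(n - 1)) \<longlongrightarrow> \<bar>0\<bar>^(n - 1)) (at 0)" by (intro tendsto_intros)
    moreover have "\<bar>0::real\<bar>^(n - 1) = 0" using assms by (simp add: power_0_left)
    ultimately have "((\<lambda>h::real. \<bar>h\<bar>^(n - 1)) \<longlongrightarrow> 0) (at 0)" by metis
    then have "((\<lambda>h::real. (max 0 h ^ n - max 0 0 ^ n) / (h - 0)) \<longlongrightarrow> 0) (at 0)"
      by (rule Lim_null_comparison[rotated]) (use b in auto)
    then show ?thesis using 3 assms by (simp add: has_field_derivative_iff power_0_left)
  qed
qed

text \<open>The third power is the smallest that gives continuous second derivatives. Being
  polynomial inside the ball, the bump has an explicit gradient and Hessian.\<close>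

definition bump :: "real \<Rightarrow> real^3 \<Rightarrow> real" where
  "bump e z = (max 0 (e\<^sup>2 - z \<bullet> z))^3"

definition bump_grad :: "real \<Rightarrow> real^3 \<Rightarrow> real^3" where
  "bump_grad e z = (- 6 * (max 0 (e\<^sup>2 - z \<bullet> z))\<^sup>2) *\<^sub>R z"

definition bump_hess :: "real \<Rightarrow> 3 \<Rightarrow> real^3 \<Rightarrow> real^3" where
  "bump_hess e i z = (24 * max 0 (e\<^sup>2 - z \<bullet> z) * z $ i) *\<^sub>R z - (6 * (max 0 (e\<^sup>2 - z \<bullet> z))\<^sup>2) *\<^sub>R axis i 1"

definition lap_bump :: "real \<Rightarrow> real^3 \<Rightarrow> real" where
  "lap_bump e z = (\<Sum>i\<in>UNIV. bump_hess e i z $ i)"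

lemma bump_continuous: "continuous_on A (bump e)" "continuous_on A (bump_grad e)"
    "continuous_on A (bump_hess e i)" "continuous_on A (lap_bump e)"
  unfolding bump_def[abs_def] bump_grad_def[abs_def] bump_hess_def[abs_def] lap_bump_def[abs_def]
  by (intro continuous_intros)+

lemma bump_measurable [measurable]: "bump e \<in> borel_measurable borel" "bump_grad e \<in> borel_measurable borel"
   "bump_hess e i \<in> borel_measurable borel" "lap_bump e \<in> borel_measurable borel"
  by (auto intro!: borel_measurable_continuous_onI bump_continuous)

lemma inner_self_gt: "norm z \<ge> e \<Longrightarrow> e > 0 \<Longrightarrow> max 0 (e\<^sup>2 - z \<bullet> z) = 0" for z :: "'a::real_inner"
  using power_mono[of e "norm z" 2] by (simp add: power2_norm_eq_inner)

lemma bump_support: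
  assumes "e > 0" "norm z \<ge> e"
  shows "bump e z = 0" "bump_grad e z = 0" "bump_hess e i z = 0" "lap_bump e z = 0"
  using inner_self_gt[OF assms(2,1)]
  by (simp_all add: bump_def bump_grad_def bump_hess_def lap_bump_def)

lemma bump_nonneg: "bump e z \<ge> 0" by (simp add: bump_def)

lemma bump_even: "bump e (- z) = bump e z" "lap_bump e (- z) = lap_bump e z"
  by (auto simp: bump_def lap_bump_def bump_hess_def)

lemma bump_hess_sym: "bump_hess e i z $ j = bump_hess e j z $ i"
  by (auto simp: bump_hess_def axis_def)

lemma bump_has_derivative: "(bump e has_derivative (\<lambda>h. bump_grad e z \<bullet> h)) (at z)"
proof -
  have "((\<lambda>s::real. (max 0 s)^3) has_real_derivative 3 * (max 0 (e\<^sup>2 - z \<bullet> z))\<^sup>2) (at (e\<^sup>2 - z \<bullet> z))"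
    using DERIV_pos_part_power[of 3 "e\<^sup>2 - z \<bullet> z"] by simp
  moreover have "((\<lambda>z. e\<^sup>2 - z \<bullet> z) has_derivative (\<lambda>h. - (2 * (z \<bullet> h)))) (at z)"
    by (auto intro!: derivative_eq_intros simp: inner_commute)
  ultimately have "((\<lambda>z. (max 0 (e\<^sup>2 - z \<bullet> z))^3) has_derivative (\<lambda>h. - (2 * (z \<bullet> h)) * (3 * (max 0 (e\<^sup>2 - z \<bullet> z))\<^sup>2))) (at z)"
    by (rule DERIV_compose_FDERIV)
  then show ?thesis unfolding bump_def[abs_def]
    by (rule has_derivative_eq_rhs) (auto simp: bump_grad_def)
qed

lemma bump_grad_has_derivative:
  "((\<lambda>z. bump_grad e z $ i) has_derivative (\<lambda>h. bump_hess e i z \<bullet> h)) (at z)"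
proof -
  have "((\<lambda>s::real. (max 0 s)\<^sup>2) has_real_derivative 2 * (max 0 (e\<^sup>2 - z \<bullet> z))) (at (e\<^sup>2 - z \<bullet> z))"
    using DERIV_pos_part_power[of 2 "e\<^sup>2 - z \<bullet> z"] by simp
  moreover have "((\<lambda>z. e\<^sup>2 - z \<bullet> z) has_derivative (\<lambda>h. - (2 * (z \<bullet> h)))) (at z)"
    by (auto intro!: derivative_eq_intros simp: inner_commute)
  ultimately have d: "((\<lambda>z. (max 0 (e\<^sup>2 - z \<bullet> z))\<^sup>2) has_derivative (\<lambda>h. - (2 * (z \<bullet> h)) * (2 * (max 0 (e\<^sup>2 - z \<bullet> z))))) (at z)"
    by (rule DERIV_compose_FDERIV)
  have n: "((\<lambda>z. z $ i) has_derivative (\<lambda>h. h $ i)) (at z)"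
    by (rule bounded_linear_imp_has_derivative[OF bounded_linear_vec_nth])
  have "((\<lambda>z. - 6 * (max 0 (e\<^sup>2 - z \<bullet> z))\<^sup>2 * z $ i) has_derivative
      (\<lambda>h. - 6 * (max 0 (e\<^sup>2 - z \<bullet> z))\<^sup>2 * h $ i + (- 6 * (- (2 * (z \<bullet> h)) * (2 * (max 0 (e\<^sup>2 - z \<bullet> z))))) * z $ i)) (at z)"
    by (intro has_derivative_mult has_derivative_mult_right d n)
  then show ?thesis
    by (auto simp: bump_grad_def bump_hess_def inner_diff_left inner_axis' algebra_simps elim!: has_derivative_eq_rhs)
qed

lemma has_derivative_imp_pd:
  assumes "\<And>x. (f has_derivative (\<lambda>h. G x \<bullet> h)) (at x)"
  shows "pd j f (\<lambda>x. G x $ j)"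
  unfolding pd_def
proof
  fix x :: "real^3"
  have l: "((\<lambda>t::real. x + t *\<^sub>R axis j 1) has_derivative (\<lambda>t. t *\<^sub>R axis j 1)) (at 0)"
    by (auto intro!: derivative_eq_intros)
  have "((\<lambda>t. f (x + t *\<^sub>R axis j 1)) has_derivative (\<lambda>t. G x \<bullet> (t *\<^sub>R axis j 1))) (at 0)"
    by (rule has_derivative_compose[OF l]) (use assms[of x] in simp)
  then show "((\<lambda>t. f (x + t *\<^sub>R axis j 1)) has_real_derivative G x $ j) (at 0)"
    unfolding has_field_derivative_def by (rule has_derivative_eq_rhs) (auto simp: inner_axis)
qed

lemma bump_pd: "pd j (bump e) (\<lambda>z. bump_grad e z $ j)" "pd j (\<lambda>z. bump_grad e z $ i) (\<lambda>z. bump_hess e i z $ j)"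
  by (intro has_derivative_imp_pd bump_has_derivative bump_grad_has_derivative)+

lemma tsupp_subset:
  assumes "\<And>x. x \<notin> S \<Longrightarrow> f x = 0" "closed S"
  shows "tsupp f \<subseteq> S"
  unfolding tsupp_def using assms by (intro closure_minimal) auto

lemma test_fnI:
  assumes "continuous_on UNIV G" "\<And>x. (f has_derivative (\<lambda>h. G x \<bullet> h)) (at x)"
    "\<And>x. x \<notin> S \<Longrightarrow> f x = 0" "compact S"
  shows "test_fn f G"
proof -
  have "tsupp f \<subseteq> S" using assms by (intro tsupp_subset compact_imp_closed) auto
  then have "compact (tsupp f)"
    using assms(4) by (metis closed_closure compact_Int_closed inf.absorb_iff2 tsupp_def)
  then show ?thesis using assms by (simp add: test_fn_def)
qed

lemma has_derivative_reflect:
  assumes "(f has_derivative (\<lambda>h. G \<bullet> h)) (at (x - y))"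
  shows "((\<lambda>y. f (x - y)) has_derivative (\<lambda>h. (- G) \<bullet> h)) (at (y::real^3))"
proof -
  have l: "((\<lambda>y. x - y) has_derivative (\<lambda>h. - h)) (at y)" by (auto intro!: derivative_eq_intros)
  have "((\<lambda>y. f (x - y)) has_derivative (\<lambda>h. G \<bullet> (- h))) (at y)"
    by (rule has_derivative_compose[OF l assms])
  then show ?thesis by simp
qed

text \<open>The bump will be inserted into the weak equation and the components of its gradient into
  the identity for the weak gradient; eliminating the gradient of the solution from the two leaves
  its Laplacian.\<close>

lemma bump_test_fn:
  assumes "e > 0"
  shows "test_fn (\<lambda>y. bump e (x - y)) (\<lambda>y. - bump_grad e (x - y))"
    "test_fn (\<lambda>y. bump_grad e (x - y) $ i) (\<lambda>y. - bump_hess e i (x - y))"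
    "tsupp (\<lambda>y. bump e (x - y)) \<subseteq> cball x e" "tsupp (\<lambda>y. bump_grad e (x - y) $ i) \<subseteq> cball x e"
proof -
  have z: "bump e (x - y) = 0" "bump_grad e (x - y) $ i = 0" if "y \<notin> cball x e" for y
    using that bump_support[OF assms, of "x - y"] by (auto simp: dist_norm)
  have c: "continuous_on UNIV (\<lambda>y. - bump_grad e (x - y))" "continuous_on UNIV (\<lambda>y. - bump_hess e i (x - y))"
    by (intro continuous_intros continuous_on_compose2[OF bump_continuous(2)[of UNIV]]
         continuous_on_compose2[OF bump_continuous(3)[of UNIV]]; simp)+
  show "test_fn (\<lambda>y. bump e (x - y)) (\<lambda>y. - bump_grad e (x - y))"
    by (rule test_fnI[OF c(1) has_derivative_reflect[OF bump_has_derivative] z(1) compact_cball])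
  show "test_fn (\<lambda>y. bump_grad e (x - y) $ i) (\<lambda>y. - bump_hess e i (x - y))"
    by (rule test_fnI[OF c(2) has_derivative_reflect[OF bump_grad_has_derivative] z(2) compact_cball])
  show "tsupp (\<lambda>y. bump e (x - y)) \<subseteq> cball x e" "tsupp (\<lambda>y. bump_grad e (x - y) $ i) \<subseteq> cball x e"
    by (intro tsupp_subset z closed_cball; assumption)+
qed

definition bump_mass :: "real \<Rightarrow> real" where
  "bump_mass e = (\<integral>z. bump e z \<partial>lborel)"

lemma bump_support': assumes "e > 0" "z \<notin> cball 0 e" shows "bump e z = 0" "bump_grad e z $ i = 0" "bump_hess e i z $ j = 0" "lap_bump e z = 0"
  using bump_support[OF assms(1), of z] assms(2) by auto

lemma bump_mass_pos:
  assumes "e > 0" shows "bump_mass e > 0"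
proof (rule ccontr)
  have i: "integrable lborel (bump e)"
    by (rule continuous_compact_support_integrable[OF bump_continuous(1) bump_support'(1)[OF assms] bounded_cball])
  assume "\<not> bump_mass e > 0"
  moreover have "0 \<le> bump_mass e" unfolding bump_mass_def by (intro integral_nonneg_AE AE_I2 bump_nonneg)
  ultimately have "AE z in lborel. bump e z = 0"
    using integral_nonneg_eq_0_iff_AE[OF i AE_I2[OF bump_nonneg]] by (simp add: bump_mass_def)
  then have "AE z in lborel. z \<notin> ball (0::real^3) e"
  proof eventually_elim
    case (elim z)
    show ?case
    proof
    assume "z \<in> ball 0 e"
    moreover from this have "z \<bullet> z < e\<^sup>2"
      using power_strict_mono[of "norm z" e 2] by (simp add: power2_norm_eq_inner)
    ultimately show False using elim by (simp add: bump_def)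
    qed
  qed
  then have "ball (0::real^3) e \<in> null_sets lborel" by (simp add: AE_iff_null_sets)
  then have "negligible (ball (0::real^3) e)" by (simp add: negligible_iff_null_sets null_sets_completionI)
  then show False using open_not_negligible[of "ball (0::real^3) e"] assms by auto
qed

definition rho :: "real \<Rightarrow> real^3 \<Rightarrow> real" where
  "rho e z = bump e z / bump_mass e"

lemma rho_mollifier: "e > 0 \<Longrightarrow> mollifier e (rho e)"
  unfolding mollifier_def rho_def[abs_def]
  using bump_mass_pos[of e] bump_nonneg bump_support'(1)[of e]
  by (auto intro!: continuous_intros bump_continuous divide_nonneg_pos simp: bump_mass_def bump_even)

lemma conv_bump: "e > 0 \<Longrightarrow> conv v (bump e) x = bump_mass e * conv v (rho e) x"
  using bump_mass_pos[of e] by (simp add: conv_def rho_def)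

lemma rho_L2_conv:
  assumes "L2 lborel v" "e > 0"
  shows "L2_conv lborel (\<lambda>n. conv v (rho (e / real (Suc n)))) v"
proof (rule mollify_L2_conv[OF assms(1), where e = "\<lambda>n. e / real (Suc n)"])
  show "mollifier (e / real (Suc n)) (rho (e / real (Suc n)))" for n using assms by (intro rho_mollifier) simp
  show "(\<lambda>n. e / real (Suc n)) \<longlonglongrightarrow> 0"
    using tendsto_mult_left[OF LIMSEQ_Suc[OF lim_1_over_n], of e] by simp
qed

text \<open>The mollifications converge to \<open>h\<close> in L2, also after multiplication by the
  indicator of \<open>A\<close>, where they all vanish. Small radii suffice, so this criterion can
  be used locally.\<close>

lemma AE_zero_if_mollified_zero:
  assumes h: "L2 lborel h" and A: "A \<in> sets borel" and e0: "e0 > 0"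
    and z: "\<And>e x. 0 < e \<Longrightarrow> e < e0 \<Longrightarrow> x \<in> A \<Longrightarrow> conv h (bump e) x = 0"
  shows "AE x in lborel. x \<in> A \<longrightarrow> h x = 0"
proof -
  note [measurable] = A
  have [measurable]: "h \<in> borel_measurable borel" using L2_measurable[OF h] by simp
  \<comment> \<open>Starting from \<open>e0 / 2\<close> keeps every radius strictly below
    \<open>e0\<close>.\<close>
  define en where "en = (\<lambda>n. e0 / 2 / real (Suc n))"
  have en: "0 < en n" "en n < e0" for n
  proof -
    show "0 < en n" using e0 by (simp add: en_def)
    have "en n \<le> e0 / 2 / 1" unfolding en_def using e0 by (intro divide_left_mono) auto
    then show "en n < e0" using e0 by simp
  qed
  have c: "L2_conv lborel (\<lambda>n. conv h (rho (en n))) h"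
    unfolding en_def by (rule rho_L2_conv[OF h]) (use e0 in simp)
  have "L2_conv lborel (\<lambda>n x. indicator A x * conv h (rho (en n)) x) (\<lambda>x. indicator A x * h x)"
    by (rule L2_conv_bounded_mult[OF c, where C = 1]) (auto simp: indicator_def)
  moreover have "(\<lambda>x. indicator A x * conv h (rho (en n)) x) = (\<lambda>x. 0)" for n
    using z[OF en, of _ n] conv_bump[of "en n" h] en(1)[of n] bump_mass_pos[OF en(1), of n]
    by (force simp: fun_eq_iff indicator_def)
  ultimately have c2: "L2_conv lborel (\<lambda>n x. 0) (\<lambda>x. indicator A x * h x)" by simp
  then have "(\<integral>x. (indicator A x * h x)\<^sup>2 \<partial>lborel) = 0"
    by (simp add: L2_conv_def LIMSEQ_const_iff)
  moreover have "integrable lborel (\<lambda>x. (indicator A x * h x)\<^sup>2)"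
    using c2 by (auto simp: L2_conv_def L2_def)
  ultimately have "AE x in lborel. (indicator A x * h x)\<^sup>2 = 0"
    using integral_nonneg_eq_0_iff_AE[of lborel "\<lambda>x. (indicator A x * h x)\<^sup>2"] by simp
  then show ?thesis by eventually_elim (auto simp: indicator_def)
qed

text \<open>This expresses \<open>\<Delta> v = h\<close> in the sense of distributions, tested only against translated bumps.\<close>
definition weak_lap :: "real \<Rightarrow> (real^3 \<Rightarrow> real) \<Rightarrow> (real^3 \<Rightarrow> real) \<Rightarrow> bool" where
  "weak_lap e0 v h \<longleftrightarrow> (\<forall>e x. 0 < e \<and> e < e0 \<longrightarrow> conv v (lap_bump e) x = conv h (bump e) x)"

lemma weak_lapD: "weak_lap e0 v h \<Longrightarrow> 0 < e \<Longrightarrow> e < e0 \<Longrightarrow> conv v (lap_bump e) x = conv h (bump e) x"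
  by (simp add: weak_lap_def)

lemma conv_cmult: "conv (\<lambda>x. c * v x) k x = c * conv v k x"
  by (simp add: conv_def mult.assoc)

lemma weak_lap_lincomb:
  assumes "weak_lap e0 v h" "weak_lap e0 v' h'" "L2 lborel v" "L2 lborel h" "L2 lborel v'" "L2 lborel h'"
  shows "weak_lap e0 (\<lambda>x. c * (v x - v' x)) (\<lambda>x. c * (h x - h' x))"
  unfolding weak_lap_def
proof (intro allI impI, elim conjE)
  fix e :: real and x :: "real^3" assume e: "0 < e" "e < e0"
  show "conv (\<lambda>x. c * (v x - v' x)) (lap_bump e) x = conv (\<lambda>x. c * (h x - h' x)) (bump e) x"
    unfolding conv_cmult
    using conv_diff[OF assms(3,5) bump_continuous(4) bump_support'(4)[OF e(1)], where x = x]
      conv_diff[OF assms(4,6) bump_continuous(1) bump_support'(1)[OF e(1)], where x = x]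
      weak_lapD[OF assms(1) e] weak_lapD[OF assms(2) e] by simp
qed

lemma weak_lap_zero_AE:
  assumes "weak_lap e0 v h" "AE x in lborel. v x = 0" "L2 lborel h" "e0 > 0" "v \<in> borel_measurable borel"
  shows "AE x in lborel. h x = 0"
proof -
  have "AE x in lborel. x \<in> UNIV \<longrightarrow> h x = 0"
  proof (rule AE_zero_if_mollified_zero[OF assms(3) _ assms(4)])
    fix e x assume e: "0 < e" "e < e0"
    note [measurable] = assms(5)
    have "conv v (lap_bump e) x = (\<integral>y. 0 \<partial>(lborel :: (real^3) measure))"
      unfolding conv_def by (rule integral_cong_AE) (use assms(2) in auto)
    then show "conv h (bump e) x = 0" using weak_lapD[OF assms(1) e] by simp
  qed simp
  then show ?thesis by simp
qed

section \<open>Symmetry of the weak Laplacian, and the Carleman estimate for it\<close>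

lemma conv_L2_compact:
  fixes k :: "real^3 \<Rightarrow> real"
  assumes "L2 lborel b" "\<And>x. x \<notin> S \<Longrightarrow> b x = 0" "bounded S"
    and k: "continuous_on UNIV k" "\<And>z. z \<notin> cball 0 e \<Longrightarrow> k z = 0"
  shows "L2 lborel (conv b k)"
proof -
  obtain R where R: "S \<subseteq> cball (0::real^3) R" using assms(3) by (auto simp: bounded_iff subset_eq)
  show ?thesis
  proof (rule continuous_compact_support_L2[OF conv_continuous[OF assms(1) k] _ bounded_cball])
    fix x :: "real^3" assume x: "x \<notin> cball 0 (R + e)"
    show "conv b k x = 0"
    proof (rule conv_support[OF k(2)])
      fix y assume "y \<in> cball x e"
      then have "y \<notin> cball 0 R" using x norm_triangle_ineq2[of x y] by (auto simp: dist_norm)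
      then show "b y = 0" using R assms(2) by blast
    qed
  qed
qed

text \<open>For an even kernel this is Fubini. The bounded support of \<open>b\<close> makes the
  convolution of \<open>\<bar>b\<bar>\<close> with \<open>\<bar>k\<bar>\<close> square-integrable,
  hence the double integral absolutely convergent.\<close>

lemma conv_swap:
  fixes k :: "real^3 \<Rightarrow> real"
  assumes a: "L2 lborel a" and b: "L2 lborel b" "\<And>x. x \<notin> S \<Longrightarrow> b x = 0" "bounded S"
    and k: "continuous_on UNIV k" "\<And>z. z \<notin> cball 0 e \<Longrightarrow> k z = 0" "\<And>z. k (- z) = k z"
  shows "(\<integral>x. a x * conv b k x \<partial>lborel) = (\<integral>x. b x * conv a k x \<partial>lborel)"
proof -
  have [measurable]: "a \<in> borel_measurable borel" "b \<in> borel_measurable borel" "k \<in> borel_measurable borel"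
    using L2_measurable[OF a] L2_measurable[OF b(1)] borel_measurable_continuous_onI[OF k(1)] by auto
  define F where "F = (\<lambda>(x, y). a x * b y * k (x - y))"
  have ab: "L2 lborel (\<lambda>x. \<bar>a x\<bar>)" "L2 lborel (\<lambda>x. \<bar>b x\<bar>)" using a b(1) by (simp_all add: L2_def)
  have ak: "continuous_on UNIV (\<lambda>z. \<bar>k z\<bar>)" by (intro continuous_intros k)
  have iF: "integrable (lborel \<Otimes>\<^sub>M lborel) F"
  proof (rule lborel_pair.Fubini_integrable)
    show "F \<in> borel_measurable (lborel \<Otimes>\<^sub>M lborel)" unfolding F_def by measurable
    have "(\<integral>y. norm (F (x, y)) \<partial>lborel) = \<bar>a x\<bar> * conv (\<lambda>x. \<bar>b x\<bar>) (\<lambda>z. \<bar>k z\<bar>) x" for x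
      unfolding F_def conv_def by (simp add: abs_mult mult.assoc)
    moreover have "integrable lborel (\<lambda>x. \<bar>a x\<bar> * conv (\<lambda>x. \<bar>b x\<bar>) (\<lambda>z. \<bar>k z\<bar>) x)"
      by (intro L2_mult_integrable ab conv_L2_compact[where S = S and e = e] ak) (use b k in auto)
    ultimately show "integrable lborel (\<lambda>x. \<integral>y. norm (F (x, y)) \<partial>lborel)" by simp
    show "AE x in lborel. integrable lborel (\<lambda>y. F (x, y))"
      using conv_integrable[OF b(1) k(1,2)] by (auto simp: F_def mult.assoc)
  qed
  have "(\<integral>x. a x * conv b k x \<partial>lborel) = (\<integral>x. \<integral>y. F (x, y) \<partial>lborel \<partial>lborel)"
    by (simp add: F_def conv_def mult.assoc)
  also have "\<dots> = (\<integral>y. \<integral>x. F (x, y) \<partial>lborel \<partial>lborel)"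
    using lborel_pair.Fubini_integral[of "\<lambda>x y. F (x, y)"] iF by simp
  also have "\<dots> = (\<integral>y. b y * conv a k y \<partial>lborel)"
  proof (rule Bochner_Integration.integral_cong[OF refl])
    fix y
    have "F (x, y) = b y * (a x * k (y - x))" for x
      using k(3)[of "x - y"] by (simp add: F_def mult_ac)
    then show "(\<integral>x. F (x, y) \<partial>lborel) = b y * conv a k y" by (simp add: conv_def)
  qed
  finally show ?thesis .
qed

text \<open>Green's second formula without derivatives: the kernel \<open>lap_bump\<close> is even
  and can be moved from \<open>b\<close> to \<open>a\<close>. The weak equations turn both sides
  into mollifications of right-hand sides, which disappear as the radius tends to 0.\<close>

lemma weak_lap_symmetric:
  assumes a: "weak_lap e0 a ha" "L2 lborel a" "L2 lborel ha" "\<And>x. x \<notin> S \<Longrightarrow> a x = 0" "\<And>x. x \<notin> S \<Longrightarrow> ha x = 0"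
    and b: "weak_lap e0 b hb" "L2 lborel b" "L2 lborel hb" "\<And>x. x \<notin> S \<Longrightarrow> b x = 0" "\<And>x. x \<notin> S \<Longrightarrow> hb x = 0"
    and S: "bounded S" and e0: "e0 > 0"
  shows "(\<integral>x. a x * hb x \<partial>lborel) = (\<integral>x. b x * ha x \<partial>lborel)"
proof -
  define en where "en = (\<lambda>n. e0 / 2 / real (Suc n))"
  have en: "0 < en n" "en n < e0" for n
  proof -
    show "0 < en n" using e0 by (simp add: en_def)
    have "en n \<le> e0 / 2 / 1" unfolding en_def using e0 by (intro divide_left_mono) auto
    then show "en n < e0" using e0 by simp
  qed
  have eq: "(\<integral>x. a x * conv hb (rho (en n)) x \<partial>lborel) = (\<integral>x. b x * conv ha (rho (en n)) x \<partial>lborel)" for n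
  proof -
    have "(\<integral>x. a x * conv hb (bump (en n)) x \<partial>lborel) = (\<integral>x. a x * conv b (lap_bump (en n)) x \<partial>lborel)"
      using weak_lapD[OF b(1) en] by simp
    also have "\<dots> = (\<integral>x. b x * conv a (lap_bump (en n)) x \<partial>lborel)"
      by (rule conv_swap[OF a(2) b(2,4) S bump_continuous(4) bump_support'(4)[OF en(1)] bump_even(2)])
    also have "\<dots> = (\<integral>x. b x * conv ha (bump (en n)) x \<partial>lborel)"
      using weak_lapD[OF a(1) en] by simp
    finally have "bump_mass (en n) * (\<integral>x. a x * conv hb (rho (en n)) x \<partial>lborel) = bump_mass (en n) * (\<integral>x. b x * conv ha (rho (en n)) x \<partial>lborel)"
      unfolding conv_bump[OF en(1)] mult.left_commute[of _ "bump_mass (en n)"] by simp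
    then show ?thesis using bump_mass_pos[OF en(1), of n] by simp
  qed
  have c: "L2_conv lborel (\<lambda>n. conv hb (rho (en n))) hb" "L2_conv lborel (\<lambda>n. conv ha (rho (en n))) ha"
    unfolding en_def by (rule rho_L2_conv; use a b e0 in simp)+
  have "(\<lambda>n. \<integral>x. a x * conv hb (rho (en n)) x \<partial>lborel) \<longlonglongrightarrow> (\<integral>x. a x * hb x \<partial>lborel)"
    by (rule L2_conv_mult[OF L2_conv_const[OF a(2)] c(1)])
  moreover have "(\<lambda>n. \<integral>x. b x * conv ha (rho (en n)) x \<partial>lborel) \<longlonglongrightarrow> (\<integral>x. b x * ha x \<partial>lborel)"
    by (rule L2_conv_mult[OF L2_conv_const[OF b(2)] c(2)])
  ultimately show ?thesis unfolding eq by (rule LIMSEQ_unique)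
qed

text \<open>The smooth estimate is applied to mollifications. These have slightly larger supports,
  so it is used in the annulus from \<open>\<rho> / 2\<close> to \<open>R + \<rho>\<close>; hence
  the comparison of \<open>\<tau>\<close> with \<open>(R + \<rho>)\<^sup>2\<close>.\<close>

lemma carleman_weak:
  fixes y0 :: "real^3"
  defines "z \<equiv> \<lambda>x. inverse ((x - y0) \<bullet> (x - y0))"
  assumes wl: "weak_lap e0 v h" "e0 > 0" and L: "L2 lborel v" "L2 lborel h"
    and supp: "\<And>x. dist x y0 < \<rho> \<or> dist x y0 > R \<Longrightarrow> v x = 0" "\<And>x. dist x y0 < \<rho> \<or> dist x y0 > R \<Longrightarrow> h x = 0"
    and \<rho>: "\<rho> > 0" and \<tau>: "4 * \<tau> \<ge> 9 * (R + \<rho>)\<^sup>2" "\<tau> > 0" and R: "R \<ge> 0"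
  shows "64 * \<tau>^3 * (\<integral>x. (z x)^5 * (exp (\<tau> * z x))\<^sup>2 * (v x)\<^sup>2 \<partial>lborel)
      \<le> (\<integral>x. (exp (\<tau> * z x))\<^sup>2 * (h x)\<^sup>2 \<partial>lborel)"
proof -
  define e1 where "e1 = min e0 \<rho> / 2"
  have e1: "e1 > 0" "e1 < e0" "e1 < \<rho>" "e1 \<le> \<rho> / 2" using wl(2) \<rho> by (auto simp: e1_def min_def)
  define en where "en = (\<lambda>n. e1 / real (Suc n))"
  have en: "0 < en n" "en n \<le> e1" for n
  proof -
    show "0 < en n" using e1 by (simp add: en_def)
    have "en n \<le> e1 / 1" unfolding en_def using e1 by (intro divide_left_mono) auto
    then show "en n \<le> e1" by simp
  qed
  define A where "A = - ball y0 (\<rho> / 2)"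
  have [measurable]: "A \<in> sets borel" by (simp add: A_def)
  have [measurable]: "z \<in> borel_measurable borel" unfolding z_def by measurable
  have zb: "0 \<le> z x" "z x \<le> 4 / \<rho>\<^sup>2" if "x \<in> A" for x
  proof -
    have "\<rho> / 2 \<le> norm (x - y0)" using that by (simp add: A_def dist_norm norm_minus_commute)
    from power_mono[OF this, of 2] have "\<rho>\<^sup>2 / 4 \<le> (x - y0) \<bullet> (x - y0)"
      using \<rho> by (simp add: power_divide power2_norm_eq_inner)
    moreover have "0 < \<rho>\<^sup>2 / 4" using \<rho> by simp
    ultimately have "inverse ((x - y0) \<bullet> (x - y0)) \<le> inverse (\<rho>\<^sup>2 / 4)" by (rule le_imp_inverse_le)
    then show "z x \<le> 4 / \<rho>\<^sup>2" by (simp add: z_def)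
  qed (simp add: z_def)
  define M where "M = 4 / \<rho>\<^sup>2"
  have M0: "M \<ge> 0" by (simp add: M_def)
  \<comment> \<open>The weights are cut off near \<open>y0\<close>, where all functions involved
    vanish. They become bounded, so multiplication by them preserves convergence in L2.\<close>
  define b1 b2 where "b1 = (\<lambda>x. indicator A x * ((z x)^5 * (exp (\<tau> * z x))\<^sup>2))"
    and "b2 = (\<lambda>x. indicator A x * (exp (\<tau> * z x))\<^sup>2)"
  have [measurable]: "b1 \<in> borel_measurable borel" "b2 \<in> borel_measurable borel"
    unfolding b1_def b2_def by measurable
  have e2: "(exp (\<tau> * z x))\<^sup>2 \<le> (exp (\<tau> * M))\<^sup>2" if "x \<in> A" for x
    using zb[OF that] \<tau> by (intro power_mono) (auto simp: M_def simp del: times_divide_eq_right intro!: mult_left_mono)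
  have bb: "\<bar>b1 x\<bar> \<le> M^5 * (exp (\<tau> * M))\<^sup>2" "\<bar>b2 x\<bar> \<le> (exp (\<tau> * M))\<^sup>2" for x
  proof -
    show "\<bar>b2 x\<bar> \<le> (exp (\<tau> * M))\<^sup>2" using e2[of x] by (auto simp: b2_def indicator_def)
    have "(z x)^5 * (exp (\<tau> * z x))\<^sup>2 \<le> M^5 * (exp (\<tau> * M))\<^sup>2" if "x \<in> A"
      using zb[OF that] M0 by (intro mult_mono power_mono e2[OF that]) (auto simp: M_def)
    then show "\<bar>b1 x\<bar> \<le> M^5 * (exp (\<tau> * M))\<^sup>2" using zb[of x] M0 by (auto simp: b1_def indicator_def)
  qed
  have sup2: "conv f k x = 0" if f: "\<And>x. dist x y0 < \<rho> \<or> dist x y0 > R \<Longrightarrow> f x = 0"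
     and k: "\<And>w. w \<notin> cball 0 (en n) \<Longrightarrow> k w = 0" and x: "dist x y0 < \<rho> / 2 \<or> dist x y0 > R + \<rho>" for f k x n
  proof (rule conv_support[OF k])
    fix y assume "y \<in> cball x (en n)"
    then have "dist x y \<le> \<rho> / 2" using en(2)[of n] e1 by simp
    moreover have "dist y y0 \<le> dist x y + dist x y0" "dist x y0 \<le> dist x y + dist y y0"
      by (metis dist_commute dist_triangle)+
    ultimately show "f y = 0" using x \<rho> by (intro f) linarith
  qed
  have ineq: "64 * \<tau>^3 * (\<integral>x. b1 x * conv v (rho (en n)) x * conv v (rho (en n)) x \<partial>lborel)
     \<le> (\<integral>x. b2 x * conv h (rho (en n)) x * conv h (rho (en n)) x \<partial>lborel)" for n
  proof -
    define m where "m = bump_mass (en n)"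
    have m: "m > 0" unfolding m_def by (rule bump_mass_pos[OF en(1)])
    note bs = bump_support'[OF en(1)]
    have cc: "continuous_on UNIV (\<lambda>z. bump_grad (en n) z $ i)" "continuous_on UNIV (\<lambda>z. bump_hess (en n) i z $ j)" for i j
      by (intro continuous_intros bump_continuous)+
    have "64 * \<tau>^3 * (\<integral>x. (z x)^5 * (exp (\<tau> * z x))\<^sup>2 * (conv v (bump (en n)) x)\<^sup>2 \<partial>lborel)
      \<le> (\<integral>x. (exp (\<tau> * z x))\<^sup>2 * (\<Sum>j\<in>UNIV. conv v (\<lambda>z. bump_hess (en n) j z $ j) x)\<^sup>2 \<partial>lborel)"
      unfolding z_def
    proof (rule carleman_C2[where \<rho> = "\<rho> / 2" and R = "R + \<rho>" and p = "\<lambda>i. conv v (\<lambda>z. bump_grad (en n) z $ i)"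
          and h = "\<lambda>i j. conv v (\<lambda>z. bump_hess (en n) i z $ j)"])
      show "pd i (conv v (bump (en n))) (conv v (\<lambda>z. bump_grad (en n) z $ i))" for i
        by (rule conv_pd[OF L(1) bump_continuous(1) bs(1) cc(1) bs(2) bump_pd(1)])
      show "pd j (conv v (\<lambda>z. bump_grad (en n) z $ i)) (conv v (\<lambda>z. bump_hess (en n) i z $ j))" for i j
        by (rule conv_pd[OF L(1) cc(1) bs(2) cc(2) bs(3) bump_pd(2)])
      show "conv v (\<lambda>z. bump_hess (en n) i z $ j) = conv v (\<lambda>z. bump_hess (en n) j z $ i)" for i j
        by (simp only: bump_hess_sym)
      show "continuous_on UNIV (conv v (bump (en n)))" by (rule conv_continuous[OF L(1) bump_continuous(1) bs(1)])
      show "continuous_on UNIV (conv v (\<lambda>z. bump_grad (en n) z $ i))" for i by (rule conv_continuous[OF L(1) cc(1) bs(2)])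
      show "continuous_on UNIV (conv v (\<lambda>z. bump_hess (en n) i z $ j))" for i j by (rule conv_continuous[OF L(1) cc(2) bs(3)])
      show "conv v (bump (en n)) x = 0" if "dist x y0 < \<rho> / 2 \<or> dist x y0 > R + \<rho>" for x by (rule sup2[OF supp(1) bs(1) that])
      show "conv v (\<lambda>z. bump_grad (en n) z $ i) x = 0" if "dist x y0 < \<rho> / 2 \<or> dist x y0 > R + \<rho>" for x i by (rule sup2[OF supp(1) bs(2) that])
      show "conv v (\<lambda>z. bump_hess (en n) i z $ j) x = 0" if "dist x y0 < \<rho> / 2 \<or> dist x y0 > R + \<rho>" for x i j by (rule sup2[OF supp(1) bs(3) that])
    qed (use \<rho> \<tau> in auto)
    also have "(\<lambda>x. \<Sum>j\<in>UNIV. conv v (\<lambda>z. bump_hess (en n) j z $ j) x) = conv h (bump (en n))"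
    proof
      fix x
      have "(\<Sum>j\<in>UNIV. conv v (\<lambda>z. bump_hess (en n) j z $ j) x) = conv v (lap_bump (en n)) x"
        unfolding conv_def lap_bump_def sum_distrib_left
        by (rule Bochner_Integration.integral_sum[symmetric]) (rule conv_integrable[OF L(1) cc(2) bs(3)])
      then show "(\<Sum>j\<in>UNIV. conv v (\<lambda>z. bump_hess (en n) j z $ j) x) = conv h (bump (en n)) x"
        using weak_lapD[OF wl(1) en(1)] en(2)[of n] e1 by simp
    qed
    finally have *: "64 * \<tau>^3 * (\<integral>x. (z x)^5 * (exp (\<tau> * z x))\<^sup>2 * (conv v (bump (en n)) x)\<^sup>2 \<partial>lborel)
      \<le> (\<integral>x. (exp (\<tau> * z x))\<^sup>2 * (conv h (bump (en n)) x)\<^sup>2 \<partial>lborel)"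
      by (simp only: fun_eq_iff)
    have ind: "indicator A x = (1::real) \<or> conv f (bump (en n)) x = 0" if "\<And>x. dist x y0 < \<rho> \<or> dist x y0 > R \<Longrightarrow> f x = 0" for f x
    proof (cases "x \<in> A")
      case False
      then have "dist x y0 < \<rho> / 2" by (simp add: A_def dist_commute)
      then show ?thesis using sup2[OF that bs(1), where x = x] by simp
    qed simp
    have e1: "(z x)^5 * (exp (\<tau> * z x))\<^sup>2 * (conv v (bump (en n)) x)\<^sup>2 = m\<^sup>2 * (b1 x * conv v (rho (en n)) x * conv v (rho (en n)) x)" for x
      using ind[OF supp(1), where x = x] m unfolding b1_def conv_bump[OF en(1)] m_def[symmetric]
      by (auto simp: power2_eq_square mult_ac)
    have e2: "(exp (\<tau> * z x))\<^sup>2 * (conv h (bump (en n)) x)\<^sup>2 = m\<^sup>2 * (b2 x * conv h (rho (en n)) x * conv h (rho (en n)) x)" for x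
      using ind[OF supp(2), where x = x] m unfolding b2_def conv_bump[OF en(1)] m_def[symmetric]
      by (auto simp: power2_eq_square mult_ac)
    from * have "m\<^sup>2 * (64 * \<tau>^3 * (\<integral>x. b1 x * conv v (rho (en n)) x * conv v (rho (en n)) x \<partial>lborel))
     \<le> m\<^sup>2 * (\<integral>x. b2 x * conv h (rho (en n)) x * conv h (rho (en n)) x \<partial>lborel)"
      unfolding e1 e2 by (simp add: mult.left_commute[of _ "m\<^sup>2"])
    then show ?thesis using m by simp
  qed
  have c: "L2_conv lborel (\<lambda>n. conv v (rho (en n))) v" "L2_conv lborel (\<lambda>n. conv h (rho (en n))) h"
    unfolding en_def by (rule rho_L2_conv[OF _ e1(1)]; use L in simp)+
  have l1: "(\<lambda>n. \<integral>x. b1 x * conv v (rho (en n)) x * conv v (rho (en n)) x \<partial>lborel) \<longlonglongrightarrow> (\<integral>x. b1 x * v x * v x \<partial>lborel)"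
    by (rule L2_conv_mult[OF L2_conv_bounded_mult[OF c(1) _ bb(1)] c(1)]) simp
  have l2: "(\<lambda>n. \<integral>x. b2 x * conv h (rho (en n)) x * conv h (rho (en n)) x \<partial>lborel) \<longlonglongrightarrow> (\<integral>x. b2 x * h x * h x \<partial>lborel)"
    by (rule L2_conv_mult[OF L2_conv_bounded_mult[OF c(2) _ bb(2)] c(2)]) simp
  have "64 * \<tau>^3 * (\<integral>x. b1 x * v x * v x \<partial>lborel) \<le> (\<integral>x. b2 x * h x * h x \<partial>lborel)"
    by (rule LIMSEQ_le[OF tendsto_mult_left[OF l1] l2]) (use ineq in auto)
  moreover have "b1 x * v x * v x = (z x)^5 * (exp (\<tau> * z x))\<^sup>2 * (v x)\<^sup>2" "b2 x * h x * h x = (exp (\<tau> * z x))\<^sup>2 * (h x)\<^sup>2" for x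
    using supp[of x] \<rho> by (auto simp: b1_def b2_def A_def indicator_def power2_eq_square dist_commute mult_ac)
  ultimately show ?thesis by simp
qed

section \<open>Families of non-radiating solutions\<close>

text \<open>If \<open>\<alpha> 1 > 0\<close>, the ratios \<open>\<alpha> n / \<alpha> (n + 1)\<close> grow at most by \<open>\<eta> n\<close> in each step, hence stay bounded.\<close>
lemma log_convex_decay_zero:
  fixes \<alpha> \<eta> :: "nat \<Rightarrow> real"
  assumes nonneg: "\<And>n. \<alpha> n \<ge> 0" "\<And>n. \<eta> n \<ge> 0" and sm: "summable \<eta>"
    and lc: "\<And>n. (\<alpha> (Suc n))\<^sup>2 \<le> \<alpha> (Suc (Suc n)) * (\<alpha> n + \<eta> n * \<alpha> (Suc n))"
    and decay: "\<And>\<delta>. \<delta> > 0 \<Longrightarrow> \<exists>C. \<forall>n. \<alpha> n \<le> C * \<delta>^n"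
  shows "\<alpha> 1 = 0"
proof (rule ccontr)
  assume "\<alpha> 1 \<noteq> 0"
  then have a1: "\<alpha> 1 > 0" using nonneg(1)[of 1] by simp
  \<comment> \<open>Log-convexity forbids a zero after a positive term, so the ratios make
    sense.\<close>
  have pos: "\<alpha> (Suc n) > 0" for n
  proof (induction n)
    case 0 then show ?case using a1 by simp
  next
    case (Suc n)
    then have "0 < (\<alpha> (Suc n))\<^sup>2" by simp
    with lc[of n] have "\<alpha> (Suc (Suc n)) \<noteq> 0" by auto
    then show ?case using nonneg(1)[of "Suc (Suc n)"] by simp
  qed
  define r where "r = (\<lambda>n. \<alpha> n / \<alpha> (Suc n))"
  have r: "r (Suc n) \<le> r n + \<eta> n" for n
  proof -
    have "(\<alpha> (Suc n))\<^sup>2 / (\<alpha> (Suc n) * \<alpha> (Suc (Suc n))) \<le> (\<alpha> (Suc (Suc n)) * (\<alpha> n + \<eta> n * \<alpha> (Suc n))) / (\<alpha> (Suc n) * \<alpha> (Suc (Suc n)))"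
      using lc[of n] pos[of n] pos[of "Suc n"] by (intro divide_right_mono) auto
    then show ?thesis using pos[of n] pos[of "Suc n"] by (simp add: r_def power2_eq_square add_divide_distrib)
  qed
  define B where "B = r 0 + suminf \<eta> + 1"
  have r0: "r n \<le> r 0 + (\<Sum>i<n. \<eta> i)" for n
  proof (induction n)
    case (Suc n) then show ?case using r[of n] by simp
  qed simp
  have "(\<Sum>i<n. \<eta> i) \<le> suminf \<eta>" for n by (rule sum_le_suminf[OF sm]) (use nonneg in auto)
  then have rB: "r n \<le> B" for n using r0[of n] unfolding B_def by (meson add_left_mono add_increasing2 order.trans zero_le_one)
  have B: "B \<ge> 1" using nonneg(1)[of 0] pos[of 0] suminf_nonneg[OF sm nonneg(2)] by (simp add: B_def r_def)
  have lower: "\<alpha> 1 \<le> B^n * \<alpha> (Suc n)" for n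
  proof (induction n)
    case (Suc n)
    have "\<alpha> (Suc n) \<le> B * \<alpha> (Suc (Suc n))"
      using rB[of "Suc n"] pos[of "Suc n"] by (simp add: r_def field_simps)
    then have "B^n * \<alpha> (Suc n) \<le> B^n * (B * \<alpha> (Suc (Suc n)))" using B by (intro mult_left_mono) auto
    with Suc show ?case by (simp add: mult_ac)
  qed simp
  \<comment> \<open>The bounded ratios force \<open>\<alpha> (Suc n) \<ge> \<alpha> 1 / B^n\<close>,
    so decay at the rate \<open>1 / (2 * B)\<close> is already contradictory.\<close>
  obtain C where C: "\<And>n. \<alpha> n \<le> C * (1 / (2 * B))^n" using decay[of "1 / (2 * B)"] B by auto
  have up: "\<alpha> 1 \<le> C / (2 * B) * (1 / 2)^n" for n
  proof -
    have "B^n * \<alpha> (Suc n) \<le> B^n * (C * (1 / (2 * B))^Suc n)" using B by (intro mult_left_mono C) auto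
    also have "\<dots> = C / (2 * B) * (1 / 2)^n" using B by (simp add: power_divide power_mult_distrib)
    finally show ?thesis using lower[of n] by simp
  qed
  have "(\<lambda>n. C / (2 * B) * (1 / 2)^n) \<longlonglongrightarrow> C / (2 * B) * 0"
    by (intro tendsto_mult tendsto_const LIMSEQ_realpow_zero) auto
  then have "\<alpha> 1 \<le> C / (2 * B) * 0" by (rule LIMSEQ_le_const) (use up in auto)
  then show False using a1 by simp
qed

text \<open>For given \<open>\<delta>\<close> the parameter \<open>\<tau>\<close> is taken so large
  that each step of the recursion contracts the weighted norm by \<open>\<delta>\<close>: of the
  factor in the Carleman estimate, one part absorbs the term with \<open>l (Suc n)\<close> and the
  rest provides \<open>1 / \<delta>\<close>. As the \<open>l n\<close> are bounded, one
  \<open>\<tau>\<close> serves all \<open>n\<close>, and the constant depends only on the weighted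
  norm of \<open>b 0\<close>.\<close>

lemma carleman_contraction:
  fixes y0 :: "real^3" and b :: "nat \<Rightarrow> real^3 \<Rightarrow> real"
  assumes L: "\<And>n. L2 lborel (b n)" and supp: "\<And>n x. dist x y0 < \<rho> \<or> dist x y0 > R \<Longrightarrow> b n x = 0"
    and q: "q \<in> borel_measurable borel" "\<And>x. \<bar>q x\<bar> \<le> Q"
    and wl: "\<And>n. weak_lap e0 (b (Suc n)) (\<lambda>x. - q x * (l (Suc n) * b (Suc n) x + b n x))" "e0 > 0"
    and \<rho>: "\<rho> > 0" "\<rho> \<le> R" and l: "\<And>n. \<bar>l n\<bar> \<le> \<Lambda>" and \<delta>: "\<delta> > 0"
  shows "\<exists>C. \<forall>n. (\<integral>x. (b n x)\<^sup>2 \<partial>lborel) \<le> C * \<delta>^n"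
proof -
  define z where "z = (\<lambda>x. inverse ((x - y0) \<bullet> (x - y0)))"
  define z0 where "z0 = inverse (R\<^sup>2)"
  have R: "R > 0" using \<rho> by simp
  have z0: "z0 > 0" using R by (simp add: z0_def)
  \<comment> \<open>Chosen so that \<open>64 * \<tau>^3 * z0^5\<close> exceeds the numerator;
    \<open>z0\<close> is the smallest value of \<open>z\<close> on the annulus containing the
    supports.\<close>
  define N where "N = (2 * Q\<^sup>2 / \<delta> + 2 * Q\<^sup>2 * \<Lambda>\<^sup>2) / (64 * z0^5)"
  define \<tau> where "\<tau> = 1 + 9 * (R + \<rho>)\<^sup>2 + N"
  have nn: "0 \<le> N" using z0 \<delta> by (simp add: N_def)
  have \<tau>: "\<tau> \<ge> 1" "4 * \<tau> \<ge> 9 * (R + \<rho>)\<^sup>2"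
  proof -
    have "0 \<le> (R + \<rho>)\<^sup>2" by simp
    with nn show "\<tau> \<ge> 1" "4 * \<tau> \<ge> 9 * (R + \<rho>)\<^sup>2"
      unfolding \<tau>_def atomize_conj by (smt (verit))
  qed
  have \<tau>3: "64 * \<tau>^3 * z0^5 \<ge> 2 * Q\<^sup>2 / \<delta> + 2 * Q\<^sup>2 * \<Lambda>\<^sup>2"
  proof -
    have "N \<le> \<tau>" unfolding \<tau>_def using zero_le_power2[of "R + \<rho>"] by linarith
    also have "\<tau> \<le> \<tau>^3" using self_le_power[OF \<tau>(1), of 3] by simp
    finally show ?thesis using z0 by (simp add: N_def pos_divide_le_eq mult_ac)
  qed
  define A where "A = - ball y0 \<rho>"
  have [measurable]: "A \<in> sets borel" by (simp add: A_def)
  have [measurable]: "z \<in> borel_measurable borel" unfolding z_def by measurable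
  have z_bd: "0 \<le> z x" "x \<in> A \<Longrightarrow> z x \<le> inverse (\<rho>\<^sup>2)" for x
  proof -
    assume "x \<in> A"
    then have "\<rho> \<le> norm (x - y0)" by (simp add: A_def dist_norm norm_minus_commute)
    from power_mono[OF this, of 2] have "\<rho>\<^sup>2 \<le> (x - y0) \<bullet> (x - y0)" using \<rho> by (simp add: power2_norm_eq_inner)
    then show "z x \<le> inverse (\<rho>\<^sup>2)" unfolding z_def using \<rho> by (intro le_imp_inverse_le) auto
  qed (simp add: z_def)
  define w where "w = (\<lambda>x. indicator A x * (exp (\<tau> * z x))\<^sup>2)"
  have wm[measurable]: "w \<in> borel_measurable borel" unfolding w_def by measurable
  define W where "W = (exp (\<tau> * inverse (\<rho>\<^sup>2)))\<^sup>2"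
  have wW: "\<bar>w x\<bar> \<le> W" for x
    using z_bd[of x] \<tau> unfolding w_def W_def
    by (cases "x \<in> A") (auto simp del: exp_gt_zero intro!: power_mono)
  have wf: "w x * (f x)\<^sup>2 = (exp (\<tau> * z x))\<^sup>2 * (f x)\<^sup>2" if "\<And>x. dist x y0 < \<rho> \<or> dist x y0 > R \<Longrightarrow> f x = 0" for f :: "real^3 \<Rightarrow> real" and x
    using that[of x] by (cases "x \<in> A") (auto simp: w_def A_def dist_commute)
  have wfb: "w x * (b m x)\<^sup>2 = (exp (\<tau> * z x))\<^sup>2 * (b m x)\<^sup>2" for x m
    by (rule wf) (rule supp)
  have wi: "integrable lborel (\<lambda>x. w x * (f x)\<^sup>2)" if "L2 lborel f" for f
    using L2_mult_integrable[OF L2_bounded_mult[OF that _ wW] that] by (simp add: power2_eq_square mult.assoc)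
  define I where "I = (\<lambda>n. \<integral>x. w x * (b n x)\<^sup>2 \<partial>lborel)"
  have w0: "w x \<ge> 0" for x by (simp add: w_def)
  have I0: "I n \<ge> 0" for n unfolding I_def using w0 by simp
  have step: "I (Suc n) \<le> \<delta> * I n" for n
  proof -
    define h where "h = (\<lambda>x. - q x * (l (Suc n) * b (Suc n) x + b n x))"
    have hL: "L2 lborel h" unfolding h_def
      by (rule L2_bounded_mult[where C = Q]) (use q in \<open>auto intro!: L2_add L2_cmult L\<close>)
    have hs: "dist x y0 < \<rho> \<or> dist x y0 > R \<Longrightarrow> h x = 0" for x using supp by (auto simp: h_def)
    have C: "64 * \<tau>^3 * (\<integral>x. (z x)^5 * (exp (\<tau> * z x))\<^sup>2 * (b (Suc n) x)\<^sup>2 \<partial>lborel)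
      \<le> (\<integral>x. (exp (\<tau> * z x))\<^sup>2 * (h x)\<^sup>2 \<partial>lborel)"
      unfolding z_def by (rule carleman_weak[OF wl(1)[of n, folded h_def] wl(2) L hL supp hs \<rho>(1) \<tau>(2)]) (use \<tau> R in auto)
    have "z0^5 * I (Suc n) \<le> (\<integral>x. (z x)^5 * (exp (\<tau> * z x))\<^sup>2 * (b (Suc n) x)\<^sup>2 \<partial>lborel)"
    proof -
      have zL: "L2 lborel (\<lambda>x. indicator A x * (z x)^5 * b (Suc n) x)"
      proof (rule L2_bounded_mult[OF L, where C = "(inverse (\<rho>\<^sup>2))^5"])
        show "\<bar>indicator A x * z x ^ 5\<bar> \<le> inverse (\<rho>\<^sup>2) ^ 5" for x
          using z_bd[of x] by (cases "x \<in> A") (auto simp del: power_inverse intro!: power_mono)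
      qed simp
      have i: "integrable lborel (\<lambda>x. (z x)^5 * (exp (\<tau> * z x))\<^sup>2 * (b (Suc n) x)\<^sup>2)"
      proof -
        have e: "(z x)^5 * (exp (\<tau> * z x))\<^sup>2 * (b (Suc n) x)\<^sup>2 = (w x * (indicator A x * (z x)^5 * b (Suc n) x)) * b (Suc n) x" for x
          using supp[of x "Suc n"] by (cases "x \<in> A") (auto simp: w_def A_def power2_eq_square dist_commute)
        have "L2 lborel (\<lambda>x. w x * (indicator A x * (z x)^5 * b (Suc n) x))"
          by (rule L2_bounded_mult[OF zL _ wW]) simp
        then show ?thesis unfolding e by (rule L2_mult_integrable) (rule L)
      qed
      have "z0^5 * I (Suc n) = (\<integral>x. z0^5 * (w x * (b (Suc n) x)\<^sup>2) \<partial>lborel)" by (simp add: I_def)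
      also have "\<dots> \<le> (\<integral>x. (z x)^5 * (exp (\<tau> * z x))\<^sup>2 * (b (Suc n) x)\<^sup>2 \<partial>lborel)"
      proof (rule integral_mono)
        show "integrable lborel (\<lambda>x. z0 ^ 5 * (w x * (b (Suc n) x)\<^sup>2))" by (intro integrable_mult_right wi L)
        fix x
        show "z0^5 * (w x * (b (Suc n) x)\<^sup>2) \<le> (z x)^5 * (exp (\<tau> * z x))\<^sup>2 * (b (Suc n) x)\<^sup>2"
        proof (cases "dist x y0 < \<rho> \<or> dist x y0 > R")
          case True then show ?thesis using supp[OF True] by simp
        next
          case False
          have "(x - y0) \<bullet> (x - y0) = (dist x y0)\<^sup>2" by (simp add: dist_norm power2_norm_eq_inner)
          moreover have "(dist x y0)\<^sup>2 \<le> R\<^sup>2" "0 < (dist x y0)\<^sup>2" using False \<rho> by (auto intro!: power_mono)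
          ultimately have "z0 \<le> z x" unfolding z0_def z_def by (intro le_imp_inverse_le) auto
          then have "z0^5 * ((exp (\<tau> * z x))\<^sup>2 * (b (Suc n) x)\<^sup>2) \<le> (z x)^5 * ((exp (\<tau> * z x))\<^sup>2 * (b (Suc n) x)\<^sup>2)"
            using z0 by (intro mult_right_mono power_mono) auto
          then show ?thesis unfolding wfb by (simp only: mult.assoc)
        qed
      qed (rule i)
      finally show ?thesis .
    qed
    moreover have "(\<integral>x. (exp (\<tau> * z x))\<^sup>2 * (h x)\<^sup>2 \<partial>lborel) \<le> 2 * Q\<^sup>2 * \<Lambda>\<^sup>2 * I (Suc n) + 2 * Q\<^sup>2 * I n"
    proof -
      have "(\<integral>x. (exp (\<tau> * z x))\<^sup>2 * (h x)\<^sup>2 \<partial>lborel) = (\<integral>x. w x * (h x)\<^sup>2 \<partial>lborel)"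
      proof (rule Bochner_Integration.integral_cong[OF refl], rule sym, rule wf)
        show "h x = 0" if "dist x y0 < \<rho> \<or> dist x y0 > R" for x by (rule hs[OF that])
      qed
      also have "\<dots> \<le> (\<integral>x. 2 * Q\<^sup>2 * \<Lambda>\<^sup>2 * (w x * (b (Suc n) x)\<^sup>2) + 2 * Q\<^sup>2 * (w x * (b n x)\<^sup>2) \<partial>lborel)"
      proof (rule integral_mono)
        show "integrable lborel (\<lambda>x. 2 * Q\<^sup>2 * \<Lambda>\<^sup>2 * (w x * (b (Suc n) x)\<^sup>2) + 2 * Q\<^sup>2 * (w x * (b n x)\<^sup>2))"
          by (intro Bochner_Integration.integrable_add integrable_mult_right wi L)
        fix x
        have qq: "(q x)\<^sup>2 \<le> Q\<^sup>2" using power_mono[OF q(2)[of x], of 2] by simp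
        have ll: "(l (Suc n))\<^sup>2 \<le> \<Lambda>\<^sup>2" using power_mono[OF l[of "Suc n"], of 2] by simp
        have "(s + t)\<^sup>2 \<le> 2 * s\<^sup>2 + 2 * t\<^sup>2" for s t :: real
          using zero_le_power2[of "s - t"] by (simp add: power2_sum power2_diff)
        then have "(l (Suc n) * b (Suc n) x + b n x)\<^sup>2 \<le> 2 * ((l (Suc n))\<^sup>2 * (b (Suc n) x)\<^sup>2) + 2 * (b n x)\<^sup>2"
          by (simp add: power_mult_distrib[symmetric])
        also have "\<dots> \<le> 2 * (\<Lambda>\<^sup>2 * (b (Suc n) x)\<^sup>2) + 2 * (b n x)\<^sup>2"
          using ll by (intro add_right_mono mult_left_mono mult_right_mono) auto
        finally have "(q x)\<^sup>2 * (l (Suc n) * b (Suc n) x + b n x)\<^sup>2 \<le> Q\<^sup>2 * (2 * (\<Lambda>\<^sup>2 * (b (Suc n) x)\<^sup>2) + 2 * (b n x)\<^sup>2)"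
          using qq by (intro mult_mono) auto
        then have "w x * (h x)\<^sup>2 \<le> w x * (Q\<^sup>2 * (2 * (\<Lambda>\<^sup>2 * (b (Suc n) x)\<^sup>2) + 2 * (b n x)\<^sup>2))"
          unfolding h_def using w0[of x] by (intro mult_left_mono) (auto simp: power_mult_distrib)
        then show "w x * (h x)\<^sup>2 \<le> 2 * Q\<^sup>2 * \<Lambda>\<^sup>2 * (w x * (b (Suc n) x)\<^sup>2) + 2 * Q\<^sup>2 * (w x * (b n x)\<^sup>2)"
          by (simp add: algebra_simps)
      qed (rule wi[OF hL])
      also have "\<dots> = 2 * Q\<^sup>2 * \<Lambda>\<^sup>2 * I (Suc n) + 2 * Q\<^sup>2 * I n"
        unfolding I_def by (subst Bochner_Integration.integral_add) (auto intro!: integrable_mult_right wi L)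
      finally show ?thesis .
    qed
    ultimately have "64 * \<tau>^3 * z0^5 * I (Suc n) \<le> 2 * Q\<^sup>2 * \<Lambda>\<^sup>2 * I (Suc n) + 2 * Q\<^sup>2 * I n"
      using C mult_left_mono[of "z0^5 * I (Suc n)" _ "64 * \<tau>^3"] \<tau> by (smt (verit) mult.assoc zero_le_power)
    moreover have "(2 * Q\<^sup>2 / \<delta> + 2 * Q\<^sup>2 * \<Lambda>\<^sup>2) * I (Suc n) \<le> 64 * \<tau>^3 * z0^5 * I (Suc n)"
      using \<tau>3 I0 by (intro mult_right_mono) auto
    ultimately have *: "2 * Q\<^sup>2 / \<delta> * I (Suc n) \<le> 2 * Q\<^sup>2 * I n" by (simp add: distrib_right)
    show ?thesis
    \<comment> \<open>Cancelling \<open>Q\<^sup>2\<close> is impossible if \<open>Q = 0\<close>;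
      then the right-hand side of the estimate is 0 and the norm at \<open>Suc n\<close>
      vanishes.\<close>
    proof (cases "Q = 0")
      case False
      then show ?thesis using * \<delta> by (simp add: field_simps)
    next
      case True
      then have "64 * \<tau>^3 * z0^5 * I (Suc n) \<le> 0"
        using \<open>64 * \<tau>^3 * z0^5 * I (Suc n) \<le> 2 * Q\<^sup>2 * \<Lambda>\<^sup>2 * I (Suc n) + 2 * Q\<^sup>2 * I n\<close> by simp
      then have "I (Suc n) \<le> 0" using z0 \<tau> by (simp add: mult_le_0_iff)
      moreover have "0 \<le> \<delta> * I n" using \<delta> I0 by simp
      ultimately show ?thesis by linarith
    qed
  qed
  have In: "I n \<le> I 0 * \<delta>^n" for n
  proof (induction n)
    case (Suc n)
    have "I (Suc n) \<le> \<delta> * I n" by (rule step)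
    also have "\<dots> \<le> \<delta> * (I 0 * \<delta>^n)" using Suc \<delta> by (intro mult_left_mono) auto
    finally show ?case by (simp add: mult_ac)
  qed simp
  \<comment> \<open>The exponential weight is at least 1, so the unweighted norms inherit the
    decay.\<close>
  have "(\<integral>x. (b n x)\<^sup>2 \<partial>lborel) \<le> I n" for n
    unfolding I_def
  proof (rule integral_mono[OF L2_square_integrable[OF L] wi[OF L]])
    fix x
    have "1 \<le> (exp (\<tau> * z x))\<^sup>2" using z_bd(1)[of x] \<tau> by (intro one_le_power) simp
    then have "1 * (b n x)\<^sup>2 \<le> (exp (\<tau> * z x))\<^sup>2 * (b n x)\<^sup>2" by (intro mult_right_mono) auto
    then show "(b n x)\<^sup>2 \<le> w x * (b n x)\<^sup>2" unfolding wfb by simp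
  qed
  then show ?thesis using In by (intro exI[of _ "I 0"]) (auto intro: order.trans)
qed

text \<open>\<open>divdiff l v n j\<close> is Newton's divided difference of the family at the nodes
  \<open>l 0, ..., l (n - 1), l j\<close>, so the diagonal value for \<open>j = n\<close> uses the
  nodes \<open>l 0, ..., l n\<close>. Leaving the last node free allows a recursion on
  \<open>n\<close> alone.\<close>

fun divdiff :: "(nat \<Rightarrow> real) \<Rightarrow> (nat \<Rightarrow> 'a \<Rightarrow> real) \<Rightarrow> nat \<Rightarrow> nat \<Rightarrow> 'a \<Rightarrow> real" where
  "divdiff l v 0 j x = v j x"
| "divdiff l v (Suc n) j x = inverse (l j - l n) * (divdiff l v n j x - divdiff l v n n x)"

text \<open>Divided differences \<open>b n\<close> of the family in the spectral parameter satisfy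
  \<open>(\<Delta> + l n q) (b n) = - q (b (n - 1))\<close>. Symmetry of the Laplacian makes their weighted norms almost
  log-convex, while the Carleman estimate makes them decay faster than any geometric sequence.\<close>
lemma nonradiating_family_zero:
  fixes y0 :: "real^3" and v :: "nat \<Rightarrow> real^3 \<Rightarrow> real"
  assumes L: "\<And>n. L2 lborel (v n)" and supp: "\<And>n x. dist x y0 < \<rho> \<or> dist x y0 > R \<Longrightarrow> v n x = 0"
    and q: "q \<in> borel_measurable borel" "\<And>x. q0 \<le> q x" "\<And>x. q x \<le> Q" "q0 > 0"
    and wl: "\<And>i j. weak_lap e0 (\<lambda>x. v i x - v j x) (\<lambda>x. - q x * (l i * v i x - l j * v j x))" "e0 > 0"
    and \<rho>: "\<rho> > 0" "\<rho> \<le> R" and l: "\<And>n. \<bar>l n\<bar> \<le> \<Lambda>" "inj l" "summable (\<lambda>n. \<bar>l (Suc n) - l n\<bar>)"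
  shows "AE x in lborel. v 0 x = 0"
proof -
  define a where "a = divdiff l v"
  have a0: "a 0 j = v j" for j by (auto simp: a_def)
  have aS: "a (Suc n) j = (\<lambda>x. inverse (l j - l n) * (a n j x - a n n x))" for n j by (auto simp: a_def)
  have aL: "L2 lborel (a n j)" for n j
    by (induction n arbitrary: j) (auto simp: a0 aS intro!: L L2_cmult L2_diff)
  have asupp: "dist x y0 < \<rho> \<or> dist x y0 > R \<Longrightarrow> a n j x = 0" for n j x
    by (induction n arbitrary: j) (use supp in \<open>auto simp: a0 aS\<close>)
  have qb: "\<bar>q x\<bar> \<le> Q" for x using q(2)[of x] q(3)[of x] q(4) by linarith
  note [measurable] = q(1)
  have qL: "L2 lborel (\<lambda>x. - q x * f x)" if "L2 lborel f" for f
    by (rule L2_bounded_mult[OF that, where C = Q]) (use qb in auto)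
  then have qL': "L2 lborel (\<lambda>x. - (q x * f x))" if "L2 lborel f" for f using that by fastforce
  \<comment> \<open>Leibniz rule for divided differences of \<open>l\<close> times the family: as
    \<open>l\<close> is linear in the node, only the top difference times \<open>l j\<close> and one
    difference of lower order survive. The base case is the hypothesis on \<open>v i - v j\<close>,
    in which the double layer has cancelled.\<close>
  have wla: "weak_lap e0 (a (Suc n) j) (\<lambda>x. - q x * (l j * a (Suc n) j x + a n n x))" if "j > n" for n j
    using that
  proof (induction n arbitrary: j)
    case 0
    then have d: "l j - l 0 \<noteq> 0" using injD[OF l(2), of j 0] by auto
    have F1: "weak_lap e0 (\<lambda>x. inverse (l j - l 0) * ((v j x - v 0 x) - 0))
       (\<lambda>x. inverse (l j - l 0) * ((- q x * (l j * v j x - l 0 * v 0 x)) - 0))"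
      by (rule weak_lap_lincomb[OF wl(1)]) (auto simp: weak_lap_def conv_def intro!: L L2_diff L2_cmult qL')
    have F2: "inverse (l j - l 0) * ((- q x * (l j * v j x - l 0 * v 0 x)) - 0) = - q x * (l j * a (Suc 0) j x + a 0 0 x)" for x
      using d by (simp add: aS a0 field_simps)
    show ?case using F1[unfolded F2] by (simp only: aS a0 diff_0_right)
  next
    case (Suc n)
    then have d: "l j - l (Suc n) \<noteq> 0" using injD[OF l(2), of j "Suc n"] by auto
    have "weak_lap e0 (\<lambda>x. inverse (l j - l (Suc n)) * (a (Suc n) j x - a (Suc n) (Suc n) x))
       (\<lambda>x. inverse (l j - l (Suc n)) * (- q x * (l j * a (Suc n) j x + a n n x) - - q x * (l (Suc n) * a (Suc n) (Suc n) x + a n n x)))"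
      by (rule weak_lap_lincomb[OF Suc.IH Suc.IH]) (use Suc.prems in \<open>auto intro!: aL L2_add L2_cmult qL'\<close>)
    moreover have "inverse (l j - l (Suc n)) * (- q x * (l j * a (Suc n) j x + a n n x) - - q x * (l (Suc n) * a (Suc n) (Suc n) x + a n n x))
      = - q x * (l j * a (Suc (Suc n)) j x + a (Suc n) (Suc n) x)" for x
      using d by (simp add: aS[of "Suc n"] field_simps)
    ultimately show ?case by (simp only: aS[of "Suc n"])
  qed
  define b where "b = (\<lambda>n. a n n)"
  have bL: "L2 lborel (b n)" for n by (simp add: b_def aL)
  have bm[measurable]: "b n \<in> borel_measurable borel" for n using L2_measurable[OF bL[of n]] by simp
  have bsupp: "dist x y0 < \<rho> \<or> dist x y0 > R \<Longrightarrow> b n x = 0" for n x by (simp add: b_def asupp)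
  have wlb: "weak_lap e0 (b (Suc n)) (\<lambda>x. - q x * (l (Suc n) * b (Suc n) x + b n x))" for n
    unfolding b_def by (rule wla) simp
  \<comment> \<open>With the factor \<open>sqrt q\<close> the pairing weighted by \<open>q\<close>
    becomes an ordinary L2 pairing, and Cauchy-Schwarz applies to it.\<close>
  define sb where "sb = (\<lambda>n x. sqrt (q x) * b n x)"
  have q0': "0 \<le> q x" for x using q(2)[of x] q(4) by linarith
  have sbL: "L2 lborel (sb n)" for n unfolding sb_def
    by (rule L2_bounded_mult[OF bL, where C = "sqrt Q"]) (use q(3) q0' in auto)
  define \<alpha> where "\<alpha> = (\<lambda>n. sqrt (\<integral>x. (sb n x)\<^sup>2 \<partial>lborel))"
  have sb2: "(sb n x)\<^sup>2 = q x * (b n x)\<^sup>2" for n x by (simp add: sb_def power_mult_distrib q0')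
  have sbm: "sb n x * sb m x = q x * (b n x * b m x)" for n m x
    using q0'[of x] by (simp add: sb_def mult_ac flip: real_sqrt_mult)
  have CS: "\<bar>\<integral>x. q x * (b n x * b m x) \<partial>lborel\<bar> \<le> \<alpha> n * \<alpha> m" for n m
    using L2_Cauchy_Schwarz_abs[OF sbL[of n] sbL[of m]] by (simp add: \<alpha>_def sbm)
  have ii: "integrable lborel (\<lambda>x. q x * (b n x * b m x))" for n m
    using L2_mult_integrable[OF sbL[of n] sbL[of m]] by (simp add: sbm)
  \<comment> \<open>Index 1 and not 0, since \<open>b 0 = v 0\<close> satisfies no equation of its
    own. It is recovered at the end: once \<open>b 1\<close> vanishes, its equation reduces to
    \<open>q * b 0 = 0\<close>.\<close>
  have "\<alpha> 1 = 0"
  proof (rule log_convex_decay_zero[where \<eta> = "\<lambda>n. \<bar>l (Suc (Suc n)) - l (Suc n)\<bar>"])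
    show "summable (\<lambda>n. \<bar>l (Suc (Suc n)) - l (Suc n)\<bar>)" using l(3) by (subst summable_Suc_iff)
    show "\<alpha> n \<ge> 0" for n by (simp add: \<alpha>_def)
    show "(\<alpha> (Suc n))\<^sup>2 \<le> \<alpha> (Suc (Suc n)) * (\<alpha> n + \<bar>l (Suc (Suc n)) - l (Suc n)\<bar> * \<alpha> (Suc n))" for n
    proof -
      let ?m = "Suc n" and ?p = "Suc (Suc n)"
      \<comment> \<open>Two consecutive equations are each paired with the solution of the other.
        Symmetry equates the results, so the mixed term survives only with the factor
        \<open>l ?p - l ?m\<close>, and the remaining terms compare
        \<open>(\<alpha> ?m)\<^sup>2\<close> with the pairing of \<open>b ?p\<close> and
        \<open>b n\<close>.\<close>
      have "(\<integral>x. b ?p x * (- q x * (l ?m * b ?m x + b n x)) \<partial>lborel) = (\<integral>x. b ?m x * (- q x * (l ?p * b ?p x + b ?m x)) \<partial>lborel)"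
        by (rule weak_lap_symmetric[OF wlb[of ?m] bL _ _ _ wlb[of n] bL _ _ _ bounded_cball[of y0 R] wl(2)])
           (use bsupp in \<open>auto intro!: qL' L2_add L2_cmult bL simp: dist_commute\<close>)
      moreover have "(\<integral>x. b ?p x * (- q x * (l ?m * b ?m x + b n x)) \<partial>lborel)
         = - (l ?m) * (\<integral>x. q x * (b ?p x * b ?m x) \<partial>lborel) - (\<integral>x. q x * (b ?p x * b n x) \<partial>lborel)"
      proof -
        have "(\<integral>x. b ?p x * (- q x * (l ?m * b ?m x + b n x)) \<partial>lborel) = (\<integral>x. (- (l ?m)) * (q x * (b ?p x * b ?m x)) - q x * (b ?p x * b n x) \<partial>lborel)"
          by (rule Bochner_Integration.integral_cong) (auto simp: algebra_simps)
        then show ?thesis using ii by simp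
      qed
      moreover have "(\<integral>x. b ?m x * (- q x * (l ?p * b ?p x + b ?m x)) \<partial>lborel)
         = - (l ?p) * (\<integral>x. q x * (b ?p x * b ?m x) \<partial>lborel) - (\<integral>x. q x * (b ?m x * b ?m x) \<partial>lborel)"
      proof -
        have "(\<integral>x. b ?m x * (- q x * (l ?p * b ?p x + b ?m x)) \<partial>lborel) = (\<integral>x. (- (l ?p)) * (q x * (b ?p x * b ?m x)) - q x * (b ?m x * b ?m x) \<partial>lborel)"
          by (rule Bochner_Integration.integral_cong) (auto simp: algebra_simps)
        then show ?thesis using ii by simp
      qed
      ultimately have eq: "(\<integral>x. q x * (b ?m x * b ?m x) \<partial>lborel) = (\<integral>x. q x * (b ?p x * b n x) \<partial>lborel)
          - (l ?p - l ?m) * (\<integral>x. q x * (b ?p x * b ?m x) \<partial>lborel)"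
        by (simp add: left_diff_distrib)
      have "(\<alpha> ?m)\<^sup>2 = (\<integral>x. q x * (b ?m x * b ?m x) \<partial>lborel)"
        by (simp add: \<alpha>_def sb2 q0' power2_eq_square[of "b ?m x" for x])
      also have "\<dots> \<le> \<bar>\<integral>x. q x * (b ?p x * b n x) \<partial>lborel\<bar> + \<bar>l ?p - l ?m\<bar> * \<bar>\<integral>x. q x * (b ?p x * b ?m x) \<partial>lborel\<bar>"
        unfolding eq abs_mult[symmetric] by linarith
      also have "\<dots> \<le> \<alpha> ?p * \<alpha> n + \<bar>l ?p - l ?m\<bar> * (\<alpha> ?p * \<alpha> ?m)"
        by (intro add_mono mult_left_mono CS) auto
      finally show ?thesis by (simp add: algebra_simps)
    qed
    fix \<delta> :: real assume \<delta>: "\<delta> > 0"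
    \<comment> \<open>The rate is \<open>\<delta>\<^sup>2\<close> because \<open>\<alpha>\<close> is
      the square root of an integral.\<close>
    have "\<exists>C. \<forall>n. (\<integral>x. (b n x)\<^sup>2 \<partial>lborel) \<le> C * (\<delta>\<^sup>2)^n"
      by (rule carleman_contraction[where b = b and l = l and q = q, OF bL bsupp q(1) qb wlb wl(2) \<rho> l(1)]) (use \<delta> in auto)
    then obtain C where C: "\<And>n. (\<integral>x. (b n x)\<^sup>2 \<partial>lborel) \<le> C * (\<delta>\<^sup>2)^n" by blast
    have Q0: "Q \<ge> 0" using qb[of 0] by linarith
    have "\<alpha> n \<le> sqrt (Q * C) * \<delta>^n" for n
    proof -
      have "(\<integral>x. (sb n x)\<^sup>2 \<partial>lborel) \<le> (\<integral>x. Q * (b n x)\<^sup>2 \<partial>lborel)"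
        by (rule integral_mono[OF L2_square_integrable[OF sbL]])
           (use L2_square_integrable[OF bL] q(3) in \<open>auto simp: sb2 intro!: mult_right_mono\<close>)
      also have "\<dots> \<le> Q * (C * (\<delta>\<^sup>2)^n)" using C Q0 by (simp add: mult_left_mono)
      finally have "\<alpha> n \<le> sqrt (Q * (C * (\<delta>\<^sup>2)^n))" unfolding \<alpha>_def by simp
      also have "Q * (C * (\<delta>\<^sup>2)^n) = (Q * C) * (\<delta>^n)\<^sup>2" by (simp add: power_mult[symmetric] mult.commute[of 2])
      finally show ?thesis using \<delta> by (simp add: real_sqrt_mult)
    qed
    then show "\<exists>C. \<forall>n. \<alpha> n \<le> C * \<delta>^n" by blast
  qed auto
  then have "(\<integral>x. (sb 1 x)\<^sup>2 \<partial>lborel) = 0" by (simp add: \<alpha>_def)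
  then have "AE x in lborel. (sb 1 x)\<^sup>2 = 0"
    using integral_nonneg_eq_0_iff_AE[OF L2_square_integrable[OF sbL[of 1]]] by simp
  then have b1: "AE x in lborel. b (Suc 0) x = 0"
  proof eventually_elim
    case (elim x)
    then show ?case using q(2)[of x] q(4) by (auto simp: sb2)
  qed
  have "AE x in lborel. - q x * (l (Suc 0) * b (Suc 0) x + b 0 x) = 0"
    by (rule weak_lap_zero_AE[OF wlb b1 _ wl(2)]) (auto intro!: qL' L2_add L2_cmult bL)
  with b1 show ?thesis
  proof eventually_elim
    case (elim x)
    then show ?case using q(2)[of x] q(4) by (auto simp: b_def a0)
  qed
qed

section \<open>Unique continuation\<close>

lemma test_fnD:
  assumes "test_fn f G"
  shows "continuous_on UNIV G" "\<And>x. (f has_derivative (\<lambda>h. G x \<bullet> h)) (at x)" "compact (tsupp f)"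
    "continuous_on UNIV f" "\<And>x. x \<notin> tsupp f \<Longrightarrow> f x = 0" "\<And>x. x \<notin> tsupp f \<Longrightarrow> G x = 0" "bounded (tsupp f)"
proof -
  show "continuous_on UNIV G" and d: "\<And>x. (f has_derivative (\<lambda>h. G x \<bullet> h)) (at x)" and c: "compact (tsupp f)"
    using assms by (auto simp: test_fn_def)
  show "bounded (tsupp f)" using c by (rule compact_imp_bounded)
  show "continuous_on UNIV f"
    by (intro continuous_at_imp_continuous_on ballI has_derivative_continuous[OF d])
  show z: "f x = 0" if "x \<notin> tsupp f" for x using that closure_subset[of "{x. f x \<noteq> 0}"] by (auto simp: tsupp_def)
  show "G x = 0" if "x \<notin> tsupp f" for x
  proof -
    have "open (- tsupp f)" by (simp add: tsupp_def open_Compl)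
    then have "((\<lambda>y. 0) has_derivative (\<lambda>h. G x \<bullet> h)) (at x)"
      by (rule has_derivative_transform_within_open[OF d]) (use that z in auto)
    moreover have "((\<lambda>y. 0::real) has_derivative (\<lambda>h. 0)) (at x)" by simp
    ultimately have "(\<lambda>h. G x \<bullet> h) = (\<lambda>h. 0)" by (rule has_derivative_unique)
    then have "G x \<bullet> G x = 0" by meson
    then show ?thesis by simp
  qed
qed

lemma closed_tsupp: "closed (tsupp f)" by (simp add: tsupp_def)

section \<open>Algebra of test functions, local square-integrability and the fundamental
  lemma\<close>

lemma test_fn_mult:
  assumes "test_fn a da" "\<And>x. (b has_derivative (\<lambda>h. db x \<bullet> h)) (at x)" "continuous_on UNIV db"
  shows "test_fn (\<lambda>x. a x * b x) (\<lambda>x. a x *\<^sub>R db x + b x *\<^sub>R da x)"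
    "tsupp (\<lambda>x. a x * b x) \<subseteq> tsupp a"
proof -
  note A = test_fnD[OF assms(1)]
  have cb: "continuous_on UNIV b"
    by (intro continuous_at_imp_continuous_on ballI has_derivative_continuous[OF assms(2)])
  show "tsupp (\<lambda>x. a x * b x) \<subseteq> tsupp a"
    by (rule tsupp_subset[OF _ closed_tsupp]) (simp add: A(5))
  show "test_fn (\<lambda>x. a x * b x) (\<lambda>x. a x *\<^sub>R db x + b x *\<^sub>R da x)"
  proof (rule test_fnI[where S = "tsupp a"])
    show "continuous_on UNIV (\<lambda>x. a x *\<^sub>R db x + b x *\<^sub>R da x)"
      by (intro continuous_intros A assms cb)
    show "((\<lambda>x. a x * b x) has_derivative (\<lambda>h. (a x *\<^sub>R db x + b x *\<^sub>R da x) \<bullet> h)) (at x)" for x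
      by (rule has_derivative_eq_rhs[OF has_derivative_mult[OF A(2) assms(2)]])
         (auto simp: inner_add_left mult_ac)
  qed (use A in auto)
qed

lemma test_fn_cmult:
  assumes "test_fn f G" shows "test_fn (\<lambda>x. c * f x) (\<lambda>x. c *\<^sub>R G x)"
proof -
  note A = test_fnD[OF assms]
  show ?thesis
  proof (rule test_fnI[OF _ _ _ A(3)])
    show "((\<lambda>x. c * f x) has_derivative (\<lambda>h. c *\<^sub>R G x \<bullet> h)) (at x)" for x
      by (rule has_derivative_eq_rhs[OF has_derivative_mult_right[OF A(2)]]) auto
  qed (use A in \<open>auto intro!: continuous_intros\<close>)
qed

lemma test_fn_sum:
  assumes "finite I" "\<And>i. i \<in> I \<Longrightarrow> test_fn (f i) (G i)"
  shows "test_fn (\<lambda>x. \<Sum>i\<in>I. f i x) (\<lambda>x. \<Sum>i\<in>I. G i x)"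
proof (rule test_fnI[where S = "\<Union>i\<in>I. tsupp (f i)"])
  show "continuous_on UNIV (\<lambda>x. \<Sum>i\<in>I. G i x)"
    using assms by (intro continuous_intros) (auto dest: test_fnD)
  show "((\<lambda>x. \<Sum>i\<in>I. f i x) has_derivative (\<lambda>h. (\<Sum>i\<in>I. G i x) \<bullet> h)) (at x)" for x
    unfolding inner_sum_left using assms by (intro has_derivative_sum test_fnD(2)) auto
  show "(\<Sum>i\<in>I. f i x) = 0" if "x \<notin> (\<Union>i\<in>I. tsupp (f i))" for x
    using that assms test_fnD(5) by (intro sum.neutral) blast
  show "compact (\<Union>i\<in>I. tsupp (f i))"
    using assms by (intro compact_UN) (auto dest: test_fnD)
qed

definition locL2 :: "(real^3 \<Rightarrow> real) \<Rightarrow> bool" where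
  "locL2 f \<longleftrightarrow> f \<in> borel_measurable borel \<and> (\<forall>R. L2 lborel (\<lambda>x. indicator (cball 0 R) x * f x))"

lemma locL2_measurable [measurable_dest]: "locL2 f \<Longrightarrow> f \<in> borel_measurable borel"
  by (simp add: locL2_def)

lemma locL2_diff: "locL2 f \<Longrightarrow> locL2 g \<Longrightarrow> locL2 (\<lambda>x. f x - g x)"
  by (auto simp: locL2_def right_diff_distrib intro!: L2_diff)

lemma locL2_bounded_support:
  assumes "locL2 f" "A \<in> sets borel" "bounded A" "b \<in> borel_measurable borel" "\<And>x. x \<in> A \<Longrightarrow> \<bar>b x\<bar> \<le> C" "C \<ge> 0"
  shows "L2 lborel (\<lambda>x. indicator A x * (b x * f x))"
proof -
  obtain R where R: "A \<subseteq> cball (0::real^3) R" using assms(3) by (auto simp: bounded_iff subset_eq)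
  note [measurable] = assms(2,4)
  have "L2 lborel (\<lambda>x. (indicator A x * b x) * (indicator (cball 0 R) x * f x))"
    by (rule L2_bounded_mult[where C = C]) (use assms in \<open>auto simp: locL2_def indicator_def\<close>)
  moreover have "(indicator A x * b x) * (indicator (cball 0 R) x * f x) = indicator A x * (b x * f x)" for x
    using R by (auto simp: indicator_def)
  ultimately show ?thesis by simp
qed

lemma locL2_mult_test_integrable:
  assumes "locL2 f" "continuous_on UNIV \<phi>" "\<And>x. x \<notin> S \<Longrightarrow> \<phi> x = 0" "bounded S"
  shows "integrable lborel (\<lambda>x. f x * \<phi> x)"
proof -
  obtain R where R: "S \<subseteq> cball (0::real^3) R" using assms(4) by (auto simp: bounded_iff subset_eq)
  have "integrable lborel (\<lambda>x. (indicator (cball 0 R) x * f x) * \<phi> x)"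
    by (intro L2_mult_integrable continuous_compact_support_L2[OF assms(2-4)]) (use assms in \<open>auto simp: locL2_def\<close>)
  moreover have "(indicator (cball 0 R) x * f x) * \<phi> x = f x * \<phi> x" for x
    using R assms(3)[of x] by (cases "x \<in> S") (auto simp: indicator_def)
  ultimately show ?thesis by simp
qed

text \<open>The passage from locally null to null is a Lindelof argument, contained in
  \<open>locally_negligible_alt\<close>.\<close>

lemma AE_zero_local:
  fixes f :: "real^3 \<Rightarrow> real"
  assumes [measurable]: "f \<in> borel_measurable borel" and "U \<in> sets borel"
    and loc: "\<And>x. x \<in> U \<Longrightarrow> \<exists>r>0. AE y in lborel. y \<in> ball x r \<longrightarrow> f y = 0"
  shows "AE x in lborel. x \<in> U \<longrightarrow> f x = 0"
proof -
  note [measurable] = assms(2)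
  define N where "N = {x \<in> U. f x \<noteq> 0}"
  have N: "N \<in> sets borel" unfolding N_def by measurable
  have "negligible N"
  proof (rule locally_negligible_alt[THEN iffD2], rule ballI)
    fix x assume x: "x \<in> N"
    then obtain r where r: "r > 0" "AE y in lborel. y \<in> ball x r \<longrightarrow> f y = 0" using loc by (auto simp: N_def)
    have "N \<inter> ball x r \<in> null_sets lborel"
      by (rule AE_iff_null_sets[THEN iffD2]) (use N r(2) in \<open>auto simp: N_def\<close>)
    then have "negligible (N \<inter> ball x r)" by (simp add: negligible_iff_null_sets null_sets_completionI)
    then show "\<exists>T. openin (top_of_set N) T \<and> x \<in> T \<and> negligible T"
      using x r(1) by (intro exI[of _ "N \<inter> ball x r"]) auto
  qed
  then have "N \<in> null_sets lborel" using N by (simp add: negligible_iff_null_sets null_sets_completion_iff)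
  then have "AE x in lborel. x \<notin> N" by (rule AE_not_in)
  then show ?thesis by eventually_elim (auto simp: N_def)
qed

text \<open>Translated bumps suffice as test functions. Cutting \<open>f\<close> off outside a ball
  makes it square-integrable, and bumps of less than half the radius, centred in the half ball, do
  not notice the cut.\<close>

lemma fundamental_lemma:
  assumes f: "locL2 f" and U: "open U"
    and z: "\<And>\<phi> d\<phi>. test_fn \<phi> d\<phi> \<Longrightarrow> tsupp \<phi> \<subseteq> U \<Longrightarrow> (\<integral>x. f x * \<phi> x \<partial>lborel) = 0"
  shows "AE x in lborel. x \<in> U \<longrightarrow> f x = 0"
proof (rule AE_zero_local)
  show "f \<in> borel_measurable borel" using f by (rule locL2_measurable)
  fix x assume "x \<in> U"
  then obtain r where r: "r > 0" "ball x r \<subseteq> U" using U by (meson openE)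
  define h where "h = (\<lambda>y. indicator (ball x r) y * (1 * f y))"
  have "AE y in lborel. y \<in> ball x (r / 2) \<longrightarrow> h y = 0"
  proof (rule AE_zero_if_mollified_zero)
    show "L2 lborel h" unfolding h_def by (rule locL2_bounded_support[OF f, where C = 1]) auto
    show "0 < r / 2" using r by simp
    fix e x' assume e: "0 < e" "e < r / 2" "x' \<in> ball x (r / 2)"
    have sub: "cball x' e \<subseteq> ball x r"
    proof
      fix y assume "y \<in> cball x' e"
      then show "y \<in> ball x r" using e dist_triangle[of x y x'] by simp
    qed
    have eq: "h y * bump e (x' - y) = f y * bump e (x' - y)" for y
    proof (cases "y \<in> cball x' e")
      case True
      then show ?thesis using sub by (auto simp: h_def)
    next
      case False
      then have "bump e (x' - y) = 0" using bump_support(1)[OF e(1), of "x' - y"] by (simp add: dist_norm)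
      then show ?thesis by simp
    qed
    have "conv h (bump e) x' = (\<integral>y. f y * bump e (x' - y) \<partial>lborel)" unfolding conv_def eq ..
    also have "\<dots> = 0"
      by (rule z[OF bump_test_fn(1)[OF e(1)]]) (use bump_test_fn(3)[OF e(1), of x'] sub r in blast)
    finally show "conv h (bump e) x' = 0" .
  qed simp
  then have "AE y in lborel. y \<in> ball x (r / 2) \<longrightarrow> f y = 0"
    by eventually_elim (use r in \<open>auto simp: h_def indicator_def\<close>)
  then show "\<exists>r>0. AE y in lborel. y \<in> ball x r \<longrightarrow> f y = 0"
    using r(1) by (intro exI[of _ "r / 2"]) simp
qed (use U in simp)

text \<open>A first-order system: \<open>W\<close> is the weak gradient of \<open>v\<close>, and the
  second identity is the weak form of \<open>\<Delta> v + l q v = 0\<close>. Carrying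
  \<open>W\<close> along makes the product rule for cut-offs available without second derivatives of
  \<open>v\<close>.\<close>

definition weak_helmholtz :: "(real^3) set \<Rightarrow> (real^3 \<Rightarrow> real) \<Rightarrow> real \<Rightarrow> (real^3 \<Rightarrow> real) \<Rightarrow> (3 \<Rightarrow> real^3 \<Rightarrow> real) \<Rightarrow> bool" where
  "weak_helmholtz U q l v W \<longleftrightarrow> (\<forall>\<phi> d\<phi>. test_fn \<phi> d\<phi> \<and> tsupp \<phi> \<subseteq> U \<longrightarrow>
     (\<forall>j. (\<integral>x. v x * d\<phi> x $ j + W j x * \<phi> x \<partial>lborel) = 0) \<and>
     (\<integral>x. (\<Sum>j\<in>UNIV. W j x * d\<phi> x $ j) - l * q x * v x * \<phi> x \<partial>lborel) = 0)"

lemma weak_helmholtz_mono: "weak_helmholtz U q l v W \<Longrightarrow> U' \<subseteq> U \<Longrightarrow> weak_helmholtz U' q l v W"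
  unfolding weak_helmholtz_def by (meson order.trans)

section \<open>Cut-offs and the propagation of zeros\<close>

lemma sum_lessThan_4: "(\<Sum>i<4. f i) = f 0 + f 1 + f 2 + f (3::nat)"
  by (simp add: eval_nat_numeral)

text \<open>A radial cut-off as a third divided difference of truncated cubes: the four nodes \<open>c i\<close> are equally
  spaced, so \<open>\<Sum>i. w i * (c i - s)^3 = 1\<close> identically in \<open>s\<close>.\<close>
lemma radial_cutoff:
  fixes y :: "real^3"
  assumes "0 < R1" "R1 < R2"
  obtains \<zeta> :: "real^3 \<Rightarrow> real" and G :: "real^3 \<Rightarrow> real^3" and H :: "3 \<Rightarrow> real^3 \<Rightarrow> real^3"
  where "test_fn \<zeta> G" "\<And>j. test_fn (\<lambda>x. G x $ j) (H j)" "tsupp \<zeta> \<subseteq> cball y R2" "\<And>j. tsupp (\<lambda>x. G x $ j) \<subseteq> cball y R2"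
    "\<And>x. dist x y \<le> R1 \<Longrightarrow> \<zeta> x = 1" "\<And>x. dist x y \<le> R1 \<Longrightarrow> G x = 0" "\<And>x j. dist x y \<le> R1 \<Longrightarrow> H j x $ j = 0"
proof -
  define d where "d = (R2\<^sup>2 - R1\<^sup>2) / 3"
  have d: "d > 0" using assms power_strict_mono[of R1 R2 2] by (simp add: d_def)
  define e where "e = (\<lambda>i::nat. sqrt (R1\<^sup>2 + real i * d))"
  have e2: "(e i)\<^sup>2 = R1\<^sup>2 + real i * d" for i using d by (simp add: e_def)
  have ep: "e i > 0" for i unfolding e_def using d assms by (simp add: add_pos_nonneg)
  have e3: "e i \<le> R2" if "i < 4" for i
  proof -
    have "real i * d \<le> 3 * d" using that d by (intro mult_right_mono) auto
    then show ?thesis unfolding e_def using assms by (intro real_le_lsqrt) (auto simp: d_def)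
  qed
  \<comment> \<open>The third difference of the cube with step \<open>d\<close> is
    \<open>6 * d^3\<close>, while first and second powers have third difference 0. On the inner ball
    no truncation is active, so the same weights give 1 for \<open>\<zeta>\<close> and 0 for its
    gradient and pure second derivatives.\<close>
  define w where "w = (\<lambda>i::nat. (if i = 0 then -1 else if i = 1 then 3 else if i = 2 then -3 else 1) / (6 * d^3))"
  define \<zeta> where "\<zeta> = (\<lambda>x. \<Sum>i<4. w i * bump (e i) (y - x))"
  define G where "G = (\<lambda>x. \<Sum>i<4. w i *\<^sub>R - bump_grad (e i) (y - x))"
  define H where "H = (\<lambda>j x. \<Sum>i<4. (- w i) *\<^sub>R - bump_hess (e i) j (y - x))"
  have t1: "test_fn \<zeta> G" unfolding \<zeta>_def G_def
    by (intro test_fn_sum test_fn_cmult bump_test_fn ep) auto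
  have Gj: "(\<lambda>x. G x $ j) = (\<lambda>x. \<Sum>i<4. (- w i) * bump_grad (e i) (y - x) $ j)" for j
    by (simp add: G_def)
  have t2: "test_fn (\<lambda>x. G x $ j) (H j)" for j unfolding Gj unfolding H_def
    by (intro test_fn_sum test_fn_cmult bump_test_fn ep) auto
  have far: "bump (e i) (y - x) = 0" "bump_grad (e i) (y - x) = 0" if "i < 4" "x \<notin> cball y R2" for i x
    using bump_support[OF ep[of i], of "y - x"] e3[OF that(1)] that(2) by (auto simp: dist_norm)
  have t3: "tsupp \<zeta> \<subseteq> cball y R2" "tsupp (\<lambda>x. G x $ j) \<subseteq> cball y R2" for j
    by (rule tsupp_subset; use far in \<open>auto simp: \<zeta>_def G_def\<close>)+
  have m: "max 0 ((e i)\<^sup>2 - (y - x) \<bullet> (y - x)) = R1\<^sup>2 + real i * d - (y - x) \<bullet> (y - x)" if "dist x y \<le> R1" for x i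
  proof -
    have "(y - x) \<bullet> (y - x) \<le> R1\<^sup>2"
      using power_mono[OF that, of 2] by (simp add: dist_norm power2_norm_eq_inner[symmetric] norm_minus_commute)
    moreover have "0 \<le> real i * d" using d by simp
    ultimately show ?thesis unfolding e2 by simp
  qed
  have i1: "\<zeta> x = 1" if "dist x y \<le> R1" for x
    unfolding \<zeta>_def bump_def m[OF that] sum_lessThan_4 w_def using d
    by (simp add: field_simps) algebra
  have i2: "G x = 0" if "dist x y \<le> R1" for x
  proof -
    have "G x = (6 * (w 0 * (R1\<^sup>2 + real 0 * d - (y - x) \<bullet> (y - x))\<^sup>2 + w 1 * (R1\<^sup>2 + real 1 * d - (y - x) \<bullet> (y - x))\<^sup>2
       + w 2 * (R1\<^sup>2 + real 2 * d - (y - x) \<bullet> (y - x))\<^sup>2 + w 3 * (R1\<^sup>2 + real 3 * d - (y - x) \<bullet> (y - x))\<^sup>2)) *\<^sub>R (y - x)"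
      unfolding G_def bump_grad_def m[OF that] sum_lessThan_4 by (simp add: scaleR_add_left distrib_left mult.left_commute)
    also have "w 0 * (R1\<^sup>2 + real 0 * d - (y - x) \<bullet> (y - x))\<^sup>2 + w 1 * (R1\<^sup>2 + real 1 * d - (y - x) \<bullet> (y - x))\<^sup>2
       + w 2 * (R1\<^sup>2 + real 2 * d - (y - x) \<bullet> (y - x))\<^sup>2 + w 3 * (R1\<^sup>2 + real 3 * d - (y - x) \<bullet> (y - x))\<^sup>2 = 0"
      unfolding w_def using d by (simp add: field_simps) algebra
    finally show ?thesis by simp
  qed
  have i3: "H j x $ j = 0" if "dist x y \<le> R1" for x j
    unfolding H_def bump_hess_def m[OF that] sum_lessThan_4 w_def using d
    by (simp add: axis_def field_simps) algebra
  show thesis by (rule that[OF t1 t2 t3 i1 i2 i3])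
qed

text \<open>The rule \<open>\<Delta> (\<zeta> v) = \<zeta> \<Delta> v + 2 grad \<zeta> . grad v + v
  \<Delta> \<zeta>\<close> in weak form. With \<open>\<psi>\<close> the bump, the products tested
  are \<open>\<zeta> \<psi>\<close> in the equation, and \<open>\<zeta>\<close> times a derivative
  of \<open>\<psi>\<close> and \<open>\<psi>\<close> times a derivative of \<open>\<zeta>\<close> in
  the gradient identity. The mixed integrals \<open>a2\<close>, in which both factors are
  differentiated, occur in the last two and cancel.\<close>

lemma cutoff_weak_lap:
  assumes sol: "weak_helmholtz U q l v W" and v: "locL2 v" and W: "\<And>j. locL2 (W j)"
    and q: "q \<in> borel_measurable borel" "\<And>x. \<bar>q x\<bar> \<le> Q"
    and \<zeta>: "test_fn \<zeta> G" "\<And>j. test_fn (\<lambda>x. G x $ j) (H j)" "tsupp \<zeta> \<subseteq> U" "\<And>j. tsupp (\<lambda>x. G x $ j) \<subseteq> U"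
    and e: "e > 0"
  shows "conv (\<lambda>x. \<zeta> x * v x) (lap_bump e) x
    = conv (\<lambda>x. - l * q x * (\<zeta> x * v x) + (\<Sum>j\<in>UNIV. 2 * (G x $ j) * W j x + H j x $ j * v x)) (bump e) x"
proof -
  define \<psi> P where "\<psi> = (\<lambda>y. bump e (x - y))" and "P = (\<lambda>y. - bump_grad e (x - y))"
  define Hs where "Hs = (\<lambda>j y. bump_hess e j (x - y))"
  note bt = bump_test_fn[OF e, of x]
  have t\<psi>: "test_fn \<psi> P" using bt(1) by (simp add: \<psi>_def P_def)
  note b1 = test_fnD[OF t\<psi>]
  have tP: "test_fn (\<lambda>y. P y $ j) (Hs j)" for j
    using test_fn_cmult[OF bt(2)[of j], of "-1"] by (simp add: P_def Hs_def)
  note b2 = test_fnD[OF tP]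
  note c1 = test_fnD[OF \<zeta>(1)] and c2 = test_fnD[OF \<zeta>(2)]
  have T: "\<And>\<phi> d\<phi> j. test_fn \<phi> d\<phi> \<Longrightarrow> tsupp \<phi> \<subseteq> U \<Longrightarrow> (\<integral>x. v x * d\<phi> x $ j + W j x * \<phi> x \<partial>lborel) = 0"
    and T': "\<And>\<phi> d\<phi>. test_fn \<phi> d\<phi> \<Longrightarrow> tsupp \<phi> \<subseteq> U \<Longrightarrow> (\<integral>x. (\<Sum>j\<in>UNIV. W j x * d\<phi> x $ j) - l * q x * v x * \<phi> x \<partial>lborel) = 0"
    using sol unfolding weak_helmholtz_def by blast+
  have p1: "test_fn (\<lambda>y. \<zeta> y * \<psi> y) (\<lambda>y. \<zeta> y *\<^sub>R P y + \<psi> y *\<^sub>R G y)" "tsupp (\<lambda>y. \<zeta> y * \<psi> y) \<subseteq> U"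
    using test_fn_mult[OF \<zeta>(1) b1(2,1)] \<zeta>(3) by auto
  have p2: "test_fn (\<lambda>y. \<zeta> y * P y $ j) (\<lambda>y. \<zeta> y *\<^sub>R Hs j y + (P y $ j) *\<^sub>R G y)" "tsupp (\<lambda>y. \<zeta> y * P y $ j) \<subseteq> U" for j
    using test_fn_mult[OF \<zeta>(1) b2(2,1)] \<zeta>(3) by auto
  have p3: "test_fn (\<lambda>y. G y $ j * \<psi> y) (\<lambda>y. (G y $ j) *\<^sub>R P y + \<psi> y *\<^sub>R H j y)" "tsupp (\<lambda>y. G y $ j * \<psi> y) \<subseteq> U" for j
    using test_fn_mult[OF \<zeta>(2)[of j] b1(2,1)] \<zeta>(4)[of j] by auto
  have cP: "continuous_on UNIV (\<lambda>y. P y $ j)" "continuous_on UNIV (\<lambda>y. G y $ j)" for j by (rule b2(4) c2(4))+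
  have cH: "continuous_on UNIV (\<lambda>y. Hs j y $ i)" "continuous_on UNIV (\<lambda>y. H j y $ i)" for i j
    by (intro continuous_intros b2(1) c2(1))+
  have z: "\<psi> y = 0" "P y $ j = 0" "Hs j y $ i = 0" if "y \<notin> cball x e" for y i j
  proof -
    have "x - y \<notin> cball 0 e" using that unfolding mem_cball_0 by (simp add: dist_norm)
    from bump_support'[OF e this] show "\<psi> y = 0" "P y $ j = 0" "Hs j y $ i = 0" by (auto simp: \<psi>_def P_def Hs_def)
  qed
  have qv: "locL2 (\<lambda>y. q y * v y)"
    unfolding locL2_def
  proof (intro conjI allI)
    show "(\<lambda>y. q y * v y) \<in> borel_measurable borel" using q(1) locL2_measurable[OF v] by measurable
    show "L2 lborel (\<lambda>y. indicator (cball 0 R) y * (q y * v y))" for R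
      by (rule locL2_bounded_support[OF v _ _ q(1), where C = Q]) (use q(2) order.trans[OF abs_ge_zero q(2)] in auto)
  qed
  note int = locL2_mult_test_integrable[where S = "cball x e"]
  have i: "integrable lborel (\<lambda>y. v y * (\<zeta> y * Hs j y $ i))" "integrable lborel (\<lambda>y. v y * (P y $ j * G y $ i))"
     "integrable lborel (\<lambda>y. W i y * (\<zeta> y * P y $ j))" "integrable lborel (\<lambda>y. v y * (\<psi> y * H j y $ i))"
     "integrable lborel (\<lambda>y. W i y * (G y $ j * \<psi> y))" "integrable lborel (\<lambda>y. (q y * v y) * (\<zeta> y * \<psi> y))" for i j
    by (intro int v W qv continuous_intros cP cH c1(4) b1(4) c2(4) bounded_cball; simp add: z)+
  define a1 a2 a3 a4 a5 where "a1 = (\<lambda>j. \<integral>y. v y * (\<zeta> y * Hs j y $ j) \<partial>lborel)" and "a2 = (\<lambda>j. \<integral>y. v y * (P y $ j * G y $ j) \<partial>lborel)"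
    and "a3 = (\<lambda>j. \<integral>y. W j y * (\<zeta> y * P y $ j) \<partial>lborel)" and "a4 = (\<lambda>j. \<integral>y. v y * (\<psi> y * H j y $ j) \<partial>lborel)"
    and "a5 = (\<lambda>j. \<integral>y. W j y * (G y $ j * \<psi> y) \<partial>lborel)"
  define a6 where "a6 = (\<integral>y. (q y * v y) * (\<zeta> y * \<psi> y) \<partial>lborel)"
  have E2: "a1 j + a2 j + a3 j = 0" for j
  proof -
    have "0 = (\<integral>y. v y * (\<zeta> y * Hs j y $ j) + v y * (P y $ j * G y $ j) + W j y * (\<zeta> y * P y $ j) \<partial>lborel)"
      using T[OF p2, of j j] by (simp add: algebra_simps)
    then show ?thesis using i by (simp add: a1_def a2_def a3_def)
  qed
  have E3: "a2 j + a4 j + a5 j = 0" for j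
  proof -
    have "0 = (\<integral>y. v y * (P y $ j * G y $ j) + v y * (\<psi> y * H j y $ j) + W j y * (G y $ j * \<psi> y) \<partial>lborel)"
      using T[OF p3, of j j] by (simp add: algebra_simps)
    then show ?thesis using i by (simp add: a2_def a4_def a5_def)
  qed
  have E1: "(\<Sum>j\<in>UNIV. a3 j + a5 j) - l * a6 = 0"
  proof -
    have "0 = (\<integral>y. (\<Sum>j\<in>UNIV. W j y * (\<zeta> y * P y $ j) + W j y * (G y $ j * \<psi> y)) - l * ((q y * v y) * (\<zeta> y * \<psi> y)) \<partial>lborel)"
      using T'[OF p1] by (simp add: algebra_simps)
    also have "\<dots> = (\<Sum>j\<in>UNIV. a3 j + a5 j) - l * a6"
      using i by (subst Bochner_Integration.integral_diff)
        (auto simp: a3_def a5_def a6_def Bochner_Integration.integral_sum intro!: Bochner_Integration.integrable_sum)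
    finally show ?thesis by simp
  qed
  have L: "conv (\<lambda>x. \<zeta> x * v x) (lap_bump e) x = (\<Sum>j\<in>UNIV. a1 j)"
  proof -
    have "conv (\<lambda>x. \<zeta> x * v x) (lap_bump e) x = (\<integral>y. (\<Sum>j\<in>UNIV. v y * (\<zeta> y * Hs j y $ j)) \<partial>lborel)"
      unfolding conv_def lap_bump_def Hs_def by (simp add: sum_distrib_left mult_ac)
    also have "\<dots> = (\<Sum>j\<in>UNIV. a1 j)" unfolding a1_def by (rule Bochner_Integration.integral_sum) (rule i)
    finally show ?thesis .
  qed
  have Rr: "conv (\<lambda>x. - l * q x * (\<zeta> x * v x) + (\<Sum>j\<in>UNIV. 2 * (G x $ j) * W j x + H j x $ j * v x)) (bump e) x
     = - l * a6 + (\<Sum>j\<in>UNIV. 2 * a5 j + a4 j)"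
  proof -
    have "conv (\<lambda>x. - l * q x * (\<zeta> x * v x) + (\<Sum>j\<in>UNIV. 2 * (G x $ j) * W j x + H j x $ j * v x)) (bump e) x
      = (\<integral>y. - l * ((q y * v y) * (\<zeta> y * \<psi> y)) + (\<Sum>j\<in>UNIV. 2 * (W j y * (G y $ j * \<psi> y)) + v y * (\<psi> y * H j y $ j)) \<partial>lborel)"
      unfolding conv_def \<psi>_def by (rule Bochner_Integration.integral_cong) (auto simp: sum_3 algebra_simps)
    also have "\<dots> = - l * a6 + (\<Sum>j\<in>UNIV. 2 * a5 j + a4 j)"
      using i by (subst Bochner_Integration.integral_add)
        (auto simp: a4_def a5_def a6_def Bochner_Integration.integral_sum intro!: Bochner_Integration.integrable_sum)
    finally show ?thesis .
  qed
  have "(\<Sum>j\<in>UNIV. a1 j + a2 j + a3 j) - (\<Sum>j\<in>UNIV. a2 j + a4 j + a5 j) = 0" by (simp add: E2 E3)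
  then have "(\<Sum>j\<in>UNIV. a1 j) = (\<Sum>j\<in>UNIV. a4 j + a5 j) - (\<Sum>j\<in>UNIV. a3 j)"
    by (simp add: sum.distrib)
  also have "\<dots> = (\<Sum>j\<in>UNIV. 2 * a5 j + a4 j) - l * a6"
    using E1 by (simp add: sum.distrib sum_distrib_left[symmetric])
  finally show ?thesis using L Rr by simp
qed

text \<open>The weight decreases with the distance from \<open>y\<close>. The errors caused by the
  cut-off lie beyond \<open>R1\<close>, where the weight is at most its value \<open>E1\<close> on
  the sphere of radius \<open>R1\<close>, while inside it is at least \<open>E1\<close>. A large
  \<open>\<tau>\<close> therefore makes the inner part dominate, which is possible only if it
  vanishes. The zero ball keeps the singular centre out of the support.\<close>

lemma ucp_ball_step:
  fixes y :: "real^3"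
  assumes sol: "weak_helmholtz (ball y R) q l v W" and v: "locL2 v" and W: "\<And>j. locL2 (W j)"
    and q: "q \<in> borel_measurable borel" "\<And>x. \<bar>q x\<bar> \<le> Q"
    and r: "0 < \<rho>" "\<rho> < R1" "R1 < R"
    and z: "AE x in lborel. x \<in> ball y \<rho> \<longrightarrow> v x = 0"
  shows "AE x in lborel. x \<in> cball y R1 \<longrightarrow> v x = 0"
proof -
  define R2 where "R2 = (R1 + R) / 2"
  have R2: "R1 < R2" "R2 < R" "0 < R2" using r by (auto simp: R2_def)
  have "0 < R1" using r by simp
  obtain \<zeta> G H where \<zeta>: "test_fn \<zeta> G" "\<And>j. test_fn (\<lambda>x. G x $ j) (H j)" "tsupp \<zeta> \<subseteq> cball y R2" "\<And>j. tsupp (\<lambda>x. G x $ j) \<subseteq> cball y R2"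
    and \<zeta>1: "\<And>x. dist x y \<le> R1 \<Longrightarrow> \<zeta> x = 1" "\<And>x. dist x y \<le> R1 \<Longrightarrow> G x = 0" "\<And>x j. dist x y \<le> R1 \<Longrightarrow> H j x $ j = 0"
    apply (rule radial_cutoff[OF \<open>0 < R1\<close> R2(1), where y = y])
    apply (rule that; assumption)
    done
  note c1 = test_fnD[OF \<zeta>(1)] and c2 = test_fnD[OF \<zeta>(2)]
  have sub: "cball y R2 \<subseteq> ball y R" using R2 by auto
  have far: "\<zeta> x = 0" "G x = 0" "H j x = 0" if "dist x y > R2" for x j
  proof -
    have x: "x \<notin> cball y R2" using that by (simp add: dist_commute)
    show "\<zeta> x = 0" "G x = 0" using x \<zeta>(3) c1(5,6) by blast+
    show "H j x = 0" using x \<zeta>(4)[of j] c2(6)[of x j] by blast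
  qed
  \<comment> \<open>\<open>v\<close> vanishes in the small ball only almost everywhere, whereas the
    Carleman estimate asks for exact zeros; multiplying by the indicator of \<open>A\<close> changes
    nothing up to a null set.\<close>
  define A where "A = - ball y \<rho>"
  have [measurable]: "A \<in> sets borel" by (simp add: A_def)
  note [measurable] = q(1) locL2_measurable[OF v] locL2_measurable[OF W]
    borel_measurable_continuous_onI[OF c1(4)]
  have mG[measurable]: "(\<lambda>x. G x $ j) \<in> borel_measurable borel" for j by (rule borel_measurable_continuous_onI[OF c2(4)])
  have cH: "continuous_on UNIV (\<lambda>x. H j x $ j)" for j by (intro continuous_intros c2(1))
  have mH[measurable]: "(\<lambda>x. H j x $ j) \<in> borel_measurable borel" for j by (rule borel_measurable_continuous_onI[OF cH])
  define h0 where "h0 = (\<lambda>x. - l * q x * (\<zeta> x * v x) + (\<Sum>j\<in>UNIV. 2 * (G x $ j) * W j x + H j x $ j * v x))"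
  define v1 h where "v1 = (\<lambda>x. indicator A x * (\<zeta> x * v x))" and "h = (\<lambda>x. indicator A x * h0 x)"
  have zA: "AE x in lborel. \<zeta> x * v x = v1 x" "AE x in lborel. h0 x = h x"
    using z by (eventually_elim, use r \<zeta>1 in \<open>auto simp: v1_def h_def h0_def A_def indicator_def dist_commute\<close>)+
  have bd: "\<exists>C\<ge>0. \<forall>x. \<bar>f x\<bar> \<le> C" if "continuous_on UNIV f" "\<And>x. dist x y > R2 \<Longrightarrow> f x = 0" for f :: "real^3 \<Rightarrow> real"
    using continuous_compact_support_bounded[OF that(1), of "cball y R2"] that(2)
    by (metis bounded_cball dist_commute mem_cball not_le)
  have L2m: "L2 lborel (\<lambda>x. indicator A x * (b x * f x))" if f: "locL2 f" and b: "continuous_on UNIV b" "\<And>x. dist x y > R2 \<Longrightarrow> b x = 0" for f b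
  proof -
    obtain C where C: "C \<ge> 0" "\<And>x. \<bar>b x\<bar> \<le> C" using bd[OF b] by blast
    have "L2 lborel (\<lambda>x. indicator (A \<inter> cball y R2) x * (b x * f x))"
      by (rule locL2_bounded_support[OF f _ _ borel_measurable_continuous_onI[OF b(1)] C(2) C(1)]) (auto intro: bounded_subset[OF bounded_cball])
    moreover have "indicator (A \<inter> cball y R2) x * (b x * f x) = indicator A x * (b x * f x)" for x
      using b(2)[of x] by (cases "dist x y > R2") (auto simp: indicator_def dist_commute)
    ultimately show ?thesis by simp
  qed
  have v1L: "L2 lborel v1" unfolding v1_def by (rule L2m[OF v c1(4) far(1)])
  have hL: "L2 lborel h"
  proof -
    have "L2 lborel (\<lambda>x. (- l * q x) * v1 x)"
    proof (rule L2_bounded_mult[OF v1L, where C = "\<bar>l\<bar> * Q"])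
      show "\<bar>- l * q x\<bar> \<le> \<bar>l\<bar> * Q" for x using q(2)[of x] by (auto simp: abs_mult intro: mult_left_mono)
    qed simp
    moreover have "L2 lborel (\<lambda>x. \<Sum>j\<in>UNIV. 2 * (indicator A x * (G x $ j * W j x)) + indicator A x * (H j x $ j * v x))"
      by (intro L2_sum L2_add L2_cmult L2m v W c2(4) cH) (use far in auto)
    ultimately have "L2 lborel (\<lambda>x. (- l * q x) * v1 x + (\<Sum>j\<in>UNIV. 2 * (indicator A x * (G x $ j * W j x)) + indicator A x * (H j x $ j * v x)))"
      by (rule L2_add)
    moreover have "(- l * q x) * v1 x + (\<Sum>j\<in>UNIV. 2 * (indicator A x * (G x $ j * W j x)) + indicator A x * (H j x $ j * v x)) = h x" for x
      by (auto simp: h_def h0_def v1_def indicator_def mult.assoc)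
    ultimately show ?thesis by simp
  qed
  have mv1: "v1 \<in> borel_measurable borel" "h \<in> borel_measurable borel" using v1L hL by (auto simp: L2_def)
  have mh0[measurable]: "h0 \<in> borel_measurable borel" unfolding h0_def by measurable
  note [measurable] = mv1
  have wl: "weak_lap 1 v1 h"
    unfolding weak_lap_def
  proof (intro allI impI, elim conjE)
    fix e :: real and x :: "real^3" assume e: "0 < e"
    have "conv v1 (lap_bump e) x = conv (\<lambda>x. \<zeta> x * v x) (lap_bump e) x"
      unfolding conv_def by (rule integral_cong_AE) (use zA(1) in auto)
    also have "\<dots> = conv h0 (bump e) x" unfolding h0_def
      by (rule cutoff_weak_lap[OF sol v W q \<zeta>(1,2) order.trans[OF \<zeta>(3) sub] order.trans[OF \<zeta>(4) sub] e])
    also have "\<dots> = conv h (bump e) x"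
      unfolding conv_def by (rule integral_cong_AE) (use zA(2) in auto)
    finally show "conv v1 (lap_bump e) x = conv h (bump e) x" .
  qed
  have supp: "v1 x = 0" "h x = 0" if "dist x y < \<rho> \<or> dist x y > R2" for x
    using that far[of x] by (auto simp: v1_def h_def h0_def A_def dist_commute)
  have inner: "h x = - l * q x * v1 x" if "dist x y \<le> R1" for x
    using \<zeta>1[OF that] by (auto simp: h_def h0_def v1_def)
  define D where "D = cball y R1"
  have [measurable]: "D \<in> sets borel" by (simp add: D_def)
  define J where "J = (\<integral>x. indicator D x * (v1 x)\<^sup>2 \<partial>lborel)"
  define K where "K = (\<integral>x. (h x)\<^sup>2 \<partial>lborel)"
  have iJ: "integrable lborel (\<lambda>x. indicator D x * (v1 x)\<^sup>2)"
    by (rule Bochner_Integration.integrable_bound[OF L2_square_integrable[OF v1L]]) (auto simp: indicator_def)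
  have J0: "J \<ge> 0" unfolding J_def by (rule integral_nonneg_AE) (auto simp: indicator_def)
  \<comment> \<open>\<open>K\<close> does not depend on \<open>\<tau>\<close>, so a bound with
    arbitrary \<open>N\<close> forces \<open>J = 0\<close>; \<open>\<tau>\<close> is chosen after
    \<open>N\<close>.\<close>
  have main: "N * J \<le> K" if N: "N \<ge> 0" for N
  proof -
    define zz where "zz = (\<lambda>x. inverse ((x - y) \<bullet> (x - y)))"
    have [measurable]: "zz \<in> borel_measurable borel" unfolding zz_def by measurable
    have zzd: "zz x = inverse ((dist x y)\<^sup>2)" for x by (simp add: zz_def dist_norm power2_norm_eq_inner)
    define z0 where "z0 = inverse (R2\<^sup>2)"
    have z0: "z0 > 0" using R2 by (simp add: z0_def)
    define M where "M = (N + l\<^sup>2 * Q\<^sup>2) / (64 * z0^5)"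
    have M0: "M \<ge> 0" using N z0 by (simp add: M_def)
    define \<tau> where "\<tau> = 1 + 9 * (R2 + \<rho>)\<^sup>2 + M"
    have P0: "0 \<le> (R2 + \<rho>)\<^sup>2" by simp
    have \<tau>: "\<tau> \<ge> 1" "4 * \<tau> \<ge> 9 * (R2 + \<rho>)\<^sup>2" "M \<le> \<tau>"
      using P0 M0 unfolding \<tau>_def atomize_conj by (smt (verit))
    have \<tau>3: "64 * \<tau>^3 * z0^5 \<ge> N + l\<^sup>2 * Q\<^sup>2"
    proof -
      have "M \<le> \<tau>^3" using \<tau>(3) self_le_power[OF \<tau>(1), of 3] by simp
      then show ?thesis using z0 by (simp add: M_def pos_divide_le_eq mult_ac)
    qed
    define E where "E = (\<lambda>x. (exp (\<tau> * zz x))\<^sup>2)"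
    have [measurable]: "E \<in> borel_measurable borel" unfolding E_def by measurable
    define E1 where "E1 = (exp (\<tau> * inverse (R1\<^sup>2)))\<^sup>2"
    have E1p: "E1 > 0" by (simp add: E1_def)
    define Em where "Em = (exp (\<tau> * inverse (\<rho>\<^sup>2)))\<^sup>2"
    have Ele: "E x \<le> (exp (\<tau> * inverse (a\<^sup>2)))\<^sup>2" if "dist x y \<ge> a" "a > 0" for a x
    proof -
      have "a\<^sup>2 \<le> (dist x y)\<^sup>2" using that by (intro power_mono) auto
      then have "zz x \<le> inverse (a\<^sup>2)" unfolding zzd using that by (intro le_imp_inverse_le) auto
      then show ?thesis unfolding E_def using \<tau> by (intro power_mono) auto
    qed
    have Ege: "E1 \<le> E x" if "dist x y \<le> R1" "x \<noteq> y" for x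
    proof -
      have "(dist x y)\<^sup>2 \<le> R1\<^sup>2" using that by (intro power_mono) auto
      then have "inverse (R1\<^sup>2) \<le> zz x" unfolding zzd using that by (intro le_imp_inverse_le) auto
      then show ?thesis unfolding E_def E1_def using \<tau> by (intro power_mono) auto
    qed
    have zge: "z0 \<le> zz x" if "dist x y \<le> R2" "x \<noteq> y" for x
    proof -
      have "(dist x y)\<^sup>2 \<le> R2\<^sup>2" using that by (intro power_mono) auto
      then show ?thesis unfolding zzd z0_def using that by (intro le_imp_inverse_le) auto
    qed
    have E0: "E x \<ge> 0" for x by (simp add: E_def)
    have iE: "integrable lborel (\<lambda>x. g x * (E x * (f x)\<^sup>2))"
      if "L2 lborel f" "\<And>x. dist x y < \<rho> \<Longrightarrow> f x = 0" "g \<in> borel_measurable borel" "\<And>x. dist x y \<ge> \<rho> \<Longrightarrow> \<bar>g x\<bar> \<le> C" for f g C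
    proof -
      have "L2 lborel (\<lambda>x. (indicator A x * (g x * E x)) * f x)"
      proof (rule L2_bounded_mult[OF that(1), where C = "C * Em"])
        note [measurable] = that(3)
        show "(\<lambda>x. indicator A x * (g x * E x)) \<in> borel_measurable lborel" by simp
        fix x
        obtain a :: "real^3" where a: "dist a y = \<rho>"
          using vector_choose_dist[of \<rho> y] r by (metis dist_commute less_imp_le)
        have C0: "C \<ge> 0" using that(4)[of a] a by linarith
        show "\<bar>indicator A x * (g x * E x)\<bar> \<le> C * Em"
        proof (cases "x \<in> A")
          case True
          then have d: "dist x y \<ge> \<rho>" by (simp add: A_def dist_commute)
          show ?thesis using True mult_mono[OF that(4)[OF d] Ele[OF d r(1)] C0 E0] E0[of x] by (simp add: abs_mult Em_def)
        next
          case False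
          then show ?thesis using C0 by (simp add: Em_def)
        qed
      qed
      from L2_mult_integrable[OF this that(1)]
      have "integrable lborel (\<lambda>x. indicator A x * (g x * E x) * f x * f x)" .
      moreover have "indicator A x * (g x * E x) * f x * f x = g x * (E x * (f x)\<^sup>2)" for x
        using that(2)[of x] by (auto simp: A_def indicator_def power2_eq_square dist_commute)
      ultimately show ?thesis by simp
    qed
    have zb: "\<bar>(zz x)^5\<bar> \<le> (inverse (\<rho>\<^sup>2))^5" if "dist x y \<ge> \<rho>" for x
    proof -
      have "\<rho>\<^sup>2 \<le> (dist x y)\<^sup>2" using that r by (intro power_mono) auto
      then have "zz x \<le> inverse (\<rho>\<^sup>2)" unfolding zzd using r by (intro le_imp_inverse_le) auto
      moreover have "0 \<le> zz x" by (simp add: zzd)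
      ultimately show ?thesis by (simp add: power_mono del: power_inverse)
    qed
    have sv: "dist x y < \<rho> \<Longrightarrow> v1 x = 0" "dist x y < \<rho> \<Longrightarrow> h x = 0" for x using supp[of x] by auto
    have i1: "integrable lborel (\<lambda>x. (zz x)^5 * (E x * (v1 x)\<^sup>2))"
      by (rule iE[OF v1L sv(1) _ zb]) auto
    have i2: "integrable lborel (\<lambda>x. 1 * (E x * (h x)\<^sup>2))"
      by (rule iE[OF hL sv(2), where C = 1]) auto
    have i3: "integrable lborel (\<lambda>x. indicator D x * (E x * (v1 x)\<^sup>2))"
      by (rule iE[OF v1L sv(1), where C = 1]) (auto simp: indicator_def)
    define I where "I = (\<integral>x. indicator D x * (E x * (v1 x)\<^sup>2) \<partial>lborel)"
    have "64 * \<tau>^3 * (\<integral>x. (zz x)^5 * (exp (\<tau> * zz x))\<^sup>2 * (v1 x)\<^sup>2 \<partial>lborel) \<le> (\<integral>x. (exp (\<tau> * zz x))\<^sup>2 * (h x)\<^sup>2 \<partial>lborel)"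
      unfolding zz_def by (rule carleman_weak[OF wl _ v1L hL supp r(1) \<tau>(2)]) (use \<tau> R2 in auto)
    then have C: "64 * \<tau>^3 * (\<integral>x. (zz x)^5 * (E x * (v1 x)\<^sup>2) \<partial>lborel) \<le> (\<integral>x. 1 * (E x * (h x)\<^sup>2) \<partial>lborel)"
      by (simp add: E_def mult.assoc)
    have "z0^5 * I = (\<integral>x. z0^5 * (indicator D x * (E x * (v1 x)\<^sup>2)) \<partial>lborel)" by (simp add: I_def)
    also have "\<dots> \<le> (\<integral>x. (zz x)^5 * (E x * (v1 x)\<^sup>2) \<partial>lborel)"
    proof (rule integral_mono[OF integrable_mult_right[OF i3] i1])
      fix x
      show "z0^5 * (indicator D x * (E x * (v1 x)\<^sup>2)) \<le> (zz x)^5 * (E x * (v1 x)\<^sup>2)"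
      proof (cases "dist x y < \<rho> \<or> dist x y > R2")
        case True then show ?thesis using supp[OF True] by simp
      next
        case False
        then have "z0 \<le> zz x" using r by (intro zge) auto
        then have "z0^5 * (E x * (v1 x)\<^sup>2) \<le> (zz x)^5 * (E x * (v1 x)\<^sup>2)" using z0 E0 by (intro mult_right_mono power_mono) auto
        moreover have "0 \<le> (zz x)^5 * (E x * (v1 x)\<^sup>2)" using E0[of x] by (simp add: zzd)
        ultimately show ?thesis by (simp add: indicator_def)
      qed
    qed
    finally have lower: "64 * \<tau>^3 * (z0^5 * I) \<le> (\<integral>x. 1 * (E x * (h x)\<^sup>2) \<partial>lborel)"
      using C mult_left_mono[of "z0^5 * I" _ "64 * \<tau>^3"] \<tau>(1) by (meson order.trans mult_nonneg_nonneg zero_le_numeral zero_le_power zero_le_one)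
    have "(\<integral>x. 1 * (E x * (h x)\<^sup>2) \<partial>lborel) \<le> (\<integral>x. l\<^sup>2 * Q\<^sup>2 * (indicator D x * (E x * (v1 x)\<^sup>2)) + E1 * (h x)\<^sup>2 \<partial>lborel)"
    proof (rule integral_mono[OF i2])
      show "integrable lborel (\<lambda>x. l\<^sup>2 * Q\<^sup>2 * (indicator D x * (E x * (v1 x)\<^sup>2)) + E1 * (h x)\<^sup>2)"
        by (intro Bochner_Integration.integrable_add integrable_mult_right i3 L2_square_integrable hL)
      fix x
      show "1 * (E x * (h x)\<^sup>2) \<le> l\<^sup>2 * Q\<^sup>2 * (indicator D x * (E x * (v1 x)\<^sup>2)) + E1 * (h x)\<^sup>2"
      \<comment> \<open>Inside, \<open>h\<close> is \<open>- l * q * v1\<close>, to be absorbed on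
        the left. Outside, the weight is at most \<open>E1\<close>, which later cancels against the
        lower bound \<open>E1 * J \<le> I\<close>.\<close>
      proof (cases "dist x y \<le> R1")
        case True
        have "(q x)\<^sup>2 \<le> Q\<^sup>2" using power_mono[OF q(2)[of x], of 2] by simp
        then have "(h x)\<^sup>2 \<le> l\<^sup>2 * Q\<^sup>2 * (v1 x)\<^sup>2"
          unfolding inner[OF True] by (auto simp: power_mult_distrib intro!: mult_right_mono mult_left_mono)
        then have "E x * (h x)\<^sup>2 \<le> E x * (l\<^sup>2 * Q\<^sup>2 * (v1 x)\<^sup>2)" using E0 by (intro mult_left_mono) auto
        moreover have "0 \<le> E1 * (h x)\<^sup>2" using E1p by simp
        moreover have "x \<in> D" using True by (simp add: D_def dist_commute)
        ultimately show ?thesis by (simp add: mult_ac)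
      next
        case False
        then have "E x \<le> E1" unfolding E1_def using r by (intro Ele) auto
        then have "E x * (h x)\<^sup>2 \<le> E1 * (h x)\<^sup>2" by (intro mult_right_mono) auto
        moreover have "0 \<le> l\<^sup>2 * Q\<^sup>2 * (indicator D x * (E x * (v1 x)\<^sup>2))" using E0[of x] by simp
        ultimately show ?thesis by linarith
      qed
    qed
    also have "\<dots> = l\<^sup>2 * Q\<^sup>2 * I + E1 * K"
      unfolding I_def K_def using i3 L2_square_integrable[OF hL] by simp
    finally have "64 * \<tau>^3 * z0^5 * I \<le> l\<^sup>2 * Q\<^sup>2 * I + E1 * K" using lower by (simp add: mult.assoc)
    moreover have I0: "I \<ge> 0" unfolding I_def using E0 by (intro integral_nonneg_AE) (auto simp: indicator_def)
    then have "(N + l\<^sup>2 * Q\<^sup>2) * I \<le> 64 * \<tau>^3 * z0^5 * I" using \<tau>3 by (intro mult_right_mono) auto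
    ultimately have NI: "N * I \<le> E1 * K" by (simp add: distrib_right)
    have "E1 * J = (\<integral>x. E1 * (indicator D x * (v1 x)\<^sup>2) \<partial>lborel)" by (simp add: J_def)
    also have "\<dots> \<le> I" unfolding I_def
    proof (rule integral_mono[OF integrable_mult_right[OF iJ] i3])
      fix x
      show "E1 * (indicator D x * (v1 x)\<^sup>2) \<le> indicator D x * (E x * (v1 x)\<^sup>2)"
      proof (cases "x \<in> D \<and> x \<noteq> y")
        case True
        then have "E1 \<le> E x" by (intro Ege) (auto simp: D_def dist_commute)
        then show ?thesis using True by (simp add: mult_right_mono)
      next
        case False
        then show ?thesis using sv(1)[of x] r by (auto simp: indicator_def)
      qed
    qed
    finally have "N * (E1 * J) \<le> N * I" using N by (rule mult_left_mono)
    with NI have "E1 * (N * J) \<le> E1 * K" by (simp add: mult_ac)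
    then show ?thesis using E1p by simp
  qed
  have "J = 0"
  proof (rule ccontr)
    assume "J \<noteq> 0"
    then have "J > 0" using J0 by simp
    moreover have "K \<ge> 0" by (simp add: K_def)
    ultimately show False using main[of "(K + 1) / J"] by simp
  qed
  then have "AE x in lborel. indicator D x * (v1 x)\<^sup>2 = 0"
    using integral_nonneg_eq_0_iff_AE[OF iJ] by (simp add: J_def indicator_def)
  with zA(1) show ?thesis
  proof eventually_elim
    case (elim x)
    show ?case
    proof
      assume "x \<in> cball y R1"
      then have "x \<in> D" "\<zeta> x = 1" using \<zeta>1(1)[of x] by (auto simp: D_def dist_commute)
      then show "v x = 0" using elim by simp
    qed
  qed
qed

text \<open>The set of points near which \<open>v\<close> vanishes is open and closed in
  \<open>U\<close>. For closedness the ball step is centred not at the limit point \<open>x\<close>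
  but at a nearby point \<open>y\<close> of the set, where a small zero ball is available.\<close>

lemma unique_continuation:
  assumes U: "open U" "connected U"
    and sol: "weak_helmholtz U q l v W" and v: "locL2 v" and W: "\<And>j. locL2 (W j)"
    and q: "q \<in> borel_measurable borel" "\<And>x. \<bar>q x\<bar> \<le> Q"
    and B: "B \<subseteq> U" "open B" "B \<noteq> {}" "AE x in lborel. x \<in> B \<longrightarrow> v x = 0"
  shows "AE x in lborel. x \<in> U \<longrightarrow> v x = 0"
proof -
  define Z where "Z = {x \<in> U. \<exists>r>0. AE y in lborel. y \<in> ball x r \<longrightarrow> v y = 0}"
  have "open Z"
    unfolding open_contains_ball
  proof
    fix x assume "x \<in> Z"
    then obtain r where r: "x \<in> U" "r > 0" "AE y in lborel. y \<in> ball x r \<longrightarrow> v y = 0" by (auto simp: Z_def)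
    obtain r' where r': "r' > 0" "ball x r' \<subseteq> U" using U(1) r(1) by (meson openE)
    define s where "s = min r r' / 2"
    have s: "s > 0" "2 * s \<le> r" "s \<le> r'" using r r' by (auto simp: s_def)
    have "x' \<in> Z" if x': "x' \<in> ball x s" for x'
    proof -
      have "x' \<in> U" using x' s r' by auto
      moreover have "AE y in lborel. y \<in> ball x' s \<longrightarrow> v y = 0"
        using r(3)
      proof eventually_elim
        case (elim y)
        show ?case
        proof
          assume "y \<in> ball x' s"
          then have "y \<in> ball x r" using x' s dist_triangle[of x y x'] by simp
          then show "v y = 0" using elim by simp
        qed
      qed
      ultimately show ?thesis using s(1) by (auto simp: Z_def)
    qed
    then show "\<exists>e>0. ball x e \<subseteq> Z" using s(1) by blast
  qed
  moreover have "open (U - Z)"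
    unfolding open_contains_ball
  proof
    fix x assume x: "x \<in> U - Z"
    obtain d where d: "d > 0" "ball x d \<subseteq> U" using U(1) x by (meson openE DiffD1)
    \<comment> \<open>With \<open>y\<close> within \<open>d / 4\<close> of \<open>x\<close>, the
      ball of radius \<open>3 * d / 4\<close> about \<open>y\<close> stays in \<open>U\<close>, and
      the one of radius \<open>d / 2\<close> about \<open>y\<close>, filled with zeros by the ball
      step, contains the ball of radius \<open>d / 4\<close> about \<open>x\<close>.\<close>
    have "y \<notin> Z" if y: "y \<in> ball x (d / 4)" for y
    proof
      assume "y \<in> Z"
      then obtain r where r: "r > 0" "AE w in lborel. w \<in> ball y r \<longrightarrow> v w = 0" by (auto simp: Z_def)
      define \<rho> where "\<rho> = min r (d / 4)"
      have \<rho>: "0 < \<rho>" "\<rho> \<le> r" "\<rho> \<le> d / 4" using r d by (auto simp: \<rho>_def)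
      have sub: "ball y (3 * d / 4) \<subseteq> U"
      proof
        fix w assume "w \<in> ball y (3 * d / 4)"
        then have "w \<in> ball x d" using y dist_triangle[of x w y] by simp
        then show "w \<in> U" using d by blast
      qed
      have "AE w in lborel. w \<in> cball y (d / 2) \<longrightarrow> v w = 0"
      proof (rule ucp_ball_step[OF weak_helmholtz_mono[OF sol sub] v W q \<rho>(1)])
        show "AE w in lborel. w \<in> ball y \<rho> \<longrightarrow> v w = 0"
          using r(2) by eventually_elim (use \<rho>(2) in auto)
      qed (use \<rho> d in auto)
      then have "AE w in lborel. w \<in> ball x (d / 4) \<longrightarrow> v w = 0"
      proof eventually_elim
        case (elim w)
        show ?case
        proof
          assume "w \<in> ball x (d / 4)"
          then have "w \<in> cball y (d / 2)" using y dist_triangle[of y w x] by (simp add: dist_commute)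
          then show "v w = 0" using elim by simp
        qed
      qed
      then have "x \<in> Z" using x d by (auto simp: Z_def intro!: exI[of _ "d / 4"])
      then show False using x by simp
    qed
    then have "ball x (d / 4) \<subseteq> U - Z" using d by auto
    then show "\<exists>e>0. ball x e \<subseteq> U - Z" using d(1) by (intro exI[of _ "d / 4"]) auto
  qed
  moreover obtain b where b: "b \<in> B" using B(3) by blast
  obtain r where r: "r > 0" "ball b r \<subseteq> B" using B(2) b by (meson openE)
  have "AE y in lborel. y \<in> ball b r \<longrightarrow> v y = 0" using B(4) by eventually_elim (use r in auto)
  then have "b \<in> Z" using b B(1) r(1) by (auto simp: Z_def)
  moreover have "Z \<subseteq> U" by (auto simp: Z_def)
  ultimately have "Z = U"
    using connectedD[OF U(2), of Z "U - Z"] by blast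
  then show ?thesis
    by (intro AE_zero_local) (use U locL2_measurable[OF v] in \<open>auto simp: Z_def\<close>)
qed

section \<open>Densities on triangulated surfaces\<close>

definition C1_fun :: "(real^3 \<Rightarrow> real) \<Rightarrow> bool" where
  "C1_fun b \<longleftrightarrow> (\<exists>db. (\<forall>x. (b has_derivative (\<lambda>h. db x \<bullet> h)) (at x)) \<and> continuous_on UNIV db)"

lemma C1_funI:
  assumes "\<And>x. (b has_derivative (\<lambda>h. db x \<bullet> h)) (at x)" "continuous_on UNIV db" shows "C1_fun b"
  unfolding C1_fun_def by (intro exI[of _ db] conjI allI assms)

lemma C1_fun_continuous: "C1_fun b \<Longrightarrow> continuous_on UNIV b"
  unfolding C1_fun_def by (meson continuous_at_imp_continuous_on has_derivative_continuous)

lemma C1_fun_mult: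
  assumes "C1_fun a" "C1_fun b" shows "C1_fun (\<lambda>x. a x * b x)"
proof -
  obtain da db where d: "\<And>x. (a has_derivative (\<lambda>h. da x \<bullet> h)) (at x)" "continuous_on UNIV da"
    "\<And>x. (b has_derivative (\<lambda>h. db x \<bullet> h)) (at x)" "continuous_on UNIV db"
    using assms unfolding C1_fun_def by blast
  have "((\<lambda>x. a x * b x) has_derivative (\<lambda>h. (a x *\<^sub>R db x + b x *\<^sub>R da x) \<bullet> h)) (at x)" for x
    by (rule has_derivative_eq_rhs[OF has_derivative_mult[OF d(1,3)]]) (auto simp: inner_add_left mult_ac)
  moreover have "continuous_on UNIV (\<lambda>x. a x *\<^sub>R db x + b x *\<^sub>R da x)"
    by (intro continuous_intros d assms C1_fun_continuous)
  ultimately show ?thesis by (rule C1_funI)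
qed

lemma C1_fun_compose:
  assumes "C1_fun b" "\<And>x. (g has_real_derivative g' (b x)) (at (b x))" "continuous_on UNIV (\<lambda>x. g' (b x))"
  shows "C1_fun (\<lambda>x. g (b x))"
proof -
  obtain db where d: "\<And>x. (b has_derivative (\<lambda>h. db x \<bullet> h)) (at x)" "continuous_on UNIV db"
    using assms(1) unfolding C1_fun_def by blast
  have "((\<lambda>x. g (b x)) has_derivative (\<lambda>h. (g' (b x) *\<^sub>R db x) \<bullet> h)) (at x)" for x
    by (rule has_derivative_eq_rhs[OF DERIV_compose_FDERIV[OF assms(2) d(1)]]) auto
  moreover have "continuous_on UNIV (\<lambda>x. g' (b x) *\<^sub>R db x)" by (intro continuous_intros d assms)
  ultimately show ?thesis by (rule C1_funI)
qed

lemma C1_fun_affine: "C1_fun (\<lambda>x. c * x $ i + d)"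
  unfolding C1_fun_def
proof (intro exI[of _ "\<lambda>x. c *\<^sub>R axis i 1"] conjI allI)
  fix x :: "real^3"
  have "((\<lambda>x. x $ i) has_derivative (\<lambda>h. h $ i)) (at x)"
    by (rule bounded_linear_imp_has_derivative[OF bounded_linear_vec_nth])
  then have "((\<lambda>x. c * x $ i + d) has_derivative (\<lambda>h. c * h $ i + 0)) (at x)"
    by (intro has_derivative_add has_derivative_mult_right has_derivative_const)
  then show "((\<lambda>x. c * x $ i + d) has_derivative (\<lambda>h. (c *\<^sub>R axis i 1) \<bullet> h)) (at x)"
    by (simp add: inner_axis')
qed simp

lemma C1_fun_pos_part_square:
  assumes "C1_fun b" shows "C1_fun (\<lambda>x. (max 0 (b x))\<^sup>2)"
  by (rule C1_fun_compose[OF assms, where g = "\<lambda>s. (max 0 s)\<^sup>2" and g' = "\<lambda>s. 2 * max 0 s"])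
     (use DERIV_pos_part_power[of 2] C1_fun_continuous[OF assms] in \<open>auto intro!: continuous_intros\<close>)

text \<open>For \<open>n\<close> tending to infinity these functions stay in \<open>[0, 1]\<close>
  and tend to the indicator of \<open>b > 0\<close>. They give continuously differentiable
  approximations of indicators, both for boxes and for the cut-off near the plane.\<close>

lemma C1_fun_saturate:
  assumes "C1_fun b" "\<And>x. b x \<ge> 0" "n \<ge> 0"
  shows "C1_fun (\<lambda>x. n * b x / (1 + n * b x))"
proof (rule C1_fun_compose[OF assms(1), where g = "\<lambda>s. n * s / (1 + n * s)" and g' = "\<lambda>s. n / (1 + n * s)\<^sup>2"])
  have p: "1 + n * b x > 0" for x using assms(2)[of x] assms(3) by (simp add: add_pos_nonneg)
  show "((\<lambda>s. n * s / (1 + n * s)) has_real_derivative n / (1 + n * b x)\<^sup>2) (at (b x))" for x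
    using p[of x] by (auto intro!: derivative_eq_intros simp: field_simps power2_eq_square)
  show "continuous_on UNIV (\<lambda>x. n / (1 + n * b x)\<^sup>2)"
    using p by (intro continuous_intros C1_fun_continuous assms(1)) (metis less_irrefl power_eq_0_iff)
qed

lemma saturate_tendsto:
  assumes "m \<ge> (0::real)"
  shows "(\<lambda>n. real n * m / (1 + real n * m)) \<longlonglongrightarrow> (if m > 0 then 1 else 0)"
proof (cases "m > 0")
  case True
  have "(\<lambda>n. 1 - inverse (1 + real n * m)) \<longlonglongrightarrow> 1 - 0"
  proof (intro tendsto_intros tendsto_inverse_0_at_top)
    show "filterlim (\<lambda>n. 1 + real n * m) at_top sequentially"
      by (intro filterlim_tendsto_add_at_top[OF tendsto_const] filterlim_at_top_mult_tendsto_pos[OF tendsto_const True filterlim_real_sequentially])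
  qed
  moreover have "1 - inverse (1 + real n * m) = real n * m / (1 + real n * m)" for n
  proof -
    have "1 + real n * m > 0" using True by (simp add: add_pos_nonneg)
    then show ?thesis by (simp add: field_simps)
  qed
  ultimately show ?thesis using True by simp
qed (use assms in simp)

lemma saturate_bounds:
  assumes "m \<ge> (0::real)" "n \<ge> 0" shows "0 \<le> n * m / (1 + n * m)" "n * m / (1 + n * m) \<le> 1"
proof -
  have "n * m \<ge> 0" using assms by simp
  then show "0 \<le> n * m / (1 + n * m)" "n * m / (1 + n * m) \<le> 1" by (auto simp: divide_le_eq_1)
qed

lemma C1_fun_prod:
  assumes "finite I" "\<And>i. i \<in> I \<Longrightarrow> C1_fun (f i)" shows "C1_fun (\<lambda>x. \<Prod>i\<in>I. f i x)"
  using assms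
proof (induction I rule: finite_induct)
  case empty
  have "C1_fun (\<lambda>x. 1)" using C1_fun_affine[of 0 1 1] by simp
  then show ?case by simp
qed (auto intro!: C1_fun_mult)

text \<open>A product of squared positive parts is continuously differentiable and positive exactly
  on the open box; saturation turns it into approximations of the indicator.\<close>

lemma box_indicator_limit:
  fixes a b :: "real^3"
  obtains \<phi> d\<phi> where "\<And>n. test_fn (\<phi> n) (d\<phi> n)" "\<And>n. tsupp (\<phi> n) \<subseteq> cbox a b"
    "\<And>n x. 0 \<le> \<phi> n x" "\<And>n x. \<phi> n x \<le> 1" "\<And>x. (\<lambda>n. \<phi> n x) \<longlonglongrightarrow> indicator (box a b) x"
proof -
  define m where "m = (\<lambda>x::real^3. \<Prod>i\<in>UNIV. (max 0 (x $ i - a $ i))\<^sup>2 * (max 0 (b $ i - x $ i))\<^sup>2)"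
  have m0: "m x \<ge> 0" for x unfolding m_def by (intro prod_nonneg) auto
  have "C1_fun m"
    unfolding m_def
  proof (intro C1_fun_prod C1_fun_mult C1_fun_pos_part_square)
    show "C1_fun (\<lambda>x. x $ i - a $ i)" "C1_fun (\<lambda>x. b $ i - x $ i)" for i
      using C1_fun_affine[of 1 i "- a $ i"] C1_fun_affine[of "-1" i "b $ i"] by simp_all
  qed simp
  then have "C1_fun (\<lambda>x. real n * m x / (1 + real n * m x))" for n
    by (rule C1_fun_saturate[OF _ m0]) simp
  then have "\<exists>d. \<forall>n. (\<forall>x. ((\<lambda>x. real n * m x / (1 + real n * m x)) has_derivative (\<lambda>h. d n x \<bullet> h)) (at x)) \<and> continuous_on UNIV (d n)"
    unfolding C1_fun_def by (intro choice allI)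
  then obtain d where d: "\<And>n x. ((\<lambda>x. real n * m x / (1 + real n * m x)) has_derivative (\<lambda>h. d n x \<bullet> h)) (at x)" "\<And>n. continuous_on UNIV (d n)"
    by blast
  have mpos: "m x > 0 \<longleftrightarrow> x \<in> box a b" for x
  proof -
    have "m x > 0 \<longleftrightarrow> m x \<noteq> 0" using m0[of x] by linarith
    also have "\<dots> \<longleftrightarrow> (\<forall>i. max 0 (x $ i - a $ i) \<noteq> 0 \<and> max 0 (b $ i - x $ i) \<noteq> 0)" by (simp add: m_def)
    also have "\<dots> \<longleftrightarrow> x \<in> box a b" by (simp add: mem_box_cart max_def not_le) (metis not_le less_le)
    finally show ?thesis .
  qed
  have mz: "m x = 0" if "x \<notin> cbox a b" for x
    using mpos[of x] m0[of x] that box_subset_cbox[of a b] by (metis less_le subset_eq)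
  show thesis
  proof (rule that)
    show "test_fn (\<lambda>x. real n * m x / (1 + real n * m x)) (d n)" for n
      by (rule test_fnI[OF d(2,1) _ compact_cbox[of a b]]) (simp add: mz)
    show "tsupp (\<lambda>x. real n * m x / (1 + real n * m x)) \<subseteq> cbox a b" for n
      by (rule tsupp_subset) (auto simp: mz closed_cbox)
    show "0 \<le> real n * m x / (1 + real n * m x)" "real n * m x / (1 + real n * m x) \<le> 1" for n x
      by (intro saturate_bounds m0 of_nat_0_le_iff)+
    show "(\<lambda>n. real n * m x / (1 + real n * m x)) \<longlonglongrightarrow> indicator (box a b) x" for x
      using saturate_tendsto[OF m0[of x]] mpos[of x] by (cases "x \<in> box a b") auto
  qed
qed

section \<open>Geometry and measure of parametrised triangles\<close>

lemma simplex2_facts: "convex std_simplex2" "compact std_simplex2" "std_simplex2 \<in> sets borel"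
proof -
  have eq: "std_simplex2 = convex hull {(0, 0), (1, 0), (0, 1)}"
    unfolding convex_hull_3_alt std_simplex2_def by auto
  show "convex std_simplex2" unfolding eq by simp
  show c: "compact std_simplex2" unfolding eq by (intro compact_convex_hull finite_imp_compact) simp
  show "std_simplex2 \<in> sets borel" using compact_imp_closed[OF c] by simp
qed

definition tri_lin :: "real^3 \<Rightarrow> real^3 \<Rightarrow> real^3 \<Rightarrow> real \<times> real \<Rightarrow> real^3" where
  "tri_lin a b c p = fst p *\<^sub>R (b - a) + snd p *\<^sub>R (c - a)"

lemma tri_param_lin: "tri_param a b c p = a + tri_lin a b c p"
  by (simp add: tri_param_def tri_lin_def)

lemma tri_lin_linear: "linear (tri_lin a b c)"
  by (intro linearI) (auto simp: tri_lin_def algebra_simps)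

text \<open>The cross product with one edge vector kills that edge and isolates the coordinate along
  the other.\<close>

lemma tri_lin_inj:
  assumes "cross3 (b - a) (c - a) \<noteq> 0" shows "inj (tri_lin a b c)"
  unfolding linear_injective_0[OF tri_lin_linear]
proof (intro allI impI)
  fix p assume z: "tri_lin a b c p = 0"
  have "cross3 (tri_lin a b c p) (c - a) = fst p *\<^sub>R cross3 (b - a) (c - a)"
    by (simp add: tri_lin_def cross_add_left cross_mult_left cross_refl)
  then have "fst p = 0" using z assms by simp
  moreover have "cross3 (b - a) (tri_lin a b c p) = snd p *\<^sub>R cross3 (b - a) (c - a)"
    by (simp add: tri_lin_def cross_add_right cross_mult_right cross_refl)
  then have "snd p = 0" using z assms by simp
  ultimately show "p = 0" by (simp add: prod_eq_iff)
qed

lemma tri_set_image: "tri_set (a, b, c) = tri_param a b c ` std_simplex2"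
proof -
  have "tri_set (a, b, c) = {tri_param a b c (u, v) | u v. 0 \<le> u \<and> 0 \<le> v \<and> u + v \<le> 1}"
    unfolding tri_set_def by (simp add: convex_hull_3_alt tri_param_def)
  also have "\<dots> = tri_param a b c ` std_simplex2" by (force simp: std_simplex2_def image_iff)
  finally show ?thesis .
qed

lemma tri_param_continuous: "continuous_on A (tri_param a b c)"
  unfolding tri_param_def[abs_def] by (intro continuous_intros)

lemma tri_set_facts: "compact (tri_set T)" "convex (tri_set T)" "aff_dim (tri_set T) \<le> 2" "tri_set T \<in> sets borel" "negligible (tri_set T)"
proof -
  obtain a b c where T: "T = (a, b, c)" by (cases T)
  have h: "tri_set T = convex hull {a, b, c}" by (simp add: T tri_set_def)
  show c: "compact (tri_set T)" unfolding h by (intro compact_convex_hull finite_imp_compact) simp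
  show "tri_set T \<in> sets borel" by (rule borel_closed[OF compact_imp_closed[OF c]])
  show cv: "convex (tri_set T)" unfolding h by simp
  have "aff_dim {a, b, c} \<le> int (card {a, b, c}) - 1" by (rule aff_dim_le_card) simp
  moreover have "card {a, b, c} \<le> 3" by (simp add: card_insert_if)
  ultimately show d: "aff_dim (tri_set T) \<le> 2" unfolding h aff_dim_convex_hull by linarith
  have "interior (tri_set T) = {}"
  proof (rule ccontr)
    assume "interior (tri_set T) \<noteq> {}"
    then have "aff_dim (tri_set T) = 3" using aff_dim_nonempty_interior[of "tri_set T"] by simp
    then show False using d by simp
  qed
  then show "negligible (tri_set T)" using negligible_convex_interior[OF cv] by simp
qed

text \<open>A triangulation only promises disjoint relative interiors. The parameters of the overlap
  form a convex set. If it had interior points, its image would span the plane of both triangles,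
  and its nonempty relative interior would lie in both relative interiors.\<close>

lemma tri_overlap_negligible:
  assumes ne: "cross3 (b - a) (c - a) \<noteq> 0" and disj: "rel_interior (tri_set (a, b, c)) \<inter> rel_interior (tri_set T') = {}"
  shows "negligible {p \<in> std_simplex2. tri_param a b c p \<in> tri_set T'}"
proof -
  define P where "P = {p \<in> std_simplex2. tri_param a b c p \<in> tri_set T'}"
  have cvP: "convex P"
  proof -
    have eq: "P = std_simplex2 \<inter> tri_lin a b c -` ((+) (- a) ` tri_set T')"
      by (auto simp: P_def tri_param_lin image_iff) (metis add.commute diff_add_cancel add_uminus_conv_diff)
    show ?thesis unfolding eq
      by (intro convex_Int simplex2_facts(1) convex_linear_vimage tri_lin_linear convex_translation tri_set_facts(2))
  qed
  have "interior P = {}"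
  proof (rule ccontr)
    assume i: "interior P \<noteq> {}"
    define K where "K = tri_param a b c ` P"
    have "K = (+) a ` (tri_lin a b c ` P)" by (auto simp: K_def tri_param_lin image_image)
    then have aK: "aff_dim K = 2" and cK: "convex K"
      using aff_dim_nonempty_interior[OF i] cvP
      by (simp_all add: aff_dim_translation_eq aff_dim_injective_linear_image[OF tri_lin_linear tri_lin_inj[OF ne]]
           convex_translation convex_linear_image[OF tri_lin_linear])
    have K1: "K \<subseteq> tri_set (a, b, c)" unfolding tri_set_image K_def P_def by auto
    have K2: "K \<subseteq> tri_set T'" by (auto simp: K_def P_def)
    have "aff_dim (tri_set (a, b, c)) = 2" "aff_dim (tri_set T') = 2"
      using aff_dim_subset[OF K1] aff_dim_subset[OF K2] tri_set_facts(3)[of "(a, b, c)"] tri_set_facts(3)[of T'] aK by auto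
    then have "affine hull K = affine hull (tri_set (a, b, c))" "affine hull K = affine hull (tri_set T')"
      using aff_dim_eq_full_gen[OF K1] aff_dim_eq_full_gen[OF K2] aK by auto
    then have "rel_interior K \<subseteq> rel_interior (tri_set (a, b, c)) \<inter> rel_interior (tri_set T')"
      using subset_rel_interior[OF K1] subset_rel_interior[OF K2] by auto
    moreover have "K \<noteq> {}" using i interior_subset[of P] by (auto simp: K_def)
    then have "rel_interior K \<noteq> {}" using rel_interior_eq_empty[OF cK] by simp
    ultimately show False using disj by auto
  qed
  then show ?thesis using negligible_convex_interior[OF cvP] by (simp add: P_def)
qed

text \<open>Normals are prescribed on relative interiors only; this makes them known almost
  everywhere. The exceptional parameters lie on the frontier of the convex simplex.\<close>

lemma tri_rel_interior_ae:
  assumes ne: "cross3 (b - a) (c - a) \<noteq> 0"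
  shows "negligible {p \<in> std_simplex2. tri_param a b c p \<notin> rel_interior (convex hull {a, b, c})}"
proof -
  have "convex hull {a, b, c} = (\<lambda>x. a + x) ` (tri_lin a b c ` std_simplex2)"
    using tri_set_image[of a b c] by (simp add: tri_set_def tri_param_lin[abs_def] image_image)
  then have "rel_interior (convex hull {a, b, c}) = (\<lambda>x. a + x) ` (tri_lin a b c ` rel_interior std_simplex2)"
    using rel_interior_injective_linear_image[OF _ tri_lin_inj[OF ne]] tri_lin_linear
    by (simp add: rel_interior_translation linear_conv_bounded_linear)
  then have "tri_param a b c p \<in> rel_interior (convex hull {a, b, c})" if "p \<in> interior std_simplex2" for p
    using that interior_subset_rel_interior[of std_simplex2] by (auto simp: tri_param_lin image_image)
  then have "{p \<in> std_simplex2. tri_param a b c p \<notin> rel_interior (convex hull {a, b, c})} \<subseteq> frontier std_simplex2"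
    using closure_subset[of std_simplex2] by (auto simp: frontier_def)
  then show ?thesis using negligible_convex_frontier[OF simplex2_facts(1)] negligible_subset by blast
qed

section \<open>Densities are determined by their integrals against test functions\<close>

abbreviation "simplex_measure \<equiv> lebesgue_on std_simplex2"

lemma simplex_measure_borel: "f \<in> borel_measurable borel \<Longrightarrow> f \<in> borel_measurable simplex_measure"
  by (intro measurable_restrict_space1 measurable_completion) simp

lemma tri_param_measurable [measurable]: "tri_param a b c \<in> borel_measurable borel"
  by (intro borel_measurable_continuous_onI tri_param_continuous)

lemma simplex_bounded_mult_integrable:
  fixes f :: "real \<times> real \<Rightarrow> real"
  assumes "integrable simplex_measure f" "g \<in> borel_measurable borel" "\<And>p. \<bar>g p\<bar> \<le> C"
  shows "integrable simplex_measure (\<lambda>p. f p * g p)"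
proof (rule Bochner_Integration.integrable_bound)
  show "integrable simplex_measure (\<lambda>p. C * f p)" using assms(1) by simp
  show "(\<lambda>p. f p * g p) \<in> borel_measurable simplex_measure"
    using assms(1) simplex_measure_borel[OF assms(2)] by measurable
  have "\<bar>g p\<bar> \<le> \<bar>C\<bar>" for p using assms(3)[of p] by linarith
  then show "AE p in simplex_measure. norm (f p * g p) \<le> norm (C * f p)"
    by (intro AE_I2) (auto simp: abs_mult mult.commute[of "\<bar>f p\<bar>" for p] intro!: mult_right_mono)
qed

text \<open>\<open>h\<close> is merely Lebesgue measurable while the test sets are Borel. A Borel
  version \<open>g\<close> has Borel sets of positivity and negativity, and testing on these two
  sets is enough.\<close>

lemma integral_zero_imp_AE_zero:
  fixes h :: "'a::euclidean_space \<Rightarrow> real"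
  assumes h: "integrable lebesgue h"
    and z: "\<And>A. A \<in> sets borel \<Longrightarrow> (\<integral>p. h p * indicator A p \<partial>lebesgue) = 0"
  shows "AE p in lebesgue. h p = 0"
proof -
  have hm: "h \<in> borel_measurable (completion lborel)" using h by simp
  obtain g where g: "g \<in> borel_measurable lborel" "AE p in lborel. h p = g p"
    using completion_ex_borel_measurable_real[OF hm] by blast
  note [measurable] = g(1)
  have gl: "AE p in lebesgue. h p = g p" using g(2) by (simp add: AE_completion_iff)
  have gm: "g \<in> borel_measurable lebesgue" using g(1) by (rule measurable_completion)
  have gi: "integrable lebesgue g" using integrable_cong_AE_imp[OF h gm] gl by (metis (mono_tags, lifting) AE_mp AE_I2)
  have *: "AE p in lebesgue. g p * indicator A p = 0" if A: "A \<in> sets borel" and nn: "\<And>p. s * (g p * indicator A p) \<ge> 0" and s: "s \<noteq> 0" for A s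
  proof -
    have Al: "A \<in> sets lebesgue" using A by simp
    have i: "integrable lebesgue (\<lambda>p. g p * indicator A p)" using integrable_real_mult_indicator[OF Al gi] .
    have "(\<integral>p. g p * indicator A p \<partial>lebesgue) = (\<integral>p. h p * indicator A p \<partial>lebesgue)"
    proof (rule integral_cong_AE)
      show "(\<lambda>p. g p * indicator A p) \<in> borel_measurable lebesgue" "(\<lambda>p. h p * indicator A p) \<in> borel_measurable lebesgue"
        using gm hm Al by measurable
      show "AE p in lebesgue. g p * indicator A p = h p * indicator A p" using gl by eventually_elim simp
    qed
    then have "(\<integral>p. s * (g p * indicator A p) \<partial>lebesgue) = 0" using z[OF A] by simp
    then have "AE p in lebesgue. s * (g p * indicator A p) = 0"
      using integral_nonneg_eq_0_iff_AE[OF integrable_mult_right[OF i, of s] AE_I2[OF nn]] by simp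
    then show ?thesis by eventually_elim (use s in simp)
  qed
  have "AE p in lebesgue. g p * indicator {p. g p > 0} p = 0"
    by (rule *[where s = 1]) (auto simp: indicator_def)
  moreover have "AE p in lebesgue. g p * indicator {p. g p < 0} p = 0"
    by (rule *[where s = "-1"]) (auto simp: indicator_def)
  ultimately show ?thesis using gl by eventually_elim (auto simp: indicator_def split: if_splits)
qed

text \<open>A triangle is seen separately from the others because distinct triangles only meet in null sets.\<close>
lemma surface_fundamental_lemma:
  fixes f :: "real^3 \<Rightarrow> real"
  assumes tr: "is_triangulation S Ts"
    and fi: "\<And>a b c. (a, b, c) \<in> Ts \<Longrightarrow> integrable simplex_measure (\<lambda>p. f (tri_param a b c p))"
    and U: "open U"
    and z: "\<And>\<phi> d\<phi>. test_fn \<phi> d\<phi> \<Longrightarrow> tsupp \<phi> \<subseteq> U \<Longrightarrow>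
      (\<Sum>(a, b, c)\<in>Ts. norm (cross3 (b - a) (c - a)) * (\<integral>p. f (tri_param a b c p) * \<phi> (tri_param a b c p) \<partial>simplex_measure)) = 0"
    and T: "(a0, b0, c0) \<in> Ts"
  shows "negligible {p \<in> std_simplex2. tri_param a0 b0 c0 p \<in> U \<and> f (tri_param a0 b0 c0 p) \<noteq> 0}"
proof -
  have fin: "finite Ts" and ne: "\<And>a b c. (a, b, c) \<in> Ts \<Longrightarrow> cross3 (b - a) (c - a) \<noteq> 0"
    and disj: "\<And>T1 T2. T1 \<in> Ts \<Longrightarrow> T2 \<in> Ts \<Longrightarrow> T1 \<noteq> T2 \<Longrightarrow> rel_interior (tri_set T1) \<inter> rel_interior (tri_set T2) = {}"
    using tr unfolding is_triangulation_def by auto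
  \<comment> \<open>The functional makes sense for all bounded Borel functions; the vanishing on
    test functions is extended to them by limits.\<close>
  define \<mu> where "\<mu> = (\<lambda>\<phi>. \<Sum>(a, b, c)\<in>Ts. norm (cross3 (b - a) (c - a)) * (\<integral>p. f (tri_param a b c p) * \<phi> (tri_param a b c p) \<partial>simplex_measure))"
  have ii: "integrable simplex_measure (\<lambda>p. f (tri_param a b c p) * \<phi> (tri_param a b c p))"
    if "(a, b, c) \<in> Ts" "\<phi> \<in> borel_measurable borel" "\<And>x. \<bar>\<phi> x\<bar> \<le> C" for a b c C \<phi>
  proof (rule simplex_bounded_mult_integrable[OF fi[OF that(1)], where C = C])
    note [measurable] = that(2)
    show "(\<lambda>p. \<phi> (tri_param a b c p)) \<in> borel_measurable borel" by measurable
  qed (rule that)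
  have \<mu>lim: "\<mu> \<phi> = 0" if m: "\<And>n. \<phi>n n \<in> borel_measurable borel" "\<And>n x. \<bar>\<phi>n n x\<bar> \<le> 1" and z: "\<And>n. \<mu> (\<phi>n n) = 0"
      and l: "\<And>x. (\<lambda>n. \<phi>n n x) \<longlonglongrightarrow> \<phi> x" for \<phi>n :: "nat \<Rightarrow> real^3 \<Rightarrow> real" and \<phi>
  proof -
    have \<phi>m[measurable]: "\<phi> \<in> borel_measurable borel" by (rule borel_measurable_LIMSEQ_real[OF l m(1)])
    note [measurable] = m(1)
    have "(\<lambda>n. \<mu> (\<phi>n n)) \<longlonglongrightarrow> \<mu> \<phi>"
      unfolding \<mu>_def split_def
    proof (intro tendsto_sum tendsto_mult tendsto_const)
      fix T assume T: "T \<in> Ts"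
      obtain a b c where T': "T = (a, b, c)" by (cases T)
      have fi': "integrable simplex_measure (\<lambda>p. f (tri_param a b c p))" using fi T T' by simp
      have "(\<lambda>n. \<integral>p. f (tri_param a b c p) * \<phi>n n (tri_param a b c p) \<partial>simplex_measure)
        \<longlonglongrightarrow> (\<integral>p. f (tri_param a b c p) * \<phi> (tri_param a b c p) \<partial>simplex_measure)"
      proof (rule integral_dominated_convergence[where w = "\<lambda>p. \<bar>f (tri_param a b c p)\<bar>"])
        have "(\<lambda>p. \<phi> (tri_param a b c p)) \<in> borel_measurable simplex_measure" "(\<lambda>p. \<phi>n n (tri_param a b c p)) \<in> borel_measurable simplex_measure" for n
          by (rule simplex_measure_borel, measurable)+
        then show "(\<lambda>p. f (tri_param a b c p) * \<phi> (tri_param a b c p)) \<in> borel_measurable simplex_measure"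
          "\<And>n. (\<lambda>p. f (tri_param a b c p) * \<phi>n n (tri_param a b c p)) \<in> borel_measurable simplex_measure"
          using borel_measurable_integrable[OF fi'] by (auto intro!: borel_measurable_times)
        show "AE p in simplex_measure. norm (f (tri_param a b c p) * \<phi>n n (tri_param a b c p)) \<le> \<bar>f (tri_param a b c p)\<bar>" for n
          using m(2) by (intro AE_I2) (auto simp: abs_mult intro!: mult_left_le)
        show "AE p in simplex_measure. (\<lambda>n. f (tri_param a b c p) * \<phi>n n (tri_param a b c p)) \<longlonglongrightarrow> f (tri_param a b c p) * \<phi> (tri_param a b c p)"
          by (intro AE_I2 tendsto_intros l)
      qed (use fi' in auto)
      then show "(\<lambda>n. \<integral>p. f (tri_param (fst T) (fst (snd T)) (snd (snd T)) p) * \<phi>n n (tri_param (fst T) (fst (snd T)) (snd (snd T)) p) \<partial>simplex_measure)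
        \<longlonglongrightarrow> (\<integral>p. f (tri_param (fst T) (fst (snd T)) (snd (snd T)) p) * \<phi> (tri_param (fst T) (fst (snd T)) (snd (snd T)) p) \<partial>simplex_measure)"
        by (simp add: T')
    qed
    then show ?thesis using z by (simp add: LIMSEQ_const_iff)
  qed
  have \<mu>add: "\<mu> (\<lambda>x. \<phi> x + s * \<psi> x) = \<mu> \<phi> + s * \<mu> \<psi>"
    if "\<phi> \<in> borel_measurable borel" "\<And>x. \<bar>\<phi> x\<bar> \<le> C" "\<psi> \<in> borel_measurable borel" "\<And>x. \<bar>\<psi> x\<bar> \<le> D" for \<phi> \<psi> s C D
  proof -
    have "(\<integral>p. f (tri_param a b c p) * (\<phi> (tri_param a b c p) + s * \<psi> (tri_param a b c p)) \<partial>simplex_measure)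
      = (\<integral>p. f (tri_param a b c p) * \<phi> (tri_param a b c p) \<partial>simplex_measure) + s * (\<integral>p. f (tri_param a b c p) * \<psi> (tri_param a b c p) \<partial>simplex_measure)"
      if "(a, b, c) \<in> Ts" for a b c
      using ii[OF that \<open>\<phi> \<in> _\<close> \<open>\<And>x. \<bar>\<phi> x\<bar> \<le> C\<close>] ii[OF that \<open>\<psi> \<in> _\<close> \<open>\<And>x. \<bar>\<psi> x\<bar> \<le> D\<close>]
      by (simp add: distrib_left mult.left_commute[of _ s])
    then show ?thesis unfolding \<mu>_def
      by (simp add: sum_distrib_left sum.distrib[symmetric] split_def distrib_left mult.left_commute[of s])
  qed
  have box0: "\<mu> (indicator (box \<alpha> \<beta>)) = 0" if "cbox \<alpha> \<beta> \<subseteq> U" for \<alpha> \<beta>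
  proof -
    obtain \<phi> d\<phi> where \<phi>: "\<And>n. test_fn (\<phi> n) (d\<phi> n)" "\<And>n. tsupp (\<phi> n) \<subseteq> cbox \<alpha> \<beta>"
      "\<And>n x. 0 \<le> \<phi> n x" "\<And>n x. \<phi> n x \<le> 1" "\<And>x. (\<lambda>n. \<phi> n x) \<longlonglongrightarrow> indicator (box \<alpha> \<beta>) x"
      apply (rule box_indicator_limit[of \<alpha> \<beta>])
      apply (rule that; assumption)
      done
    show ?thesis
    proof (rule \<mu>lim[OF _ _ _ \<phi>(5)])
      show "\<phi> n \<in> borel_measurable borel" for n by (rule borel_measurable_continuous_onI[OF test_fnD(4)[OF \<phi>(1)]])
      show "\<bar>\<phi> n x\<bar> \<le> 1" for n x using \<phi>(3,4)[of n x] by simp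
      show "\<mu> (\<phi> n) = 0" for n unfolding \<mu>_def by (rule z[OF \<phi>(1)]) (use \<phi>(2) that in blast)
    qed
  qed
  \<comment> \<open>Dynkin's argument, with boxes as generators stable under intersection.
    Intersecting with one fixed box keeps everything inside \<open>U\<close>, and provides the value
    on the whole space that the complement step needs.\<close>
  have borel0: "\<mu> (indicator (box \<alpha> \<beta> \<inter> N)) = 0" if sub: "cbox \<alpha> \<beta> \<subseteq> U" and N: "N \<in> sets borel" for \<alpha> \<beta> N
  proof -
    have N': "N \<in> sigma_sets UNIV (range (\<lambda>(a, b). box a b :: (real^3) set))"
      using N unfolding borel_eq_box by (simp add: sets_measure_of)
    have st: "Int_stable (range (\<lambda>(a, b). box a b :: (real^3) set))"
      by (auto simp: Int_stable_def box_Int_box)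
    have B: "box \<alpha> \<beta> \<in> sets borel" by simp
    have cl: "range (\<lambda>(a, b). box a b :: (real^3) set) \<subseteq> Pow UNIV" by simp
    from st cl N' show ?thesis
    proof (induction rule: sigma_sets_induct_disjoint)
      case (basic A)
      then obtain a b where A: "A = box a b" by auto
      have "box \<alpha> \<beta> \<inter> A = box (\<Sum>i\<in>Basis. max (\<alpha>\<bullet>i) (a\<bullet>i) *\<^sub>R i) (\<Sum>i\<in>Basis. min (\<beta>\<bullet>i) (b\<bullet>i) *\<^sub>R i)"
        unfolding A box_Int_box ..
      moreover have "cbox (\<Sum>i\<in>Basis. max (\<alpha>\<bullet>i) (a\<bullet>i) *\<^sub>R i) (\<Sum>i\<in>Basis. min (\<beta>\<bullet>i) (b\<bullet>i) *\<^sub>R i) \<subseteq> U"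
        using sub unfolding Int_interval[symmetric] by blast
      ultimately show ?case using box0 by simp
    next
      case empty
      then show ?case by (simp add: \<mu>_def)
    next
      case (compl A)
      then have A: "A \<in> sets borel" unfolding borel_eq_box by (simp add: sets_measure_of)
      have "indicator (box \<alpha> \<beta> \<inter> (UNIV - A)) = (\<lambda>x. indicator (box \<alpha> \<beta>) x + (-1) * indicator (box \<alpha> \<beta> \<inter> A) x :: real)"
        by (auto simp: indicator_def fun_eq_iff)
      moreover have "\<mu> (\<lambda>x. indicator (box \<alpha> \<beta>) x + (-1) * indicator (box \<alpha> \<beta> \<inter> A) x) = \<mu> (indicator (box \<alpha> \<beta>)) + (-1) * \<mu> (indicator (box \<alpha> \<beta> \<inter> A))"
        by (rule \<mu>add[where C = 1 and D = 1]) (use A B in \<open>auto simp: indicator_def\<close>)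
      ultimately show ?case using compl.IH box0[OF sub] by simp
    next
      case (union A)
      have A: "A i \<in> sets borel" for i using union.hyps unfolding borel_eq_box by (auto simp: sets_measure_of)
      have Am: "indicator (box \<alpha> \<beta> \<inter> (\<Union>i\<in>I. A i)) \<in> borel_measurable borel" if "finite I" for I :: "nat set"
        using A B that by (intro borel_measurable_indicator sets.Int sets.finite_UN) auto
      have fin0: "\<mu> (indicator (box \<alpha> \<beta> \<inter> (\<Union>i<n. A i))) = 0" for n
      proof (induction n)
        case 0 then show ?case by (simp add: \<mu>_def)
      next
        case (Suc n)
        have e: "indicator (box \<alpha> \<beta> \<inter> (\<Union>i<Suc n. A i)) = (\<lambda>x. indicator (box \<alpha> \<beta> \<inter> (\<Union>i<n. A i)) x + 1 * indicator (box \<alpha> \<beta> \<inter> A n) x :: real)"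
        proof
          fix x
          have "A i \<inter> A n = {}" if "i < n" for i
            using union.hyps(1) that by (auto simp: disjoint_family_on_def)
          then have "x \<notin> A i" if "x \<in> A n" "i < n" for i using that by blast
          then show "indicator (box \<alpha> \<beta> \<inter> (\<Union>i<Suc n. A i)) x
              = (indicator (box \<alpha> \<beta> \<inter> (\<Union>i<n. A i)) x + 1 * indicator (box \<alpha> \<beta> \<inter> A n) x :: real)"
            by (cases "x \<in> A n"; cases "x \<in> (\<Union>i<n. A i)") (auto simp: indicator_def lessThan_Suc)
        qed
        have "\<mu> (\<lambda>x. indicator (box \<alpha> \<beta> \<inter> (\<Union>i<n. A i)) x + 1 * indicator (box \<alpha> \<beta> \<inter> A n) x)
          = \<mu> (indicator (box \<alpha> \<beta> \<inter> (\<Union>i<n. A i))) + 1 * \<mu> (indicator (box \<alpha> \<beta> \<inter> A n))"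
          by (rule \<mu>add[where C = 1 and D = 1]) (use A B Am[of "{..<n}"] in \<open>auto simp: indicator_def\<close>)
        then show ?case using Suc union.IH[of n] unfolding e by simp
      qed
      show ?case
      proof (rule \<mu>lim[OF _ _ fin0])
        show "indicator (box \<alpha> \<beta> \<inter> (\<Union>i<n. A i)) \<in> borel_measurable borel" for n by (rule Am) simp
        fix x
        have "(\<lambda>n. indicator (\<Union>i<n. A i) x :: real) \<longlonglongrightarrow> indicator (\<Union>i. A i) x" by (rule LIMSEQ_indicator_UN)
        then have "(\<lambda>n. indicator (box \<alpha> \<beta>) x * indicator (\<Union>i<n. A i) x :: real) \<longlonglongrightarrow> indicator (box \<alpha> \<beta>) x * indicator (\<Union>i. A i) x"
          by (intro tendsto_intros)
        then show "(\<lambda>n. indicator (box \<alpha> \<beta> \<inter> (\<Union>i<n. A i)) x :: real) \<longlonglongrightarrow> indicator (box \<alpha> \<beta> \<inter> (\<Union>i. A i)) x"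
          by (simp add: indicator_inter_arith)
      qed (auto simp: indicator_def)
    qed
  qed
  define others where "others = (\<Union>T\<in>Ts - {(a0, b0, c0)}. tri_set T)"
  have othm: "others \<in> sets borel" unfolding others_def using fin tri_set_facts(4) by (intro sets.finite_UN) auto
  \<comment> \<open>The linear left inverse recovers parameters from points, so that sets of
    parameters become Borel sets in space without any statement about images.\<close>
  obtain L where L: "linear L" "L \<circ> tri_lin a0 b0 c0 = id"
    using linear_injective_left_inverse[OF tri_lin_linear tri_lin_inj[OF ne[OF T]]] by blast
  have Lm[measurable]: "L \<in> borel_measurable borel"
    by (intro borel_measurable_continuous_onI linear_continuous_on L(1)[unfolded linear_conv_bounded_linear])
  have Lp: "L (tri_param a0 b0 c0 p - a0) = p" for p
    using fun_cong[OF L(2), of p] by (simp add: tri_param_lin)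
  define c where "c = norm (cross3 (b0 - a0) (c0 - a0))"
  have c: "c > 0" using ne[OF T] by (simp add: c_def)
  define g where "g = (\<lambda>p. f (tri_param a0 b0 c0 p))"
  have boxnull: "negligible {p \<in> std_simplex2. tri_param a0 b0 c0 p \<in> box \<alpha> \<beta> \<and> g p \<noteq> 0}" if sub: "cbox \<alpha> \<beta> \<subseteq> U" for \<alpha> \<beta>
  proof -
    define E where "E = {p. tri_param a0 b0 c0 p \<in> box \<alpha> \<beta> \<and> tri_param a0 b0 c0 p \<notin> others}"
    have E[measurable]: "E \<in> sets borel"
      unfolding E_def using othm by measurable
    define h where "h = (\<lambda>p. indicator std_simplex2 p * (g p * indicator E p))"
    have gi: "integrable simplex_measure g" unfolding g_def by (rule fi[OF T])
    have gE: "integrable simplex_measure (\<lambda>p. g p * indicator E p)"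
      by (rule simplex_bounded_mult_integrable[OF gi, where C = 1]) (auto simp: indicator_def)
    have ssl: "std_simplex2 \<in> sets lebesgue" using simplex2_facts(3) by simp
    have hi: "integrable lebesgue h"
      using gE ssl by (simp add: integrable_restrict_space h_def)
    have "AE p in lebesgue. h p = 0"
    proof (rule integral_zero_imp_AE_zero[OF hi])
      fix A :: "(real \<times> real) set" assume A[measurable]: "A \<in> sets borel"
      \<comment> \<open>The part of the chosen triangle with parameters in \<open>A\<close>, minus
        all other triangles. On its indicator only one summand of \<open>\<mu>\<close> survives, and
        that summand is the integral of \<open>g\<close> over a set of parameters.\<close>
      define N where "N = {x. x \<in> tri_set (a0, b0, c0) \<and> x \<notin> others \<and> L (x - a0) \<in> A}"
      have Nm: "N \<in> sets borel"
        unfolding N_def using othm tri_set_facts(4)[of "(a0, b0, c0)"] by measurable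
      have oth: "indicator (box \<alpha> \<beta> \<inter> N) (tri_param a b c p) = (0::real)" if "(a, b, c) \<in> Ts" "(a, b, c) \<noteq> (a0, b0, c0)" "p \<in> std_simplex2" for a b c p
      proof -
        have "tri_param a b c p \<in> others" using that tri_set_image[of a b c] unfolding others_def by blast
        then show ?thesis by (simp add: N_def indicator_def)
      qed
      have self: "indicator (box \<alpha> \<beta> \<inter> N) (tri_param a0 b0 c0 p) = (indicator E p * indicator A p :: real)" if "p \<in> std_simplex2" for p
        using that tri_set_image[of a0 b0 c0] by (auto simp: N_def E_def Lp indicator_def)
      have "0 = \<mu> (indicator (box \<alpha> \<beta> \<inter> N))" using borel0[OF sub Nm] by simp
      also have "\<dots> = (\<Sum>T\<in>Ts. if T = (a0, b0, c0) then c * (\<integral>p. g p * (indicator E p * indicator A p) \<partial>simplex_measure) else 0)"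
        unfolding \<mu>_def
      proof (rule sum.cong[OF refl], clarify)
        fix a b c' assume abc: "(a, b, c') \<in> Ts"
        show "norm (cross3 (b - a) (c' - a)) * (\<integral>p. f (tri_param a b c' p) * indicator (box \<alpha> \<beta> \<inter> N) (tri_param a b c' p) \<partial>simplex_measure)
          = (if (a, b, c') = (a0, b0, c0) then c * (\<integral>p. g p * (indicator E p * indicator A p) \<partial>simplex_measure) else 0)"
        proof (cases "(a, b, c') = (a0, b0, c0)")
          case True
          then show ?thesis unfolding c_def g_def
            by (auto intro!: Bochner_Integration.integral_cong simp: self)
        next
          case False
          have "(\<integral>p. f (tri_param a b c' p) * indicator (box \<alpha> \<beta> \<inter> N) (tri_param a b c' p) \<partial>simplex_measure) = (\<integral>p. 0 \<partial>simplex_measure)"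
            by (rule Bochner_Integration.integral_cong[OF refl]) (use oth[OF abc False] in auto)
          then show ?thesis unfolding if_not_P[OF False] by simp
        qed
      qed
      also have "\<dots> = c * (\<integral>p. g p * (indicator E p * indicator A p) \<partial>simplex_measure)"
        using fin T by simp
      finally have "(\<integral>p. g p * (indicator E p * indicator A p) \<partial>simplex_measure) = 0" using c by simp
      then show "(\<integral>p. h p * indicator A p \<partial>lebesgue) = 0"
        using ssl by (simp add: integral_restrict_space h_def mult.assoc)
    qed
    then have ae: "AE p in lebesgue. p \<notin> {p. h p \<noteq> 0}" by simp
    have [measurable]: "h \<in> borel_measurable lebesgue" using hi by simp
    have "{p \<in> space lebesgue. h p \<noteq> 0} \<in> sets lebesgue" by measurable
    then have "{p. h p \<noteq> 0} \<in> sets lebesgue" by simp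
    then have n1: "negligible {p. h p \<noteq> 0}"
      unfolding negligible_iff_null_sets using AE_iff_null_sets ae by blast
    \<comment> \<open>The removed overlaps are null in the parameter plane, so the density vanishes
      almost everywhere on the whole triangle within the box.\<close>
    have "negligible (\<Union>T\<in>Ts - {(a0, b0, c0)}. {p \<in> std_simplex2. tri_param a0 b0 c0 p \<in> tri_set T})"
    proof (rule negligible_Union[of "(\<lambda>T. {p \<in> std_simplex2. tri_param a0 b0 c0 p \<in> tri_set T}) ` (Ts - {(a0, b0, c0)})"])
      show "finite ((\<lambda>T. {p \<in> std_simplex2. tri_param a0 b0 c0 p \<in> tri_set T}) ` (Ts - {(a0, b0, c0)}))" using fin by simp
      show "negligible t" if "t \<in> (\<lambda>T. {p \<in> std_simplex2. tri_param a0 b0 c0 p \<in> tri_set T}) ` (Ts - {(a0, b0, c0)})" for t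
        using that tri_overlap_negligible[OF ne[OF T] disj[OF T]] by blast
    qed
    with n1 have "negligible ({p. h p \<noteq> 0} \<union> (\<Union>T\<in>Ts - {(a0, b0, c0)}. {p \<in> std_simplex2. tri_param a0 b0 c0 p \<in> tri_set T}))"
      by (rule negligible_Un)
    then show ?thesis
      by (rule negligible_subset) (auto simp: h_def E_def others_def indicator_def)
  qed
  show ?thesis
  proof (rule locally_negligible_alt[THEN iffD2], rule ballI)
    define X where "X = {p \<in> std_simplex2. tri_param a0 b0 c0 p \<in> U \<and> f (tri_param a0 b0 c0 p) \<noteq> 0}"
    fix p assume "p \<in> {p \<in> std_simplex2. tri_param a0 b0 c0 p \<in> U \<and> f (tri_param a0 b0 c0 p) \<noteq> 0}"
    then have p: "p \<in> X" "tri_param a0 b0 c0 p \<in> U" by (auto simp: X_def)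
    obtain \<alpha> \<beta> where ab: "cbox \<alpha> \<beta> \<subseteq> U" "tri_param a0 b0 c0 p \<in> box \<alpha> \<beta>"
      using open_contains_cbox[OF U p(2)] by metis
    have op: "open (tri_param a0 b0 c0 -` box \<alpha> \<beta>)"
      by (rule open_vimage[OF open_box tri_param_continuous])
    have "negligible (X \<inter> tri_param a0 b0 c0 -` box \<alpha> \<beta>)"
      by (rule negligible_subset[OF boxnull[OF ab(1)]]) (auto simp: X_def g_def)
    moreover have "openin (top_of_set X) (X \<inter> tri_param a0 b0 c0 -` box \<alpha> \<beta>)"
      using op by (rule openin_open_Int)
    ultimately show "\<exists>T. openin (top_of_set {p \<in> std_simplex2. tri_param a0 b0 c0 p \<in> U \<and> f (tri_param a0 b0 c0 p) \<noteq> 0}) T \<and> p \<in> T \<and> negligible T"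
      unfolding X_def[symmetric] using p ab(2) by blast
  qed
qed

lemma negligible_finite_UN:
  "finite I \<Longrightarrow> (\<And>i. i \<in> I \<Longrightarrow> negligible (N i)) \<Longrightarrow> negligible (\<Union>i\<in>I. N i)"
  by (intro negligible_Union) auto

lemma integrable_AE_lebesgue:
  fixes F :: "'a::euclidean_space \<Rightarrow> 'b::euclidean_space"
  assumes "integrable lebesgue F" "AE x in lebesgue. F x = G x"
  shows "integrable lebesgue G"
  using integrable_cong_AE_imp[OF assms(1) borel_measurable_AE[OF borel_measurable_integrable[OF assms(1)] assms(2)] assms(2)] .

lemma simplex_sets: "std_simplex2 \<in> sets lebesgue" "std_simplex2 \<inter> space lebesgue \<in> sets lebesgue"
  using simplex2_facts(3) by simp_all

lemma simplex_L2_integrable: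
  assumes "L2_on std_simplex2 f" shows "integrable simplex_measure f"
proof (rule Bochner_Integration.integrable_bound)
  have "emeasure lebesgue std_simplex2 < \<infinity>"
    using emeasure_compact_finite[OF simplex2_facts(2)] simplex2_facts(3) by simp
  then have "integrable lebesgue (indicator std_simplex2 :: real \<times> real \<Rightarrow> real)"
    using simplex_sets by (intro integrable_real_indicator) auto
  then have "integrable simplex_measure (\<lambda>p. 1 :: real)"
    by (simp add: integrable_restrict_space[OF simplex_sets(2)])
  then show "integrable simplex_measure (\<lambda>p. 1 + (norm (f p))\<^sup>2)"
    using assms by (auto simp: L2_on_def)
  show "f \<in> borel_measurable simplex_measure" using assms by (simp add: L2_on_def)
  have "a \<le> 1 + a\<^sup>2" for a :: real
  proof -
    have "0 \<le> (a - 1/2)\<^sup>2" by simp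
    then have "a \<le> a\<^sup>2 + (1 / 2)\<^sup>2" by (simp add: power2_diff)
    then show ?thesis by (simp add: power2_eq_square)
  qed
  then show "AE p in simplex_measure. norm (f p) \<le> norm (1 + (norm (f p))\<^sup>2)"
    by (intro AE_I2) (auto simp: abs_of_nonneg intro: order.trans)
qed

section \<open>Surfaces of class P, their normals and real parts of surface integrals\<close>

lemma tris_triangulation: "class_P \<Gamma> \<Longrightarrow> is_triangulation (closure \<Gamma>) (tris \<Gamma>)"
  unfolding class_P_def tris_def by (metis someI_ex)

lemma tris_props:
  assumes "class_P \<Gamma>"
  shows "finite (tris \<Gamma>)" "\<And>a b c. (a, b, c) \<in> tris \<Gamma> \<Longrightarrow> cross3 (b - a) (c - a) \<noteq> 0"
    "closure \<Gamma> = (\<Union>T\<in>tris \<Gamma>. tri_set T)"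
    "\<And>a b c p. (a, b, c) \<in> tris \<Gamma> \<Longrightarrow> p \<in> std_simplex2 \<Longrightarrow> tri_param a b c p \<in> closure \<Gamma>"
proof -
  note t = tris_triangulation[OF assms, unfolded is_triangulation_def]
  show "finite (tris \<Gamma>)" "\<And>a b c. (a, b, c) \<in> tris \<Gamma> \<Longrightarrow> cross3 (b - a) (c - a) \<noteq> 0" using t by auto
  show e: "closure \<Gamma> = (\<Union>T\<in>tris \<Gamma>. tri_set T)" using t by blast
  show "tri_param a b c p \<in> closure \<Gamma>" if "(a, b, c) \<in> tris \<Gamma>" "p \<in> std_simplex2" for a b c p
    unfolding e using that tri_set_image[of a b c] by blast
qed

lemma class_P_closure:
  assumes "class_P \<Gamma>" shows "compact (closure \<Gamma>)" "negligible (closure \<Gamma>)"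
proof -
  show "compact (closure \<Gamma>)" unfolding tris_props(3)[OF assms]
    by (intro compact_UN tris_props(1)[OF assms] tri_set_facts(1))
  show "negligible (closure \<Gamma>)" unfolding tris_props(3)[OF assms]
    by (intro negligible_finite_UN tris_props(1)[OF assms] tri_set_facts(5))
qed

lemma normal_ae:
  assumes "class_P \<Gamma>" "unit_normal_on \<Gamma> n" "(a, b, c) \<in> tris \<Gamma>"
  obtains \<nu> where "norm \<nu> = 1" "negligible {p \<in> std_simplex2. n (tri_param a b c p) \<noteq> \<nu>}"
proof -
  let ?k = "cross3 (b - a) (c - a)"
  have ne: "?k \<noteq> 0" using tris_props(2)[OF assms(1,3)] .
  obtain \<sigma> :: real where \<sigma>: "\<sigma> \<in> {1, -1}" "\<And>x. x \<in> rel_interior (convex hull {a, b, c}) \<Longrightarrow> n x = (\<sigma> / norm ?k) *\<^sub>R ?k"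
    using bspec[OF assms(2)[unfolded unit_normal_on_def] assms(3)] unfolding prod.case by metis
  show thesis
  proof (rule that)
    show "norm ((\<sigma> / norm ?k) *\<^sub>R ?k) = 1"
    proof -
      have "\<bar>\<sigma>\<bar> = 1" using \<sigma>(1) by auto
      then show ?thesis using ne by simp
    qed
    show "negligible {p \<in> std_simplex2. n (tri_param a b c p) \<noteq> (\<sigma> / norm ?k) *\<^sub>R ?k}"
    proof (rule negligible_subset[OF tri_rel_interior_ae[OF ne]], clarify)
      fix p assume "n (tri_param a b c p) \<noteq> (\<sigma> / norm ?k) *\<^sub>R ?k" "tri_param a b c p \<in> rel_interior (convex hull {a, b, c})"
      then show False using \<sigma>(2) by blast
    qed
  qed
qed

lemma negligible_AE: "negligible N \<Longrightarrow> AE x in lebesgue. x \<notin> N"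
  by (simp add: negligible_iff_null_sets AE_not_in)

text \<open>The normal field is an arbitrary function off the relative interiors. Measurability of
  the product comes from replacing it on each triangle by the constant vector that it equals almost
  everywhere.\<close>

lemma surf_density_integrable:
  assumes "class_P \<Gamma>" "unit_normal_on \<Gamma> n" "surf_L2 \<Gamma> g" "(a, b, c) \<in> tris \<Gamma>"
  shows "integrable simplex_measure (\<lambda>p. g (tri_param a b c p) * of_real (n (tri_param a b c p) $ j))"
proof -
  obtain \<nu> where \<nu>: "negligible {p \<in> std_simplex2. n (tri_param a b c p) \<noteq> \<nu>}"
    using normal_ae[OF assms(1,2,4)] by blast
  have "integrable simplex_measure (\<lambda>p. g (tri_param a b c p))"
    using assms(3,4) unfolding surf_L2_def by (intro simplex_L2_integrable) blast
  then have "integrable simplex_measure (\<lambda>p. g (tri_param a b c p) * of_real (\<nu> $ j))" by simp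
  then have "integrable lebesgue (\<lambda>p. indicator std_simplex2 p *\<^sub>R (g (tri_param a b c p) * of_real (\<nu> $ j)))"
    by (simp only: integrable_restrict_space[OF simplex_sets(2)])
  then have "integrable lebesgue (\<lambda>p. indicator std_simplex2 p *\<^sub>R (g (tri_param a b c p) * of_real (n (tri_param a b c p) $ j)))"
    by (rule integrable_AE_lebesgue) (use negligible_AE[OF \<nu>] in \<open>eventually_elim, auto simp: indicator_def\<close>)
  then show ?thesis by (simp only: integrable_restrict_space[OF simplex_sets(2)])
qed

lemma simplex_test_mult_integrable:
  fixes F :: "real \<times> real \<Rightarrow> complex"
  assumes "integrable simplex_measure F" "test_fn \<phi> d\<phi>"
  shows "integrable simplex_measure (\<lambda>p. F p * of_real (\<phi> (tri_param a b c p)))"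
proof -
  note T = test_fnD[OF assms(2)]
  obtain B where B: "B \<ge> 0" "\<And>x. \<bar>\<phi> x\<bar> \<le> B"
    using continuous_compact_support_bounded[OF T(4,5,7)] by blast
  have m: "(\<lambda>p. \<phi> (tri_param a b c p)) \<in> borel_measurable simplex_measure"
    by (intro simplex_measure_borel borel_measurable_continuous_onI continuous_on_compose2[OF T(4) tri_param_continuous]) simp
  show ?thesis
  proof (rule Bochner_Integration.integrable_bound)
    show "integrable simplex_measure (\<lambda>p. B * norm (F p))" using assms(1) by simp
    show "(\<lambda>p. F p * of_real (\<phi> (tri_param a b c p))) \<in> borel_measurable simplex_measure"
      using assms(1) m by measurable
    show "AE p in simplex_measure. norm (F p * of_real (\<phi> (tri_param a b c p))) \<le> norm (B * norm (F p))"
      using B by (intro AE_I2) (simp add: norm_mult mult.commute[of "cmod (F p)" for p] mult_right_mono)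
  qed
qed

text \<open>Ranges over the real and the imaginary part. Since \<open>k\<close> and the weights are
  real, both parts of a solution satisfy the same real equations, and everything is proved once for
  real functions.\<close>

definition real_part_fun :: "(complex \<Rightarrow> real) \<Rightarrow> bool" where
  "real_part_fun c \<longleftrightarrow> c = Re \<or> c = Im"

lemma real_part_fun:
  assumes "real_part_fun c"
  shows "bounded_linear c" "c (z * of_real r) = c z * r" "c (of_real r * z) = r * c z" "\<bar>c z\<bar> \<le> norm z"
    "c (z + w) = c z + c w" "c (z - w) = c z - c w" "c (- z) = - c z" "c 0 = 0" "c (sum f A) = (\<Sum>i\<in>A. c (f i))"
  using assms abs_Re_le_cmod abs_Im_le_cmod
  by (auto simp: real_part_fun_def bounded_linear_Re bounded_linear_Im)

lemma complex_zero_parts: "(\<And>c. real_part_fun c \<Longrightarrow> c z = 0) \<Longrightarrow> z = 0"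
  by (auto simp: real_part_fun_def complex_eq_iff)

lemma surf_int_real_part:
  assumes c: "real_part_fun cc"
    and F: "\<And>a b c. (a, b, c) \<in> tris \<Gamma> \<Longrightarrow> integrable simplex_measure (\<lambda>p. F (tri_param a b c p))"
    and \<phi>: "test_fn \<phi> d\<phi>"
  shows "cc (surf_int \<Gamma> (\<lambda>x. F x * of_real (\<phi> x))) =
    (\<Sum>(a, b, c)\<in>tris \<Gamma>. norm (cross3 (b - a) (c - a)) * (\<integral>p. cc (F (tri_param a b c p)) * \<phi> (tri_param a b c p) \<partial>simplex_measure))"
proof -
  have "cc (of_real (norm (cross3 (b - a) (c - a))) * (\<integral>p. F (tri_param a b c p) * of_real (\<phi> (tri_param a b c p)) \<partial>simplex_measure))
     = norm (cross3 (b - a) (c - a)) * (\<integral>p. cc (F (tri_param a b c p)) * \<phi> (tri_param a b c p) \<partial>simplex_measure)" if "(a, b, c) \<in> tris \<Gamma>" for a b c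
    using integral_bounded_linear[OF real_part_fun(1)[OF c] simplex_test_mult_integrable[OF F[OF that] \<phi>, of a b c]]
    by (simp add: real_part_fun[OF c])
  then show ?thesis unfolding surf_int_def real_part_fun(9)[OF c] by (intro sum.cong) auto
qed

lemma surf_int_vanish:
  assumes "class_P \<Gamma>" "\<And>x. x \<in> closure \<Gamma> \<Longrightarrow> F x = 0"
  shows "surf_int \<Gamma> F = 0"
  unfolding surf_int_def
proof (rule sum.neutral, clarify)
  fix a b c assume T: "(a, b, c) \<in> tris \<Gamma>"
  have "(\<integral>p. F (tri_param a b c p) \<partial>simplex_measure) = (\<integral>p. 0 \<partial>simplex_measure)"
    by (rule Bochner_Integration.integral_cong[OF refl]) (use assms(2) tris_props(4)[OF assms(1) T] in auto)
  then show "of_real (norm (cross3 (b - a) (c - a))) * (\<integral>p. F (tri_param a b c p) \<partial>simplex_measure) = 0" by simp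
qed

lemma surf_density_zero:
  assumes P: "class_P \<Gamma>" and U: "open U"
    and F: "\<And>a b c. (a, b, c) \<in> tris \<Gamma> \<Longrightarrow> integrable simplex_measure (\<lambda>p. F (tri_param a b c p))"
    and z: "\<And>\<phi> d\<phi>. test_fn \<phi> d\<phi> \<Longrightarrow> tsupp \<phi> \<subseteq> U \<Longrightarrow> surf_int \<Gamma> (\<lambda>x. F x * of_real (\<phi> x)) = 0"
    and T: "(a, b, c) \<in> tris \<Gamma>"
  shows "negligible {p \<in> std_simplex2. tri_param a b c p \<in> U \<and> F (tri_param a b c p) \<noteq> 0}"
proof -
  have "negligible {p \<in> std_simplex2. tri_param a b c p \<in> U \<and> cc (F (tri_param a b c p)) \<noteq> 0}" if cc: "real_part_fun cc" for cc
  proof (rule surface_fundamental_lemma[OF tris_triangulation[OF P] _ U _ T, where f = "\<lambda>x. cc (F x)"])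
    show "integrable simplex_measure (\<lambda>p. cc (F (tri_param a b c p)))" if "(a, b, c) \<in> tris \<Gamma>" for a b c
      by (rule integrable_bounded_linear[OF real_part_fun(1)[OF cc] F[OF that]])
    fix \<phi> d\<phi> assume \<phi>: "test_fn \<phi> d\<phi>" "tsupp \<phi> \<subseteq> U"
    show "(\<Sum>(a, b, c)\<in>tris \<Gamma>. norm (cross3 (b - a) (c - a)) * (\<integral>p. cc (F (tri_param a b c p)) * \<phi> (tri_param a b c p) \<partial>simplex_measure)) = 0"
    proof -
      have "cc (surf_int \<Gamma> (\<lambda>x. F x * of_real (\<phi> x))) =
        (\<Sum>(a, b, c)\<in>tris \<Gamma>. norm (cross3 (b - a) (c - a)) * (\<integral>p. cc (F (tri_param a b c p)) * \<phi> (tri_param a b c p) \<partial>simplex_measure))"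
        by (rule surf_int_real_part[OF cc F \<phi>(1)])
      then show ?thesis unfolding z[OF \<phi>] real_part_fun(8)[OF cc] by (rule sym)
    qed
  qed
  from this[of Re] this[of Im]
  have "negligible ({p \<in> std_simplex2. tri_param a b c p \<in> U \<and> Re (F (tri_param a b c p)) \<noteq> 0}
     \<union> {p \<in> std_simplex2. tri_param a b c p \<in> U \<and> Im (F (tri_param a b c p)) \<noteq> 0})"
    by (intro negligible_Un) (auto simp: real_part_fun_def)
  then show ?thesis by (rule negligible_subset) (auto simp: complex_eq_iff)
qed

section \<open>Recovering the surface and the jump from the double layer\<close>

lemma open_lower_half: "open lower_half"
  unfolding lower_half_def by (intro open_Collect_less continuous_intros)

text \<open>Off the second surface the second double layer is invisible, so the density
  \<open>g1 n1\<close> vanishes there. A unit normal has a nonzero component, so \<open>g1\<close>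
  itself vanishes; full support then leaves no point of the first surface off the closure of the
  second.\<close>

lemma surface_support_subset:
  assumes P1: "class_P \<Gamma>1" "closure \<Gamma>1 \<subseteq> lower_half" "unit_normal_on \<Gamma>1 n1" "surf_L2 \<Gamma>1 g1" "full_support \<Gamma>1 g1"
    and P2: "class_P \<Gamma>2"
    and eq: "\<And>\<phi> d\<phi> j. test_fn \<phi> d\<phi> \<Longrightarrow> tsupp \<phi> \<subseteq> lower_half \<Longrightarrow>
       surf_int \<Gamma>1 (\<lambda>x. g1 x * of_real (n1 x $ j) * of_real (\<phi> x)) = surf_int \<Gamma>2 (\<lambda>x. g2 x * of_real (n2 x $ j) * of_real (\<phi> x))"
  shows "closure \<Gamma>1 \<subseteq> closure \<Gamma>2"
proof -
  define U where "U = lower_half - closure \<Gamma>2"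
  have U: "open U" unfolding U_def by (intro open_Diff open_lower_half closed_closure)
  have zero: "negligible {p \<in> std_simplex2. tri_param a b c p \<in> U \<and> g1 (tri_param a b c p) \<noteq> 0}" if T: "(a, b, c) \<in> tris \<Gamma>1" for a b c
  proof -
    have nj: "negligible {p \<in> std_simplex2. tri_param a b c p \<in> U \<and> g1 (tri_param a b c p) * of_real (n1 (tri_param a b c p) $ j) \<noteq> 0}" for j
    proof (rule surf_density_zero[OF P1(1) U surf_density_integrable[OF P1(1,3,4)] _ T])
      fix \<phi> d\<phi> assume \<phi>: "test_fn \<phi> d\<phi>" "tsupp \<phi> \<subseteq> U"
      have "\<phi> x = 0" if "x \<in> closure \<Gamma>2" for x using \<phi> that test_fnD(5)[OF \<phi>(1), of x] by (auto simp: U_def)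
      then have "surf_int \<Gamma>2 (\<lambda>x. g2 x * of_real (n2 x $ j) * of_real (\<phi> x)) = 0"
        by (intro surf_int_vanish[OF P2]) simp
      then show "surf_int \<Gamma>1 (\<lambda>x. g1 x * of_real (n1 x $ j) * of_real (\<phi> x)) = 0"
        using eq[OF \<phi>(1), of j] \<phi>(2) by (auto simp: U_def)
    qed
    obtain \<nu> where \<nu>: "norm \<nu> = 1" "negligible {p \<in> std_simplex2. n1 (tri_param a b c p) \<noteq> \<nu>}"
      using normal_ae[OF P1(1,3) T] by blast
    then have "\<nu> \<noteq> 0" by auto
    then obtain j where j: "\<nu> $ j \<noteq> 0" by (auto simp: vec_eq_iff)
    have "negligible ({p \<in> std_simplex2. n1 (tri_param a b c p) \<noteq> \<nu>} \<union>
      {p \<in> std_simplex2. tri_param a b c p \<in> U \<and> g1 (tri_param a b c p) * of_real (n1 (tri_param a b c p) $ j) \<noteq> 0})"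
      by (intro negligible_Un \<nu> nj)
    then show ?thesis by (rule negligible_subset) (use j in auto)
  qed
  have "\<Gamma>1 \<subseteq> closure \<Gamma>2"
  proof
    fix x assume x: "x \<in> \<Gamma>1"
    show "x \<in> closure \<Gamma>2"
    proof (rule ccontr)
      assume "x \<notin> closure \<Gamma>2"
      then have "x \<in> U" using x P1(2) closure_subset[of \<Gamma>1] by (auto simp: U_def)
      then obtain r where r: "r > 0" "ball x r \<subseteq> U" using U by (meson openE)
      have "surf_ae \<Gamma>1 (\<lambda>y. y \<in> ball x r \<longrightarrow> g1 y = 0)"
        unfolding surf_ae_def
      proof (intro exI conjI ballI impI)
        show "surf_null \<Gamma>1 {y \<in> ball x r. g1 y \<noteq> 0}"
          unfolding surf_null_def
        proof clarify
          fix a b c assume T: "(a, b, c) \<in> tris \<Gamma>1"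
          have "negligible {p \<in> std_simplex2. tri_param a b c p \<in> {y \<in> ball x r. g1 y \<noteq> 0}}"
            by (rule negligible_subset[OF zero[OF T]]) (use r in auto)
          then show "{p \<in> std_simplex2. tri_param a b c p \<in> {y \<in> ball x r. g1 y \<noteq> 0}} \<in> null_sets lebesgue"
            by (simp only: negligible_iff_null_sets)
        qed
      qed auto
      then show False using P1(5) x r(1) unfolding full_support_def by blast
    qed
  qed
  then show ?thesis by (intro closure_minimal) auto
qed

text \<open>What a double layer determines is the vector density \<open>g n\<close>, which does not
  change when the normal and with it the jump switch sign. Hence the conclusion compares these
  products and not the jumps alone.\<close>

lemma surface_determined:
  assumes P1: "class_P \<Gamma>1" "closure \<Gamma>1 \<subseteq> lower_half" "unit_normal_on \<Gamma>1 n1" "surf_L2 \<Gamma>1 g1" "full_support \<Gamma>1 g1"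
    and P2: "class_P \<Gamma>2" "closure \<Gamma>2 \<subseteq> lower_half" "unit_normal_on \<Gamma>2 n2" "surf_L2 \<Gamma>2 g2" "full_support \<Gamma>2 g2"
    and eq: "\<And>\<phi> d\<phi> j. test_fn \<phi> d\<phi> \<Longrightarrow> tsupp \<phi> \<subseteq> lower_half \<Longrightarrow>
       surf_int \<Gamma>1 (\<lambda>x. g1 x * of_real (n1 x $ j) * of_real (\<phi> x)) = surf_int \<Gamma>2 (\<lambda>x. g2 x * of_real (n2 x $ j) * of_real (\<phi> x))"
  shows "closure \<Gamma>1 = closure \<Gamma>2 \<and> surf_ae \<Gamma>1 (\<lambda>x. \<forall>j. g1 x * of_real (n1 x $ j) = g2 x * of_real (n2 x $ j))"
proof
  show cl: "closure \<Gamma>1 = closure \<Gamma>2"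
  proof
    show "closure \<Gamma>1 \<subseteq> closure \<Gamma>2" by (rule surface_support_subset[OF P1 P2(1)]) (rule eq)
    show "closure \<Gamma>2 \<subseteq> closure \<Gamma>1" by (rule surface_support_subset[OF P2 P1(1)]) (rule eq[symmetric])
  qed
  \<comment> \<open>The triangulation is chosen from the closure alone, so equal closures have the
    same triangles and densities can be compared triangle by triangle.\<close>
  have tr: "tris \<Gamma>2 = tris \<Gamma>1" unfolding tris_def cl ..
  define N where "N = {x. \<exists>j. g1 x * of_real (n1 x $ j) \<noteq> g2 x * of_real (n2 x $ j)}"
  have i1: "integrable simplex_measure (\<lambda>p. g1 (tri_param a b c p) * of_real (n1 (tri_param a b c p) $ j))"
    and i2: "integrable simplex_measure (\<lambda>p. g2 (tri_param a b c p) * of_real (n2 (tri_param a b c p) $ j))" if "(a, b, c) \<in> tris \<Gamma>1" for a b c j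
    using surf_density_integrable[OF P1(1,3,4) that] surf_density_integrable[OF P2(1,3,4)] that tr by auto
  have nj: "negligible {p \<in> std_simplex2. tri_param a b c p \<in> lower_half \<and>
     g1 (tri_param a b c p) * of_real (n1 (tri_param a b c p) $ j) - g2 (tri_param a b c p) * of_real (n2 (tri_param a b c p) $ j) \<noteq> 0}"
    if T: "(a, b, c) \<in> tris \<Gamma>1" for a b c j
  proof (rule surf_density_zero[OF P1(1) open_lower_half _ _ T])
    show "integrable simplex_measure (\<lambda>p. g1 (tri_param a b c p) * of_real (n1 (tri_param a b c p) $ j) - g2 (tri_param a b c p) * of_real (n2 (tri_param a b c p) $ j))"
      if "(a, b, c) \<in> tris \<Gamma>1" for a b c
      by (intro Bochner_Integration.integrable_diff i1 i2 that)
    fix \<phi> d\<phi> assume \<phi>: "test_fn \<phi> d\<phi>" "tsupp \<phi> \<subseteq> lower_half"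
    have "(\<integral>p. (g1 (tri_param a b c p) * of_real (n1 (tri_param a b c p) $ j) - g2 (tri_param a b c p) * of_real (n2 (tri_param a b c p) $ j)) * of_real (\<phi> (tri_param a b c p)) \<partial>simplex_measure)
      = (\<integral>p. g1 (tri_param a b c p) * of_real (n1 (tri_param a b c p) $ j) * of_real (\<phi> (tri_param a b c p)) \<partial>simplex_measure)
       - (\<integral>p. g2 (tri_param a b c p) * of_real (n2 (tri_param a b c p) $ j) * of_real (\<phi> (tri_param a b c p)) \<partial>simplex_measure)"
      if "(a, b, c) \<in> tris \<Gamma>1" for a b c
      using simplex_test_mult_integrable[OF i1[OF that, of j] \<phi>(1), of a b c] simplex_test_mult_integrable[OF i2[OF that, of j] \<phi>(1), of a b c]
      by (simp add: left_diff_distrib)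
    then have "surf_int \<Gamma>1 (\<lambda>x. (g1 x * of_real (n1 x $ j) - g2 x * of_real (n2 x $ j)) * of_real (\<phi> x))
      = surf_int \<Gamma>1 (\<lambda>x. g1 x * of_real (n1 x $ j) * of_real (\<phi> x)) - surf_int \<Gamma>2 (\<lambda>x. g2 x * of_real (n2 x $ j) * of_real (\<phi> x))"
      unfolding surf_int_def tr sum_subtractf[symmetric] by (intro sum.cong) (auto simp: right_diff_distrib)
    then show "surf_int \<Gamma>1 (\<lambda>x. (g1 x * of_real (n1 x $ j) - g2 x * of_real (n2 x $ j)) * of_real (\<phi> x)) = 0"
      using eq[OF \<phi>] by simp
  qed
  have "surf_null \<Gamma>1 N"
    unfolding surf_null_def
  proof clarify
    fix a b c assume T: "(a, b, c) \<in> tris \<Gamma>1"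
    have "negligible (\<Union>j::3. {p \<in> std_simplex2. tri_param a b c p \<in> lower_half \<and>
     g1 (tri_param a b c p) * of_real (n1 (tri_param a b c p) $ j) - g2 (tri_param a b c p) * of_real (n2 (tri_param a b c p) $ j) \<noteq> 0})"
      by (intro negligible_finite_UN finite nj[OF T])
    then have "negligible {p \<in> std_simplex2. tri_param a b c p \<in> N}"
      by (rule negligible_subset) (use tris_props(4)[OF P1(1) T] P1(2) in \<open>auto simp: N_def\<close>)
    then show "{p \<in> std_simplex2. tri_param a b c p \<in> N} \<in> null_sets lebesgue"
      by (simp only: negligible_iff_null_sets)
  qed
  then show "surf_ae \<Gamma>1 (\<lambda>x. \<forall>j. g1 x * of_real (n1 x $ j) = g2 x * of_real (n2 x $ j))"
    unfolding surf_ae_def by (intro exI[of _ N]) (auto simp: N_def)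
qed

section \<open>Real and imaginary parts of solutions\<close>

lemma weight_pos: "sqrt (1 + (norm (x::real^3))\<^sup>2) > 0"
  by (simp add: add_pos_nonneg)

lemma lebesgue_on_measurable:
  "f \<in> borel_measurable borel \<Longrightarrow> f \<in> borel_measurable (lebesgue_on \<Omega>)"
  by (intro measurable_restrict_space1 measurable_completion) simp

lemma weighted_L2_measurable:
  assumes "L2_on \<Omega> (\<lambda>x. u x / of_real (sqrt (1 + (norm (x::real^3))\<^sup>2)))"
  shows "u \<in> borel_measurable (lebesgue_on \<Omega>)"
proof -
  have m: "(\<lambda>x. u x / of_real (sqrt (1 + (norm x)\<^sup>2))) \<in> borel_measurable (lebesgue_on \<Omega>)"
    using assms by (simp add: L2_on_def)
  have s: "(\<lambda>x::real^3. complex_of_real (sqrt (1 + (norm x)\<^sup>2))) \<in> borel_measurable (lebesgue_on \<Omega>)"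
    by (rule lebesgue_on_measurable) measurable
  have "(\<lambda>x. u x / of_real (sqrt (1 + (norm x)\<^sup>2)) * of_real (sqrt (1 + (norm x)\<^sup>2))) \<in> borel_measurable (lebesgue_on \<Omega>)"
    using m s by (rule borel_measurable_times)
  moreover have "u x / of_real (sqrt (1 + (norm x)\<^sup>2)) * of_real (sqrt (1 + (norm x)\<^sup>2)) = u x" for x
    using weight_pos[of x] by simp
  ultimately show ?thesis by simp
qed

text \<open>The growth factor of the solution space is moved onto \<open>\<phi>\<close>, where it is
  harmless because the support is bounded.\<close>

lemma weighted_L2_mult_integrable:
  assumes u: "L2_on \<Omega> (\<lambda>x. u x / of_real (sqrt (1 + (norm (x::real^3))\<^sup>2)))" and \<Omega>: "\<Omega> \<in> sets borel"
    and \<phi>: "continuous_on UNIV \<phi>" "\<And>x. x \<notin> S \<Longrightarrow> \<phi> x = 0" "bounded S"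
  shows "integrable (lebesgue_on \<Omega>) (\<lambda>x. u x * of_real (\<phi> x))"
proof (rule Bochner_Integration.integrable_bound)
  let ?s = "\<lambda>x::real^3. sqrt (1 + (norm x)\<^sup>2)"
  have \<phi>m: "\<phi> \<in> borel_measurable borel" by (rule borel_measurable_continuous_onI[OF \<phi>(1)])
  have "integrable lborel (\<lambda>x. (?s x * \<phi> x)\<^sup>2)"
    by (rule continuous_compact_support_integrable[OF _ _ \<phi>(3)]) (use \<phi> in \<open>auto intro!: continuous_intros\<close>)
  then have "integrable lebesgue (\<lambda>x. (?s x * \<phi> x)\<^sup>2)"
    using \<phi>m by (subst integrable_completion) auto
  then have "integrable lebesgue (\<lambda>x. indicator \<Omega> x *\<^sub>R (?s x * \<phi> x)\<^sup>2)"
    by (rule integrable_mult_indicator[rotated]) (use \<Omega> in simp)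
  then have "integrable (lebesgue_on \<Omega>) (\<lambda>x. (?s x * \<phi> x)\<^sup>2)"
    using \<Omega> by (subst integrable_restrict_space) auto
  then show "integrable (lebesgue_on \<Omega>) (\<lambda>x. (norm (u x / of_real (?s x)))\<^sup>2 + (?s x * \<phi> x)\<^sup>2)"
    using u by (intro Bochner_Integration.integrable_add) (auto simp: L2_on_def)
  show "(\<lambda>x. u x * of_real (\<phi> x)) \<in> borel_measurable (lebesgue_on \<Omega>)"
    using weighted_L2_measurable[OF u] lebesgue_on_measurable[OF \<phi>m] by measurable
  show "AE x in lebesgue_on \<Omega>. norm (u x * of_real (\<phi> x)) \<le> norm ((norm (u x / of_real (?s x)))\<^sup>2 + (?s x * \<phi> x)\<^sup>2)"
  proof (rule AE_I2)
    fix x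
    have *: "a * b \<le> a\<^sup>2 + b\<^sup>2" if "a \<ge> 0" "b \<ge> 0" for a b :: real
    proof -
      have "0 \<le> (a - b)\<^sup>2" "0 \<le> a * b" using that by simp_all
      then show ?thesis by (simp add: power2_diff)
    qed
    have "norm (u x * of_real (\<phi> x)) = norm (u x / of_real (?s x)) * \<bar>?s x * \<phi> x\<bar>"
      using weight_pos[of x] by (simp add: norm_mult norm_divide abs_mult)
    also have "\<dots> \<le> (norm (u x / of_real (?s x)))\<^sup>2 + \<bar>?s x * \<phi> x\<bar>\<^sup>2"
      by (rule *) auto
    finally show "norm (u x * of_real (\<phi> x)) \<le> norm ((norm (u x / of_real (?s x)))\<^sup>2 + (?s x * \<phi> x)\<^sup>2)" by simp
  qed
qed

text \<open>Solutions are Lebesgue measurable functions on \<open>\<Omega>\<close>. A Borel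
  representative, extended by zero to the whole space, makes convolutions and Fubini for
  \<open>lborel\<close> available.\<close>

lemma locL2_version:
  assumes c: "real_part_fun c" and u: "L2_on \<Omega> (\<lambda>x. u x / of_real (sqrt (1 + (norm (x::real^3))\<^sup>2)))" and \<Omega>: "\<Omega> \<in> sets borel"
  shows "\<exists>v. locL2 v \<and> (\<forall>x. x \<notin> \<Omega> \<longrightarrow> v x = 0) \<and> (AE x in lebesgue. v x = indicator \<Omega> x * c (u x))"
proof -
  have \<Omega>l: "\<Omega> \<inter> space lebesgue \<in> sets lebesgue" using \<Omega> by simp
  have cm: "c \<in> borel_measurable borel"
    using real_part_fun(1)[OF c] by (intro borel_measurable_continuous_onI linear_continuous_on)
  have "(\<lambda>x. c (u x)) \<in> borel_measurable (lebesgue_on \<Omega>)"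
    using measurable_compose[OF weighted_L2_measurable[OF u] cm] .
  then have "(\<lambda>x. indicator \<Omega> x *\<^sub>R c (u x)) \<in> borel_measurable lebesgue"
    by (simp only: borel_measurable_restrict_space_iff[OF \<Omega>l])
  then obtain v0 where v0: "v0 \<in> borel_measurable lborel" "AE x in lborel. indicator \<Omega> x *\<^sub>R c (u x) = v0 x"
    using completion_ex_borel_measurable_real by blast
  define v where "v = (\<lambda>x. indicator \<Omega> x * v0 x)"
  have vm[measurable]: "v \<in> borel_measurable borel" unfolding v_def using v0(1) \<Omega> by simp
  have "AE x in lebesgue. indicator \<Omega> x *\<^sub>R c (u x) = v0 x" using v0(2) by (simp add: AE_completion_iff)
  then have ae: "AE x in lebesgue. v x = indicator \<Omega> x * c (u x)"
    by eventually_elim (auto simp: v_def indicator_def)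
  define D where "D = (\<lambda>x. indicator \<Omega> x *\<^sub>R (norm (u x / of_real (sqrt (1 + (norm x)\<^sup>2))))\<^sup>2)"
  have "integrable (lebesgue_on \<Omega>) (\<lambda>x. (norm (u x / of_real (sqrt (1 + (norm x)\<^sup>2))))\<^sup>2)"
    using u by (simp add: L2_on_def)
  then have iD: "integrable lebesgue D" unfolding D_def by (simp only: integrable_restrict_space[OF \<Omega>l])
  have "integrable lebesgue (\<lambda>x. (v x)\<^sup>2 / (1 + (norm x)\<^sup>2))"
  proof (rule Bochner_Integration.integrable_bound[OF iD])
    show "(\<lambda>x. (v x)\<^sup>2 / (1 + (norm x)\<^sup>2)) \<in> borel_measurable lebesgue"
      by (rule measurable_completion) measurable
    show "AE x in lebesgue. norm ((v x)\<^sup>2 / (1 + (norm x)\<^sup>2)) \<le> norm (D x)"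
      using ae
    proof eventually_elim
      case (elim x)
      have "(c (u x))\<^sup>2 \<le> (norm (u x))\<^sup>2" using real_part_fun(4)[OF c, of "u x"] by (simp add: abs_le_square_iff[symmetric])
      moreover have "0 < 1 + (norm x)\<^sup>2" by (simp add: add_pos_nonneg)
      ultimately show ?case unfolding elim D_def
        by (auto simp: indicator_def norm_divide power_divide divide_right_mono)
    qed
  qed
  then have i: "integrable lborel (\<lambda>x. (v x)\<^sup>2 / (1 + (norm x)\<^sup>2))"
    by (subst (asm) integrable_completion) auto
  have "locL2 v"
    unfolding locL2_def
  proof (intro conjI allI vm)
    fix R :: real
    show "L2 lborel (\<lambda>x. indicator (cball 0 R) x * v x)"
    proof (rule L2_bound[OF _ integrable_mult_right[OF i, of "1 + R\<^sup>2"]])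
      fix x :: "real^3"
      have p: "0 < 1 + (norm x)\<^sup>2" by (simp add: add_pos_nonneg)
      show "(indicator (cball 0 R) x * v x)\<^sup>2 \<le> (1 + R\<^sup>2) * ((v x)\<^sup>2 / (1 + (norm x)\<^sup>2))"
      proof (cases "x \<in> cball 0 R")
        case True
        then have "(norm x)\<^sup>2 \<le> R\<^sup>2" by (intro power_mono) auto
        then have "(v x)\<^sup>2 * (1 + (norm x)\<^sup>2) \<le> (v x)\<^sup>2 * (1 + R\<^sup>2)" by (intro mult_left_mono) auto
        then show ?thesis using True p by (simp add: field_simps)
      next
        case False
        then show ?thesis using p by (simp add: add_nonneg_nonneg)
      qed
    next
      show "(\<lambda>x. indicator (cball 0 R) x * v x) \<in> borel_measurable lborel"
        by (intro borel_measurable_times borel_measurable_indicator) (use vm in auto)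
    qed
  qed
  then show ?thesis using ae by (intro exI[of _ v]) (simp add: v_def)
qed

lemma integral_real_part_transfer:
  assumes c: "real_part_fun c" and H: "integrable (lebesgue_on \<Omega>) H" and \<Omega>: "\<Omega> \<in> sets borel"
    and G: "G \<in> borel_measurable borel" "AE x in lebesgue. G x = indicator \<Omega> x * c (H x)"
  shows "c (\<integral>x. H x \<partial>lebesgue_on \<Omega>) = (\<integral>x. G x \<partial>lborel)"
proof -
  have \<Omega>l: "\<Omega> \<inter> space lebesgue \<in> sets lebesgue" using \<Omega> by simp
  have ci: "integrable (lebesgue_on \<Omega>) (\<lambda>x. c (H x))"
    by (rule integrable_bounded_linear[OF real_part_fun(1)[OF c] H])
  have "c (\<integral>x. H x \<partial>lebesgue_on \<Omega>) = (\<integral>x. c (H x) \<partial>lebesgue_on \<Omega>)"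
    using integral_bounded_linear[OF real_part_fun(1)[OF c] H] by simp
  also have "\<dots> = (\<integral>x. indicator \<Omega> x *\<^sub>R c (H x) \<partial>lebesgue)" by (rule integral_restrict_space[OF \<Omega>l])
  also have "\<dots> = (\<integral>x. G x \<partial>lebesgue)"
  proof (rule integral_cong_AE)
    show "(\<lambda>x. indicator \<Omega> x *\<^sub>R c (H x)) \<in> borel_measurable lebesgue"
      using borel_measurable_integrable[OF ci] by (simp only: borel_measurable_restrict_space_iff[OF \<Omega>l])
    show "G \<in> borel_measurable lebesgue" using G(1) by (intro measurable_completion) simp
    show "AE x in lebesgue. indicator \<Omega> x *\<^sub>R c (H x) = G x" using G(2) by eventually_elim simp
  qed
  also have "\<dots> = (\<integral>x. G x \<partial>lborel)" using G(1) by (intro integral_completion) simp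
  finally show ?thesis .
qed

text \<open>The real form of the problem, extended by zero to the upper half-space. The equation is
  tested with functions that may reach across the plane, which encodes the Neumann condition and the
  continuity of the normal derivative. The gradient identity is tested inside the half-space only,
  and its defect \<open>S\<close> is the double layer; it carries no frequency.\<close>

definition jump_solution :: "real \<Rightarrow> (real^3 \<Rightarrow> real) \<Rightarrow> (3 \<Rightarrow> (real^3 \<Rightarrow> real) \<Rightarrow> real) \<Rightarrow> (real^3 \<Rightarrow> real) \<Rightarrow> (3 \<Rightarrow> real^3 \<Rightarrow> real) \<Rightarrow> bool" where
  "jump_solution l q S v W \<longleftrightarrow> locL2 v \<and> (\<forall>j. locL2 (W j)) \<and> (\<forall>x. x \<notin> lower_half \<longrightarrow> v x = 0 \<and> (\<forall>j. W j x = 0)) \<and>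
     (\<forall>\<phi> d\<phi>. test_fn \<phi> d\<phi> \<longrightarrow> (\<integral>x. (\<Sum>j\<in>UNIV. W j x * d\<phi> x $ j) - l * q x * v x * \<phi> x \<partial>lborel) = 0) \<and>
     (\<forall>\<phi> d\<phi> j. test_fn \<phi> d\<phi> \<and> tsupp \<phi> \<subseteq> lower_half \<longrightarrow> (\<integral>x. v x * d\<phi> x $ j + W j x * \<phi> x \<partial>lborel) = S j \<phi>)"

lemma test_fn_component:
  assumes "test_fn \<phi> d\<phi>"
  shows "continuous_on UNIV (\<lambda>x. d\<phi> x $ j)" "\<And>x. x \<notin> tsupp \<phi> \<Longrightarrow> d\<phi> x $ j = 0"
  using test_fnD(1,6)[OF assms] by (auto intro!: continuous_intros)

lemma lower_half_borel [measurable, simp]: "lower_half \<in> sets borel" by (simp add: open_lower_half)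

lemma solution_real_part:
  assumes c: "real_part_fun c"
    and sol: "is_solution k k0 t \<Gamma> g n u w"
    and k: "k \<in> borel_measurable (lebesgue_on lower_half)"
    and q: "q \<in> borel_measurable borel" "AE x in lebesgue_on lower_half. (k x)\<^sup>2 = q x" "\<And>x. \<bar>q x\<bar> \<le> Q"
  obtains v W where "jump_solution (t\<^sup>2) q (\<lambda>j \<phi>. - c (surf_int \<Gamma> (\<lambda>x. g x * of_real (n x $ j) * of_real (\<phi> x)))) v W"
    "AE x in lebesgue. v x = indicator (lower_half - closure \<Gamma>) x * c (u x)"
    "\<And>j. AE x in lebesgue. W j x = indicator (lower_half - closure \<Gamma>) x * c (w x $ j)"
proof -
  define \<Omega> where "\<Omega> = lower_half - closure \<Gamma>"
  have \<Omega>: "\<Omega> \<in> sets borel" unfolding \<Omega>_def by (intro sets.Diff) auto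
  have \<Omega>l: "\<Omega> \<inter> space lebesgue \<in> sets lebesgue" "lower_half \<inter> space lebesgue \<in> sets lebesgue" using \<Omega> by simp_all
  note s = sol[unfolded is_solution_def Let_def, folded \<Omega>_def]
  have uL: "L2_on \<Omega> (\<lambda>x. u x / of_real (sqrt (1 + (norm x)\<^sup>2)))"
    and wL: "\<And>j. L2_on \<Omega> (\<lambda>x. w x $ j / of_real (sqrt (1 + (norm x)\<^sup>2)))" using s by blast+
  have pde: "\<And>\<phi> d\<phi>. test_fn \<phi> d\<phi> \<Longrightarrow> (LINT x | lebesgue_on \<Omega>.
             (\<Sum>j\<in>UNIV. w x $ j * of_real (d\<phi> x $ j)) - of_real (t\<^sup>2 * (k x)\<^sup>2) * u x * of_real (\<phi> x)) = 0" using s by blast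
  have jmp: "\<And>\<phi> d\<phi> j. test_fn \<phi> d\<phi> \<Longrightarrow> tsupp \<phi> \<subseteq> lower_half \<Longrightarrow>
          (LINT x | lebesgue_on \<Omega>. u x * of_real (d\<phi> x $ j) + w x $ j * of_real (\<phi> x)) =
          - surf_int \<Gamma> (\<lambda>x. g x * of_real (n x $ j) * of_real (\<phi> x))" using s by blast
  obtain v where v: "locL2 v" "\<And>x. x \<notin> \<Omega> \<Longrightarrow> v x = 0" "AE x in lebesgue. v x = indicator \<Omega> x * c (u x)"
    using locL2_version[OF c uL \<Omega>] by blast
  have "\<exists>W. locL2 W \<and> (\<forall>x. x \<notin> \<Omega> \<longrightarrow> W x = 0) \<and> (AE x in lebesgue. W x = indicator \<Omega> x * c (w x $ j))" for j
    by (rule locL2_version[OF c wL \<Omega>])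
  then have "\<exists>W. \<forall>j. locL2 (W j) \<and> (\<forall>x. x \<notin> \<Omega> \<longrightarrow> W j x = 0) \<and> (AE x in lebesgue. W j x = indicator \<Omega> x * c (w x $ j))"
    by (intro choice allI)
  then obtain W where W: "\<And>j. locL2 (W j)" "\<And>j x. x \<notin> \<Omega> \<Longrightarrow> W j x = 0" "\<And>j. AE x in lebesgue. W j x = indicator \<Omega> x * c (w x $ j)"
    by blast
  note [measurable] = q(1) locL2_measurable[OF v(1)] locL2_measurable[OF W(1)]
  have int: "integrable (lebesgue_on \<Omega>) (\<lambda>x. u x * of_real (\<phi> x))" "integrable (lebesgue_on \<Omega>) (\<lambda>x. w x $ i * of_real (\<phi> x))"
    "integrable (lebesgue_on \<Omega>) (\<lambda>x. u x * of_real (d\<phi> x $ j))" "integrable (lebesgue_on \<Omega>) (\<lambda>x. w x $ i * of_real (d\<phi> x $ j))"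
    if \<phi>: "test_fn \<phi> d\<phi>" for \<phi> d\<phi> i j
    by (intro weighted_L2_mult_integrable[OF uL \<Omega>] weighted_L2_mult_integrable[OF wL \<Omega>];
        (rule test_fnD(4,5,7)[OF \<phi>] test_fn_component[OF \<phi>]; assumption?))+
  have "jump_solution (t\<^sup>2) q (\<lambda>j \<phi>. - c (surf_int \<Gamma> (\<lambda>x. g x * of_real (n x $ j) * of_real (\<phi> x)))) v W"
    unfolding jump_solution_def
  proof (intro conjI allI impI v W; (elim conjE)?)
    fix \<phi> d\<phi> assume \<phi>: "test_fn \<phi> d\<phi>"
    note [measurable] = borel_measurable_continuous_onI[OF test_fnD(4)[OF \<phi>]] borel_measurable_continuous_onI[OF test_fn_component(1)[OF \<phi>]]
    define H where "H = (\<lambda>x. (\<Sum>j\<in>UNIV. w x $ j * of_real (d\<phi> x $ j)) - of_real (t\<^sup>2 * q x) * (u x * of_real (\<phi> x)))"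
    have iH2: "integrable (lebesgue_on \<Omega>) (\<lambda>x. of_real (t\<^sup>2 * q x) * (u x * of_real (\<phi> x)))"
    proof (rule Bochner_Integration.integrable_bound)
      show "integrable (lebesgue_on \<Omega>) (\<lambda>x. (t\<^sup>2 * Q) * norm (u x * of_real (\<phi> x)))"
        by (intro integrable_mult_right integrable_norm int(1)[OF \<phi>])
      have "(\<lambda>x. complex_of_real (t\<^sup>2 * q x)) \<in> borel_measurable (lebesgue_on \<Omega>)" by (rule lebesgue_on_measurable) measurable
      then show "(\<lambda>x. of_real (t\<^sup>2 * q x) * (u x * of_real (\<phi> x))) \<in> borel_measurable (lebesgue_on \<Omega>)"
        using borel_measurable_integrable[OF int(1)[OF \<phi>]] by (rule borel_measurable_times)
      have "cmod (complex_of_real (t\<^sup>2 * q x)) \<le> \<bar>t\<^sup>2 * Q\<bar>" for x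
        using q(3)[of x] unfolding norm_of_real abs_mult by (intro mult_left_mono) auto
      then show "AE x in lebesgue_on \<Omega>. norm (of_real (t\<^sup>2 * q x) * (u x * of_real (\<phi> x))) \<le> norm ((t\<^sup>2 * Q) * norm (u x * of_real (\<phi> x)))"
        unfolding norm_mult[of "complex_of_real (t\<^sup>2 * q x)" for x] real_norm_def abs_mult[of "t\<^sup>2 * Q"]
        by (intro AE_I2 mult_mono) auto
    qed
    have iH: "integrable (lebesgue_on \<Omega>) H" unfolding H_def
      by (intro Bochner_Integration.integrable_diff Bochner_Integration.integrable_sum int(4)[OF \<phi>] iH2)
    have kq: "AE x in lebesgue_on \<Omega>. (k x)\<^sup>2 = q x"
      using q(2) unfolding AE_restrict_space_iff[OF \<Omega>l(1)] AE_restrict_space_iff[OF \<Omega>l(2)]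
      by eventually_elim (auto simp: \<Omega>_def)
    have km: "k \<in> borel_measurable (lebesgue_on \<Omega>)"
      by (rule measurable_restrict_mono[OF k]) (auto simp: \<Omega>_def)
    have um: "u \<in> borel_measurable (lebesgue_on \<Omega>)" by (rule weighted_L2_measurable[OF uL])
    have \<phi>m: "\<phi> \<in> borel_measurable (lebesgue_on \<Omega>)" by (rule lebesgue_on_measurable) measurable
    have "(LINT x | lebesgue_on \<Omega>. H x) = (LINT x | lebesgue_on \<Omega>.
             (\<Sum>j\<in>UNIV. w x $ j * of_real (d\<phi> x $ j)) - of_real (t\<^sup>2 * (k x)\<^sup>2) * u x * of_real (\<phi> x))"
    proof (rule integral_cong_AE)
      show "H \<in> borel_measurable (lebesgue_on \<Omega>)" using iH by simp
      have "(\<lambda>x. \<Sum>j\<in>UNIV. w x $ j * of_real (d\<phi> x $ j)) \<in> borel_measurable (lebesgue_on \<Omega>)"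
        by (intro borel_measurable_sum borel_measurable_integrable int(4)[OF \<phi>])
      moreover have "(\<lambda>x. of_real (t\<^sup>2 * (k x)\<^sup>2) * u x * of_real (\<phi> x)) \<in> borel_measurable (lebesgue_on \<Omega>)"
        using km um \<phi>m by measurable
      ultimately show "(\<lambda>x. (\<Sum>j\<in>UNIV. w x $ j * of_real (d\<phi> x $ j)) - of_real (t\<^sup>2 * (k x)\<^sup>2) * u x * of_real (\<phi> x)) \<in> borel_measurable (lebesgue_on \<Omega>)"
        by (rule borel_measurable_diff)
      show "AE x in lebesgue_on \<Omega>. H x = (\<Sum>j\<in>UNIV. w x $ j * of_real (d\<phi> x $ j)) - of_real (t\<^sup>2 * (k x)\<^sup>2) * u x * of_real (\<phi> x)"
        using kq by eventually_elim (simp add: H_def mult.assoc)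
    qed
    then have "c (LINT x | lebesgue_on \<Omega>. H x) = 0" using pde[OF \<phi>] real_part_fun(8)[OF c] by simp
    moreover have "c (LINT x | lebesgue_on \<Omega>. H x) = (\<integral>x. (\<Sum>j\<in>UNIV. W j x * d\<phi> x $ j) - t\<^sup>2 * q x * v x * \<phi> x \<partial>lborel)"
    proof (rule integral_real_part_transfer[OF c iH \<Omega>])
      have "AE x in lebesgue. \<forall>j. W j x = indicator \<Omega> x * c (w x $ j)" using W(3) by (intro AE_all_countable[THEN iffD2] allI)
      with v(3) show "AE x in lebesgue. (\<Sum>j\<in>UNIV. W j x * d\<phi> x $ j) - t\<^sup>2 * q x * v x * \<phi> x = indicator \<Omega> x * c (H x)"
      proof eventually_elim
        case (elim x)
        then show ?case
          by (auto simp: H_def real_part_fun(2-6,9)[OF c] indicator_def mult.assoc simp del: of_real_mult of_real_power)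
      qed
    qed measurable
    ultimately show "(\<integral>x. (\<Sum>j\<in>UNIV. W j x * d\<phi> x $ j) - t\<^sup>2 * q x * v x * \<phi> x \<partial>lborel) = 0" by simp
  next
    fix \<phi> d\<phi> j assume \<phi>: "test_fn \<phi> d\<phi>" "tsupp \<phi> \<subseteq> lower_half"
    note [measurable] = borel_measurable_continuous_onI[OF test_fnD(4)[OF \<phi>(1)]] borel_measurable_continuous_onI[OF test_fn_component(1)[OF \<phi>(1)]]
    have "c (LINT x | lebesgue_on \<Omega>. u x * of_real (d\<phi> x $ j) + w x $ j * of_real (\<phi> x)) = (\<integral>x. v x * d\<phi> x $ j + W j x * \<phi> x \<partial>lborel)"
    proof (rule integral_real_part_transfer[OF c _ \<Omega>])
      show "integrable (lebesgue_on \<Omega>) (\<lambda>x. u x * of_real (d\<phi> x $ j) + w x $ j * of_real (\<phi> x))"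
        by (intro Bochner_Integration.integrable_add int[OF \<phi>(1)])
      show "AE x in lebesgue. v x * d\<phi> x $ j + W j x * \<phi> x = indicator \<Omega> x * c (u x * of_real (d\<phi> x $ j) + w x $ j * of_real (\<phi> x))"
        using v(3) W(3)[of j] by eventually_elim (auto simp: real_part_fun(2-6)[OF c] indicator_def)
    qed measurable
    then show "(\<integral>x. v x * d\<phi> x $ j + W j x * \<phi> x \<partial>lborel) = - c (surf_int \<Gamma> (\<lambda>x. g x * of_real (n x $ j) * of_real (\<phi> x)))"
      using jmp[OF \<phi>] real_part_fun(7)[OF c] by simp
  qed (use v(2) W(2) in \<open>auto simp: \<Omega>_def\<close>)
  then show thesis using v(3) W(3) unfolding \<Omega>_def by (rule that)
qed

lemma locL2_q_mult:
  assumes "locL2 v" "q \<in> borel_measurable borel" "\<And>x. \<bar>q x\<bar> \<le> Q"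
  shows "locL2 (\<lambda>x. q x * v x)"
  unfolding locL2_def
proof (intro conjI allI)
  show "(\<lambda>y. q y * v y) \<in> borel_measurable borel" using assms(2) locL2_measurable[OF assms(1)] by measurable
  show "L2 lborel (\<lambda>y. indicator (cball 0 R) y * (q y * v y))" for R
    by (rule locL2_bounded_support[OF assms(1) _ _ assms(2), where C = Q]) (use assms(3) order.trans[OF abs_ge_zero assms(3)] in auto)
qed

lemma locL2_test_integrable:
  assumes "locL2 f" "test_fn \<phi> d\<phi>"
  shows "integrable lborel (\<lambda>x. f x * \<phi> x)" "integrable lborel (\<lambda>x. f x * d\<phi> x $ j)"
  by (rule locL2_mult_test_integrable[OF assms(1) test_fnD(4,5,7)[OF assms(2)]], assumption)
     (rule locL2_mult_test_integrable[OF assms(1) test_fn_component[OF assms(2)] test_fnD(7)[OF assms(2)]], assumption)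

lemma jump_solution_diff:
  assumes s1: "jump_solution l q S1 v1 W1" and s2: "jump_solution l q S2 v2 W2"
    and q: "q \<in> borel_measurable borel" "\<And>x. \<bar>q x\<bar> \<le> Q"
  shows "jump_solution l q (\<lambda>j \<phi>. S1 j \<phi> - S2 j \<phi>) (\<lambda>x. v1 x - v2 x) (\<lambda>j x. W1 j x - W2 j x)"
proof -
  have L: "locL2 v1" "\<And>j. locL2 (W1 j)" "locL2 v2" "\<And>j. locL2 (W2 j)"
    using s1 s2 by (auto simp: jump_solution_def)
  note qL = locL2_q_mult[OF L(1) q] locL2_q_mult[OF L(3) q]
  show ?thesis
    unfolding jump_solution_def
  proof (intro conjI allI impI locL2_diff L; (elim conjE)?)
    fix \<phi> d\<phi> assume \<phi>: "test_fn \<phi> d\<phi>"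
    note i = locL2_test_integrable[OF _ \<phi>]
    have "(\<integral>x. (\<Sum>j\<in>UNIV. (W1 j x - W2 j x) * d\<phi> x $ j) - l * q x * (v1 x - v2 x) * \<phi> x \<partial>lborel)
      = (\<integral>x. ((\<Sum>j\<in>UNIV. W1 j x * d\<phi> x $ j) - l * ((q x * v1 x) * \<phi> x)) - ((\<Sum>j\<in>UNIV. W2 j x * d\<phi> x $ j) - l * ((q x * v2 x) * \<phi> x)) \<partial>lborel)"
      by (rule Bochner_Integration.integral_cong) (auto simp: sum_subtractf algebra_simps)
    also have "\<dots> = (\<integral>x. (\<Sum>j\<in>UNIV. W1 j x * d\<phi> x $ j) - l * ((q x * v1 x) * \<phi> x) \<partial>lborel) - (\<integral>x. (\<Sum>j\<in>UNIV. W2 j x * d\<phi> x $ j) - l * ((q x * v2 x) * \<phi> x) \<partial>lborel)"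
      by (intro Bochner_Integration.integral_diff Bochner_Integration.integrable_diff Bochner_Integration.integrable_sum integrable_mult_right i L qL)
    also have "\<dots> = 0" using s1 s2 \<phi> unfolding jump_solution_def mult.assoc by simp
    finally show "(\<integral>x. (\<Sum>j\<in>UNIV. (W1 j x - W2 j x) * d\<phi> x $ j) - l * q x * (v1 x - v2 x) * \<phi> x \<partial>lborel) = 0" .
  next
    fix \<phi> d\<phi> j assume \<phi>: "test_fn \<phi> d\<phi>" "tsupp \<phi> \<subseteq> lower_half"
    note i = locL2_test_integrable[OF _ \<phi>(1)]
    have "(\<integral>x. (v1 x - v2 x) * d\<phi> x $ j + (W1 j x - W2 j x) * \<phi> x \<partial>lborel)
      = (\<integral>x. (v1 x * d\<phi> x $ j + W1 j x * \<phi> x) - (v2 x * d\<phi> x $ j + W2 j x * \<phi> x) \<partial>lborel)"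
      by (rule Bochner_Integration.integral_cong) (auto simp: algebra_simps)
    also have "\<dots> = (\<integral>x. v1 x * d\<phi> x $ j + W1 j x * \<phi> x \<partial>lborel) - (\<integral>x. v2 x * d\<phi> x $ j + W2 j x * \<phi> x \<partial>lborel)"
      by (intro Bochner_Integration.integral_diff Bochner_Integration.integrable_add i L)
    also have "\<dots> = S1 j \<phi> - S2 j \<phi>" using s1 s2 \<phi> unfolding jump_solution_def by simp
    finally show "(\<integral>x. (v1 x - v2 x) * d\<phi> x $ j + (W1 j x - W2 j x) * \<phi> x \<partial>lborel) = S1 j \<phi> - S2 j \<phi>" .
  qed (use s1 s2 in \<open>auto simp: jump_solution_def\<close>)
qed

text \<open>The test functions vanish on both surfaces, so integrals over the half-space and over
  the two slit domains agree.\<close>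

lemma trace_real_part:
  assumes c: "real_part_fun c"
    and sol: "is_solution k k0 t \<Gamma>1 g1 n1 u1 w1" "is_solution k k0 t \<Gamma>2 g2 n2 u2 w2"
    and tr: "traces_agree_on V \<Gamma>1 \<Gamma>2 u1 w1 u2 w2"
    and v: "locL2 v1" "locL2 v2" "AE x in lebesgue. v1 x = indicator (lower_half - closure \<Gamma>1) x * c (u1 x)"
       "AE x in lebesgue. v2 x = indicator (lower_half - closure \<Gamma>2) x * c (u2 x)"
    and W: "locL2 W1" "locL2 W2" "AE x in lebesgue. W1 x = indicator (lower_half - closure \<Gamma>1) x * c (w1 x $ 3)"
       "AE x in lebesgue. W2 x = indicator (lower_half - closure \<Gamma>2) x * c (w2 x $ 3)"
    and \<phi>: "test_fn \<phi> d\<phi>" "tsupp \<phi> \<inter> bdry_plane \<subseteq> V" "tsupp \<phi> \<inter> (closure \<Gamma>1 \<union> closure \<Gamma>2) = {}"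
  shows "(\<integral>x. (v1 x - v2 x) * d\<phi> x $ 3 + (W1 x - W2 x) * \<phi> x \<partial>lborel) = 0"
proof -
  note [measurable] = locL2_measurable[OF v(1)] locL2_measurable[OF v(2)] locL2_measurable[OF W(1)] locL2_measurable[OF W(2)]
    borel_measurable_continuous_onI[OF test_fnD(4)[OF \<phi>(1)]] borel_measurable_continuous_onI[OF test_fn_component(1)[OF \<phi>(1)]]
  have z: "\<phi> x = 0" "d\<phi> x $ j = 0" if "x \<in> closure \<Gamma>1 \<union> closure \<Gamma>2" for x j
    using \<phi>(3) that test_fnD(5)[OF \<phi>(1), of x] test_fn_component(2)[OF \<phi>(1), of x j] by blast+
  have int: "integrable (lebesgue_on lower_half) (\<lambda>x. f x * of_real (\<psi> x))"
    if f: "L2_on (lower_half - closure \<Gamma>) (\<lambda>x. f x / of_real (sqrt (1 + (norm x)\<^sup>2)))" and \<psi>: "continuous_on UNIV \<psi>" "\<And>x. x \<notin> tsupp \<phi> \<Longrightarrow> \<psi> x = 0"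
      and \<psi>0: "\<And>x. x \<in> closure \<Gamma> \<Longrightarrow> \<psi> x = 0" for f :: "real^3 \<Rightarrow> complex" and \<psi> \<Gamma>
  proof -
    have "integrable (lebesgue_on (lower_half - closure \<Gamma>)) (\<lambda>x. f x * of_real (\<psi> x))"
      by (rule weighted_L2_mult_integrable[OF f _ \<psi> test_fnD(7)[OF \<phi>(1)]]) auto
    moreover have "indicator (lower_half - closure \<Gamma>) x *\<^sub>R (f x * complex_of_real (\<psi> x)) = indicator lower_half x *\<^sub>R (f x * of_real (\<psi> x))" for x
      using \<psi>0[of x] by (auto simp: indicator_def)
    ultimately show ?thesis by (simp add: integrable_restrict_space)
  qed
  have L: "L2_on (lower_half - closure \<Gamma>1) (\<lambda>x. u1 x / of_real (sqrt (1 + (norm x)\<^sup>2)))" "L2_on (lower_half - closure \<Gamma>2) (\<lambda>x. u2 x / of_real (sqrt (1 + (norm x)\<^sup>2)))"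
    "L2_on (lower_half - closure \<Gamma>1) (\<lambda>x. w1 x $ 3 / of_real (sqrt (1 + (norm x)\<^sup>2)))" "L2_on (lower_half - closure \<Gamma>2) (\<lambda>x. w2 x $ 3 / of_real (sqrt (1 + (norm x)\<^sup>2)))"
    using sol unfolding is_solution_def Let_def by blast+
  have i: "integrable (lebesgue_on lower_half) (\<lambda>x. u1 x * of_real (d\<phi> x $ 3))" "integrable (lebesgue_on lower_half) (\<lambda>x. u2 x * of_real (d\<phi> x $ 3))"
    "integrable (lebesgue_on lower_half) (\<lambda>x. w1 x $ 3 * of_real (\<phi> x))" "integrable (lebesgue_on lower_half) (\<lambda>x. w2 x $ 3 * of_real (\<phi> x))"
  proof -
    show "integrable (lebesgue_on lower_half) (\<lambda>x. u1 x * of_real (d\<phi> x $ 3))"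
      by (rule int[OF L(1) test_fn_component[OF \<phi>(1)]]) (use z in auto)
    show "integrable (lebesgue_on lower_half) (\<lambda>x. u2 x * of_real (d\<phi> x $ 3))"
      by (rule int[OF L(2) test_fn_component[OF \<phi>(1)]]) (use z in auto)
    show "integrable (lebesgue_on lower_half) (\<lambda>x. w1 x $ 3 * of_real (\<phi> x))"
      by (rule int[OF L(3) test_fnD(4,5)[OF \<phi>(1)]]) (use z in auto)
    show "integrable (lebesgue_on lower_half) (\<lambda>x. w2 x $ 3 * of_real (\<phi> x))"
      by (rule int[OF L(4) test_fnD(4,5)[OF \<phi>(1)]]) (use z in auto)
  qed
  have "c (LINT x | lebesgue_on lower_half. (u1 x - u2 x) * of_real (d\<phi> x $ 3) + (w1 x $ 3 - w2 x $ 3) * of_real (\<phi> x))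
     = (\<integral>x. (v1 x - v2 x) * d\<phi> x $ 3 + (W1 x - W2 x) * \<phi> x \<partial>lborel)"
  proof (rule integral_real_part_transfer[OF c])
    show "integrable (lebesgue_on lower_half) (\<lambda>x. (u1 x - u2 x) * of_real (d\<phi> x $ 3) + (w1 x $ 3 - w2 x $ 3) * of_real (\<phi> x))"
      unfolding left_diff_distrib by (intro Bochner_Integration.integrable_add Bochner_Integration.integrable_diff i)
    show "AE x in lebesgue. (v1 x - v2 x) * d\<phi> x $ 3 + (W1 x - W2 x) * \<phi> x =
      indicator lower_half x * c ((u1 x - u2 x) * of_real (d\<phi> x $ 3) + (w1 x $ 3 - w2 x $ 3) * of_real (\<phi> x))"
      using v(3,4) W(3,4)
    proof eventually_elim
      case (elim x)
      show ?case
      proof (cases "x \<in> closure \<Gamma>1 \<union> closure \<Gamma>2")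
        case True
        then show ?thesis using z[OF True] real_part_fun(8)[OF c] by simp
      next
        case False
        then show ?thesis unfolding elim using real_part_fun(2,5,6)[OF c] by (simp add: indicator_def)
      qed
    qed
  qed (auto, measurable)
  then show ?thesis using tr \<phi> real_part_fun(8)[OF c] unfolding traces_agree_on_def by simp
qed

section \<open>Solutions vanishing outside a box\<close>

text \<open>The cut-off vanishes in a layer of width \<open>1 / Suc n\<close> below the plane. Its
  normal derivative is not controlled as the layer shrinks, so it is meant for tangential
  derivatives only, for which the gradient components are 0.\<close>

lemma plane_cutoff:
  obtains \<theta> d\<theta> where "\<And>n x. (\<theta> n has_derivative (\<lambda>h. d\<theta> n x \<bullet> h)) (at x)" "\<And>n. continuous_on UNIV (d\<theta> n)"
    "\<And>n x j. j \<noteq> 3 \<Longrightarrow> d\<theta> n x $ j = 0" "\<And>n x. x $ 3 > - 1 / real (Suc n) \<Longrightarrow> \<theta> n x = 0"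
    "\<And>n x. \<bar>\<theta> n x\<bar> \<le> 1" "\<And>x::real^3. x $ 3 < 0 \<Longrightarrow> (\<lambda>n. \<theta> n x) \<longlonglongrightarrow> 1"
proof -
  define m where "m = (\<lambda>n (x::real^3). (max 0 (-1 * x $ 3 + - 1 / real (Suc n)))\<^sup>2)"
  define \<theta> where "\<theta> = (\<lambda>n x. real n * m n x / (1 + real n * m n x))"
  have m0: "m n x \<ge> 0" for n x by (simp add: m_def)
  have "C1_fun (m n)" for n unfolding m_def by (intro C1_fun_pos_part_square C1_fun_affine)
  then have "C1_fun (\<theta> n)" for n unfolding \<theta>_def by (rule C1_fun_saturate[OF _ m0]) simp
  then have "\<exists>d. \<forall>n. (\<forall>x. (\<theta> n has_derivative (\<lambda>h. d n x \<bullet> h)) (at x)) \<and> continuous_on UNIV (d n)"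
    unfolding C1_fun_def by (intro choice allI)
  then obtain d where d: "\<And>n x. (\<theta> n has_derivative (\<lambda>h. d n x \<bullet> h)) (at x)" "\<And>n. continuous_on UNIV (d n)"
    by blast
  have dj: "d n x $ j = 0" if j: "j \<noteq> 3" for n x j
  proof -
    have "pd j (\<theta> n) (\<lambda>x. d n x $ j)" by (rule has_derivative_imp_pd[OF d(1)])
    then have "((\<lambda>t. \<theta> n (x + t *\<^sub>R axis j 1)) has_real_derivative d n x $ j) (at 0)" by (simp add: pd_def)
    moreover have "(\<lambda>t. \<theta> n (x + t *\<^sub>R axis j 1)) = (\<lambda>t. \<theta> n x)"
      using j by (simp add: \<theta>_def m_def axis_def)
    ultimately show ?thesis using DERIV_unique[OF _ DERIV_const] by simp
  qed
  show thesis
  proof (rule that[OF d dj])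
    show "\<theta> n x = 0" if "x $ 3 > - 1 / real (Suc n)" for n x using that by (simp add: \<theta>_def m_def)
    show "\<bar>\<theta> n x\<bar> \<le> 1" for n x
      unfolding \<theta>_def abs_le_iff using saturate_bounds[OF m0[of n x], of "real n"] by linarith
    fix x :: "real^3" assume x: "x $ 3 < 0"
    define a where "a = - x $ 3"
    have a: "a > 0" using x by (simp add: a_def)
    show "(\<lambda>n. \<theta> n x) \<longlonglongrightarrow> 1"
    \<comment> \<open>Once \<open>1 / Suc n\<close> is below \<open>a / 2\<close>, the unsaturated
      function is at least \<open>(a / 2)\<^sup>2\<close>; as saturation is monotone, a sequence
      with fixed base bounds the cut-off from below.\<close>
    proof (rule tendsto_sandwich[OF _ _ _ tendsto_const])
      show "\<forall>\<^sub>F n in sequentially. \<theta> n x \<le> 1" using saturate_bounds[OF m0] by (auto simp: \<theta>_def)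
      have "(\<lambda>n. 1 / real (Suc n)) \<longlonglongrightarrow> 0" by (rule LIMSEQ_Suc[OF lim_1_over_n])
      then have "\<forall>\<^sub>F n in sequentially. 1 / real (Suc n) < a / 2" by (rule order_tendstoD) (use a in simp)
      then show "\<forall>\<^sub>F n in sequentially. real n * (a / 2)\<^sup>2 / (1 + real n * (a / 2)\<^sup>2) \<le> \<theta> n x"
      proof eventually_elim
        case (elim n)
        have "a / 2 \<le> max 0 (-1 * x $ 3 + - 1 / real (Suc n))" using elim by (simp add: a_def)
        then have mm: "(a / 2)\<^sup>2 \<le> m n x" unfolding m_def by (rule power_mono) (use a in simp)
        define s where "s = real n * (a / 2)\<^sup>2"
        define s' where "s' = real n * m n x"
        have s: "0 \<le> s" "s \<le> s'" unfolding s_def s'_def using mm by (auto intro: mult_left_mono)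
        have "s / (1 + s) \<le> s' / (1 + s')" using s by (simp add: divide_simps) (simp add: algebra_simps)
        then show ?case by (simp add: \<theta>_def s_def s'_def)
      qed
      show "(\<lambda>n. real n * (a / 2)\<^sup>2 / (1 + real n * (a / 2)\<^sup>2)) \<longlonglongrightarrow> 1"
        using saturate_tendsto[of "(a / 2)\<^sup>2"] a by simp
    qed
  qed
qed

text \<open>The cut-off near the plane depends on \<open>x $ 3\<close> only, so tangential derivatives do not see it.\<close>
lemma tangential_weak_derivative:
  assumes sol: "jump_solution l q S v W" and S: "\<And>j \<phi>. (\<And>x. x \<in> K \<Longrightarrow> \<phi> x = 0) \<Longrightarrow> S j \<phi> = 0"
    and \<phi>: "test_fn \<phi> d\<phi>" "tsupp \<phi> \<inter> K = {}" and j: "j \<noteq> 3"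
  shows "(\<integral>x. v x * d\<phi> x $ j + W j x * \<phi> x \<partial>lborel) = 0"
proof -
  have L: "locL2 v" "locL2 (W j)" and out: "\<And>x. x \<notin> lower_half \<Longrightarrow> v x = 0 \<and> W j x = 0"
    and jump: "\<And>\<phi> d\<phi>. test_fn \<phi> d\<phi> \<Longrightarrow> tsupp \<phi> \<subseteq> lower_half \<Longrightarrow> (\<integral>x. v x * d\<phi> x $ j + W j x * \<phi> x \<partial>lborel) = S j \<phi>"
    using sol by (auto simp: jump_solution_def)
  obtain \<theta> d\<theta> where \<theta>: "\<And>n x. (\<theta> n has_derivative (\<lambda>h. d\<theta> n x \<bullet> h)) (at x)" "\<And>n. continuous_on UNIV (d\<theta> n)"
    "\<And>n x j. j \<noteq> 3 \<Longrightarrow> d\<theta> n x $ j = 0" "\<And>n x. x $ 3 > - 1 / real (Suc n) \<Longrightarrow> \<theta> n x = 0"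
    "\<And>n x. \<bar>\<theta> n x\<bar> \<le> 1" "\<And>x::real^3. x $ 3 < 0 \<Longrightarrow> (\<lambda>n. \<theta> n x) \<longlonglongrightarrow> 1"
    apply (rule plane_cutoff)
    apply (rule that; assumption)
    done
  note i = locL2_test_integrable[OF L(1) \<phi>(1)] locL2_test_integrable[OF L(2) \<phi>(1)]
  define F where "F = (\<lambda>x. v x * d\<phi> x $ j + W j x * \<phi> x)"
  have iF: "integrable lborel F" unfolding F_def by (intro Bochner_Integration.integrable_add i)
  have \<theta>c: "continuous_on UNIV (\<theta> n)" for n
    by (intro continuous_at_imp_continuous_on ballI has_derivative_continuous[OF \<theta>(1)])
  note [measurable] = borel_measurable_continuous_onI[OF \<theta>c] borel_measurable_integrable[OF iF]
  have z: "(\<integral>x. F x * \<theta> n x \<partial>lborel) = 0" for n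
  proof -
    note m = test_fn_mult[OF \<phi>(1) \<theta>(1,2), of n]
    have t: "tsupp (\<lambda>x. \<phi> x * \<theta> n x) \<subseteq> {x. x $ 3 \<le> - 1 / real (Suc n)}"
      by (rule tsupp_subset) (use \<theta>(4) in \<open>auto simp: not_le intro!: closed_Collect_le continuous_intros\<close>)
    have low: "tsupp (\<lambda>x. \<phi> x * \<theta> n x) \<subseteq> lower_half"
    proof
      fix x assume "x \<in> tsupp (\<lambda>x. \<phi> x * \<theta> n x)"
      then have "x $ 3 \<le> - 1 / real (Suc n)" using t by blast
      also have "\<dots> < 0" by simp
      finally show "x \<in> lower_half" by (simp add: lower_half_def)
    qed
    have "\<phi> x * \<theta> n x = 0" if "x \<in> K" for x using that \<phi>(2) test_fnD(5)[OF \<phi>(1), of x] by auto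
    then have "(\<integral>x. v x * (\<phi> x *\<^sub>R d\<theta> n x + \<theta> n x *\<^sub>R d\<phi> x) $ j + W j x * (\<phi> x * \<theta> n x) \<partial>lborel) = 0"
      using jump[OF m(1) low] S by simp
    moreover have "v x * (\<phi> x *\<^sub>R d\<theta> n x + \<theta> n x *\<^sub>R d\<phi> x) $ j + W j x * (\<phi> x * \<theta> n x) = F x * \<theta> n x" for x
      using \<theta>(3)[OF j, of n x] by (simp add: F_def algebra_simps)
    ultimately show ?thesis by simp
  qed
  \<comment> \<open>The cut-off tends to 1 only in the lower half-space, but elsewhere
    \<open>F\<close> vanishes because the solution is extended by zero.\<close>
  have "(\<lambda>n. \<integral>x. F x * \<theta> n x \<partial>lborel) \<longlonglongrightarrow> (\<integral>x. F x \<partial>lborel)"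
  proof (rule integral_dominated_convergence[where w = "\<lambda>x. \<bar>F x\<bar>"])
    show "AE x in lborel. (\<lambda>n. F x * \<theta> n x) \<longlonglongrightarrow> F x"
    proof (rule AE_I2)
      fix x
      show "(\<lambda>n. F x * \<theta> n x) \<longlonglongrightarrow> F x"
      proof (cases "x \<in> lower_half")
        case True
        then show ?thesis using tendsto_mult_left[OF \<theta>(6)[of x], of "F x"] by (simp add: lower_half_def)
      next
        case False
        then show ?thesis using out[of x] by (simp add: F_def)
      qed
    qed
    show "AE x in lborel. norm (F x * \<theta> n x) \<le> \<bar>F x\<bar>" for n
      using \<theta>(5) by (intro AE_I2) (auto simp: abs_mult intro!: mult_left_le)
  qed (use iF in auto)
  then show ?thesis using z by (simp add: LIMSEQ_const_iff F_def)
qed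

text \<open>A box around both surfaces at distance \<open>\<delta>\<close> from the plane. Its
  complement in the half-space is connected, which is not guaranteed for the complement of the
  surfaces.\<close>

definition slab_box :: "real \<Rightarrow> real \<Rightarrow> (real^3) set" where
  "slab_box \<delta> M = {x. x $ 3 \<le> - \<delta> \<and> (\<forall>i. \<bar>x $ i\<bar> \<le> M)}"

lemma slab_box_covers:
  assumes "compact K" "K \<subseteq> lower_half"
  obtains \<delta> M where "\<delta> > 0" "M > 0" "K \<subseteq> slab_box \<delta> M"
proof -
  obtain B where B: "\<And>x. x \<in> K \<Longrightarrow> norm x \<le> B" using compact_imp_bounded[OF assms(1)] by (auto simp: bounded_iff)
  have "\<exists>\<delta>>0. \<forall>x\<in>K. x $ 3 \<le> - \<delta>"
  proof (cases "K = {}")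
    case True then show ?thesis by (intro exI[of _ 1]) auto
  next
    case False
    have "continuous_on K (\<lambda>x. x $ 3)" by (intro continuous_intros)
    from continuous_attains_sup[OF assms(1) False this]
    obtain x0 where x0: "x0 \<in> K" "\<And>x. x \<in> K \<Longrightarrow> x $ 3 \<le> x0 $ 3" by blast
    then show ?thesis using assms(2) by (intro exI[of _ "- x0 $ 3"]) (auto simp: lower_half_def)
  qed
  then obtain \<delta> where \<delta>: "\<delta> > 0" "\<And>x. x \<in> K \<Longrightarrow> x $ 3 \<le> - \<delta>" by blast
  have "K \<subseteq> slab_box \<delta> (max 1 B)"
    unfolding slab_box_def using \<delta>(2) B component_le_norm_cart by (auto intro: order.trans[OF component_le_norm_cart] simp: le_max_iff_disj)
  then show thesis using \<delta>(1) by (intro that[of \<delta> "max 1 B"]) auto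
qed

lemma slab_box_closed: "closed (slab_box \<delta> M)"
  unfolding slab_box_def by (intro closed_Collect_conj closed_Collect_all closed_Collect_le continuous_intros)

lemma slab_box_norm:
  assumes "x \<in> slab_box \<delta> M" "\<delta> > 0" shows "\<delta> \<le> norm x" "norm x \<le> 3 * M"
proof -
  have "\<delta> \<le> \<bar>x $ 3\<bar>" using assms by (auto simp: slab_box_def)
  then show "\<delta> \<le> norm x" using component_le_norm_cart[of x 3] by linarith
  have "norm x \<le> (\<Sum>i\<in>UNIV. \<bar>x $ i\<bar>)" by (rule norm_le_l1_cart)
  also have "\<dots> \<le> 3 * M"
  proof -
    have "\<bar>x $ i\<bar> \<le> M" for i using assms by (simp add: slab_box_def)
    from this[of 1] this[of 2] this[of 3] show ?thesis unfolding sum_3 by linarith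
  qed
  finally show "norm x \<le> 3 * M" .
qed

lemma convex_halfspace_component: "convex {x::real^3. x $ i < b}" "convex {x::real^3. x $ i > b}"
  using convex_halfspace_lt[of "axis i (1::real)" b] convex_halfspace_gt[of b "axis i (1::real)"] by (simp_all add: inner_axis' inner_real_def)

text \<open>The complement is a union of six convex pieces: the layer \<open>A\<close> below the
  plane meets the four side pieces, and the piece \<open>C 3\<close> underneath the box is joined
  through one of the sides.\<close>

lemma connected_lower_half_diff_box:
  assumes "\<delta> > 0" "M > 0" shows "connected (lower_half - slab_box \<delta> M)"
proof -
  define A where "A = {x::real^3. x $ 3 < 0} \<inter> {x. x $ 3 > - \<delta>}"
  define B where "B = (\<lambda>i. {x::real^3. x $ 3 < 0} \<inter> {x. x $ i > M})"
  define C where "C = (\<lambda>i. {x::real^3. x $ 3 < 0} \<inter> {x. x $ i < - M})"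
  have con: "connected A" "connected (B i)" "connected (C i)" for i
    unfolding A_def B_def C_def by (intro convex_connected convex_Int convex_halfspace_component)+
  have eq: "lower_half - slab_box \<delta> M = (A \<union> B 1 \<union> B 2 \<union> C 1 \<union> C 2) \<union> C 3"
    using assms by (auto simp: lower_half_def slab_box_def A_def B_def C_def not_le forall_3 abs_le_iff)

  define e where "e = min (\<delta> / 2) M"
  define p where "p = (\<lambda>a b c. vector [a, b, c] :: real^3)"
  have pn: "p a b c $ 1 = a" "p a b c $ 2 = b" "p a b c $ 3 = c" for a b c by (simp_all add: p_def)
  have e: "0 < e" "e < \<delta>" using assms by (auto simp: e_def)
  have "p (M + 1) 0 (- e) \<in> A \<inter> B 1" "p 0 (M + 1) (- e) \<in> A \<inter> B 2" "p (- M - 1) 0 (- e) \<in> A \<inter> C 1" "p 0 (- M - 1) (- e) \<in> A \<inter> C 2"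
    using e assms by (auto simp: A_def B_def C_def pn)
  then have ne: "A \<inter> B 1 \<noteq> {}" "A \<inter> B 2 \<noteq> {}" "A \<inter> C 1 \<noteq> {}" "A \<inter> C 2 \<noteq> {}" by blast+
  have "p (M + 1) 0 (- M - 1) \<in> B 1 \<inter> C 3" using assms by (auto simp: B_def C_def pn)
  then have ne3: "B 1 \<inter> C 3 \<noteq> {}" by blast
  have "connected (A \<union> B 1)" by (rule connected_Un[OF con(1) con(2) ne(1)])
  moreover have "(A \<union> B 1) \<inter> B 2 \<noteq> {}" using ne by blast
  ultimately have "connected (A \<union> B 1 \<union> B 2)" by (rule connected_Un[OF _ con(2)])
  moreover have "(A \<union> B 1 \<union> B 2) \<inter> C 1 \<noteq> {}" using ne by blast
  ultimately have "connected (A \<union> B 1 \<union> B 2 \<union> C 1)" by (rule connected_Un[OF _ con(3)])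
  moreover have "(A \<union> B 1 \<union> B 2 \<union> C 1) \<inter> C 2 \<noteq> {}" using ne by blast
  ultimately have "connected (A \<union> B 1 \<union> B 2 \<union> C 1 \<union> C 2)" by (rule connected_Un[OF _ con(3)])
  moreover have "(A \<union> B 1 \<union> B 2 \<union> C 1 \<union> C 2) \<inter> C 3 \<noteq> {}" using ne3 by blast
  ultimately have "connected ((A \<union> B 1 \<union> B 2 \<union> C 1 \<union> C 2) \<union> C 3)" by (rule connected_Un[OF _ con(3)])
  then show ?thesis unfolding eq .
qed

text \<open>Extending by zero across \<open>V\<close> keeps the equation, and unique continuation starts from the upper half-space.\<close>
lemma exterior_vanishing:
  assumes sol: "jump_solution l q S v W" and S: "\<And>j \<phi>. (\<And>x. x \<in> K \<Longrightarrow> \<phi> x = 0) \<Longrightarrow> S j \<phi> = 0"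
    and q: "q \<in> borel_measurable borel" "\<And>x. \<bar>q x\<bar> \<le> Q"
    and K: "K \<subseteq> slab_box \<delta> M" "\<delta> > 0" "M > 0"
    and V: "V \<noteq> {}" "openin (top_of_set bdry_plane) V"
    and tr: "\<And>\<phi> d\<phi>. test_fn \<phi> d\<phi> \<Longrightarrow> tsupp \<phi> \<inter> bdry_plane \<subseteq> V \<Longrightarrow> tsupp \<phi> \<inter> K = {} \<Longrightarrow>
       (\<integral>x. v x * d\<phi> x $ 3 + W 3 x * \<phi> x \<partial>lborel) = 0"
  shows "AE x in lborel. x \<notin> slab_box \<delta> M \<longrightarrow> v x = 0"
proof -
  have L: "locL2 v" "\<And>j. locL2 (W j)" and out: "\<And>x. x \<notin> lower_half \<Longrightarrow> v x = 0"
    using sol by (auto simp: jump_solution_def)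
  obtain T where T: "open T" "V = bdry_plane \<inter> T" using V(2) by (auto simp: openin_open)
  obtain p where p: "p \<in> V" using V(1) by blast
  then have p3: "p $ 3 = 0" using T by (auto simp: bdry_plane_def)
  obtain r0 where r0: "r0 > 0" "ball p r0 \<subseteq> T" using T p by (meson IntD2 openE)
  \<comment> \<open>At most \<open>\<delta>\<close>, so that the ball around the point of
    \<open>V\<close> does not reach the box.\<close>
  define r where "r = min r0 \<delta>"
  have r: "r > 0" "ball p r \<subseteq> T" using r0 K by (auto simp: r_def)
  have r3: "\<bar>x $ 3\<bar> < \<delta>" if "x \<in> ball p r" for x
    using component_le_norm_cart[of "p - x" 3] that p3 by (simp add: r_def dist_norm)
  define upper where "upper = {x::real^3. x $ 3 > 0}"
  \<comment> \<open>The ball is the bridge through \<open>V\<close> that connects the outside of the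
    box with the upper half-space, where the extension is zero.\<close>
  define U where "U = (lower_half - slab_box \<delta> M) \<union> ball p r \<union> upper"
  have ou: "open upper" unfolding upper_def by (intro open_Collect_less continuous_intros)
  have oU: "open U" unfolding U_def
    by (intro open_Un open_Diff open_lower_half slab_box_closed open_ball ou)
  have cU: "connected U"
    unfolding U_def
  proof (intro connected_Un connected_lower_half_diff_box K)
    show "connected (ball p r)" by (rule convex_connected[OF convex_ball])
    show "connected upper" unfolding upper_def by (intro convex_connected convex_halfspace_component)
    have a: "p - (r / 2) *\<^sub>R axis 3 1 \<in> ball p r" "p + (r / 2) *\<^sub>R axis 3 1 \<in> ball p r" using r by (auto simp: dist_norm)
    have "p - (r / 2) *\<^sub>R axis 3 1 \<in> lower_half - slab_box \<delta> M"
      using r3[OF a(1)] p3 r by (auto simp: lower_half_def slab_box_def axis_def)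
    then show "(lower_half - slab_box \<delta> M) \<inter> ball p r \<noteq> {}" using a by blast
    have "p + (r / 2) *\<^sub>R axis 3 1 \<in> upper" using p3 r by (auto simp: upper_def axis_def)
    then show "((lower_half - slab_box \<delta> M) \<union> ball p r) \<inter> upper \<noteq> {}" using a by blast
  qed
  have UK: "U \<inter> K = {}"
    using K(1,2) r3 by (fastforce simp: U_def upper_def slab_box_def)
  have UV: "U \<inter> bdry_plane \<subseteq> V"
    using r(2) T by (auto simp: U_def upper_def lower_half_def bdry_plane_def)
  have "weak_helmholtz U q l v W"
    unfolding weak_helmholtz_def
  proof (intro allI impI conjI; elim conjE)
    fix \<phi> d\<phi> assume \<phi>: "test_fn \<phi> d\<phi>" "tsupp \<phi> \<subseteq> U"
    show "(\<integral>x. (\<Sum>j\<in>UNIV. W j x * d\<phi> x $ j) - l * q x * v x * \<phi> x \<partial>lborel) = 0"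
      using sol \<phi>(1) by (auto simp: jump_solution_def)
    have k: "tsupp \<phi> \<inter> K = {}" using \<phi>(2) UK by blast
    \<comment> \<open>Only the derivative normal to the plane could produce a boundary term, and
      this is what the agreement of traces excludes.\<close>
    fix j show "(\<integral>x. v x * d\<phi> x $ j + W j x * \<phi> x \<partial>lborel) = 0"
    proof (cases "j = 3")
      case True
      then show ?thesis using tr[OF \<phi>(1) _ k] \<phi>(2) UV by auto
    next
      case False
      show ?thesis by (rule tangential_weak_derivative[OF sol _ \<phi>(1) k False]) (rule S)
    qed
  qed
  then have "AE x in lborel. x \<in> U \<longrightarrow> v x = 0"
  proof (rule unique_continuation[OF oU cU _ L q])
    show "upper \<subseteq> U" by (auto simp: U_def)
    show "open upper" by (rule ou)
    have "axis 3 1 \<in> upper" by (simp add: upper_def)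
    then show "upper \<noteq> {}" by blast
    show "AE x in lborel. x \<in> upper \<longrightarrow> v x = 0" using out by (auto simp: upper_def lower_half_def)
  qed
  then show ?thesis
  proof eventually_elim
    case (elim x)
    then show ?case using out[of x] by (auto simp: U_def)
  qed
qed

text \<open>All members have the same source \<open>S\<close>, so it drops out of differences. The
  weak Laplacian of a difference can be tested with a bump in two situations: the bump lies in the
  half-space, or it misses the box, where both sides vanish. Bumps below a certain radius always
  fall under one of them, so the plane is never tested.\<close>

lemma jump_solution_family_zero:
  assumes sol: "\<And>n. jump_solution (l n) q S (v n) (W n)"
    and ext: "\<And>n. AE x in lborel. x \<notin> slab_box \<delta> M \<longrightarrow> v n x = 0" and \<delta>: "\<delta> > 0" "M > 0"
    and q: "q \<in> borel_measurable borel" "\<And>x. q0 \<le> q x" "\<And>x. q x \<le> Q" "q0 > 0"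
    and l: "\<And>n. \<bar>l n\<bar> \<le> \<Lambda>" "inj l" "summable (\<lambda>n. \<bar>l (Suc n) - l n\<bar>)"
  shows "AE x in lborel. v 0 x = 0"
proof -
  define K where "K = slab_box \<delta> M"
  have Km[measurable]: "K \<in> sets borel" unfolding K_def using slab_box_closed by simp
  have Kb: "bounded K" using slab_box_norm(2)[OF _ \<delta>(1)] by (auto simp: K_def bounded_iff)
  define u where "u = (\<lambda>n x. indicator K x * (1 * v n x))"
  have L: "locL2 (v n)" "locL2 (W n j)" for n j using sol[of n] by (auto simp: jump_solution_def)
  have uL: "L2 lborel (u n)" for n unfolding u_def by (rule locL2_bounded_support[OF L(1) Km Kb, where C = 1]) auto
  have uv: "AE x in lborel. u n x = v n x" for n
    using ext[of n] by eventually_elim (auto simp: u_def K_def indicator_def)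
  have [measurable]: "u n \<in> borel_measurable borel" "v n \<in> borel_measurable borel" "q \<in> borel_measurable borel" for n
    using L2_measurable[OF uL[of n]] locL2_measurable[OF L(1)[of n]] q(1) by auto
  have qb: "\<bar>q x\<bar> \<le> Q" for x using q(2)[of x] q(3)[of x] q(4) by linarith
  have qv: "locL2 (\<lambda>x. q x * v n x)" for n by (rule locL2_q_mult[OF L(1) q(1) qb])
  have uout: "u n x = 0" if "x \<notin> K" for n x using that by (simp add: u_def)
  \<comment> \<open>The gradient of the bump goes into the gradient identity and the bump into the
    equation; eliminating \<open>W n\<close> leaves the Laplacian. The right-hand side does not
    depend on \<open>n\<close>.\<close>
  have key: "conv (u n) (lap_bump e) x + l n * conv (\<lambda>x. q x * u n x) (bump e) x = - (\<Sum>j\<in>UNIV. S j (\<lambda>y. bump_grad e (x - y) $ j))"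
    if e: "0 < e" "cball x e \<subseteq> lower_half" for n e x
  proof -
    note bt = bump_test_fn[OF e(1), of x]
    have J: "(\<integral>y. v n y * (- bump_hess e j (x - y) $ j) + W n j y * bump_grad e (x - y) $ j \<partial>lborel) = S j (\<lambda>y. bump_grad e (x - y) $ j)" for j
      using sol[of n] bt(2)[of j] order.trans[OF bt(4)[of j] e(2)] unfolding jump_solution_def by fastforce
    have P: "(\<integral>y. (\<Sum>j\<in>UNIV. W n j y * (- bump_grad e (x - y) $ j)) - l n * q y * v n y * bump e (x - y) \<partial>lborel) = 0"
      using sol[of n] bt(1) unfolding jump_solution_def by fastforce
    have i: "integrable lborel (\<lambda>y. v n y * bump_hess e j (x - y) $ j)" "integrable lborel (\<lambda>y. W n j y * bump_grad e (x - y) $ j)"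
      "integrable lborel (\<lambda>y. (q y * v n y) * bump e (x - y))" for j
      using locL2_test_integrable(2)[OF L(1) bt(2), of n j j] locL2_test_integrable(1)[OF L(2) bt(2), of n j j]
        locL2_test_integrable(1)[OF qv bt(1)] by simp_all
    define a b where "a = (\<lambda>j. \<integral>y. v n y * bump_hess e j (x - y) $ j \<partial>lborel)" and "b = (\<lambda>j. \<integral>y. W n j y * bump_grad e (x - y) $ j \<partial>lborel)"
    define d where "d = (\<integral>y. (q y * v n y) * bump e (x - y) \<partial>lborel)"
    have J': "- a j + b j = S j (\<lambda>y. bump_grad e (x - y) $ j)" for j
      using J[of j] i(1,2)[of j] by (simp add: a_def b_def)
    have "(\<integral>y. - (\<Sum>j\<in>UNIV. W n j y * bump_grad e (x - y) $ j) - l n * ((q y * v n y) * bump e (x - y)) \<partial>lborel) = 0"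
      using P by (simp add: sum_negf mult.assoc)
    moreover have "(\<integral>y. - (\<Sum>j\<in>UNIV. W n j y * bump_grad e (x - y) $ j) - l n * ((q y * v n y) * bump e (x - y)) \<partial>lborel)
      = - (\<Sum>j\<in>UNIV. b j) - l n * d"
      using i(2,3) by (simp add: b_def d_def Bochner_Integration.integral_sum)
    ultimately have P': "(\<Sum>j\<in>UNIV. b j) = - (l n * d)" by simp
    have "conv (u n) (lap_bump e) x = (\<integral>y. v n y * lap_bump e (x - y) \<partial>lborel)"
      unfolding conv_def by (rule integral_cong_AE) (use uv[of n] in auto)
    also have "\<dots> = (\<Sum>j\<in>UNIV. a j)"
      unfolding lap_bump_def sum_distrib_left a_def by (rule Bochner_Integration.integral_sum) (rule i)
    finally have c1: "conv (u n) (lap_bump e) x = (\<Sum>j\<in>UNIV. a j)" .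
    have c2: "conv (\<lambda>x. q x * u n x) (bump e) x = d"
      unfolding conv_def d_def by (rule integral_cong_AE) (use uv[of n] in auto)
    have "(\<Sum>j\<in>UNIV. S j (\<lambda>y. bump_grad e (x - y) $ j)) = - (\<Sum>j\<in>UNIV. a j) + (\<Sum>j\<in>UNIV. b j)"
      unfolding J'[symmetric] by (simp only: sum.distrib sum_negf)
    then show ?thesis unfolding c1 c2 using P' by simp
  qed
  have qu: "L2 lborel (\<lambda>x. q x * u n x)" for n by (rule L2_bounded_mult[OF uL _ qb]) simp
  \<comment> \<open>A ball of radius below \<open>\<delta> / 2\<close> that meets the box has
    diameter below \<open>\<delta>\<close> and so stays in the open half-space.\<close>
  have wl: "weak_lap (\<delta> / 2) (\<lambda>x. u i x - u j x) (\<lambda>x. - q x * (l i * u i x - l j * u j x))" for i j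
    unfolding weak_lap_def
  proof (intro allI impI, elim conjE)
    fix e :: real and x :: "real^3" assume e: "0 < e" "e < \<delta> / 2"
    have c1: "conv (\<lambda>x. u i x - u j x) (lap_bump e) x = conv (u i) (lap_bump e) x - conv (u j) (lap_bump e) x"
      by (rule conv_diff[OF uL uL bump_continuous(4) bump_support'(4)[OF e(1)]])
    have "(\<lambda>x. - q x * (l i * u i x - l j * u j x)) = (\<lambda>x. l j * (q x * u j x) - l i * (q x * u i x))"
      by (auto simp: algebra_simps)
    then have c2: "conv (\<lambda>x. - q x * (l i * u i x - l j * u j x)) (bump e) x = l j * conv (\<lambda>x. q x * u j x) (bump e) x - l i * conv (\<lambda>x. q x * u i x) (bump e) x"
      using conv_diff[OF L2_cmult[OF qu] L2_cmult[OF qu] bump_continuous(1) bump_support'(1)[OF e(1)], where x = x]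
      by (simp add: conv_cmult)
    show "conv (\<lambda>x. u i x - u j x) (lap_bump e) x = conv (\<lambda>x. - q x * (l i * u i x - l j * u j x)) (bump e) x"
    proof (cases "cball x e \<inter> K = {}")
      case True
      then have z: "u n y = 0" if "y \<in> cball x e" for n y using that uout by blast
      have "conv (u n) (lap_bump e) x = 0" "conv (\<lambda>x. q x * u n x) (bump e) x = 0" for n
        by (rule conv_support[OF bump_support'(4)[OF e(1)]], assumption, rule z, assumption)
           (rule conv_support[OF bump_support'(1)[OF e(1)]], assumption, simp add: z)
      then show ?thesis unfolding c1 c2 by simp
    next
      case False
      then obtain y where y: "y \<in> K" "dist x y \<le> e" by auto
      have "cball x e \<subseteq> lower_half"
      proof
        fix w assume "w \<in> cball x e"
        then have "dist y w \<le> 2 * e" using y(2) dist_triangle[of y w x] by (simp add: dist_commute)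
        then have "\<bar>(y - w) $ 3\<bar> < \<delta>" using component_le_norm_cart[of "y - w" 3] e(2) by (simp add: dist_norm)
        then show "w \<in> lower_half" using y(1) by (auto simp: K_def slab_box_def lower_half_def)
      qed
      from key[OF e(1) this, of i] key[OF e(1) this, of j] show ?thesis unfolding c1 c2 by simp
    qed
  qed
  \<comment> \<open>The weight is centred at the origin, a point of the plane whose distance from
    the box is at least \<open>\<delta>\<close>. The outer radius \<open>3 * M\<close> is enlarged
    by \<open>\<delta>\<close> so that the inner radius cannot exceed it.\<close>
  have "AE x in lborel. u 0 x = 0"
  proof (rule nonradiating_family_zero[where ?y0.0 = 0 and \<rho> = \<delta> and R = "3 * M + \<delta>", OF uL _ q wl _ \<delta>(1) _ l])
    show "u n x = 0" if "dist x 0 < \<delta> \<or> 3 * M + \<delta> < dist x 0" for n x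
    proof (rule uout)
      show "x \<notin> K" using that slab_box_norm[OF _ \<delta>(1), of x M] \<delta> by (fastforce simp: K_def)
    qed
  qed (use \<delta> in auto)
  with uv[of 0] show ?thesis by eventually_elim simp
qed

text \<open>\<open>W\<close> is the gradient of \<open>v\<close> only away from \<open>K\<close>.
  There it vanishes together with \<open>v\<close>, and since \<open>K\<close> is null it vanishes
  almost everywhere. The gradient identity then leaves nothing for the jump.\<close>

lemma jump_solution_zero_imp_no_jump:
  assumes sol: "jump_solution l q S v W" and z: "AE x in lborel. v x = 0"
    and K: "closed K" "negligible K" and S: "\<And>j \<phi>. (\<And>x. x \<in> K \<Longrightarrow> \<phi> x = 0) \<Longrightarrow> S j \<phi> = 0"
    and \<phi>: "test_fn \<phi> d\<phi>" "tsupp \<phi> \<subseteq> lower_half"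
  shows "S j \<phi> = 0"
proof -
  have L: "locL2 v" "locL2 (W j)" and jump: "\<And>\<phi> d\<phi>. test_fn \<phi> d\<phi> \<Longrightarrow> tsupp \<phi> \<subseteq> lower_half \<Longrightarrow> (\<integral>x. v x * d\<phi> x $ j + W j x * \<phi> x \<partial>lborel) = S j \<phi>"
    and out: "\<And>x. x \<notin> lower_half \<Longrightarrow> W j x = 0"
    using sol by (auto simp: jump_solution_def)
  note [measurable] = locL2_measurable[OF L(1)] locL2_measurable[OF L(2)]
  have vz: "(\<integral>x. W j x * \<phi> x \<partial>lborel) = S j \<phi>" if \<phi>: "test_fn \<phi> d\<phi>" "tsupp \<phi> \<subseteq> lower_half" for \<phi> d\<phi>
  proof -
    note [measurable] = borel_measurable_continuous_onI[OF test_fnD(4)[OF \<phi>(1)]] borel_measurable_continuous_onI[OF test_fn_component(1)[OF \<phi>(1)]]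
    have "(\<integral>x. W j x * \<phi> x \<partial>lborel) = (\<integral>x. v x * d\<phi> x $ j + W j x * \<phi> x \<partial>lborel)"
      by (rule integral_cong_AE) (use z in auto)
    then show ?thesis using jump[OF \<phi>] by simp
  qed
  have "AE x in lborel. x \<in> lower_half - K \<longrightarrow> W j x = 0"
  proof (rule fundamental_lemma[OF L(2)])
    show "open (lower_half - K)" by (intro open_Diff open_lower_half K)
    fix \<phi> d\<phi> assume \<phi>: "test_fn \<phi> d\<phi>" "tsupp \<phi> \<subseteq> lower_half - K"
    have "\<phi> x = 0" if "x \<in> K" for x using \<phi>(2) that test_fnD(5)[OF \<phi>(1), of x] by blast
    then have "S j \<phi> = 0" by (rule S)
    then show "(\<integral>x. W j x * \<phi> x \<partial>lborel) = 0" using vz[OF \<phi>(1)] \<phi>(2) by auto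
  qed
  moreover have "AE x in lborel. x \<notin> K"
    using negligible_AE[OF K(2)] by (simp add: AE_completion_iff)
  ultimately have W0: "AE x in lborel. W j x = 0"
  proof eventually_elim
    case (elim x)
    then show ?case using out[of x] by blast
  qed
  note [measurable] = borel_measurable_continuous_onI[OF test_fnD(4)[OF \<phi>(1)]]
  have "(\<integral>x. W j x * \<phi> x \<partial>lborel) = (\<integral>x. 0 \<partial>(lborel :: (real^3) measure))"
    by (rule integral_cong_AE) (use W0 in auto)
  then show ?thesis using vz[OF \<phi>] by simp
qed

text \<open>Each term is chosen closer to \<open>x\<close> than its predecessor, which gives
  injectivity, and within \<open>(1/2)^n\<close>, which will make the variation summable.\<close>

lemma islimpt_fast_sequence:
  fixes x :: real
  assumes "x islimpt D"
  obtains f where "\<And>n::nat. f n \<in> D" "inj f" "\<And>n. \<bar>f n - x\<bar> \<le> (1/2)^n"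
proof -
  have step: "\<exists>y. y \<in> D \<and> y \<noteq> x \<and> dist y x < r" if "r > 0" for r
    using assms that by (meson islimpt_approachable)
  have "\<exists>f. \<forall>n::nat. (f n \<in> D \<and> f n \<noteq> x \<and> dist (f n) x \<le> (1/2)^n) \<and> dist (f (Suc n)) x < dist (f n) x"
  proof (rule dependent_nat_choice)
    show "\<exists>y. y \<in> D \<and> y \<noteq> x \<and> dist y x \<le> (1/2)^0" using step[of 1] by force
    fix y :: real and n :: nat assume y: "y \<in> D \<and> y \<noteq> x \<and> dist y x \<le> (1/2)^n"
    then have "min (dist y x) ((1/2)^Suc n) > 0" by simp
    from step[OF this] show "\<exists>w. (w \<in> D \<and> w \<noteq> x \<and> dist w x \<le> (1/2)^Suc n) \<and> dist w x < dist y x" by force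
  qed
  then obtain f where f: "\<And>n::nat. f n \<in> D" "\<And>n. dist (f n) x \<le> (1/2)^n" "\<And>n. dist (f (Suc n)) x < dist (f n) x" by blast
  have "dist (f m) x < dist (f n) x" if "n < m" for m n
    using that f(3) by (rule less_Suc_induct[of n m]) (auto intro: order.strict_trans)
  then have "inj f" by (intro injI) (metis less_irrefl linorder_neqE_nat)
  then show thesis using f by (intro that[of f]) (auto simp: dist_real_def)
qed

section \<open>Discreteness of the exceptional frequencies\<close>

text \<open>Clamping a Borel version of \<open>k\<^sup>2\<close> gives bounds at every point, also
  in the upper half-space, where the solutions are extended by zero and the value of the coefficient
  does not matter.\<close>

lemma bounded_positive_version:
  fixes k :: "real^3 \<Rightarrow> real"
  assumes k: "k \<in> borel_measurable (lebesgue_on lower_half)"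
    and M: "AE x in lebesgue_on lower_half. \<bar>k x\<bar> \<le> M" and kmin: "kmin > 0" "AE x in lebesgue_on lower_half. k x \<ge> kmin"
  obtains q Q where "q \<in> borel_measurable borel" "AE x in lebesgue_on lower_half. (k x)\<^sup>2 = q x"
    "\<And>x. kmin\<^sup>2 \<le> q x" "\<And>x. q x \<le> Q" "\<And>x. \<bar>q x\<bar> \<le> Q"
proof -
  have ll: "lower_half \<inter> space lebesgue \<in> sets lebesgue" by simp
  have "(\<lambda>x. indicator lower_half x *\<^sub>R (k x)\<^sup>2) \<in> borel_measurable lebesgue"
    using borel_measurable_power[OF k, of 2] by (simp only: borel_measurable_restrict_space_iff[OF ll])
  then obtain h where h: "h \<in> borel_measurable lborel" "AE x in lborel. indicator lower_half x *\<^sub>R (k x)\<^sup>2 = h x"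
    using completion_ex_borel_measurable_real by blast
  have hl: "AE x in lebesgue. indicator lower_half x *\<^sub>R (k x)\<^sup>2 = h x" using h(2) by (simp add: AE_completion_iff)
  define Q where "Q = max (kmin\<^sup>2) (M\<^sup>2)"
  define q where "q = (\<lambda>x. max (kmin\<^sup>2) (min Q (h x)))"
  show thesis
  proof (rule that[of q Q])
    show "q \<in> borel_measurable borel" using h(1) unfolding q_def by simp
    show "AE x in lebesgue_on lower_half. (k x)\<^sup>2 = q x"
      unfolding AE_restrict_space_iff[OF ll]
      using hl M[unfolded AE_restrict_space_iff[OF ll]] kmin(2)[unfolded AE_restrict_space_iff[OF ll]]
    proof eventually_elim
      case (elim x)
      show ?case
      proof
        assume x: "x \<in> lower_half"
        have "kmin\<^sup>2 \<le> (k x)\<^sup>2" using elim(3) x kmin(1) by (intro power_mono) auto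
        moreover have "(k x)\<^sup>2 \<le> M\<^sup>2" using elim(2) x by (simp add: abs_le_square_iff[symmetric])
        moreover have "h x = (k x)\<^sup>2" using elim(1) x by simp
        ultimately show "(k x)\<^sup>2 = q x" by (auto simp: q_def Q_def)
      qed
    qed
    show "kmin\<^sup>2 \<le> q x" "q x \<le> Q" for x by (auto simp: q_def Q_def)
    show "\<bar>q x\<bar> \<le> Q" for x
    proof -
      have "kmin\<^sup>2 \<le> q x" "q x \<le> Q" "0 \<le> kmin\<^sup>2" by (auto simp: q_def Q_def)
      then show ?thesis by linarith
    qed
  qed
qed

theorem theorem4p1:
  fixes k :: "real^3 \<Rightarrow> real" and kmin k0 R0 :: real
    and \<Gamma>1 \<Gamma>2 :: "(real^3) set" and g1 g2 :: "real^3 \<Rightarrow> complex"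
    and n1 n2 :: "real^3 \<Rightarrow> real^3"
  assumes k_meas: "k \<in> borel_measurable (lebesgue_on lower_half)"
    and k_bdd: "\<exists>M. AE x in lebesgue_on lower_half. \<bar>k x\<bar> \<le> M"
    and kmin: "kmin > 0" "AE x in lebesgue_on lower_half. k x \<ge> kmin"
    and k_out: "R0 > 0" "k0 > 0" "\<forall>x\<in>lower_half. norm x \<ge> R0 \<longrightarrow> k x = k0"
    and G1: "class_P \<Gamma>1" "closure \<Gamma>1 \<subseteq> lower_half" "unit_normal_on \<Gamma>1 n1"
            "surf_L2 \<Gamma>1 g1" "full_support \<Gamma>1 g1"
    and G2: "class_P \<Gamma>2" "closure \<Gamma>2 \<subseteq> lower_half" "unit_normal_on \<Gamma>2 n2"
            "surf_L2 \<Gamma>2 g2" "full_support \<Gamma>2 g2"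
  shows "\<exists>\<D>. \<D> \<subseteq> {0..} \<and> (\<forall>x. \<not> x islimpt \<D>) \<and>
     (\<forall>t V u1 w1 u2 w2. t > 0 \<and> t \<notin> \<D> \<and> V \<noteq> {} \<and> openin (top_of_set bdry_plane) V \<and>
        is_solution k k0 t \<Gamma>1 g1 n1 u1 w1 \<and> is_solution k k0 t \<Gamma>2 g2 n2 u2 w2 \<and>
        traces_agree_on V \<Gamma>1 \<Gamma>2 u1 w1 u2 w2 \<longrightarrow>
        closure \<Gamma>1 = closure \<Gamma>2 \<and>
        surf_ae \<Gamma>1 (\<lambda>x. \<forall>j. g1 x * of_real (n1 x $ j) = g2 x * of_real (n2 x $ j)))"
proof -
  obtain M where M: "AE x in lebesgue_on lower_half. \<bar>k x\<bar> \<le> M" using k_bdd by blast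
  obtain q Q where q: "q \<in> borel_measurable borel" "AE x in lebesgue_on lower_half. (k x)\<^sup>2 = q x"
    "\<And>x. kmin\<^sup>2 \<le> q x" "\<And>x. q x \<le> Q" "\<And>x. \<bar>q x\<bar> \<le> Q"
    apply (rule bounded_positive_version[OF k_meas M kmin])
    apply (rule that; assumption)
    done
  define K where "K = closure \<Gamma>1 \<union> closure \<Gamma>2"
  have K: "compact K" "negligible K" "K \<subseteq> lower_half" "closed K"
    unfolding K_def using class_P_closure G1(1,2) G2(1,2) by (auto intro!: compact_Un negligible_Un)
  obtain \<delta> B where \<delta>: "\<delta> > 0" "B > 0" "K \<subseteq> slab_box \<delta> B"
    using slab_box_covers[OF K(1,3)] by blast
  define s1 s2 where "s1 = (\<lambda>j \<phi>. surf_int \<Gamma>1 (\<lambda>x. g1 x * of_real (n1 x $ j) * of_real (\<phi> x)))"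
    and "s2 = (\<lambda>j \<phi>. surf_int \<Gamma>2 (\<lambda>x. g2 x * of_real (n2 x $ j) * of_real (\<phi> x)))"
  \<comment> \<open>The double layer of the difference of the two solutions, one real functional for
    each choice of real or imaginary part. It is built from the surfaces and jumps alone.\<close>
  define S where "S = (\<lambda>c j \<phi>. - c (s1 j \<phi>) - - c (s2 j \<phi>) :: real)"
  have SK: "S c j \<phi> = 0" if c: "real_part_fun c" and z: "\<And>x. x \<in> K \<Longrightarrow> \<phi> x = 0" for c j \<phi>
  proof -
    have "s1 j \<phi> = 0" unfolding s1_def by (rule surf_int_vanish[OF G1(1)]) (use z in \<open>simp add: K_def\<close>)
    moreover have "s2 j \<phi> = 0" unfolding s2_def by (rule surf_int_vanish[OF G2(1)]) (use z in \<open>simp add: K_def\<close>)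
    ultimately show ?thesis using real_part_fun(8)[OF c] by (simp add: S_def)
  qed
  \<comment> \<open>The frequencies at which the hypotheses can be met for some \<open>V\<close> and
    some pair of solutions. Off this set the claim is vacuous.\<close>
  define bad where "bad = (\<lambda>t. \<exists>V u1 w1 u2 w2. t > 0 \<and> V \<noteq> {} \<and> openin (top_of_set bdry_plane) V \<and>
        is_solution k k0 t \<Gamma>1 g1 n1 u1 w1 \<and> is_solution k k0 t \<Gamma>2 g2 n2 u2 w2 \<and>
        traces_agree_on V \<Gamma>1 \<Gamma>2 u1 w1 u2 w2)"
  have bad_sol: "\<exists>v W. jump_solution (t\<^sup>2) q (S c) v W \<and> (AE x in lborel. x \<notin> slab_box \<delta> B \<longrightarrow> v x = 0)"
    if t: "bad t" and c: "real_part_fun c" for t c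
  proof -
    obtain V u1 w1 u2 w2 where V: "V \<noteq> {}" "openin (top_of_set bdry_plane) V"
      and sol: "is_solution k k0 t \<Gamma>1 g1 n1 u1 w1" "is_solution k k0 t \<Gamma>2 g2 n2 u2 w2"
      and tr: "traces_agree_on V \<Gamma>1 \<Gamma>2 u1 w1 u2 w2" using t unfolding bad_def by blast
    obtain v1 W1 where j1: "jump_solution (t\<^sup>2) q (\<lambda>j \<phi>. - c (s1 j \<phi>)) v1 W1"
      and v1: "AE x in lebesgue. v1 x = indicator (lower_half - closure \<Gamma>1) x * c (u1 x)"
      and W1: "\<And>j. AE x in lebesgue. W1 j x = indicator (lower_half - closure \<Gamma>1) x * c (w1 x $ j)"
      unfolding s1_def
      apply (rule solution_real_part[OF c sol(1) k_meas q(1,2,5)])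
      apply (rule that[unfolded s1_def]; assumption)
      done
    obtain v2 W2 where j2: "jump_solution (t\<^sup>2) q (\<lambda>j \<phi>. - c (s2 j \<phi>)) v2 W2"
      and v2: "AE x in lebesgue. v2 x = indicator (lower_half - closure \<Gamma>2) x * c (u2 x)"
      and W2: "\<And>j. AE x in lebesgue. W2 j x = indicator (lower_half - closure \<Gamma>2) x * c (w2 x $ j)"
      unfolding s2_def
      apply (rule solution_real_part[OF c sol(2) k_meas q(1,2,5)])
      apply (rule that[unfolded s2_def]; assumption)
      done
    have J: "jump_solution (t\<^sup>2) q (S c) (\<lambda>x. v1 x - v2 x) (\<lambda>j x. W1 j x - W2 j x)"
      unfolding S_def by (rule jump_solution_diff[OF j1 j2 q(1,5)])
    have L: "locL2 v1" "locL2 v2" "locL2 (W1 3)" "locL2 (W2 3)"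
      using j1 j2 by (auto simp: jump_solution_def)
    have "AE x in lborel. x \<notin> slab_box \<delta> B \<longrightarrow> v1 x - v2 x = 0"
    proof (rule exterior_vanishing[OF J _ q(1,5) \<delta>(3,1,2) V])
      show "S c j \<phi> = 0" if "\<And>x. x \<in> K \<Longrightarrow> \<phi> x = 0" for j \<phi> by (rule SK[OF c that])
      fix \<phi> d\<phi> assume \<phi>: "test_fn \<phi> d\<phi>" "tsupp \<phi> \<inter> bdry_plane \<subseteq> V" "tsupp \<phi> \<inter> K = {}"
      show "(\<integral>x. (v1 x - v2 x) * d\<phi> x $ 3 + (W1 3 x - W2 3 x) * \<phi> x \<partial>lborel) = 0"
        by (rule trace_real_part[OF c sol tr L(1,2) v1 v2 L(3,4) W1 W2 \<phi>(1,2) \<phi>(3)[unfolded K_def]])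
    qed
    with J show ?thesis by blast
  qed
  \<comment> \<open>If the double layers agree, the conclusion holds at every frequency and the
    empty set will do. If they differ, the bad frequencies themselves form the exceptional set, and
    an accumulation point of them would make the double layers agree.\<close>
  show ?thesis
  proof (cases "\<forall>j \<phi> d\<phi>. test_fn \<phi> d\<phi> \<and> tsupp \<phi> \<subseteq> lower_half \<longrightarrow> s1 j \<phi> = s2 j \<phi>")
    case True
    have "closure \<Gamma>1 = closure \<Gamma>2 \<and> surf_ae \<Gamma>1 (\<lambda>x. \<forall>j. g1 x * of_real (n1 x $ j) = g2 x * of_real (n2 x $ j))"
      by (rule surface_determined[OF G1 G2]) (use True in \<open>auto simp: s1_def s2_def\<close>)
    then show ?thesis by (intro exI[of _ "{}"]) (simp add: islimpt_EMPTY)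
  next
    case False
    then obtain j \<phi> d\<phi> where \<phi>: "test_fn \<phi> d\<phi>" "tsupp \<phi> \<subseteq> lower_half" "s1 j \<phi> \<noteq> s2 j \<phi>" by blast
    have "\<not> x islimpt {t. bad t}" for x
    proof
      assume "x islimpt {t. bad t}"
      then obtain f where f: "\<And>n::nat. bad (f n)" "inj f" "\<And>n. \<bar>f n - x\<bar> \<le> (1/2)^n"
        by (rule islimpt_fast_sequence) auto
      define l where "l = (\<lambda>n. (f n)\<^sup>2)"
      have fpos: "f n > 0" for n using f(1)[of n] by (auto simp: bad_def)
      have fb: "\<bar>f n\<bar> \<le> \<bar>x\<bar> + 1" for n
      proof -
        have "(1/2::real)^n \<le> 1" by (simp add: power_le_one)
        then show ?thesis using f(3)[of n] by linarith
      qed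
      have lb: "\<bar>l n\<bar> \<le> (\<bar>x\<bar> + 1)\<^sup>2" for n
        using power_mono[OF fb[of n], of 2] by (simp add: l_def)
      have linj: "inj l"
      proof (rule injI)
        fix m n assume "l m = l n"
        then have "f m = f n" using fpos[of m] fpos[of n] by (simp add: l_def power2_eq_iff_nonneg)
        then show "m = n" using f(2) by (simp add: inj_eq)
      qed
      \<comment> \<open>The difference of squares is the bounded sum of two frequencies times their
        difference, which is geometrically small.\<close>
      have lsum: "summable (\<lambda>n. \<bar>l (Suc n) - l n\<bar>)"
      proof (rule summable_comparison_test')
        show "summable (\<lambda>n. 4 * (\<bar>x\<bar> + 1) * (1/2::real)^n)" by (intro summable_mult summable_geometric) simp
        fix n :: nat
        have h: "(1/2::real)^Suc n \<le> (1/2)^n" by simp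
        have "\<bar>f (Suc n) - f n\<bar> \<le> 2 * (1/2)^n" using f(3)[of n] f(3)[of "Suc n"] h by linarith
        moreover have "\<bar>f (Suc n) + f n\<bar> \<le> 2 * (\<bar>x\<bar> + 1)"
          using order.trans[OF abs_triangle_ineq add_mono[OF fb[of "Suc n"] fb[of n]]] by simp
        ultimately have "\<bar>f (Suc n) + f n\<bar> * \<bar>f (Suc n) - f n\<bar> \<le> (2 * (\<bar>x\<bar> + 1)) * (2 * (1/2)^n)"
          by (intro mult_mono) auto
        moreover have e: "l (Suc n) - l n = (f (Suc n) + f n) * (f (Suc n) - f n)"
          by (simp add: l_def power2_eq_square algebra_simps)
        ultimately show "norm \<bar>l (Suc n) - l n\<bar> \<le> 4 * (\<bar>x\<bar> + 1) * (1/2::real)^n"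
          unfolding e abs_mult by (simp add: algebra_simps)
      qed
      have "c (s1 j \<phi> - s2 j \<phi>) = 0" if c: "real_part_fun c" for c
      proof -
        have "\<forall>n. \<exists>p. jump_solution (l n) q (S c) (fst p) (snd p) \<and> (AE x in lborel. x \<notin> slab_box \<delta> B \<longrightarrow> fst p x = 0)"
          using bad_sol[OF f(1) c] by (auto simp: l_def)
        then have "\<exists>p. \<forall>n. jump_solution (l n) q (S c) (fst (p n)) (snd (p n)) \<and> (AE x in lborel. x \<notin> slab_box \<delta> B \<longrightarrow> fst (p n) x = 0)"
          by (rule choice)
        then obtain p where p: "\<And>n. jump_solution (l n) q (S c) (fst (p n)) (snd (p n))"
          "\<And>n. AE x in lborel. x \<notin> slab_box \<delta> B \<longrightarrow> fst (p n) x = 0" by blast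
        have "AE x in lborel. fst (p 0) x = 0"
          by (rule jump_solution_family_zero[where v = "\<lambda>n. fst (p n)" and W = "\<lambda>n. snd (p n)", OF p \<delta>(1,2) q(1,3,4) _ lb linj lsum])
             (use kmin in simp)
        then have "S c j \<phi> = 0"
          by (rule jump_solution_zero_imp_no_jump[OF p(1) _ K(4,2) _ \<phi>(1,2)]) (rule SK[OF c])
        then show ?thesis by (simp add: S_def real_part_fun(6)[OF c])
      qed
      then have "s1 j \<phi> - s2 j \<phi> = 0" by (rule complex_zero_parts)
      then show False using \<phi>(3) by simp
    qed
    moreover have "{t. bad t} \<subseteq> {0..}" by (auto simp: bad_def)
    ultimately show ?thesis by (intro exI[of _ "{t. bad t}"]) (auto simp: bad_def)
  qed
qed

end
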